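(* Let $\mathcal{A}$ be a finitely generated commutative real unital algebra and let $\mathcal{T}$ be a finitely generated preorder of $\mathcal{A}$. Suppose that $h_1,\dots,h_m\in\mathcal{A}$ are elements that are bounded on the set $\mathcal{K}(\mathcal{T})$, and put $\mathsf{h}(\mathcal{K}(\mathcal{T}))=\{(h_1(x),\dots,h_m(x)) : x\in\mathcal{K}(\mathcal{T})\}\subseteq\mathbb{R}^m$. For $\lambda=(\lambda_1,\dots,\lambda_m)\in\mathbb{R}^m$ let $\mathcal{I}_\lambda$ be the ideal of $\mathcal{A}$ generated by $h_1-\lambda_1,\dots,h_m-\lambda_m$, let $\hat{\mathcal{I}}_\lambda$ be the ideal of all $f\in\mathcal{A}$ that vanish on the zero set $\mathcal{Z}(\mathcal{I}_\lambda)\subseteq\hat{\mathcal{A}}$, and set $\mathcal{T}_\lambda=\mathcal{T}+\mathcal{I}_\lambda$ and $\hat{\mathcal{T}}_\lambda=\mathcal{T}+\hat{\mathcal{I}}_\lambda$. Then the following five statements are equivalent when each is read with (SMP), and they are also equivalent when each is read with (MP): (i) $\mathcal{T}$ has property (SMP) (resp. (MP)) in $\mathcal{A}$. (ii) $\mathcal{T}_\lambda$ satisfies (SMP) (resp. (MP)) in $\mathcal{A}$ for all $\lambda\in\mathsf{h}(\mathcal{K}(\mathcal{T}))$. (ii)$'$ $\hat{\mathcal{T}}_\lambda$ satisfies (SMP) (resp. (MP)) in $\mathcal{A}$ for all $\lambda\in\mathsf{h}(\mathcal{K}(\mathcal{T}))$. (iii) $\mathcal{T}_\lambda/\mathcal{I}_\lambda$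 has (SMP) (resp. (MP)) in $\mathcal{A}/\mathcal{I}_\lambda$ for all $\lambda\in\mathsf{h}(\mathcal{K}(\mathcal{T}))$. (iii)$'$ $\hat{\mathcal{T}}_\lambda/\hat{\mathcal{I}}_\lambda$ has (SMP) (resp. (MP)) in $\mathcal{A}/\hat{\mathcal{I}}_\lambda$ for all $\lambda\in\mathsf{h}(\mathcal{K}(\mathcal{T}))$.
   Context: Let $\mathcal{A}$ be a finitely generated commutative real unital algebra. A character of $\mathcal{A}$ is an algebra homomorphism $\chi:\mathcal{A}\to\mathbb{R}$ with $\chi(1)=1$. The set $\hat{\mathcal{A}}$ of all characters carries the weak topology (the topology of pointwise convergence on $\mathcal{A}$). For $x=\chi\in\hat{\mathcal{A}}$ and $f\in\mathcal{A}$ write $f(x):=\chi(f)$. (A choice of $d$ generators of $\mathcal{A}$ identifies $\hat{\mathcal{A}}$ with a real algebraic subvariety of $\mathbb{R}^d$.) For an ideal $\mathcal{I}$, its zero set is $\mathcal{Z}(\mathcal{I})=\{x\in\hat{\mathcal{A}} : f(x)=0 \text{ for all } f\in\mathcal{I}\}$. A preorder of $\mathcal{A}$ is a subset $\mathcal{T}\subseteq\mathcal{A}$ with $\mathcal{T}\cdot\mathcal{T}\subseteq\mathcal{T}$, $\mathcal{T}+\mathcal{T}\subseteq\mathcal{T}$, $1\in\mathcal{T}$, and $a^2\mathcal{T}\subseteq\mathcal{T}$ for all $a\in\mathcal{A}$. It is finitely generated if it is the smallest preorder containing some finite subset of $\mathcal{A}$. Set $\mathcal{K}(\mathcal{T})=\{x\in\hat{\mathcal{A}}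 : f(x)\ge 0\text{ for all } f\in\mathcal{T}\}$. An $\mathbb{R}$-linear functional $L:\mathcal{A}\to\mathbb{R}$ is $\mathcal{T}$-positive if $L(f)\ge0$ for all $f\in\mathcal{T}$. $\mathcal{M}(\hat{\mathcal{A}})$ denotes the set of positive Borel measures $\mu$ on $\hat{\mathcal{A}}$ such that each $f\in\mathcal{A}$ (as the function $x\mapsto f(x)$) is $\mu$-integrable. A preorder $\mathcal{T}$ of $\mathcal{A}$ has - the moment property (MP) in $\mathcal{A}$ if for each $\mathcal{T}$-positive linear functional $L$ on $\mathcal{A}$ there is $\mu\in\mathcal{M}(\hat{\mathcal{A}})$ with $L(f)=\int_{\hat{\mathcal{A}}} f(x)\,d\mu(x)$ for all $f\in\mathcal{A}$; - the strong moment property (SMP) in $\mathcal{A}$ if for each $\mathcal{T}$-positive linear functional $L$ on $\mathcal{A}$ there is such a $\mu\in\mathcal{M}(\hat{\mathcal{A}})$ with, in addition, $\operatorname{supp}\mu\subseteq\mathcal{K}(\mathcal{T})$. The same definitions apply to quotient algebras of $\mathcal{A}$. For an ideal $\mathcal{I}$ and a preorder $\mathcal{S}\supseteq\mathcal{I}$, $\mathcal{S}/\mathcal{I}$ denotes the image of $\mathcal{S}$ in $\mathcal{A}/\mathcal{I}$, which is a preorder of $\mathcal{A}/\mathcal{I}$. *)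

theory Defs
  imports "HOL-Analysis.Analysis" "HOL-Algebra.Algebraic_Closure_Type"
begin

text \<open>
  Algebras are carrier-based, so that an algebra and its quotients, whose carriers consist
  of cosets, are instances of the same notion. The zero algebra is admitted.
  The name \<open>algebra\<close> alone would denote the set algebras of measure theory.
\<close>

abbreviation real_ring :: "real ring" where
  "real_ring \<equiv> ring_of_type_algebra"

definition comm_real_algebra :: "(real, 'a, 'm) module_scheme \<Rightarrow> bool" where
  "comm_real_algebra A \<longleftrightarrow> Module.algebra real_ring A"

definition real_subalgebra :: "(real, 'a, 'm) module_scheme \<Rightarrow> 'a set \<Rightarrow> bool" where
  "real_subalgebra A B \<longleftrightarrow> subring B A \<and> (\<forall>c. \<forall>b\<in>B. c \<odot>\<^bsub>A\<^esub> b \<in> B)"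

definition finitely_generated_algebra :: "(real, 'a, 'm) module_scheme \<Rightarrow> bool" where
  "finitely_generated_algebra A \<longleftrightarrow>
     (\<exists>G. finite G \<and> G \<subseteq> carrier A \<and> \<Inter>{B. real_subalgebra A B \<and> G \<subseteq> B} = carrier A)"

definition quotient_algebra ::
    "(real, 'a, 'm) module_scheme \<Rightarrow> 'a set \<Rightarrow> (real, 'a set) module" where
  "quotient_algebra A I =
     ring.extend (A Quot I) (module.fields (\<lambda>c C. \<Union>x\<in>C. I +>\<^bsub>A\<^esub> (c \<odot>\<^bsub>A\<^esub> x)))"

definition quotient_image :: "(real, 'a, 'm) module_scheme \<Rightarrow> 'a set \<Rightarrow> 'a set \<Rightarrow> 'a set set" where
  "quotient_image A S I = (\<lambda>s. I +>\<^bsub>A\<^esub> s) ` S"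

definition linear_functional :: "(real, 'a, 'm) module_scheme \<Rightarrow> ('a \<Rightarrow> real) \<Rightarrow> bool" where
  "linear_functional A L \<longleftrightarrow>
     (\<forall>f\<in>carrier A. \<forall>g\<in>carrier A. L (f \<oplus>\<^bsub>A\<^esub> g) = L f + L g) \<and>
     (\<forall>c. \<forall>f\<in>carrier A. L (c \<odot>\<^bsub>A\<^esub> f) = c * L f)"

text \<open>
  A character is a function on the carrier only; it is made extensional, so that equality of
  HOL functions is equality of characters. The value $f(x)$ is written \<open>x f\<close>.
\<close>

definition characters :: "(real, 'a, 'm) module_scheme \<Rightarrow> ('a \<Rightarrow> real) set" where
  "characters A = {x \<in> extensional (carrier A).
     linear_functional A x \<and>
     (\<forall>f\<in>carrier A. \<forall>g\<in>carrier A. x (f \<otimes>\<^bsub>A\<^esub> g) = x f * x g) \<and>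
     x \<one>\<^bsub>A\<^esub> = 1}"

definition character_topology :: "(real, 'a, 'm) module_scheme \<Rightarrow> ('a \<Rightarrow> real) topology" where
  "character_topology A = subtopology (powertop_real (carrier A)) (characters A)"

definition zero_set :: "(real, 'a, 'm) module_scheme \<Rightarrow> 'a set \<Rightarrow> ('a \<Rightarrow> real) set" where
  "zero_set A I = {x \<in> characters A. \<forall>f\<in>I. x f = 0}"

definition vanishing_ideal :: "(real, 'a, 'm) module_scheme \<Rightarrow> ('a \<Rightarrow> real) set \<Rightarrow> 'a set" where
  "vanishing_ideal A Z = {f \<in> carrier A. \<forall>x\<in>Z. x f = 0}"

definition preordering :: "(real, 'a, 'm) module_scheme \<Rightarrow> 'a set \<Rightarrow> bool" where
  "preordering A T \<longleftrightarrow> T \<subseteq> carrier A \<and>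
     (\<forall>s\<in>T. \<forall>t\<in>T. s \<otimes>\<^bsub>A\<^esub> t \<in> T) \<and>
     (\<forall>s\<in>T. \<forall>t\<in>T. s \<oplus>\<^bsub>A\<^esub> t \<in> T) \<and>
     \<one>\<^bsub>A\<^esub> \<in> T \<and>
     (\<forall>a\<in>carrier A. \<forall>t\<in>T. (a [^]\<^bsub>A\<^esub> (2::nat)) \<otimes>\<^bsub>A\<^esub> t \<in> T)"

definition finitely_generated_preordering ::
    "(real, 'a, 'm) module_scheme \<Rightarrow> 'a set \<Rightarrow> bool" where
  "finitely_generated_preordering A T \<longleftrightarrow>
     (\<exists>G. finite G \<and> G \<subseteq> carrier A \<and> T = \<Inter>{P. preordering A P \<and> G \<subseteq> P})"

definition nonneg_set :: "(real, 'a, 'm) module_scheme \<Rightarrow> 'a set \<Rightarrow> ('a \<Rightarrow> real) set" where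
  "nonneg_set A T = {x \<in> characters A. \<forall>f\<in>T. x f \<ge> 0}"

definition positive_functional ::
    "(real, 'a, 'm) module_scheme \<Rightarrow> 'a set \<Rightarrow> ('a \<Rightarrow> real) \<Rightarrow> bool" where
  "positive_functional A T L \<longleftrightarrow> linear_functional A L \<and> (\<forall>f\<in>T. L f \<ge> 0)"

definition borel_sigma :: "'b topology \<Rightarrow> 'b measure" where
  "borel_sigma \<tau> = sigma (topspace \<tau>) {U. openin \<tau> U}"

definition measure_support :: "'b topology \<Rightarrow> 'b measure \<Rightarrow> 'b set" where
  "measure_support \<tau> \<mu> =
     {x \<in> topspace \<tau>. \<forall>U. openin \<tau> U \<and> x \<in> U \<longrightarrow> emeasure \<mu> U > 0}"

definition moment_measures :: "(real, 'a, 'm) module_scheme \<Rightarrow> ('a \<Rightarrow> real) measure set" where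
  "moment_measures A = {\<mu>. sets \<mu> = sets (borel_sigma (character_topology A)) \<and>
     (\<forall>f\<in>carrier A. integrable \<mu> (\<lambda>x. x f))}"

definition MP :: "(real, 'a, 'm) module_scheme \<Rightarrow> 'a set \<Rightarrow> bool" where
  "MP A T \<longleftrightarrow> (\<forall>L. positive_functional A T L \<longrightarrow>
     (\<exists>\<mu>\<in>moment_measures A. \<forall>f\<in>carrier A. L f = (\<integral>x. x f \<partial>\<mu>)))"

definition SMP :: "(real, 'a, 'm) module_scheme \<Rightarrow> 'a set \<Rightarrow> bool" where
  "SMP A T \<longleftrightarrow> (\<forall>L. positive_functional A T L \<longrightarrow>
     (\<exists>\<mu>\<in>moment_measures A. (\<forall>f\<in>carrier A. L f = (\<integral>x. x f \<partial>\<mu>)) \<and>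
        measure_support (character_topology A) \<mu> \<subseteq> nonneg_set A T))"

definition joint_image ::
    "('n::finite \<Rightarrow> 'a) \<Rightarrow> ('a \<Rightarrow> real) set \<Rightarrow> (real ^ 'n) set" where
  "joint_image h K = (\<lambda>x. \<chi> i. x (h i)) ` K"

definition fibre_ideal ::
    "(real, 'a, 'm) module_scheme \<Rightarrow> ('n::finite \<Rightarrow> 'a) \<Rightarrow> real ^ 'n \<Rightarrow> 'a set" where
  "fibre_ideal A h lam = Idl\<^bsub>A\<^esub> (range (\<lambda>i. h i \<ominus>\<^bsub>A\<^esub> (lam $ i) \<odot>\<^bsub>A\<^esub> \<one>\<^bsub>A\<^esub>))"

definition fibre_ideal_hat ::
    "(real, 'a, 'm) module_scheme \<Rightarrow> ('n::finite \<Rightarrow> 'a) \<Rightarrow> real ^ 'n \<Rightarrow> 'a set" where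
  "fibre_ideal_hat A h lam = vanishing_ideal A (zero_set A (fibre_ideal A h lam))"

definition fibre_preordering ::
    "(real, 'a, 'm) module_scheme \<Rightarrow> 'a set \<Rightarrow> ('n::finite \<Rightarrow> 'a) \<Rightarrow> real ^ 'n \<Rightarrow> 'a set" where
  "fibre_preordering A T h lam = T <+>\<^bsub>A\<^esub> fibre_ideal A h lam"

definition fibre_preordering_hat ::
    "(real, 'a, 'm) module_scheme \<Rightarrow> 'a set \<Rightarrow> ('n::finite \<Rightarrow> 'a) \<Rightarrow> real ^ 'n \<Rightarrow> 'a set" where
  "fibre_preordering_hat A T h lam = T <+>\<^bsub>A\<^esub> fibre_ideal_hat A h lam"

end

theory Submission
  imports Defs
begin

text \<open>
  By Haviland's theorem, (MP) and (SMP) say that every \<open>T\<close>-positive functional is nonnegative on the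
  elements of \<open>A\<close> that are nonnegative on all characters, respectively on \<open>K(T)\<close>. Suppose a \<open>T\<close>-positive
  functional is negative at such an element \<open>f\<close>. It belongs to a compact cap of the cone
  of \<open>T\<close>-positive functionals, so some extremal ray contains an \<open>L\<close> with \<open>L f < 0\<close>. Since \<open>h\<^sub>i\<close> is
  bounded by \<open>c\<close> on \<open>K(T)\<close>, the Positivstellensatz makes \<open>L((c \<plusminus> h\<^sub>i) \<cdot>)\<close> again \<open>T\<close>-positive. These
  two functionals add up to a multiple of \<open>L\<close>, so by extremality \<open>L(h\<^sub>i g) = \<lambda>\<^sub>i L g\<close> for all \<open>g\<close>, that is,
  \<open>L\<close> is \<open>T\<^sub>\<lambda>\<close>-positive. If \<open>\<lambda>\<close> is not in the joint image of \<open>K(T)\<close>, then \<open>K(T\<^sub>\<lambda>)\<close> is empty,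
  \<open>-1 \<in> T\<^sub>\<lambda>\<close> and \<open>L = 0\<close>; otherwise the moment property of the fibre gives \<open>0 \<le> L f\<close>. Conversely, a
  measure representing a functional that vanishes on \<open>I\<^sub>\<lambda>\<close> is carried by the zero set of \<open>I\<^sub>\<lambda>\<close>. The
  Positivstellensatz itself is proved by Artin's method: an ordering of a finitely generated real domain
  is matched sign by sign with real points, through the real closure of its fraction field.
\<close>

section \<open>Real closures\<close>

text \<open>(MP) and (SMP) differ only in the set \<open>C\<close> of characters on which test
  elements are nonnegative. The predicate \<open>positive_on C T\<close> keeps \<open>C\<close> and
  \<open>T\<close> apart, so one argument serves both, and \<open>C\<close> stays fixed while
  \<open>T\<close> is enlarged to the preorder of a fibre. Quotients bring in a smaller set, the
  zeros of the ideal; a representing measure gives the squares of the generators of the ideal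
  integral 0, which bridges this gap.

  The cone of positive functionals has no evident compact base. A weighted series of the values at 1
  + (\<open>e k\<close>)^2, for a countable spanning sequence \<open>e\<close>, cuts off a compact
  cap, although the series may diverge on other functionals. Countability also makes extreme points
  accessible by minimizing one coordinate after another.

  The Positivstellensatz enters as: if K(T) is empty, then -1 lies in T. Its certificate contains an
  unknown cofactor t. Iterated multiplication by h^2 turns t into a constant in front of a geometric
  sequence, and logarithmic convexity makes that constant irrelevant.\<close>

hide_const (open) Module.smult Polynomials.degree up_ring.coeff up_ring.monom Coset.order Polynomials.lead_coeff

text \<open>The ambient type will be an algebraic closure, where -1 is a square. So only squares of
  differences of elements of \<open>P\<close> are required, that is, squares from the subfield that
  \<open>P\<close> generates; closure under inverses makes these differences a field.\<close>

definition field_preorder :: "'a::field set \<Rightarrow> bool" where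
  "field_preorder P \<longleftrightarrow> 1 \<in> P \<and> (\<forall>x\<in>P. \<forall>y\<in>P. x + y \<in> P \<and> x * y \<in> P \<and> (x - y)\<^sup>2 \<in> P) \<and>
     (\<forall>x\<in>P. inverse x \<in> P) \<and> -1 \<notin> P"

definition difference_set :: "'a::ab_group_add set \<Rightarrow> 'a set" where
  "difference_set P = {x - y | x y. x \<in> P \<and> y \<in> P}"

definition subfield_set :: "'a::field set \<Rightarrow> bool" where
  "subfield_set F \<longleftrightarrow> 0 \<in> F \<and> 1 \<in> F \<and> (\<forall>x\<in>F. \<forall>y\<in>F. x + y \<in> F \<and> x * y \<in> F) \<and>
     (\<forall>x\<in>F. - x \<in> F \<and> inverse x \<in> F)"

lemma subfield_setD:
  assumes "subfield_set F"
  shows "0 \<in> F" "1 \<in> F" "x \<in> F \<Longrightarrow> y \<in> F \<Longrightarrow> x + y \<in> F" "x \<in> F \<Longrightarrow> y \<in> F \<Longrightarrow> x * y \<in> F"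
    "x \<in> F \<Longrightarrow> - x \<in> F" "x \<in> F \<Longrightarrow> inverse x \<in> F" "x \<in> F \<Longrightarrow> y \<in> F \<Longrightarrow> x - y \<in> F"
    "x \<in> F \<Longrightarrow> y \<in> F \<Longrightarrow> x / y \<in> F"
proof -
  show add: "x \<in> F \<Longrightarrow> y \<in> F \<Longrightarrow> x + y \<in> F" for x y
    using assms unfolding subfield_set_def by blast
  show mult: "x \<in> F \<Longrightarrow> y \<in> F \<Longrightarrow> x * y \<in> F" for x y
    using assms unfolding subfield_set_def by blast
  show neg: "x \<in> F \<Longrightarrow> - x \<in> F" and inv: "x \<in> F \<Longrightarrow> inverse x \<in> F" for x
    using assms unfolding subfield_set_def by blast+
  show "x \<in> F \<Longrightarrow> y \<in> F \<Longrightarrow> x - y \<in> F"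
    using add[OF _ neg, of x y] by simp
  show "x \<in> F \<Longrightarrow> y \<in> F \<Longrightarrow> x / y \<in> F"
    using mult[OF _ inv, of x y] by (simp add: divide_inverse)
qed (use assms in \<open>auto simp: subfield_set_def\<close>)

lemma field_preorderD:
  assumes "field_preorder P"
  shows "1 \<in> P" "x \<in> P \<Longrightarrow> y \<in> P \<Longrightarrow> x + y \<in> P" "x \<in> P \<Longrightarrow> y \<in> P \<Longrightarrow> x * y \<in> P"
    "x \<in> P \<Longrightarrow> y \<in> P \<Longrightarrow> (x - y)\<^sup>2 \<in> P" "x \<in> P \<Longrightarrow> inverse x \<in> P" "-1 \<notin> P" "0 \<in> P"
proof -
  have "(1 - 1 :: 'a)\<^sup>2 \<in> P"
    using assms unfolding field_preorder_def by blast
  then show "0 \<in> P" by simp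
qed (use assms in \<open>auto simp: field_preorder_def\<close>)

lemma field_preorder_square:
  assumes "field_preorder P" "x \<in> difference_set P"
  shows "x\<^sup>2 \<in> P" "x * x \<in> P"
  using assms field_preorderD(4)[OF assms(1)]
  by (auto simp: difference_set_def power2_eq_square)

lemma subset_difference_set:
  assumes "field_preorder P"
  shows "P \<subseteq> difference_set P"
proof
  fix x assume "x \<in> P"
  then show "x \<in> difference_set P"
    using field_preorderD(7)[OF assms] unfolding difference_set_def
    by (intro CollectI exI[of _ x] exI[of _ 0]) simp
qed

lemma subfield_difference_set:
  assumes P: "field_preorder P"
  shows "subfield_set (difference_set P)"
proof -
  note D = field_preorderD[OF P]
  have add: "x + y \<in> difference_set P" if xy: "x \<in> difference_set P" "y \<in> difference_set P" for x y
  proof -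
    obtain a b c d where "x = a - b" "y = c - d" "a \<in> P" "b \<in> P" "c \<in> P" "d \<in> P"
      using xy by (auto simp: difference_set_def)
    then have "x + y = (a + c) - (b + d)" "a + c \<in> P" "b + d \<in> P"
      using D by auto
    then show ?thesis unfolding difference_set_def by blast
  qed
  have mult: "x * y \<in> difference_set P" if xy: "x \<in> difference_set P" "y \<in> difference_set P" for x y
  proof -
    obtain a b c d where "x = a - b" "y = c - d" "a \<in> P" "b \<in> P" "c \<in> P" "d \<in> P"
      using xy by (auto simp: difference_set_def)
    then have "x * y = (a * c + b * d) - (a * d + b * c)" "a * c + b * d \<in> P" "a * d + b * c \<in> P"
      using D by (auto simp: algebra_simps)
    then show ?thesis unfolding difference_set_def by blast
  qed
  have sub: "x \<in> difference_set P" if "x \<in> P" for x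
    using subset_difference_set[OF P] that by blast
  have inv: "inverse x \<in> difference_set P" if "x \<in> difference_set P" for x
  proof -
    \<comment> \<open>Inverses are available only for elements of \<open>P\<close>; the square of
      \<open>x\<close> is one.\<close>
    have "inverse x = x * inverse (x\<^sup>2)"
      by (cases "x = 0") (auto simp: power2_eq_square)
    moreover have "inverse (x\<^sup>2) \<in> P"
      by (intro D field_preorder_square[OF P that])
    ultimately show ?thesis using mult[OF that sub] by metis
  qed
  have neg: "- x \<in> difference_set P" if x: "x \<in> difference_set P" for x
  proof -
    obtain a b where "x = a - b" "a \<in> P" "b \<in> P"
      using x by (auto simp: difference_set_def)
    then show ?thesis
      unfolding difference_set_def by (intro CollectI exI[of _ b] exI[of _ a]) simp
  qed
  show ?thesis
    unfolding subfield_set_def using add mult inv neg sub[OF D(1)] sub[OF D(7)] by simp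
qed

lemma field_preorderI:
  assumes F: "subfield_set F" and "Q \<subseteq> F" and "\<And>x. x \<in> F \<Longrightarrow> x\<^sup>2 \<in> Q"
    and add: "\<And>x y. x \<in> Q \<Longrightarrow> y \<in> Q \<Longrightarrow> x + y \<in> Q" and mult: "\<And>x y. x \<in> Q \<Longrightarrow> y \<in> Q \<Longrightarrow> x * y \<in> Q"
    and "-1 \<notin> Q"
  shows "field_preorder Q"
proof -
  have "1 \<in> Q"
    using assms(3)[of 1] subfield_setD[OF F] by simp
  moreover have "(x - y)\<^sup>2 \<in> Q" if "x \<in> Q" "y \<in> Q" for x y
    using that assms(2) by (intro assms(3) subfield_setD(7)[OF F]) auto
  moreover have "inverse x \<in> Q" if "x \<in> Q" for x
  proof -
    have "inverse x = x * (inverse x)\<^sup>2"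
      by (cases "x = 0") (auto simp: power2_eq_square)
    moreover have "(inverse x)\<^sup>2 \<in> Q"
      using that assms(2) by (intro assms(3) subfield_setD(6)[OF F]) auto
    ultimately show ?thesis using mult[OF that] by metis
  qed
  ultimately show ?thesis
    unfolding field_preorder_def using add mult assms(6) by simp
qed

lemma field_preorder_adjoin:
  fixes P :: "'a::field set"
  assumes P: "field_preorder P" and a: "a \<in> difference_set P"
    and "\<And>s t. s \<in> P \<Longrightarrow> t \<in> P \<Longrightarrow> -1 \<noteq> s + a * t"
  shows "field_preorder {s + a * t | s t. s \<in> P \<and> t \<in> P}" (is "field_preorder ?Q")
proof (rule field_preorderI)
  note D = field_preorderD[OF P]
  note F = subfield_setD[OF subfield_difference_set[OF P]]
  show "subfield_set (difference_set P)" by (rule subfield_difference_set[OF P])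
  show "?Q \<subseteq> difference_set P"
    using subset_difference_set[OF P] by (auto intro!: F a)
  show "x\<^sup>2 \<in> ?Q" if "x \<in> difference_set P" for x
  proof -
    have "x\<^sup>2 = x\<^sup>2 + a * 0" by simp
    then show ?thesis using field_preorder_square(1)[OF P that] D(7) by blast
  qed
  fix x y assume "x \<in> ?Q" "y \<in> ?Q"
  then obtain s t s' t' where xy: "x = s + a * t" "y = s' + a * t'" "s \<in> P" "t \<in> P" "s' \<in> P" "t' \<in> P"
    by blast
  have "x + y = (s + s') + a * (t + t')" using xy by (simp add: algebra_simps)
  then show "x + y \<in> ?Q" using D(2)[OF xy(3,5)] D(2)[OF xy(4,6)] by blast
  have "x * y = (s * s' + a\<^sup>2 * (t * t')) + a * (s * t' + t * s')"
    using xy by (simp add: algebra_simps power2_eq_square)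
  moreover have "s * s' + a\<^sup>2 * (t * t') \<in> P" "s * t' + t * s' \<in> P"
    by (intro D field_preorder_square[OF P a] xy)+
  ultimately show "x * y \<in> ?Q" by blast
qed (use assms(3) in auto)

text \<open>The competitors \<open>Q\<close> may live on larger subfields of the ambient field.
  Maximality therefore has two effects: \<open>P\<close> is total on its own field, and no proper
  algebraic extension of that field inside the closure can be ordered compatibly.\<close>

definition maximal_field_preorder :: "'a::field set \<Rightarrow> bool" where
  "maximal_field_preorder P \<longleftrightarrow> field_preorder P \<and> (\<forall>Q. field_preorder Q \<and> P \<subseteq> Q \<longrightarrow> Q = P)"

lemma maximal_field_preorder_exists:
  assumes "field_preorder P"
  shows "\<exists>Q. maximal_field_preorder Q \<and> P \<subseteq> Q"
proof -
  let ?S = "{Q. field_preorder Q \<and> P \<subseteq> Q}"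
  have "\<exists>M\<in>?S. \<forall>Y\<in>?S. M \<subseteq> Y \<longrightarrow> Y = M"
  proof (rule subset_Zorn_nonempty)
    fix C assume C: "C \<noteq> {}" "subset.chain ?S C"
    then have mem: "\<And>Q. Q \<in> C \<Longrightarrow> field_preorder Q \<and> P \<subseteq> Q"
      by (auto simp: subset.chain_def)
    have joint: "\<exists>Q\<in>C. x \<in> Q \<and> y \<in> Q" if "x \<in> \<Union>C" "y \<in> \<Union>C" for x y
      using that C unfolding subset.chain_def by blast
    have "field_preorder (\<Union>C)"
      unfolding field_preorder_def
    proof (intro conjI ballI)
      show "1 \<in> \<Union>C" using C mem field_preorderD(1) by blast
      show "- 1 \<notin> \<Union>C" using mem field_preorderD(6) by blast
    next
      fix x assume "x \<in> \<Union>C"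
      then show "inverse x \<in> \<Union>C" using mem field_preorderD(5) by blast
      fix y assume "y \<in> \<Union>C"
      from joint[OF \<open>x \<in> \<Union>C\<close> this] obtain Q where "Q \<in> C" "x \<in> Q" "y \<in> Q" by blast
      then show "x + y \<in> \<Union>C" "x * y \<in> \<Union>C" "(x - y)\<^sup>2 \<in> \<Union>C"
        using mem field_preorderD(2-4) by blast+
    qed
    then show "\<Union>C \<in> ?S" using C mem by blast
  qed (use assms in auto)
  then obtain M where M: "field_preorder M" "P \<subseteq> M"
    "\<And>Y. field_preorder Y \<Longrightarrow> P \<subseteq> Y \<Longrightarrow> M \<subseteq> Y \<Longrightarrow> Y = M"
    by auto
  have "Q = M" if "field_preorder Q" "M \<subseteq> Q" for Q
    using M(3)[OF that(1) _ that(2)] that(2) M(2) by simp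
  then show ?thesis unfolding maximal_field_preorder_def using M(1,2) by blast
qed

text \<open>Adjoining \<open>a\<close> or \<open>- a\<close> must each produce -1. Multiplying the
  two equations \<open>a * t = - 1 - s\<close> and \<open>a * t' = 1 + s'\<close> gives an identity
  that puts -1 into \<open>P\<close> itself.\<close>

lemma maximal_field_preorder_total:
  assumes P: "maximal_field_preorder P" and a: "a \<in> difference_set P"
  shows "a \<in> P \<or> - a \<in> P"
proof (rule ccontr)
  assume *: "\<not> (a \<in> P \<or> - a \<in> P)"
  have fp: "field_preorder P" and mx: "\<And>Q. field_preorder Q \<Longrightarrow> P \<subseteq> Q \<Longrightarrow> Q = P"
    using P unfolding maximal_field_preorder_def by auto
  note D = field_preorderD[OF fp]
  have ex: "\<exists>s\<in>P. \<exists>t\<in>P. -1 = s + b * t" if "b \<in> difference_set P" "b \<notin> P" for b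
  proof (rule ccontr)
    assume "\<not> ?thesis"
    then have "field_preorder {s + b * t | s t. s \<in> P \<and> t \<in> P}" (is "field_preorder ?Q")
      by (intro field_preorder_adjoin[OF fp that(1)]) auto
    moreover have "P \<subseteq> ?Q"
    proof
      fix x assume "x \<in> P"
      then show "x \<in> ?Q" using D(7) by (intro CollectI exI[of _ x] exI[of _ 0]) auto
    qed
    ultimately have "?Q = P" by (rule mx)
    moreover have "b \<in> ?Q"
      using D by (intro CollectI exI[of _ 0] exI[of _ 1]) auto
    ultimately show False using that by blast
  qed
  have "- a \<in> difference_set P"
    by (intro a subfield_setD[OF subfield_difference_set[OF fp]])
  with ex[OF a] ex[of "- a"] * obtain s t s' t' where st: "s \<in> P" "t \<in> P" "s' \<in> P" "t' \<in> P"
    "-1 = s + a * t" "-1 = s' + - a * t'" by blast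
  have "a * t = - 1 - s" "a * t' = 1 + s'"
    using st(5,6) by (simp_all add: algebra_simps eq_neg_iff_add_eq_0 add_eq_0_iff)
  then have "a\<^sup>2 * (t * t') = (- 1 - s) * (1 + s')"
    by (metis mult.assoc mult.left_commute power2_eq_square)
  then have "s + s' + s * s' + a\<^sup>2 * (t * t') = -1"
    by (simp add: algebra_simps)
  moreover have "s + s' + s * s' + a\<^sup>2 * (t * t') \<in> P"
    by (intro D field_preorder_square[OF fp a] st)
  ultimately show False using D(6) by simp
qed

lemma field_preorder_antisym:
  assumes fp: "field_preorder P" and "a \<in> P" "- a \<in> P"
  shows "a = 0"
proof (rule ccontr)
  assume "a \<noteq> 0"
  then have "- 1 = inverse a * - a" by simp
  then show False using field_preorderD(6)[OF fp] field_preorderD(3,5)[OF fp] assms by metis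
qed

lemma maximal_field_preorder_above_nonneg:
  "\<exists>P::'a::linordered_field alg_closure set. maximal_field_preorder P \<and> to_ac ` {0..} \<subseteq> P"
proof -
  have "field_preorder (to_ac ` {0::'a..})"
    unfolding field_preorder_def
  proof (intro conjI ballI)
    show "1 \<in> to_ac ` {0::'a..}" by (rule image_eqI[of _ _ 1]) auto
    show "- 1 \<notin> to_ac ` {0::'a..}"
    proof
      assume "- 1 \<in> to_ac ` {0::'a..}"
      then obtain x :: 'a where "- to_ac 1 = to_ac x" "x \<ge> 0" by auto
      then have "x = -1" by (simp only: to_ac_minus[symmetric] to_ac_eq_iff)
      then show False using \<open>x \<ge> 0\<close> by simp
    qed
  next
    fix x assume "x \<in> to_ac ` {0::'a..}"
    then obtain a :: 'a where a: "x = to_ac a" "a \<ge> 0" by auto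
    then show "inverse x \<in> to_ac ` {0::'a..}" by (intro image_eqI[of _ _ "inverse a"]) auto
    fix y assume "y \<in> to_ac ` {0::'a..}"
    then obtain b :: 'a where b: "y = to_ac b" "b \<ge> 0" by auto
    show "x + y \<in> to_ac ` {0::'a..}" using a b by (intro image_eqI[of _ _ "a + b"]) auto
    show "x * y \<in> to_ac ` {0::'a..}" using a b by (intro image_eqI[of _ _ "a * b"]) auto
    show "(x - y)\<^sup>2 \<in> to_ac ` {0::'a..}" using a b by (intro image_eqI[of _ _ "(a - b)\<^sup>2"]) auto
  qed
  from maximal_field_preorder_exists[OF this] show ?thesis by blast
qed

text \<open>One choice per ordered field, made globally because the type of the real closure is
  built from it.\<close>

definition real_closure_cone :: "'a::linordered_field alg_closure set" where
  "real_closure_cone = (SOME P. maximal_field_preorder P \<and> to_ac ` {0..} \<subseteq> P)"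

lemma real_closure_cone:
  "maximal_field_preorder (real_closure_cone :: 'a::linordered_field alg_closure set)"
  "field_preorder (real_closure_cone :: 'a::linordered_field alg_closure set)"
  "to_ac ` {0::'a..} \<subseteq> real_closure_cone"
  using someI_ex[OF maximal_field_preorder_above_nonneg, where 'a1 = 'a]
  unfolding real_closure_cone_def by (auto simp: maximal_field_preorder_def)

section \<open>The real closure as an ordered field\<close>

typedef (overloaded) 'a real_closure =
  "difference_set (real_closure_cone :: 'a::linordered_field alg_closure set)"
  using subfield_setD(1)[OF subfield_difference_set[OF real_closure_cone(2)]] by blast

setup_lifting type_definition_real_closure

instantiation real_closure :: (linordered_field) field
begin

lift_definition zero_real_closure :: "'a real_closure" is 0
  by (rule subfield_setD[OF subfield_difference_set[OF real_closure_cone(2)]])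
lift_definition one_real_closure :: "'a real_closure" is 1
  by (rule subfield_setD[OF subfield_difference_set[OF real_closure_cone(2)]])
lift_definition plus_real_closure :: "'a real_closure \<Rightarrow> 'a real_closure \<Rightarrow> 'a real_closure" is "(+)"
  by (rule subfield_setD[OF subfield_difference_set[OF real_closure_cone(2)]])
lift_definition minus_real_closure :: "'a real_closure \<Rightarrow> 'a real_closure \<Rightarrow> 'a real_closure" is "(-)"
  by (rule subfield_setD[OF subfield_difference_set[OF real_closure_cone(2)]])
lift_definition times_real_closure :: "'a real_closure \<Rightarrow> 'a real_closure \<Rightarrow> 'a real_closure" is "(*)"
  by (rule subfield_setD[OF subfield_difference_set[OF real_closure_cone(2)]])
lift_definition divide_real_closure :: "'a real_closure \<Rightarrow> 'a real_closure \<Rightarrow> 'a real_closure" is "(/)"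
  by (rule subfield_setD[OF subfield_difference_set[OF real_closure_cone(2)]])
lift_definition uminus_real_closure :: "'a real_closure \<Rightarrow> 'a real_closure" is "uminus"
  by (rule subfield_setD[OF subfield_difference_set[OF real_closure_cone(2)]])
lift_definition inverse_real_closure :: "'a real_closure \<Rightarrow> 'a real_closure" is "inverse"
  by (rule subfield_setD[OF subfield_difference_set[OF real_closure_cone(2)]])

instance
  by standard (transfer; simp add: algebra_simps divide_inverse)+

end

instantiation real_closure :: (linordered_field) linordered_field
begin

lift_definition less_eq_real_closure :: "'a real_closure \<Rightarrow> 'a real_closure \<Rightarrow> bool"
  is "\<lambda>x y. y - x \<in> real_closure_cone" .
definition less_real_closure :: "'a real_closure \<Rightarrow> 'a real_closure \<Rightarrow> bool"
  where "less_real_closure x y \<longleftrightarrow> x \<le> y \<and> x \<noteq> y"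
definition abs_real_closure :: "'a real_closure \<Rightarrow> 'a real_closure"
  where "abs_real_closure x = (if x < 0 then - x else x)"
definition sgn_real_closure :: "'a real_closure \<Rightarrow> 'a real_closure"
  where "sgn_real_closure x = (if x = 0 then 0 else if 0 < x then 1 else - 1)"

instance
proof
  note D = field_preorderD[OF real_closure_cone(2)]
  fix x y z :: "'a real_closure"
  show anti: "x \<le> y \<Longrightarrow> y \<le> x \<Longrightarrow> x = y"
    for x y :: "'a real_closure"
  proof transfer
    fix x y :: "'a alg_closure"
    assume "y - x \<in> real_closure_cone" "x - y \<in> real_closure_cone"
    then show "x = y"
      using field_preorder_antisym[OF real_closure_cone(2), of "y - x"] by simp
  qed
  show "x < y \<longleftrightarrow> x \<le> y \<and> \<not> y \<le> x"
    unfolding less_real_closure_def using anti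
    by (metis (mono_tags, lifting) cancel_comm_monoid_add_class.diff_cancel D(7) less_eq_real_closure.rep_eq)
  show "x \<le> x" by transfer (use D in simp)
  show "x \<le> y \<Longrightarrow> y \<le> z \<Longrightarrow> x \<le> z"
  proof transfer
    fix x y z :: "'a alg_closure"
    assume "y - x \<in> real_closure_cone" "z - y \<in> real_closure_cone"
    from D(2)[OF this] show "z - x \<in> real_closure_cone" by simp
  qed
  show "x \<le> y \<Longrightarrow> z + x \<le> z + y" by transfer simp
  show "x \<le> y \<or> y \<le> x"
  proof transfer
    fix x y :: "'a alg_closure"
    assume "x \<in> difference_set real_closure_cone" "y \<in> difference_set real_closure_cone"
    then have "y - x \<in> difference_set real_closure_cone"
      by (intro subfield_setD[OF subfield_difference_set[OF real_closure_cone(2)]])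
    then show "y - x \<in> real_closure_cone \<or> x - y \<in> real_closure_cone"
      using maximal_field_preorder_total[OF real_closure_cone(1)] by fastforce
  qed
  have pos: "0 \<le> a \<Longrightarrow> 0 \<le> b \<Longrightarrow> 0 \<le> a * b" for a b :: "'a real_closure"
    by transfer (use D(3) in auto)
  assume "x < y" "0 < z"
  then have "0 \<le> z * (y - x)" "x \<noteq> y" "z \<noteq> 0"
    using pos[of z "y - x"] unfolding less_real_closure_def
    by (auto simp: less_eq_real_closure.rep_eq minus_real_closure.rep_eq zero_real_closure.rep_eq)
  moreover have "z * x \<noteq> z * y" using \<open>x \<noteq> y\<close> \<open>z \<noteq> 0\<close> by simp
  ultimately show "z * x < z * y"
    unfolding less_real_closure_def
    by (simp add: less_eq_real_closure.rep_eq times_real_closure.rep_eq minus_real_closure.rep_eq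
        zero_real_closure.rep_eq algebra_simps)
qed (auto simp: abs_real_closure_def sgn_real_closure_def)

end

lift_definition to_real_closure :: "'a::linordered_field \<Rightarrow> 'a real_closure" is to_ac
proof -
  fix x :: 'a
  \<comment> \<open>Positive part minus negative part, both in the cone.\<close>
  have "to_ac x = to_ac (max x 0) - to_ac (max (- x) 0)"
    by (simp add: to_ac_diff[symmetric] max_def del: to_ac_diff)
  moreover have "to_ac (max x 0) \<in> real_closure_cone" "to_ac (max (- x) 0) \<in> real_closure_cone"
    using real_closure_cone(3) by auto
  ultimately show "to_ac x \<in> difference_set real_closure_cone"
    unfolding difference_set_def by blast
qed

lemma to_real_closure_simps [simp]:
  "to_real_closure 0 = 0" "to_real_closure 1 = 1"
  "to_real_closure (x + y) = to_real_closure x + to_real_closure y"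
  "to_real_closure (x * y) = to_real_closure x * to_real_closure y"
  by (transfer; simp)+

lemma to_real_closure_mono: "x \<le> y \<Longrightarrow> to_real_closure x \<le> to_real_closure y"
proof transfer
  fix x y :: 'a assume "x \<le> y"
  then have "to_ac (y - x) \<in> real_closure_cone"
    using real_closure_cone(3) by (meson atLeast_iff diff_ge_0_iff_ge image_subset_iff)
  then show "to_ac y - to_ac x \<in> real_closure_cone" by simp
qed

text \<open>
  A sign change of an irreducible polynomial \<open>p\<close> over the real closure would make the field
  generated by a root of \<open>p\<close> in the algebraic closure orderable: otherwise \<open>-1\<close> is a weighted sum of
  squares modulo \<open>p\<close>, and the cofactor of \<open>p\<close> in that identity has smaller degree and also changes sign.
\<close>

abbreviation eval_ac :: "'a::linordered_field real_closure poly \<Rightarrow> 'a alg_closure \<Rightarrow> 'a alg_closure" where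
  "eval_ac p \<alpha> \<equiv> poly (map_poly Rep_real_closure p) \<alpha>"

lemma Rep_real_closure_simps:
  "Rep_real_closure 0 = 0" "Rep_real_closure 1 = 1"
  "Rep_real_closure (x + y) = Rep_real_closure x + Rep_real_closure y"
  "Rep_real_closure (x * y) = Rep_real_closure x * Rep_real_closure y"
  "Rep_real_closure (- x) = - Rep_real_closure x"
  by (simp_all add: zero_real_closure.rep_eq one_real_closure.rep_eq plus_real_closure.rep_eq
      times_real_closure.rep_eq uminus_real_closure.rep_eq)

lemma eval_ac_add: "eval_ac (p + q) \<alpha> = eval_ac p \<alpha> + eval_ac q \<alpha>"
proof -
  have "map_poly Rep_real_closure (p + q) = map_poly Rep_real_closure p + map_poly Rep_real_closure q"
    by (rule poly_eqI) (simp add: coeff_map_poly Rep_real_closure_simps)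
  then show ?thesis by simp
qed

lemma eval_ac_pCons: "eval_ac (pCons a p) \<alpha> = Rep_real_closure a + \<alpha> * eval_ac p \<alpha>"
  by (simp add: map_poly_pCons Rep_real_closure_simps)

lemma eval_ac_0: "eval_ac 0 \<alpha> = 0"
  by simp

lemma eval_ac_smult: "eval_ac (smult c p) \<alpha> = Rep_real_closure c * eval_ac p \<alpha>"
  by (induction p) (simp_all add: eval_ac_pCons eval_ac_0 Rep_real_closure_simps algebra_simps)

lemma eval_ac_mult: "eval_ac (p * q) \<alpha> = eval_ac p \<alpha> * eval_ac q \<alpha>"
  by (induction p)
    (simp_all add: eval_ac_add eval_ac_pCons eval_ac_0 eval_ac_smult Rep_real_closure_simps
      algebra_simps)

lemma degree_map_Rep_real_closure: "degree (map_poly Rep_real_closure p) = degree p"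
  by (rule degree_map_poly) (metis Rep_real_closure_inverse Rep_real_closure_simps(1))

text \<open>The preorder generated by the squares of \<open>F\<close> and the nonnegative elements
  of the real closure. As soon as it misses -1, it competes with the maximal cone.\<close>

inductive_set weighted_squares :: "'a::linordered_field alg_closure set \<Rightarrow> 'a alg_closure set"
  for F where
  zero: "0 \<in> weighted_squares F"
| step: "0 \<le> c \<Longrightarrow> x \<in> F \<Longrightarrow> y \<in> weighted_squares F \<Longrightarrow>
    Rep_real_closure c * x\<^sup>2 + y \<in> weighted_squares F"

lemma weighted_squares_add:
  assumes "x \<in> weighted_squares F" "y \<in> weighted_squares F"
  shows "x + y \<in> weighted_squares F"
  using assms(1) by induction (auto simp: assms(2) add.assoc intro: weighted_squares.intros)

lemma weighted_squares_scale:
  assumes "x \<in> weighted_squares F" "0 \<le> c" "z \<in> F" "subfield_set F"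
  shows "Rep_real_closure c * z\<^sup>2 * x \<in> weighted_squares F"
  using assms(1)
proof induction
  case (step d x y)
  have "Rep_real_closure c * z\<^sup>2 * (Rep_real_closure d * x\<^sup>2 + y) =
      Rep_real_closure (c * d) * (z * x)\<^sup>2 + Rep_real_closure c * z\<^sup>2 * y"
    by (simp add: Rep_real_closure_simps algebra_simps power2_eq_square)
  then show ?case
    using step assms(2,3) subfield_setD(4)[OF assms(4)]
    by (metis mult_nonneg_nonneg weighted_squares.step)
qed (simp add: weighted_squares.zero)

lemma weighted_squares_mult:
  assumes "x \<in> weighted_squares F" "y \<in> weighted_squares F" "subfield_set F"
  shows "x * y \<in> weighted_squares F"
  using assms(1)
proof induction
  case (step c x z)
  then show ?case
    using weighted_squares_add[OF weighted_squares_scale[OF assms(2) step(1,2) assms(3)] step(4)]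
    by (simp add: algebra_simps)
qed (simp add: weighted_squares.zero)

lemma Rep_real_closure_nonneg_iff: "0 \<le> c \<longleftrightarrow> Rep_real_closure c \<in> real_closure_cone"
  by (simp add: less_eq_real_closure.rep_eq Rep_real_closure_simps)

lemma weighted_squares_subset:
  assumes "subfield_set F" "range Rep_real_closure \<subseteq> F"
  shows "weighted_squares F \<subseteq> F"
proof
  fix x assume "x \<in> weighted_squares F"
  then show "x \<in> F"
    by induction (use assms(2) in \<open>auto simp: power2_eq_square intro!: subfield_setD[OF assms(1)]\<close>)
qed

lemma real_closure_subset_weighted_squares:
  assumes F: "subfield_set F"
  shows "real_closure_cone \<subseteq> weighted_squares F"
proof
  fix x :: "'a alg_closure" assume x: "x \<in> real_closure_cone"
  then have "x \<in> difference_set real_closure_cone"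
    using subset_difference_set[OF real_closure_cone(2)] by blast
  then obtain c where c: "x = Rep_real_closure c" by (metis Rep_real_closure_cases)
  then have "0 \<le> c" using x by (simp add: Rep_real_closure_nonneg_iff)
  from weighted_squares.step[OF this subfield_setD(2)[OF F] weighted_squares.zero]
  show "x \<in> weighted_squares F" using c by simp
qed

text \<open>Without -1 the weighted squares form a preorder above the maximal cone, hence equal to
  it. Each \<alpha> in \<open>F\<close> is the difference of the squares of (\<alpha> + 1)/2 and
  (\<alpha> - 1)/2, so it lies in the field of the cone, which is the real closure.\<close>

lemma real_closure_no_extension:
  fixes F :: "'a::linordered_field alg_closure set"
  assumes F: "subfield_set F" "range Rep_real_closure \<subseteq> F" and "-1 \<notin> weighted_squares F"
    and \<alpha>: "\<alpha> \<in> F"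
  obtains r where "\<alpha> = Rep_real_closure r"
proof -
  let ?Q = "weighted_squares F"
  have sq: "x\<^sup>2 \<in> ?Q" if "x \<in> F" for x
    using weighted_squares.step[OF zero_le_one that weighted_squares.zero]
    by (simp add: Rep_real_closure_simps)
  have "field_preorder ?Q"
    by (rule field_preorderI[OF F(1)])
      (use assms(3) weighted_squares_subset[OF F] sq weighted_squares_add weighted_squares_mult F(1) in auto)
  then have eq: "?Q = real_closure_cone"
    using real_closure_cone(1) real_closure_subset_weighted_squares[OF F(1)]
    unfolding maximal_field_preorder_def by blast
  have "((\<alpha> + 1) / 2)\<^sup>2 - ((\<alpha> - 1) / 2)\<^sup>2 = \<alpha>"
    by (simp add: power2_eq_square field_simps)
  moreover have "(2 :: 'a alg_closure) \<in> F"
    using subfield_setD(3)[OF F(1) subfield_setD(2)[OF F(1)] subfield_setD(2)[OF F(1)]] by simp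
  then have "((\<alpha> + 1) / 2)\<^sup>2 \<in> ?Q" "((\<alpha> - 1) / 2)\<^sup>2 \<in> ?Q"
    by (intro sq subfield_setD[OF F(1)] \<alpha>; assumption?)+
  ultimately have "\<alpha> \<in> difference_set real_closure_cone"
    unfolding difference_set_def eq by (smt (verit) mem_Collect_eq)
  then show thesis using that by (metis Rep_real_closure_cases)
qed

text \<open>If \<open>f\<close> does not vanish at \<alpha>, the ideal generated by \<open>f\<close>
  and \<open>p\<close> is generated by a constant: its generator \<open>d\<close> divides
  \<open>p\<close>, but is not associated to \<open>p\<close>, as it also divides \<open>f\<close>.
  The resulting Bezout identity, evaluated at \<alpha>, inverts the value of
  \<open>f\<close>.\<close>

lemma subfield_eval_ac:
  fixes p :: "'a::linordered_field real_closure poly"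
  assumes root: "eval_ac p \<alpha> = 0" "p \<noteq> 0" and irr: "\<And>q s. p = q * s \<Longrightarrow> degree q = 0 \<or> degree s = 0"
  shows "subfield_set (range (\<lambda>f. eval_ac f \<alpha>))" (is "subfield_set ?F")
proof -
  have inv: "inverse (eval_ac f \<alpha>) \<in> ?F" for f
  proof (cases "eval_ac f \<alpha> = 0")
    case False
    define J where "J = {u * f + v * p | u v. True}"
    have pJ: "p \<in> J" "f \<in> J"
      unfolding J_def by (rule CollectI, rule exI[of _ 0], rule exI[of _ 1], simp)
        (rule CollectI, rule exI[of _ 1], rule exI[of _ 0], simp)
    define d where "d = arg_min degree (\<lambda>d. d \<in> J \<and> d \<noteq> 0)"
    have d: "d \<in> J" "d \<noteq> 0" and dmin: "\<And>e. e \<in> J \<Longrightarrow> e \<noteq> 0 \<Longrightarrow> degree d \<le> degree e"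
      using arg_min_nat_lemma[of "\<lambda>d. d \<in> J \<and> d \<noteq> 0" p degree] pJ root unfolding d_def by auto
    have modJ: "e mod d \<in> J" if e: "e \<in> J" for e
    proof -
      obtain u v u' v' where "e = u * f + v * p" "d = u' * f + v' * p"
        using e d(1) unfolding J_def by blast
      then have "e mod d = (u - (e div d) * u') * f + (v - (e div d) * v') * p"
        by (simp add: minus_div_mult_eq_mod[symmetric] algebra_simps)
      then show ?thesis unfolding J_def by blast
    qed
    have dvd: "d dvd e" if "e \<in> J" for e
    proof (rule ccontr)
      assume "\<not> d dvd e"
      then have "e mod d \<noteq> 0" by (simp add: dvd_eq_mod_eq_0)
      then show False
        using dmin[OF modJ[OF that]] degree_mod_less[OF d(2), of e] by auto
    qed
    obtain s where s: "p = d * s" using dvd[OF pJ(1)] by (elim dvdE)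
    have "degree d = 0"
    proof (rule ccontr)
      assume "degree d \<noteq> 0"
      with irr[OF s] obtain c where c: "s = [:c:]" by (metis degree_eq_zeroE)
      then have "c \<noteq> 0" using s root by auto
      obtain w where "f = d * w" using dvd[OF pJ(2)] by (elim dvdE)
      then have "Rep_real_closure c * eval_ac f \<alpha> = eval_ac p \<alpha> * eval_ac w \<alpha>"
        using s c by (simp add: eval_ac_mult eval_ac_pCons eval_ac_0 del: mult_pCons_right)
      moreover have "Rep_real_closure c \<noteq> 0"
        using \<open>c \<noteq> 0\<close> by (metis Rep_real_closure_inverse Rep_real_closure_simps(1))
      ultimately show False using root False by simp
    qed
    then obtain c where c: "d = [:c:]" "c \<noteq> 0" using d by (metis degree_eq_zeroE pCons_0_0)
    obtain u v where "d = u * f + v * p" using d(1) unfolding J_def by blast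
    then have "[:c:] = u * f + v * p" using c(1) by simp
    then have "Rep_real_closure c = eval_ac u \<alpha> * eval_ac f \<alpha>"
      using root by (metis add.right_neutral eval_ac_0 eval_ac_add eval_ac_mult eval_ac_pCons mult_zero_right)
    moreover have "Rep_real_closure (inverse c) * Rep_real_closure c = 1"
      using c(2) by (simp flip: Rep_real_closure_simps(4) add: Rep_real_closure_simps(2))
    ultimately have "eval_ac (smult (inverse c) u) \<alpha> * eval_ac f \<alpha> = 1"
      by (simp add: eval_ac_smult mult.assoc)
    then have "inverse (eval_ac f \<alpha>) = eval_ac (smult (inverse c) u) \<alpha>"
      using False by (simp add: field_simps)
    then show ?thesis by blast
  next
    case True
    then show ?thesis using rangeI[of "\<lambda>f. eval_ac f \<alpha>" 0] by simp
  qed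
  have "- eval_ac f \<alpha> \<in> ?F" for f
  proof -
    have "- eval_ac f \<alpha> = eval_ac (smult (- 1) f) \<alpha>"
      unfolding eval_ac_smult by (simp add: Rep_real_closure_simps)
    then show ?thesis by blast
  qed
  moreover have "eval_ac f \<alpha> + eval_ac g \<alpha> \<in> ?F" "eval_ac f \<alpha> * eval_ac g \<alpha> \<in> ?F" for f g
    by (simp_all flip: eval_ac_add eval_ac_mult)
  moreover have "0 \<in> ?F" by (rule range_eqI[of _ _ 0]) simp
  moreover have "1 \<in> ?F"
    by (rule range_eqI[of _ _ "[:1:]"]) (simp add: eval_ac_pCons eval_ac_0 Rep_real_closure_simps)
  ultimately show ?thesis using inv unfolding subfield_set_def by blast
qed

theorem real_closure_IVT:
  fixes p :: "'a::linordered_field real_closure poly"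
  assumes "a < b" "poly p a * poly p b < 0"
  shows "\<exists>r. a < r \<and> r < b \<and> poly p r = 0"
  using assms(2)
proof (induction "degree p" arbitrary: p rule: less_induct)
  case less
  have p0: "p \<noteq> 0" using less.prems by auto
  show ?case
  proof (cases "\<exists>q s. p = q * s \<and> degree q \<noteq> 0 \<and> degree s \<noteq> 0")
    case True
    then obtain q s where qs: "p = q * s" "degree q \<noteq> 0" "degree s \<noteq> 0" by blast
    have "q \<noteq> 0" "s \<noteq> 0" using p0 qs by auto
    then have deg: "degree q < degree p" "degree s < degree p"
      using qs by (auto simp: degree_mult_eq)
    have "(poly q a * poly q b) * (poly s a * poly s b) < 0"
      using less.prems qs by (simp add: mult_ac)
    then have "poly q a * poly q b < 0 \<or> poly s a * poly s b < 0"
      by (metis mult_less_0_iff)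
    then show ?thesis
    proof
      assume "poly q a * poly q b < 0"
      from less.hyps[OF deg(1) this] show ?thesis using qs(1) by auto
    next
      assume "poly s a * poly s b < 0"
      from less.hyps[OF deg(2) this] show ?thesis using qs(1) by auto
    qed
  next
    case False
    then have irr: "\<And>q s. p = q * s \<Longrightarrow> degree q = 0 \<or> degree s = 0" by blast
    let ?n = "degree p"
    consider "?n = 0" | "?n = 1" | "?n \<ge> 2" by linarith
    then show ?thesis
    proof cases
      case 1
      then obtain c where "p = [:c:]" by (metis degree_eq_zeroE)
      then have "poly p a * poly p b = c * c" by simp
      then show ?thesis using less.prems zero_le_square[of c] by linarith
    next
      case 2
      then obtain d c where p: "p = [:c, d:]" "d \<noteq> 0" by (elim degree1_coeffs)
      define r where "r = - c / d"
      have val: "poly p x = d * (x - r)" for x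
        using p by (simp add: r_def field_simps)
      have "d\<^sup>2 * ((a - r) * (b - r)) < 0"
        using less.prems unfolding val by (simp add: power2_eq_square mult_ac)
      then have "(a - r) * (b - r) < 0"
        by (meson mult_nonneg_nonneg not_less zero_le_power2)
      then have "a < r" "r < b" using \<open>a < b\<close> unfolding mult_less_0_iff by linarith+
      moreover have "poly p r = 0" unfolding val by simp
      ultimately show ?thesis by blast
    next
      case 3
      have "\<exists>\<alpha>. eval_ac p \<alpha> = 0"
        using 3 by (intro alg_closed_imp_poly_has_root) (simp add: degree_map_Rep_real_closure)
      then obtain \<alpha> where \<alpha>: "eval_ac p \<alpha> = 0" by blast
      define F where "F = range (\<lambda>f. eval_ac f \<alpha>)"
      have F: "subfield_set F" unfolding F_def by (rule subfield_eval_ac[OF \<alpha> p0 irr])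
      have red: "\<exists>f'. eval_ac f' \<alpha> = eval_ac f \<alpha> \<and> degree f' < ?n" for f
      proof (intro exI conjI)
        have "eval_ac f \<alpha> = eval_ac (p * (f div p) + f mod p) \<alpha>"
          by (simp only: mult_div_mod_eq)
        then show "eval_ac (f mod p) \<alpha> = eval_ac f \<alpha>"
          using \<alpha> by (simp only: eval_ac_add eval_ac_mult) simp
        show "degree (f mod p) < ?n"
          using degree_mod_less[OF p0, of f] 3 by auto
      qed
      have dvd: "p dvd f" if f: "eval_ac f \<alpha> = 0" for f
      proof (rule ccontr)
        assume ndvd: "\<not> p dvd f"
        \<comment> \<open>A nonzero polynomial of least degree that vanishes at \<alpha> divides
          every other one. It divides \<open>p\<close>, so \<open>p\<close> is a constant multiple
          of it.\<close>
        define m where "m = arg_min degree (\<lambda>m. eval_ac m \<alpha> = 0 \<and> m \<noteq> 0)"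
        have m: "eval_ac m \<alpha> = 0" "m \<noteq> 0" and mmin: "\<And>e. eval_ac e \<alpha> = 0 \<Longrightarrow> e \<noteq> 0 \<Longrightarrow> degree m \<le> degree e"
          using arg_min_nat_lemma[of "\<lambda>m. eval_ac m \<alpha> = 0 \<and> m \<noteq> 0" p degree] \<alpha> p0 unfolding m_def by auto
        have modm: "e mod m = 0" if "eval_ac e \<alpha> = 0" for e
        proof (rule ccontr)
          assume nz: "e mod m \<noteq> 0"
          have "eval_ac e \<alpha> = eval_ac (m * (e div m) + e mod m) \<alpha>"
            by (simp only: mult_div_mod_eq)
          then have "eval_ac (e mod m) \<alpha> = 0"
            using m that by (simp only: eval_ac_add eval_ac_mult) simp
          from mmin[OF this nz] show False using degree_mod_less[OF m(2), of e] nz by auto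
        qed
        have pm: "p = m * (p div m)" using modm[OF \<alpha>] by (metis mult_div_mod_eq add.right_neutral)
        have "degree m \<noteq> 0"
        proof
          assume "degree m = 0"
          then obtain c where "m = [:c:]" by (metis degree_eq_zeroE)
          then have "Rep_real_closure c = 0" "c \<noteq> 0"
            using m by (auto simp: eval_ac_pCons eval_ac_0)
          then show False by (metis Rep_real_closure_inverse Rep_real_closure_simps(1))
        qed
        with irr[OF pm] obtain c where c: "p div m = [:c:]" by (metis degree_eq_zeroE)
        then have "c \<noteq> 0" "p = smult c m" using pm p0 by auto
        moreover have "m dvd f" using modm[OF f] by (simp add: dvd_eq_mod_eq_0)
        ultimately show False using ndvd by (simp add: smult_dvd_iff)
      qed
      have ranF: "range Rep_real_closure \<subseteq> F"
      proof -
        have "Rep_real_closure c = eval_ac [:c:] \<alpha>" for c by (simp add: eval_ac_pCons eval_ac_0)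
        then show ?thesis unfolding F_def by blast
      qed
      \<comment> \<open>A weighted sum of squares in \<open>F\<close> comes from a polynomial that
        is nonnegative at all points of the real closure. Squaring remainders modulo
        \<open>p\<close> keeps its degree at most 2n - 2, which leaves degree at most n - 2 for the
        cofactor \<open>k\<close> below.\<close>
      have rep: "\<exists>g. eval_ac g \<alpha> = y \<and> (\<forall>r. 0 \<le> poly g r) \<and> degree g \<le> 2 * ?n - 2"
        if "y \<in> weighted_squares F" for y
        using that
      proof induction
        case zero
        show ?case by (rule exI[of _ 0]) simp
      next
        case (step c x y)
        then obtain g where g: "eval_ac g \<alpha> = y" "\<And>r. 0 \<le> poly g r" "degree g \<le> 2 * ?n - 2" by blast
        obtain f where f: "eval_ac f \<alpha> = x" "degree f < ?n" using step(2) red unfolding F_def by blast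
        have "degree (f * f) \<le> 2 * ?n - 2"
          using degree_mult_le[of f f] f(2) by linarith
        then have "degree (smult c (f * f) + g) \<le> 2 * ?n - 2"
          using g(3) degree_smult_le[of c "f * f"] by (intro degree_add_le) linarith+
        moreover have "0 \<le> poly (smult c (f * f) + g) r" for r
          using step(1) g(2)[of r] by simp
        moreover have "eval_ac (smult c (f * f) + g) \<alpha> = Rep_real_closure c * x\<^sup>2 + y"
          unfolding eval_ac_add eval_ac_smult eval_ac_mult f g by (simp add: power2_eq_square)
        ultimately show ?case by blast
      qed
      have "- 1 \<notin> weighted_squares F"
      proof
        assume "- 1 \<in> weighted_squares F"
        from rep[OF this] obtain g where g: "eval_ac g \<alpha> = - 1" "\<And>r. 0 \<le> poly g r" "degree g \<le> 2 * ?n - 2"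
          by blast
        have "eval_ac (g + [:1:]) \<alpha> = 0"
          unfolding eval_ac_add g by (simp add: eval_ac_pCons eval_ac_0 Rep_real_closure_simps)
        then obtain k where k: "g + [:1:] = p * k" using dvd by (elim dvdE[OF dvd])
        \<comment> \<open>The product is g + 1 with \<open>g\<close> nonnegative. Hence
          \<open>p\<close> and \<open>k\<close> have equal signs everywhere, and the sign change of
          \<open>p\<close> is one of \<open>k\<close>.\<close>
        have pos: "poly p r * poly k r > 0" for r
          using g(2)[of r] arg_cong[OF k, of "\<lambda>q. poly q r"] by simp
        have "k \<noteq> 0" using pos[of a] by auto
        then have "?n + degree k = degree (g + [:1:])" using k p0 by (simp add: degree_mult_eq)
        also have "\<dots> \<le> 2 * ?n - 2" using g(3) by (intro degree_add_le) auto
        finally have "degree k < ?n" using 3 by linarith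
        moreover have "(poly p a * poly p b) * (poly k a * poly k b) > 0"
          using mult_pos_pos[OF pos[of a] pos[of b]] by (simp add: mult_ac)
        then have "poly k a * poly k b < 0"
          using less.prems unfolding zero_less_mult_iff[of "poly p a * poly p b"] by linarith
        ultimately obtain r where "poly k r = 0" using less.hyps by blast
        then show False using pos[of r] by simp
      qed
      moreover have "\<alpha> \<in> F"
        unfolding F_def by (rule range_eqI[of _ _ "[:0, 1:]"])
          (simp add: eval_ac_pCons eval_ac_0 Rep_real_closure_simps)
      ultimately obtain r where "\<alpha> = Rep_real_closure r"
        using real_closure_no_extension[OF F ranF] by blast
      \<comment> \<open>A linear polynomial that vanishes at \<alpha> is a multiple of
        \<open>p\<close>, whose degree is at least 2 in this case.\<close>
      then have "eval_ac [:- r, 1:] \<alpha> = 0"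
        by (simp add: eval_ac_pCons eval_ac_0 Rep_real_closure_simps)
      from dvd[OF this] have "degree p \<le> 1" by (auto dest: dvd_imp_degree_le)
      then show ?thesis using 3 by simp
    qed
  qed
qed

section \<open>Sign tables over real closed fields\<close>

text \<open>The intermediate value property for polynomials. A power sum with a coefficient function
  stands for a polynomial, so that the class axiom does not involve the type \<open>'a poly\<close>,
  which presupposes class structure on \<open>'a\<close>.\<close>

class real_closed_field = linordered_field +
  assumes power_sum_IVT: "a < b \<Longrightarrow> (\<Sum>k\<le>n. f k * a ^ k) * (\<Sum>k\<le>n. f k * b ^ k) < 0 \<Longrightarrow>
    \<exists>r>a. r < b \<and> (\<Sum>k\<le>n. f k * r ^ k) = 0"

lemma real_closed_fieldI:
  assumes "\<And>(p::'a::linordered_field poly) a b. a < b \<Longrightarrow> poly p a * poly p b < 0 \<Longrightarrow>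
    \<exists>r>a. r < b \<and> poly p r = 0"
  shows "OFCLASS('a, real_closed_field_class)"
proof
  fix f :: "nat \<Rightarrow> 'a" and a b :: 'a and n :: nat
  assume ab: "a < b" "(\<Sum>k\<le>n. f k * a ^ k) * (\<Sum>k\<le>n. f k * b ^ k) < 0"
  define p where "p = (\<Sum>k\<le>n. monom (f k) k)"
  have "poly p x = (\<Sum>k\<le>n. f k * x ^ k)" for x
    by (simp add: p_def poly_sum poly_monom)
  then show "\<exists>r>a. r < b \<and> (\<Sum>k\<le>n. f k * r ^ k) = 0"
    using assms[of a b p] ab by simp
qed

lemma poly_sign_change:
  fixes p :: "'a::real_closed_field poly"
  assumes "a < b" "poly p a * poly p b < 0"
  shows "\<exists>r>a. r < b \<and> poly p r = 0"
  using power_sum_IVT[OF assms(1), of "coeff p" "degree p"] assms(2) by (simp add: poly_altdef)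

instance real :: real_closed_field
proof (rule real_closed_fieldI)
  fix p :: "real poly" and a b :: real
  assume ab: "a < b" "poly p a * poly p b < 0"
  then consider "poly p a < 0" "0 < poly p b" | "poly p a > 0" "0 > poly p b"
    by (auto simp: mult_less_0_iff)
  then show "\<exists>r>a. r < b \<and> poly p r = 0"
    using poly_IVT_pos[OF ab(1)] poly_IVT_neg[OF ab(1)] by cases blast+
qed

text \<open>The order is not complete, so the proof is algebraic. With \<open>p\<close> = (X -
  a)^(k+1) (X - b)^(l+1) q, the factor \<open>q\<close> has no sign change on the interval, and the
  derivative is (X - a)^k (X - b)^l g, where \<open>g\<close> has opposite signs at a and b.\<close>

lemma poly_rolle_consecutive:
  fixes p :: "'a::real_closed_field poly"
  assumes "a < b" "poly p a = 0" "poly p b = 0" "p \<noteq> 0"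
    and no: "\<And>r. a < r \<Longrightarrow> r < b \<Longrightarrow> poly p r \<noteq> 0"
  shows "\<exists>c>a. c < b \<and> poly (pderiv p) c = 0"
proof -
  let ?u = "[:- a, 1:]" and ?v = "[:- b, 1:]"
  obtain q1 where q1: "p = ?u ^ order a p * q1" "\<not> ?u dvd q1"
    using order_decomp[OF \<open>p \<noteq> 0\<close>] by blast
  have "q1 \<noteq> 0" using q1 \<open>p \<noteq> 0\<close> by auto
  have "poly q1 b = 0"
    using arg_cong[OF q1(1), of "\<lambda>q. poly q b"] assms by (simp add: poly_power)
  obtain q where q: "q1 = ?v ^ order b q1 * q" "\<not> ?v dvd q"
    using order_decomp[OF \<open>q1 \<noteq> 0\<close>] by blast
  have "order a p \<noteq> 0" "order b q1 \<noteq> 0"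
    using assms \<open>q1 \<noteq> 0\<close> \<open>poly q1 b = 0\<close> by (auto simp: order_root)
  then obtain k l where kl: "order a p = Suc k" "order b q1 = Suc l"
    by (meson not0_implies_Suc)
  have p: "p = ?u ^ Suc k * (?v ^ Suc l * q)"
    using q1(1) q(1) kl by simp
  have qa: "poly q a \<noteq> 0"
  proof
    assume "poly q a = 0"
    then have "?u dvd q" by (simp add: poly_eq_0_iff_dvd)
    then have "?u dvd q1" using q(1) by (metis dvd_mult)
    then show False using q1 by blast
  qed
  have qb: "poly q b \<noteq> 0" using q(2) by (simp add: poly_eq_0_iff_dvd)
  have "poly q a * poly q b > 0"
  proof (rule ccontr)
    assume "\<not> ?thesis"
    then have "poly q a * poly q b < 0" using qa qb by (metis linorder_neqE mult_eq_0_iff)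
    then obtain r where r: "a < r" "r < b" "poly q r = 0" using poly_sign_change[OF \<open>a < b\<close>] by blast
    then have "poly p r = 0" unfolding p by simp
    then show False using no r by blast
  qed
  define g where "g = smult (of_nat (Suc k)) (?v * q) + smult (of_nat (Suc l)) (?u * q) + ?u * (?v * pderiv q)"
  have du: "pderiv ?u = 1" "pderiv ?v = 1" by (simp_all add: pderiv_pCons)
  have dp: "pderiv p = ?u ^ k * (?v ^ l * g)"
    unfolding p pderiv_mult pderiv_power_Suc du g_def
    by (simp only: power_Suc mult_1_right mult_1_left mult_smult_left mult_smult_right smult_add_right
        distrib_left distrib_right mult.assoc mult.commute mult.left_commute add.assoc add.commute add.left_commute)
  have gab: "poly g a = of_nat (Suc k) * ((a - b) * poly q a)"
    "poly g b = of_nat (Suc l) * ((b - a) * poly q b)"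
    unfolding g_def by (simp_all add: algebra_simps)
  have "poly g a * poly g b = - (of_nat (Suc k) * of_nat (Suc l) * (b - a)\<^sup>2 * (poly q a * poly q b))"
    unfolding gab by (simp add: power2_eq_square algebra_simps)
  moreover have "of_nat (Suc k) * of_nat (Suc l) * (b - a)\<^sup>2 * (poly q a * poly q b) > 0"
    using \<open>a < b\<close>
    by (intro mult_pos_pos[OF _ \<open>poly q a * poly q b > 0\<close>] mult_pos_pos zero_less_power)
      (auto simp del: of_nat_Suc)
  ultimately have "poly g a * poly g b < 0" by linarith
  then obtain c where "a < c" "c < b" "poly g c = 0" using poly_sign_change[OF \<open>a < b\<close>] by blast
  then show ?thesis using dp by auto
qed

lemma poly_rolle:
  fixes p :: "'a::real_closed_field poly"
  assumes "a < b" "poly p a = 0" "poly p b = 0" "p \<noteq> 0"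
  shows "\<exists>c>a. c < b \<and> poly (pderiv p) c = 0"
proof -
  let ?R = "{r. poly p r = 0 \<and> a < r \<and> r \<le> b}"
  have fin: "finite ?R"
    by (rule finite_subset[OF _ poly_roots_finite[OF \<open>p \<noteq> 0\<close>]]) auto
  have ne: "?R \<noteq> {}" using assms by auto
  define m where "m = Min ?R"
  have m: "m \<in> ?R" unfolding m_def by (rule Min_in[OF fin ne])
  have "poly p r \<noteq> 0" if r: "a < r" "r < m" for r
  proof
    assume "poly p r = 0"
    then have "r \<in> ?R" using r m by auto
    then have "m \<le> r" unfolding m_def using fin by simp
    then show False using r by simp
  qed
  then obtain c where "a < c" "c < m" "poly (pderiv p) c = 0"
    using poly_rolle_consecutive[of a m p] m assms by auto
  then show ?thesis using m by (intro exI[of _ c]) auto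
qed

lemma poly_mean_value:
  fixes p :: "'a::real_closed_field poly"
  assumes "a < b"
  shows "\<exists>c>a. c < b \<and> poly p b - poly p a = (b - a) * poly (pderiv p) c"
proof -
  define s where "s = (poly p b - poly p a) / (b - a)"
  define g where "g = p - [:poly p a - s * a, s:]"
  have dg: "poly (pderiv g) x = poly (pderiv p) x - s" for x
    by (simp add: g_def pderiv_diff pderiv_pCons)
  have s: "s * (b - a) = poly p b - poly p a" using assms by (simp add: s_def)
  have "poly g a = 0" "poly g b = 0"
    using s by (simp_all add: g_def algebra_simps)
  have "\<exists>c>a. c < b \<and> poly (pderiv g) c = 0"
  proof (cases "g = 0")
    case True
    then show ?thesis using dense[OF assms] by auto
  next
    case False
    then show ?thesis using poly_rolle[OF assms \<open>poly g a = 0\<close> \<open>poly g b = 0\<close>] by blast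
  qed
  then obtain c where "a < c" "c < b" "poly (pderiv p) c = s"
    using dg by auto
  then show ?thesis using s by (intro exI[of _ c]) (simp add: mult.commute)
qed

text \<open>Integer-valued, unlike \<open>sgn\<close>, so that signs taken in two different fields
  can be compared.\<close>

definition sg :: "'a::linordered_idom \<Rightarrow> int" where
  "sg x = (if x = 0 then 0 else if 0 < x then 1 else - 1)"

lemma sg_simps [simp]: "sg (0::'a::linordered_idom) = 0" "sg (1::'a::linordered_idom) = 1"
  by (auto simp: sg_def)

lemma sg_eq_0_iff [simp]: "sg x = 0 \<longleftrightarrow> x = 0"
  by (auto simp: sg_def)

lemma sg_eq_iff:
  "sg x = sg y \<longleftrightarrow> (x = 0 \<longleftrightarrow> y = 0) \<and> (0 < x \<longleftrightarrow> 0 < y)"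
  by (auto simp: sg_def)

lemma sg_mult: "sg (x * y) = sg x * sg y"
  by (auto simp: sg_def zero_less_mult_iff mult_less_0_iff not_less)

lemma sg_uminus [simp]: "sg (- x) = - sg x"
  by (auto simp: sg_def)

lemma sg_cases: "sg x = 0 \<or> sg x = 1 \<or> sg x = - 1"
  by (auto simp: sg_def)

section \<open>Signs of polynomials on intervals and at infinity\<close>

lemma poly_root_between:
  fixes p :: "'a::real_closed_field poly"
  assumes "a < b" "sg (poly p a) \<noteq> sg (poly p b)"
  shows "\<exists>r\<ge>a. r \<le> b \<and> poly p r = 0"
proof (cases "poly p a = 0 \<or> poly p b = 0")
  case True
  then show ?thesis using assms(1) by (meson less_le order_refl)
next
  case False
  then have "poly p a * poly p b < 0"
    using assms(2) by (auto simp: sg_def mult_less_0_iff split: if_splits)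
  then show ?thesis using poly_sign_change[OF assms(1)] by (meson less_le)
qed

lemma poly_root_strictly_between:
  fixes p :: "'a::real_closed_field poly"
  assumes "a < b" "sg (poly p a) \<noteq> sg (poly p b)" "poly p a \<noteq> 0" "poly p b \<noteq> 0"
  shows "\<exists>r>a. r < b \<and> poly p r = 0"
  using poly_root_between[OF assms(1,2)] assms(3,4) by (metis order.not_eq_order_implies_strict)

lemma sg_difference:
  fixes p :: "'a::real_closed_field poly"
  assumes "a < b" "\<And>c. a < c \<Longrightarrow> c < b \<Longrightarrow> sg (poly (pderiv p) c) = s"
  shows "sg (poly p b - poly p a) = s"
proof -
  obtain c where c: "a < c" "c < b" "poly p b - poly p a = (b - a) * poly (pderiv p) c"
    using poly_mean_value[OF assms(1)] by blast
  have "sg (b - a) = 1" using assms(1) by (simp add: sg_def)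
  then show ?thesis using c assms(2) by (simp add: sg_mult)
qed

lemma poly_ge_lead_coeff:
  fixes p :: "'a::linordered_field poly"
  assumes "lead_coeff p > 0"
  shows "\<exists>B. \<forall>x\<ge>B. poly p x \<ge> lead_coeff p"
  using assms
proof (induction p)
  case (pCons a q)
  show ?case
  proof (cases "q = 0")
    case False
    then have lc: "lead_coeff (pCons a q) = lead_coeff q" "lead_coeff q > 0" using pCons.prems by auto
    then obtain B where B: "\<And>x. x \<ge> B \<Longrightarrow> poly q x \<ge> lead_coeff q" using pCons.IH by blast
    \<comment> \<open>From this bound on, \<open>x * lead_coeff q\<close> exceeds
      \<open>lead_coeff q\<close> by at least \<open>\<bar>a\<bar>\<close>, which absorbs the
      constant coefficient.\<close>
    have "poly (pCons a q) x \<ge> lead_coeff q" if x: "x \<ge> max (max B 1) (1 + \<bar>a\<bar> / lead_coeff q)" for x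
    proof -
      have "x \<ge> 1" "x \<ge> B" and "x \<ge> 1 + \<bar>a\<bar> / lead_coeff q" using x by auto
      then have "x * lead_coeff q \<ge> (1 + \<bar>a\<bar> / lead_coeff q) * lead_coeff q"
        using lc(2) by (intro mult_right_mono) auto
      then have "x * lead_coeff q \<ge> lead_coeff q + \<bar>a\<bar>"
        using lc(2) False by (simp add: distrib_right)
      moreover have "x * poly q x \<ge> x * lead_coeff q"
        using B[OF \<open>x \<ge> B\<close>] \<open>x \<ge> 1\<close> by (intro mult_left_mono) auto
      ultimately show ?thesis by (simp add: abs_if split: if_splits)
    qed
    then show ?thesis unfolding lc(1) by blast
  qed auto
qed simp

lemma sg_poly_at_top:
  fixes p :: "'a::linordered_field poly"
  shows "\<exists>B. \<forall>x\<ge>B. sg (poly p x) = sg (lead_coeff p)"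
proof -
  consider "lead_coeff p = 0" | "lead_coeff p > 0" | "lead_coeff (- p) > 0"
    by (metis lead_coeff_minus linorder_neqE neg_0_less_iff_less)
  then show ?thesis
  proof cases
    case 2
    then obtain B where "\<And>x. x \<ge> B \<Longrightarrow> poly p x \<ge> lead_coeff p" using poly_ge_lead_coeff by blast
    then have "sg (poly p x) = sg (lead_coeff p)" if "x \<ge> B" for x
      using that 2 by (auto simp: sg_def dest!: order.strict_trans2[OF 2])
    then show ?thesis by blast
  next
    case 3
    then obtain B where B: "\<And>x. x \<ge> B \<Longrightarrow> poly (- p) x \<ge> lead_coeff (- p)" using poly_ge_lead_coeff by blast
    have "sg (poly p x) = sg (lead_coeff p)" if "x \<ge> B" for x
    proof -
      have "0 < poly (- p) x" using B[OF that] 3 by linarith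
      then show ?thesis using 3 by (auto simp: sg_def)
    qed
    then show ?thesis by blast
  qed simp
qed

lemma sg_poly_at_bot:
  fixes p :: "'a::linordered_field poly"
  shows "\<exists>B. \<forall>x\<le>B. sg (poly p x) = sg (lead_coeff p) * (- 1) ^ degree p"
proof -
  define q where "q = pcompose p [:0, - 1:]"
  obtain B where B: "\<And>x. x \<ge> B \<Longrightarrow> sg (poly q x) = sg (lead_coeff q)" using sg_poly_at_top by blast
  have "lead_coeff q = lead_coeff p * (- 1) ^ degree p"
    unfolding q_def by (subst lead_coeff_comp) auto
  then have "sg (lead_coeff q) = sg (lead_coeff p) * (- 1) ^ degree p"
    by (cases "even (degree p)") auto
  moreover have "poly q (- x) = poly p x" for x by (simp add: q_def poly_pcompose)
  ultimately have "sg (poly p x) = sg (lead_coeff p) * (- 1) ^ degree p" if "x \<le> - B" for x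
    using B[of "- x"] that by simp
  then show ?thesis by blast
qed

text \<open>
  A sign table matches the roots of finitely many polynomials over one real closed field with the roots
  of as many polynomials over another one by an order isomorphism \<open>\<rho>\<close>, such that points in corresponding
  positions give the same signs. The definitions are symmetric in the two fields.
\<close>

type_synonym ('a, 'b) matching = "('a \<times> 'b) set"

definition monotone_matching :: "('a::linordered_idom, 'b::linordered_idom) matching \<Rightarrow> bool" where
  "monotone_matching \<rho> \<longleftrightarrow> finite \<rho> \<and> (\<forall>(z, w)\<in>\<rho>. \<forall>(z', w')\<in>\<rho>. sg (z - z') = sg (w - w'))"

definition same_cell :: "('a::linordered_idom, 'b::linordered_idom) matching \<Rightarrow> 'a \<Rightarrow> 'b \<Rightarrow> bool" where
  "same_cell \<rho> x y \<longleftrightarrow> (\<forall>(z, w)\<in>\<rho>. sg (x - z) = sg (y - w))"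

text \<open>Zero polynomials contribute no points to the matching, which has to stay finite; they
  are still subject to the condition on signs.\<close>

definition sign_table ::
    "('a::linordered_idom, 'b::linordered_idom) matching \<Rightarrow> ('a poly \<times> 'b poly) set \<Rightarrow> bool" where
  "sign_table \<rho> S \<longleftrightarrow> monotone_matching \<rho> \<and>
     Domain \<rho> = {x. \<exists>(P, p)\<in>S. P \<noteq> 0 \<and> poly P x = 0} \<and>
     Range \<rho> = {y. \<exists>(P, p)\<in>S. p \<noteq> 0 \<and> poly p y = 0} \<and>
     (\<forall>x y. same_cell \<rho> x y \<longrightarrow> (\<forall>(P, p)\<in>S. sg (poly P x) = sg (poly p y)))"

lemma monotone_matching_converse: "monotone_matching \<rho> \<Longrightarrow> monotone_matching (\<rho>\<inverse>)"
  by (fastforce simp: monotone_matching_def)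

lemma same_cell_iff: "same_cell \<rho> x y \<longleftrightarrow> (\<forall>z w. (z, w) \<in> \<rho> \<longrightarrow> sg (x - z) = sg (y - w))"
  by (auto simp: same_cell_def)

lemma same_cell_converse: "same_cell (\<rho>\<inverse>) y x \<longleftrightarrow> same_cell \<rho> x y"
  by (auto simp: same_cell_iff)

lemma sign_table_converse: "sign_table \<rho> S \<Longrightarrow> sign_table (\<rho>\<inverse>) (S\<inverse>)"
  unfolding sign_table_def
  by (simp add: monotone_matching_converse same_cell_converse)
    (intro conjI allI impI; fastforce)

lemma same_cell_matched: "monotone_matching \<rho> \<Longrightarrow> (z, w) \<in> \<rho> \<Longrightarrow> same_cell \<rho> z w"
  by (fastforce simp: monotone_matching_def same_cell_def)

lemma same_cellD: "same_cell \<rho> x y \<Longrightarrow> (z, w) \<in> \<rho> \<Longrightarrow> sg (x - z) = sg (y - w)"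
  by (fastforce simp: same_cell_def)

lemma finite_sets_gap:
  fixes A B :: "'a::linordered_field set"
  assumes "finite A" "finite B" "\<And>a b. a \<in> A \<Longrightarrow> b \<in> B \<Longrightarrow> a < b"
  shows "\<exists>y. (\<forall>a\<in>A. a < y) \<and> (\<forall>b\<in>B. y < b)"
proof -
  consider "A = {}" "B = {}" | "A \<noteq> {}" "B = {}" | "A = {}" "B \<noteq> {}" | "A \<noteq> {}" "B \<noteq> {}" by blast
  then show ?thesis
  proof cases
    case 2
    have "a < Max A + 1" if "a \<in> A" for a
      using Max_ge[OF assms(1) that] by linarith
    then show ?thesis using 2 by blast
  next
    case 3
    have "Min B - 1 < b" if "b \<in> B" for b
      using Min_le[OF assms(2) that] by linarith
    then show ?thesis using 3 by blast
  next
    case 4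
    then have "Max A < Min B" using assms by simp
    then obtain y where "Max A < y" "y < Min B" using dense by blast
    then show ?thesis using assms(1,2) 4 by (intro exI[of _ y]) auto
  qed auto
qed

text \<open>Finite sets in order-preserving correspondence have corresponding gaps, and an ordered
  field, being dense and unbounded, has a point in every gap.\<close>

lemma same_cell_exists:
  fixes \<rho> :: "('a::linordered_field, 'b::linordered_field) matching"
  assumes "monotone_matching \<rho>"
  shows "\<exists>y. same_cell \<rho> x y"
proof (cases "x \<in> Domain \<rho>")
  case True
  then show ?thesis using same_cell_matched[OF assms] by blast
next
  case False
  let ?A = "snd ` {(z, w) \<in> \<rho>. z < x}" and ?B = "snd ` {(z, w) \<in> \<rho>. x < z}"
  have fin: "finite \<rho>" using assms by (simp add: monotone_matching_def)
  have "w < w'" if "(z, w) \<in> \<rho>" "(z', w') \<in> \<rho>" "z < x" "x < z'" for z w z' w'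
    using same_cellD[OF same_cell_matched[OF assms that(1)] that(2)] that(3,4)
    by (auto simp: sg_def split: if_splits)
  then have "\<exists>y. (\<forall>a\<in>?A. a < y) \<and> (\<forall>b\<in>?B. y < b)"
    using fin by (intro finite_sets_gap) (auto intro: finite_subset[OF _ fin])
  then obtain y where y: "\<And>z w. (z, w) \<in> \<rho> \<Longrightarrow> z < x \<Longrightarrow> w < y" "\<And>z w. (z, w) \<in> \<rho> \<Longrightarrow> x < z \<Longrightarrow> y < w"
    by force
  have "sg (x - z) = sg (y - w)" if zw: "(z, w) \<in> \<rho>" for z w
  proof -
    have "z \<noteq> x" using zw False by blast
    then consider "z < x" | "x < z" by force
    then show ?thesis using y[OF zw] by cases (auto simp: sg_def)
  qed
  then show ?thesis unfolding same_cell_def by blast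
qed

text \<open>Every point shares its cell with a point of the other field, so vanishing everywhere
  transfers in both directions.\<close>

lemma sign_table_zero_iff:
  fixes \<rho> :: "('a::linordered_field, 'b::linordered_field) matching"
  assumes T: "sign_table \<rho> S" and "(P, p) \<in> S"
  shows "P = 0 \<longleftrightarrow> p = 0"
proof -
  have mm: "monotone_matching \<rho>" using T by (simp add: sign_table_def)
  have sgn: "sg (poly P x) = sg (poly p y)" if "same_cell \<rho> x y" for x y
    using T assms(2) that unfolding sign_table_def by fastforce
  show ?thesis
  proof
    assume "P = 0"
    have "poly p y = 0" for y
      using same_cell_exists[OF monotone_matching_converse[OF mm], of y] sgn \<open>P = 0\<close>
      unfolding same_cell_converse by fastforce
    then show "p = 0" using poly_all_0_iff_0 by blast
  next
    assume "p = 0"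
    have "poly P x = 0" for x
      using same_cell_exists[OF mm, of x] sgn \<open>p = 0\<close> by fastforce
    then show "P = 0" using poly_all_0_iff_0 by blast
  qed
qed

lemma sign_table_sg:
  "sign_table \<rho> S \<Longrightarrow> (P, p) \<in> S \<Longrightarrow> same_cell \<rho> x y \<Longrightarrow> sg (poly P x) = sg (poly p y)"
  unfolding sign_table_def by fastforce

text \<open>Removing polynomials merges cells. On a merged cell a remaining polynomial keeps its
  sign, because a change of sign would produce one of its roots there, and all of these remain
  matched.\<close>

lemma sign_table_subset:
  fixes \<rho> :: "('a::linordered_field, 'b::real_closed_field) matching"
  assumes T: "sign_table \<rho> S" and "S' \<subseteq> S"
  defines "\<rho>' \<equiv> {(z, w) \<in> \<rho>. \<exists>(P, p)\<in>S'. P \<noteq> 0 \<and> poly P z = 0}"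
  shows "sign_table \<rho>' S'"
proof -
  have mm: "monotone_matching \<rho>" and dom: "Domain \<rho> = {x. \<exists>(P, p)\<in>S. P \<noteq> 0 \<and> poly P x = 0}"
    and ran: "Range \<rho> = {y. \<exists>(P, p)\<in>S. p \<noteq> 0 \<and> poly p y = 0}"
    using T by (auto simp: sign_table_def)
  have sub: "\<rho>' \<subseteq> \<rho>" by (auto simp: \<rho>'_def)
  have mm': "monotone_matching \<rho>'"
    using mm sub finite_subset unfolding monotone_matching_def by fast
  have root_iff: "(P \<noteq> 0 \<and> poly P z = 0) \<longleftrightarrow> (p \<noteq> 0 \<and> poly p w = 0)"
    if "(P, p) \<in> S'" "(z, w) \<in> \<rho>" for P p z w
    using sign_table_zero_iff[OF T, of P p] sign_table_sg[OF T, of P p z w] same_cell_matched[OF mm that(2)]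
      that(1) \<open>S' \<subseteq> S\<close> by (metis sg_eq_0_iff subsetD)
  have dom': "Domain \<rho>' = {x. \<exists>(P, p)\<in>S'. P \<noteq> 0 \<and> poly P x = 0}"
  proof (intro equalityI subsetI)
    fix x assume "x \<in> {x. \<exists>(P, p)\<in>S'. P \<noteq> 0 \<and> poly P x = 0}"
    then obtain P p where Pp: "(P, p) \<in> S'" "P \<noteq> 0" "poly P x = 0" by blast
    then have "x \<in> Domain \<rho>" unfolding dom using \<open>S' \<subseteq> S\<close> by blast
    then obtain w where "(x, w) \<in> \<rho>" by blast
    then show "x \<in> Domain \<rho>'" using Pp unfolding \<rho>'_def by blast
  qed (auto simp: \<rho>'_def)
  have ran': "Range \<rho>' = {y. \<exists>(P, p)\<in>S'. p \<noteq> 0 \<and> poly p y = 0}"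
  proof (intro equalityI subsetI)
    fix y assume "y \<in> {y. \<exists>(P, p)\<in>S'. p \<noteq> 0 \<and> poly p y = 0}"
    then obtain P p where Pp: "(P, p) \<in> S'" "p \<noteq> 0" "poly p y = 0" by blast
    then have "y \<in> Range \<rho>" unfolding ran using \<open>S' \<subseteq> S\<close> by blast
    then obtain z where "(z, y) \<in> \<rho>" by blast
    then show "y \<in> Range \<rho>'" using Pp root_iff unfolding \<rho>'_def by blast
  next
    fix y assume "y \<in> Range \<rho>'"
    then show "y \<in> {y. \<exists>(P, p)\<in>S'. p \<noteq> 0 \<and> poly p y = 0}"
      using root_iff unfolding \<rho>'_def by blast
  qed
  have "sg (poly P x) = sg (poly p y)" if xy: "same_cell \<rho>' x y" and Pp: "(P, p) \<in> S'" for x y P p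
  proof (cases "p = 0")
    case True
    then show ?thesis using sign_table_zero_iff[OF T, of P p] Pp \<open>S' \<subseteq> S\<close> by auto
  next
    case False
    obtain y' where y': "same_cell \<rho> x y'" using same_cell_exists[OF mm] by blast
    have Px: "sg (poly P x) = sg (poly p y')"
      using sign_table_sg[OF T _ y'] Pp \<open>S' \<subseteq> S\<close> by blast
    have pos: "sg (y - w) = sg (y' - w)" if w: "w \<in> Range \<rho>'" for w
    proof -
      obtain z where z: "(z, w) \<in> \<rho>'" using w by blast
      then show ?thesis using same_cellD[OF xy z] same_cellD[OF y', of z w] sub by auto
    qed
    have no: "r \<in> Range \<rho>'" if "poly p r = 0" for r
      unfolding ran' using Pp False that by blast
    have "sg (poly p y) = sg (poly p y')"
    proof (rule ccontr)
      assume neq: "sg (poly p y) \<noteq> sg (poly p y')"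
      then have "y \<noteq> y'" by auto
      then consider "y < y'" | "y' < y" by force
      then show False
      proof cases
        case 1
        from poly_root_between[OF this neq] obtain r where "y \<le> r" "r \<le> y'" "poly p r = 0" by blast
        then show False using pos[OF no] 1 by (fastforce simp: sg_eq_iff)
      next
        case 2
        from poly_root_between[OF this neq[symmetric]] obtain r where "y' \<le> r" "r \<le> y" "poly p r = 0" by blast
        then show False using pos[OF no] 2 by (fastforce simp: sg_eq_iff)
      qed
    qed
    then show ?thesis using Px by simp
  qed
  then show ?thesis unfolding sign_table_def using mm' dom' ran' by blast
qed

text \<open>
  Witnesses next to a point of a cell that is not a root: the neighbouring matched roots, or points far
  out if there are none, where the leading coefficient determines the sign.
\<close>

lemma lower_witness:
  fixes \<rho> :: "('a::linordered_field, 'b::linordered_field) matching"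
  assumes mm: "monotone_matching \<rho>" and x: "x \<notin> Domain \<rho>" and xy: "same_cell \<rho> x y"
    and sgn: "\<And>z w. (z, w) \<in> \<rho> \<Longrightarrow> sg (poly P z) = sg (poly p w)"
    and lc: "degree P = degree p" "sg (lead_coeff P) = sg (lead_coeff p)"
  obtains a b where "a < x" "b < y" "sg (poly P a) = sg (poly p b)"
    "\<And>c. a < c \<Longrightarrow> c \<le> x \<Longrightarrow> same_cell \<rho> c y" "\<And>d. b < d \<Longrightarrow> d \<le> y \<Longrightarrow> same_cell \<rho> x d"
proof (cases "\<exists>z\<in>Domain \<rho>. z < x")
  case True
  let ?Z = "{z \<in> Domain \<rho>. z < x}"
  have fin: "finite ?Z" using mm by (auto simp: monotone_matching_def finite_Domain)
  have "Max ?Z \<in> ?Z" using True fin by (intro Max_in) auto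
  then obtain b where ab: "(Max ?Z, b) \<in> \<rho>" "Max ?Z < x" by blast
  have ba: "b < y" using same_cellD[OF xy ab(1)] ab(2) by (auto simp: sg_def split: if_splits)
  have pos: "z \<le> Max ?Z \<and> w \<le> b \<or> x < z \<and> y < w" if zw: "(z, w) \<in> \<rho>" for z w
  proof (cases "z < x")
    case True
    then have "z \<le> Max ?Z" using zw fin by (intro Max_ge) auto
    moreover have "sg (z - Max ?Z) = sg (w - b)"
      using same_cellD[OF same_cell_matched[OF mm zw] ab(1)] .
    ultimately show ?thesis by (auto simp: sg_def split: if_splits)
  next
    case False
    then have "x < z" using x zw by (metis Domain.DomainI linorder_neqE)
    then show ?thesis using same_cellD[OF xy zw] by (auto simp: sg_def split: if_splits)
  qed
  have "same_cell \<rho> c y" if "Max ?Z < c" "c \<le> x" for c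
    unfolding same_cell_iff using pos that ba by (fastforce simp: sg_def)
  moreover have "same_cell \<rho> x d" if "b < d" "d \<le> y" for d
    unfolding same_cell_iff using pos that ab(2) by (fastforce simp: sg_def)
  ultimately show ?thesis using that[OF ab(2) ba sgn[OF ab(1)]] by blast
next
  case False
  have pos: "x < z \<and> y < w" if zw: "(z, w) \<in> \<rho>" for z w
  proof -
    have "x < z" using x zw False by (metis Domain.DomainI linorder_neqE)
    then show ?thesis using same_cellD[OF xy zw] by (auto simp: sg_def split: if_splits)
  qed
  obtain A where A: "\<And>c. c \<le> A \<Longrightarrow> sg (poly P c) = sg (lead_coeff P) * (- 1) ^ degree P"
    using sg_poly_at_bot by blast
  obtain B where B: "\<And>d. d \<le> B \<Longrightarrow> sg (poly p d) = sg (lead_coeff p) * (- 1) ^ degree p"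
    using sg_poly_at_bot by blast
  have "sg (poly P (min A (x - 1))) = sg (poly p (min B (y - 1)))"
    using A[of "min A (x - 1)"] B[of "min B (y - 1)"] lc by simp
  moreover have "min A (x - 1) < x" "min B (y - 1) < y" by (auto simp: min_def)
  moreover have "same_cell \<rho> c y" if "c \<le> x" for c
    unfolding same_cell_iff using pos that by (fastforce simp: sg_def)
  moreover have "same_cell \<rho> x d" if "d \<le> y" for d
    unfolding same_cell_iff using pos that by (fastforce simp: sg_def)
  ultimately show ?thesis using that by blast
qed

lemma upper_witness:
  fixes \<rho> :: "('a::linordered_field, 'b::linordered_field) matching"
  assumes mm: "monotone_matching \<rho>" and x: "x \<notin> Domain \<rho>" and xy: "same_cell \<rho> x y"
    and sgn: "\<And>z w. (z, w) \<in> \<rho> \<Longrightarrow> sg (poly P z) = sg (poly p w)"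
    and lc: "sg (lead_coeff P) = sg (lead_coeff p)"
  obtains a b where "x < a" "y < b" "sg (poly P a) = sg (poly p b)"
    "\<And>c. x \<le> c \<Longrightarrow> c < a \<Longrightarrow> same_cell \<rho> c y" "\<And>d. y \<le> d \<Longrightarrow> d < b \<Longrightarrow> same_cell \<rho> x d"
proof (cases "\<exists>z\<in>Domain \<rho>. x < z")
  case True
  let ?Z = "{z \<in> Domain \<rho>. x < z}"
  have fin: "finite ?Z" using mm by (auto simp: monotone_matching_def finite_Domain)
  have "Min ?Z \<in> ?Z" using True fin by (intro Min_in) auto
  then obtain b where ab: "(Min ?Z, b) \<in> \<rho>" "x < Min ?Z" by blast
  have ba: "y < b" using same_cellD[OF xy ab(1)] ab(2) by (auto simp: sg_def split: if_splits)
  have pos: "Min ?Z \<le> z \<and> b \<le> w \<or> z < x \<and> w < y" if zw: "(z, w) \<in> \<rho>" for z w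
  proof (cases "x < z")
    case True
    then have "Min ?Z \<le> z" using zw fin by (intro Min_le) auto
    moreover have "sg (z - Min ?Z) = sg (w - b)"
      using same_cellD[OF same_cell_matched[OF mm zw] ab(1)] .
    ultimately show ?thesis by (auto simp: sg_def split: if_splits)
  next
    case False
    then have "z < x" using x zw by (metis Domain.DomainI linorder_neqE)
    then show ?thesis using same_cellD[OF xy zw] by (auto simp: sg_def split: if_splits)
  qed
  have "same_cell \<rho> c y" if "x \<le> c" "c < Min ?Z" for c
    unfolding same_cell_iff using pos that ba by (fastforce simp: sg_def)
  moreover have "same_cell \<rho> x d" if "y \<le> d" "d < b" for d
    unfolding same_cell_iff using pos that ab(2) by (fastforce simp: sg_def)
  ultimately show ?thesis using that[OF ab(2) ba sgn[OF ab(1)]] by blast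
next
  case False
  have pos: "z < x \<and> w < y" if zw: "(z, w) \<in> \<rho>" for z w
  proof -
    have "z < x" using x zw False by (metis Domain.DomainI linorder_neqE)
    then show ?thesis using same_cellD[OF xy zw] by (auto simp: sg_def split: if_splits)
  qed
  obtain A where A: "\<And>c. A \<le> c \<Longrightarrow> sg (poly P c) = sg (lead_coeff P)"
    using sg_poly_at_top by blast
  obtain B where B: "\<And>d. B \<le> d \<Longrightarrow> sg (poly p d) = sg (lead_coeff p)"
    using sg_poly_at_top by blast
  have "sg (poly P (max A (x + 1))) = sg (poly p (max B (y + 1)))"
    using A[of "max A (x + 1)"] B[of "max B (y + 1)"] lc by simp
  moreover have "x < max A (x + 1)" "y < max B (y + 1)" by (auto simp: max_def)
  moreover have "same_cell \<rho> c y" if "x \<le> c" for c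
    unfolding same_cell_iff using pos that by (fastforce simp: sg_def)
  moreover have "same_cell \<rho> x d" if "y \<le> d" for d
    unfolding same_cell_iff using pos that by (fastforce simp: sg_def)
  ultimately show ?thesis using that by blast
qed

section \<open>Adding a polynomial to a sign table\<close>

text \<open>The derivative gives monotonicity inside each cell. The signs at the matched points, and
  those at infinity fixed by degree and leading coefficient, then decide whether a cell contains a
  root of the new polynomial.\<close>

definition extendable_table ::
    "('a::linordered_idom, 'b::linordered_idom) matching \<Rightarrow> ('a poly \<times> 'b poly) set \<Rightarrow> 'a poly \<Rightarrow> 'b poly \<Rightarrow> bool" where
  "extendable_table \<rho> S P p \<longleftrightarrow> sign_table \<rho> S \<and> (pderiv P, pderiv p) \<in> S \<and>
     (\<forall>z w. (z, w) \<in> \<rho> \<longrightarrow> sg (poly P z) = sg (poly p w)) \<and>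
     degree P = degree p \<and> sg (lead_coeff P) = sg (lead_coeff p) \<and> 0 < degree P"

lemma extendable_table_converse: "extendable_table \<rho> S P p \<Longrightarrow> extendable_table (\<rho>\<inverse>) (S\<inverse>) p P"
  unfolding extendable_table_def by (auto simp: sign_table_converse)

lemma extendable_tableD:
  fixes \<rho> :: "('a::linordered_field, 'b::linordered_field) matching"
  assumes "extendable_table \<rho> S P p"
  shows "monotone_matching \<rho>" "(z, w) \<in> \<rho> \<Longrightarrow> sg (poly P z) = sg (poly p w)" "degree P = degree p"
    "sg (lead_coeff P) = sg (lead_coeff p)"
    "same_cell \<rho> x y \<Longrightarrow> sg (poly (pderiv P) x) = sg (poly (pderiv p) y)"
    "poly (pderiv P) x = 0 \<Longrightarrow> x \<in> Domain \<rho>" "P \<noteq> 0"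
proof -
  have T: "sign_table \<rho> S" and S: "(pderiv P, pderiv p) \<in> S" and d: "0 < degree P"
    using assms by (auto simp: extendable_table_def)
  show "P \<noteq> 0" using d by auto
  have "pderiv P \<noteq> 0" using d by (simp add: pderiv_eq_0_iff)
  then show "poly (pderiv P) x = 0 \<Longrightarrow> x \<in> Domain \<rho>"
    using T S unfolding sign_table_def by fast
  show "same_cell \<rho> x y \<Longrightarrow> sg (poly (pderiv P) x) = sg (poly (pderiv p) y)"
    using sign_table_sg[OF T S] .
qed (use assms in \<open>auto simp: extendable_table_def sign_table_def\<close>)

text \<open>By Rolle's theorem two roots in one cell enclose a root of the derivative, which is
  matched and separates them.\<close>

lemma extendable_table_root_unique:
  fixes \<rho> :: "('a::real_closed_field, 'b::linordered_field) matching"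
  assumes E: "extendable_table \<rho> S P p" and "poly P r = 0" "poly P r' = 0"
    and same: "\<And>z w. (z, w) \<in> \<rho> \<Longrightarrow> sg (r - z) = sg (r' - z)"
  shows "r = r'"
proof -
  have *: "\<not> r < r'" if roots: "poly P r = 0" "poly P r' = 0"
    and same: "\<And>z w. (z, w) \<in> \<rho> \<Longrightarrow> sg (r - z) = sg (r' - z)" for r r'
  proof
    assume "r < r'"
    then obtain c where c: "r < c" "c < r'" "poly (pderiv P) c = 0"
      using poly_rolle[OF _ roots extendable_tableD(7)[OF E]] by blast
    then obtain w where "(c, w) \<in> \<rho>" using extendable_tableD(6)[OF E] by blast
    then have "sg (r - c) = sg (r' - c)" by (rule same)
    then show False using c by (simp add: sg_def)
  qed
  have "\<not> r < r'" using assms by (intro *) auto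
  moreover have "\<not> r' < r" using assms by (intro *) auto
  ultimately show ?thesis by simp
qed

text \<open>On the cell of an unmatched root \<open>r\<close> the derivative has a constant sign s.
  Let y be a point of the corresponding cell. If \<open>p\<close> has sign s at y, then
  \<open>P\<close> has sign -s at the lower end, and so has \<open>p\<close>: a root lies below y.
  If \<open>p\<close> has sign -s at y, the upper end gives a root above y.\<close>

lemma extendable_table_root_matched:
  fixes \<rho> :: "('a::real_closed_field, 'b::real_closed_field) matching"
  assumes E: "extendable_table \<rho> S P p" and r: "poly P r = 0"
  shows "\<exists>t. poly p t = 0 \<and> same_cell \<rho> r t"
proof (cases "r \<in> Domain \<rho>")
  case True
  then obtain w where w: "(r, w) \<in> \<rho>" by blast
  from extendable_tableD(2)[OF E this] r have "poly p w = 0" by (metis sg_eq_0_iff)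
  then show ?thesis using same_cell_matched[OF extendable_tableD(1)[OF E] w] by blast
next
  case False
  note D = extendable_tableD[OF E]
  obtain y where y: "same_cell \<rho> r y" using same_cell_exists[OF D(1)] by blast
  define s where "s = sg (poly (pderiv P) r)"
  have s0: "s \<noteq> 0" using D(6)[of r] False by (auto simp: s_def)
  have dy: "sg (poly (pderiv P) c) = s" if "same_cell \<rho> c y" for c
    using D(5)[OF that] D(5)[OF y] by (simp add: s_def)
  consider "poly p y = 0" | "sg (poly p y) = s" | "sg (poly p y) = - s"
    using s0 sg_cases[of "poly p y"] sg_cases[of "poly (pderiv P) r"] unfolding s_def by force
  then show ?thesis
  proof cases
    case 1
    then show ?thesis using y by blast
  next
    case 2
    obtain a b where ab: "a < r" "b < y" "sg (poly P a) = sg (poly p b)"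
      "\<And>c. a < c \<Longrightarrow> c \<le> r \<Longrightarrow> same_cell \<rho> c y" "\<And>d. b < d \<Longrightarrow> d \<le> y \<Longrightarrow> same_cell \<rho> r d"
      using lower_witness[OF D(1) False y D(2) D(3) D(4)] by blast
    have "sg (poly P r - poly P a) = s"
      using ab(4) by (intro sg_difference[OF ab(1)] dy) auto
    then have "sg (poly p b) = - s" using r ab(3) by simp
    then obtain t where "b < t" "t < y" "poly p t = 0"
      using poly_root_strictly_between[OF ab(2), of p] 2 s0 by (metis minus_equation_iff neg_equal_zero sg_eq_0_iff)
    then show ?thesis using ab(5) by (meson less_imp_le)
  next
    case 3
    obtain a b where ab: "r < a" "y < b" "sg (poly P a) = sg (poly p b)"
      "\<And>c. r \<le> c \<Longrightarrow> c < a \<Longrightarrow> same_cell \<rho> c y" "\<And>d. y \<le> d \<Longrightarrow> d < b \<Longrightarrow> same_cell \<rho> r d"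
      using upper_witness[OF D(1) False y D(2) D(4)] by blast
    have "sg (poly P a - poly P r) = s"
      using ab(4) by (intro sg_difference[OF ab(1)] dy) auto
    then have "sg (poly p b) = s" using r ab(3) by simp
    then obtain t where "y < t" "t < b" "poly p t = 0"
      using poly_root_strictly_between[OF ab(2), of p] 3 s0 by (metis minus_equation_iff neg_equal_zero sg_eq_0_iff)
    then show ?thesis using ab(5) by (meson less_imp_le)
  qed
qed

definition extended_matching ::
    "('a::linordered_idom, 'b::linordered_idom) matching \<Rightarrow> 'a poly \<Rightarrow> 'b poly \<Rightarrow> ('a, 'b) matching" where
  "extended_matching \<rho> P p = \<rho> \<union> {(r, t). poly P r = 0 \<and> poly p t = 0 \<and> same_cell \<rho> r t}"

lemma extended_matching_converse: "(extended_matching \<rho> P p)\<inverse> = extended_matching (\<rho>\<inverse>) p P"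
  by (auto simp: extended_matching_def same_cell_converse)

text \<open>Where \<open>P\<close> and its derivative have the same sign, moving left cannot leave the cell without
  meeting a root of \<open>P\<close> or a point at which \<open>P\<close> still has this sign.\<close>

lemma extended_matching_sg_derivative:
  fixes \<rho> :: "('a::real_closed_field, 'b::real_closed_field) matching"
  assumes E: "extendable_table \<rho> S P p" and x: "x \<notin> Domain \<rho>"
    and xy: "same_cell (extended_matching \<rho> P p) x y"
    and s: "sg (poly P x) = sg (poly (pderiv P) x)"
  shows "sg (poly p y) = sg (poly (pderiv P) x)"
proof -
  note D = extendable_tableD[OF E]
  define s where "s = sg (poly (pderiv P) x)"
  have s0: "s \<noteq> 0" using D(6)[of x] x by (auto simp: s_def)
  have xy': "same_cell \<rho> x y" using xy by (simp add: extended_matching_def same_cell_iff)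
  have dp: "sg (poly (pderiv p) d) = s" if "same_cell \<rho> x d" for d
    using D(5)[OF that] by (simp add: s_def)
  obtain a b where ab: "a < x" "b < y" "sg (poly P a) = sg (poly p b)"
    "\<And>c. a < c \<Longrightarrow> c \<le> x \<Longrightarrow> same_cell \<rho> c y" "\<And>d. b < d \<Longrightarrow> d \<le> y \<Longrightarrow> same_cell \<rho> x d"
    using lower_witness[OF D(1) x xy' D(2) D(3) D(4)] by blast
  have pos: "sg (poly p y) = s" if "t < y" "sg (poly p t) = 0 \<or> sg (poly p t) = s"
    and cell: "\<And>d. t < d \<Longrightarrow> d \<le> y \<Longrightarrow> same_cell \<rho> x d" for t
  proof -
    have "sg (poly p y - poly p t) = s"
      using cell by (intro sg_difference[OF that(1)] dp) auto
    then show ?thesis using that(2) s0 by (auto simp: sg_def split: if_splits)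
  qed
  have "sg (poly p y) = s"
  proof (cases "\<exists>r>a. r < x \<and> poly P r = 0")
    case True
    then obtain r where r: "a < r" "r < x" "poly P r = 0" by blast
    have cr: "same_cell \<rho> r y" using ab(4) r by auto
    obtain t where t: "poly p t = 0" "same_cell \<rho> r t"
      using extendable_table_root_matched[OF E r(3)] by blast
    then have "(r, t) \<in> extended_matching \<rho> P p" using r by (simp add: extended_matching_def)
    from same_cellD[OF xy this] r(2) have "t < y" by (auto simp: sg_def split: if_splits)
    have eq: "sg (t - w) = sg (y - w)" "sg (x - z) = sg (y - w)" if "(z, w) \<in> \<rho>" for z w
      using same_cellD[OF t(2) that] same_cellD[OF cr that] same_cellD[OF xy' that] by auto
    have "same_cell \<rho> x d" if "t < d" "d \<le> y" for d
      unfolding same_cell_iff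
    proof (intro allI impI)
      fix z w assume "(z, w) \<in> \<rho>"
      from eq[OF this] show "sg (x - z) = sg (d - w)"
        using that by (auto simp: sg_def split: if_splits)
    qed
    then show ?thesis using pos[OF \<open>t < y\<close>] t by simp
  next
    case False
    have "sg (poly P a) = 0 \<or> sg (poly P a) = s"
    proof (rule ccontr)
      assume "\<not> ?thesis"
      then show False
        using poly_root_strictly_between[OF ab(1), of P] False s s0 unfolding s_def by (metis sg_eq_0_iff)
    qed
    then show ?thesis using pos[OF ab(2)] ab(3,5) by simp
  qed
  then show ?thesis by (simp add: s_def)
qed

text \<open>A cell contains at most one root of each new polynomial, and a root of one exactly when
  it contains a root of the other. Matching these roots keeps the order; it remains to compare signs
  between the points.\<close>

lemma sign_table_extend:
  fixes \<rho> :: "('a::real_closed_field, 'b::real_closed_field) matching"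
  assumes E: "extendable_table \<rho> S P p"
  shows "sign_table (extended_matching \<rho> P p) (insert (P, p) S)"
proof -
  note D = extendable_tableD[OF E]
  note E' = extendable_table_converse[OF E]
  note D' = extendable_tableD[OF E']
  let ?R = "extended_matching \<rho> P p"
  have T: "sign_table \<rho> S" using E by (simp add: extendable_table_def)
  have p0: "P \<noteq> 0" "p \<noteq> 0" using D(7) D'(7) by auto
  have dom: "Domain ?R = Domain \<rho> \<union> {r. poly P r = 0}"
    using extendable_table_root_matched[OF E] by (auto simp: extended_matching_def)
  have ran: "Range ?R = Range \<rho> \<union> {r. poly p r = 0}"
    using extendable_table_root_matched[OF E'] unfolding same_cell_converse
    by (auto simp: extended_matching_def)
  have fin: "finite ?R"
  proof (rule finite_subset)
    show "?R \<subseteq> Domain ?R \<times> Range ?R" by auto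
    have "finite \<rho>" using D(1) by (simp add: monotone_matching_def)
    then show "finite (Domain ?R \<times> Range ?R)"
      unfolding dom ran using poly_roots_finite[OF p0(1)] poly_roots_finite[OF p0(2)]
      by (simp add: finite_Domain finite_Range)
  qed
  have new: "sg (r - r') = sg (t - t')"
    if "poly P r = 0" "poly p t = 0" "same_cell \<rho> r t" "poly P r' = 0" "poly p t' = 0" "same_cell \<rho> r' t'"
    for r t r' t'
  proof (cases "\<forall>z w. (z, w) \<in> \<rho> \<longrightarrow> sg (r - z) = sg (r' - z)")
    case True
    then have "r = r'" using extendable_table_root_unique[OF E] that by blast
    moreover have "sg (t - w) = sg (t' - w)" if "(w, z) \<in> \<rho>\<inverse>" for w z
      using True that same_cellD[OF \<open>same_cell \<rho> r t\<close>, of z w] same_cellD[OF \<open>same_cell \<rho> r' t'\<close>, of z w] by auto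
    then have "t = t'" using extendable_table_root_unique[OF E'] that by blast
    ultimately show ?thesis by simp
  next
    case False
    \<comment> \<open>Roots in different cells are ordered through a matched point on whose position
      they disagree.\<close>
    then obtain z w where zw: "(z, w) \<in> \<rho>" "sg (r - z) \<noteq> sg (r' - z)" by blast
    then show ?thesis
      using same_cellD[OF that(3) zw(1)] same_cellD[OF that(6) zw(1)]
      by (auto simp: sg_def split: if_splits)
  qed
  have mm: "monotone_matching ?R"
  proof -
    have "sg (z - z') = sg (w - w')" if "(z, w) \<in> ?R" "(z', w') \<in> ?R" for z w z' w'
    proof -
      have flip: "sg (a - b) = sg (c - d)" if "sg (b - a) = sg (d - c)" for a b :: 'a and c d :: 'b
        using that by (metis minus_diff_eq sg_uminus)
      show ?thesis
        using that new same_cellD[of \<rho>] same_cell_matched[OF D(1)] flip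
        unfolding extended_matching_def by (smt (verit) Un_iff case_prod_conv mem_Collect_eq)
    qed
    then show ?thesis using fin unfolding monotone_matching_def by blast
  qed
  have sub: "same_cell \<rho> x y" if "same_cell ?R x y" for x y
    using that by (simp add: extended_matching_def same_cell_iff)
  have sgP: "sg (poly P x) = sg (poly p y)" if xy: "same_cell ?R x y" for x y
  proof -
    consider "x \<in> Domain ?R" | "y \<in> Range ?R" | "x \<notin> Domain ?R" "y \<notin> Range ?R" by blast
    then show ?thesis
    proof cases
      case 1
      then obtain w where w: "(x, w) \<in> ?R" by blast
      then have "sg (y - w) = 0" using same_cellD[OF xy w] by simp
      then have "(x, y) \<in> ?R" using w by simp
      then show ?thesis using D(2) by (auto simp: extended_matching_def)
    next
      case 2
      then obtain z where z: "(z, y) \<in> ?R" by blast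
      then have "sg (x - z) = 0" using same_cellD[OF xy z] by simp
      then have "(x, y) \<in> ?R" using z by simp
      then show ?thesis using D(2) by (auto simp: extended_matching_def)
    next
      case 3
      have x: "x \<notin> Domain \<rho>" "poly P x \<noteq> 0" and y: "y \<notin> Domain (\<rho>\<inverse>)" "poly p y \<noteq> 0"
        using 3 unfolding dom ran by auto
      have xy': "same_cell (extended_matching (\<rho>\<inverse>) p P) y x"
        using xy by (simp add: same_cell_converse flip: extended_matching_converse)
      \<comment> \<open>Off all roots both signs are s or -s, so it suffices that each of them is s
        whenever the other is. The second implication is the first one with the two fields
        exchanged.\<close>
      define s where "s = sg (poly (pderiv P) x)"
      have s: "sg (poly (pderiv p) y) = s" using D(5)[OF sub[OF xy]] by (simp add: s_def)
      have "s \<noteq> 0" using D(6)[of x] x by (auto simp: s_def)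
      have "sg (poly P x) = s \<Longrightarrow> sg (poly p y) = s"
        using extended_matching_sg_derivative[OF E x(1) xy] by (simp add: s_def)
      moreover have "sg (poly p y) = s \<Longrightarrow> sg (poly P x) = s"
        using extended_matching_sg_derivative[OF E' y(1) xy'] s by simp
      ultimately show ?thesis
        using x(2) y(2) \<open>s \<noteq> 0\<close> unfolding s_def by (smt (verit) sg_cases sg_eq_0_iff)
    qed
  qed
  show ?thesis
    unfolding sign_table_def
  proof (intro conjI allI impI)
    show "monotone_matching ?R" by (rule mm)
    show "Domain ?R = {x. \<exists>(P', p')\<in>insert (P, p) S. P' \<noteq> 0 \<and> poly P' x = 0}"
      unfolding dom using T p0 unfolding sign_table_def by auto
    show "Range ?R = {x. \<exists>(P', p')\<in>insert (P, p) S. p' \<noteq> 0 \<and> poly p' x = 0}"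
      unfolding ran using T p0 unfolding sign_table_def by auto
    fix x y assume "same_cell ?R x y"
    then show "\<forall>(P', p')\<in>insert (P, p) S. sg (poly P' x) = sg (poly p' y)"
      using sgP sign_table_sg[OF T] sub by blast
  qed
qed

section \<open>Real points with prescribed signs\<close>

text \<open>\<open>K\<close> relates an element of the real closed field to real functions that
  represent it in the manner of germs along the filter. It stands for a coefficient field: in the
  induction over the number of variables, \<open>'b\<close> is the space of values for the variables
  already treated.\<close>

locale sign_filter =
  fixes \<F> :: "'b filter" and K :: "('r::real_closed_field \<times> ('b \<Rightarrow> real)) set"
  assumes K_zero: "(0, \<lambda>_. 0) \<in> K" and K_one: "(1, \<lambda>_. 1) \<in> K"
    and K_diff: "(a, g) \<in> K \<Longrightarrow> (c, h) \<in> K \<Longrightarrow> (a - c, \<lambda>b. g b - h b) \<in> K"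
    and K_mult: "(a, g) \<in> K \<Longrightarrow> (c, h) \<in> K \<Longrightarrow> (a * c, \<lambda>b. g b * h b) \<in> K"
    and K_divide: "(a, g) \<in> K \<Longrightarrow> (c, h) \<in> K \<Longrightarrow> c \<noteq> 0 \<Longrightarrow> (a / c, \<lambda>b. g b / h b) \<in> K"
    and K_eventually: "(a, g) \<in> K \<Longrightarrow> eventually (\<lambda>b. g' b = g b) \<F> \<Longrightarrow> (a, g') \<in> K"
    and K_sg: "(a, g) \<in> K \<Longrightarrow> eventually (\<lambda>b. sg (g b) = sg a) \<F>"
begin

lemma K_of_nat: "(of_nat n, \<lambda>_. of_nat n) \<in> K"
proof (induction n)
  case (Suc n)
  from K_diff[OF Suc K_diff[OF K_zero K_one]] show ?case by (simp add: add.commute)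
qed (simp add: K_zero)

text \<open>The bound on the degrees lets finitely many coefficient conditions determine the degree
  of \<open>q b\<close> eventually.\<close>

definition PP :: "('r poly \<times> ('b \<Rightarrow> real poly)) set" where
  "PP = {(P, q). (\<forall>k. (coeff P k, \<lambda>b. coeff (q b) k) \<in> K) \<and> (\<exists>N. eventually (\<lambda>b. degree (q b) \<le> N) \<F>)}"

lemma PP_coeff: "(P, q) \<in> PP \<Longrightarrow> (coeff P k, \<lambda>b. coeff (q b) k) \<in> K"
  by (simp add: PP_def)

lemma PP_degree:
  assumes "(P, q) \<in> PP"
  shows "eventually (\<lambda>b. degree (q b) = degree P \<and> sg (lead_coeff (q b)) = sg (lead_coeff P)) \<F>"
proof -
  obtain N where N: "eventually (\<lambda>b. degree (q b) \<le> N) \<F>" using assms by (auto simp: PP_def)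
  have "eventually (\<lambda>b. \<forall>k\<in>{..N + degree P}. sg (coeff (q b) k) = sg (coeff P k)) \<F>"
    using K_sg[OF PP_coeff[OF assms]] by (intro eventually_ball_finite) auto
  with N show ?thesis
  proof eventually_elim
    case (elim b)
    then have sgn: "sg (coeff (q b) k) = sg (coeff P k)" for k
      by (cases "k \<le> N + degree P") (auto simp: coeff_eq_0)
    then have zero: "coeff (q b) k = 0 \<longleftrightarrow> coeff P k = 0" for k by (metis sg_eq_0_iff)
    have "degree (q b) = degree P"
    proof (rule antisym)
      show "degree (q b) \<le> degree P" by (rule degree_le) (simp add: zero coeff_eq_0)
      show "degree P \<le> degree (q b)" by (rule degree_le) (simp add: zero[symmetric] coeff_eq_0)
    qed
    then show ?case using sgn by simp
  qed
qed

lemma PP_zero_iff: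
  assumes "(P, q) \<in> PP"
  shows "eventually (\<lambda>b. q b = 0 \<longleftrightarrow> P = 0) \<F>"
  using PP_degree[OF assms] by eventually_elim (metis leading_coeff_0_iff sg_eq_0_iff)

lemma PP_eventually:
  assumes "(P, q) \<in> PP" "eventually (\<lambda>b. q' b = q b) \<F>"
  shows "(P, q') \<in> PP"
proof -
  obtain N where N: "eventually (\<lambda>b. degree (q b) \<le> N) \<F>" using assms by (auto simp: PP_def)
  have "(coeff P k, \<lambda>b. coeff (q' b) k) \<in> K" for k
    by (rule K_eventually[OF PP_coeff[OF assms(1)]]) (use assms(2) in eventually_elim, simp)
  moreover have "eventually (\<lambda>b. degree (q' b) \<le> N) \<F>"
    using N assms(2) by eventually_elim simp
  ultimately show ?thesis by (auto simp: PP_def)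
qed

lemma PP_pderiv:
  assumes "(P, q) \<in> PP"
  shows "(pderiv P, \<lambda>b. pderiv (q b)) \<in> PP"
proof -
  obtain N where N: "eventually (\<lambda>b. degree (q b) \<le> N) \<F>" using assms by (auto simp: PP_def)
  then have "eventually (\<lambda>b. degree (pderiv (q b)) \<le> N) \<F>"
    by eventually_elim (simp add: degree_pderiv)
  moreover have "(coeff (pderiv P) k, \<lambda>b. coeff (pderiv (q b)) k) \<in> K" for k
    unfolding coeff_pderiv by (rule K_mult[OF K_of_nat PP_coeff[OF assms]])
  ultimately show ?thesis by (auto simp: PP_def)
qed

lemma PP_reduction_step:
  assumes "(P, q) \<in> PP" "(Q, r) \<in> PP" "(c, g) \<in> K"
  shows "(P - smult c (monom 1 d * Q), \<lambda>b. q b - smult (g b) (monom 1 d * r b)) \<in> PP"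
proof -
  obtain N M where NM: "eventually (\<lambda>b. degree (q b) \<le> N) \<F>" "eventually (\<lambda>b. degree (r b) \<le> M) \<F>"
    using assms by (auto simp: PP_def)
  have "eventually (\<lambda>b. degree (q b - smult (g b) (monom 1 d * r b)) \<le> N + (d + M)) \<F>"
    using NM
  proof eventually_elim
    case (elim b)
    have "degree (smult (g b) (monom 1 d * r b)) \<le> d + M"
      using degree_smult_le[of "g b" "monom 1 d * r b"] degree_mult_le[of "monom 1 d" "r b"]
        degree_monom_le[of "1::real" d] elim(2) by linarith
    then show ?case using elim(1) by (intro degree_diff_le) auto
  qed
  moreover have "(coeff (monom 1 d * Q) k, \<lambda>b. coeff (monom 1 d * r b) k) \<in> K" for k
    using PP_coeff[OF assms(2)] K_zero by (simp add: coeff_monom_mult)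
  then have "(coeff (P - smult c (monom 1 d * Q)) k, \<lambda>b. coeff (q b - smult (g b) (monom 1 d * r b)) k) \<in> K" for k
    using K_diff[OF PP_coeff[OF assms(1)] K_mult[OF assms(3)]] by simp
  ultimately show ?thesis by (auto simp: PP_def)
qed

text \<open>Division with remainder uses field operations on coefficients and tests whether they
  vanish. \<open>K\<close> respects both along the filter, one reduction step at a time.\<close>

lemma PP_mod:
  assumes "(P, q) \<in> PP" "(Q, r) \<in> PP" "Q \<noteq> 0"
  shows "(P mod Q, \<lambda>b. q b mod r b) \<in> PP"
  using assms(1)
\<comment> \<open>The measure distinguishes the zero polynomial from the nonzero constants, which
  have degree 0 as well.\<close>
proof (induction "if P = 0 then 0 else Suc (degree P)" arbitrary: P q rule: less_induct)
  case less
  have r0: "eventually (\<lambda>b. r b \<noteq> 0) \<F>"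
    using PP_zero_iff[OF assms(2)] by eventually_elim (simp add: assms(3))
  consider "P = 0" | "P \<noteq> 0" "degree P < degree Q" | "P \<noteq> 0" "degree Q \<le> degree P" by linarith
  then show ?case
  proof cases
    case 1
    have "eventually (\<lambda>b. q b mod r b = q b) \<F>"
      using PP_zero_iff[OF less.prems] by eventually_elim (simp add: 1)
    then show ?thesis using PP_eventually[OF less.prems] 1 by simp
  next
    case 2
    have "eventually (\<lambda>b. q b mod r b = q b) \<F>"
      using PP_degree[OF less.prems] PP_degree[OF assms(2)] by eventually_elim (simp add: 2 mod_poly_less)
    then show ?thesis using PP_eventually[OF less.prems] 2 by (simp add: mod_poly_less)
  next
    case 3
    define d where "d = degree P - degree Q"
    define c where "c = lead_coeff P / lead_coeff Q"
    define g where "g = (\<lambda>b. coeff (q b) (degree P) / coeff (r b) (degree Q))"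
    have cg: "(c, g) \<in> K"
      unfolding c_def g_def
      by (rule K_divide[OF PP_coeff[OF less.prems] PP_coeff[OF assms(2)]]) (simp add: assms(3))
    define P1 where "P1 = P - smult c (monom 1 d * Q)"
    define q1 where "q1 = (\<lambda>b. q b - smult (g b) (monom 1 d * r b))"
    have P1: "(P1, q1) \<in> PP" unfolding P1_def q1_def by (rule PP_reduction_step[OF less.prems assms(2) cg])
    have modeq: "P1 mod Q = P mod Q" "q1 b mod r b = q b mod r b" for b
      unfolding P1_def q1_def mult_smult_left[symmetric] by (simp_all add: mod_diff_eq[symmetric] flip: mult_smult_left)
    have "coeff P1 k = 0" if "k \<ge> degree P" for k
    proof (cases "k = degree P")
      case True
      then show ?thesis
        unfolding P1_def c_def d_def using 3 assms(3) by (simp add: coeff_monom_mult)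
    next
      case False
      then have "k > degree P" using that by simp
      then show ?thesis
        unfolding P1_def d_def using 3 by (simp add: coeff_monom_mult coeff_eq_0)
    qed
    then have "P1 = 0 \<or> degree P1 < degree P"
      by (metis leading_coeff_0_iff not_le_imp_less)
    then have "(if P1 = 0 then 0 else Suc (degree P1)) < (if P = 0 then 0 else Suc (degree P))"
      using 3 by auto
    from less.hyps[OF this P1] show ?thesis by (simp add: modeq)
  qed
qed

section \<open>Sign tables along the filter\<close>

lemma eventually_sign_table_const:
  assumes "finite S" "S \<subseteq> PP" "\<And>P q. (P, q) \<in> S \<Longrightarrow> degree P = 0"
  shows "eventually (\<lambda>b. \<exists>\<rho>. sign_table \<rho> ((\<lambda>(P, q). (P, q b)) ` S)) \<F>"
proof -
  have "eventually (\<lambda>b. \<forall>x\<in>S. degree (snd x b) = 0 \<and> sg (lead_coeff (snd x b)) = sg (lead_coeff (fst x))) \<F>"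
  proof (intro eventually_ball_finite assms(1) ballI)
    fix x assume "x \<in> S"
    then have "(fst x, snd x) \<in> PP" "degree (fst x) = 0" using assms by (auto, metis prod.collapse)
    from PP_degree[OF this(1)] this(2)
    show "eventually (\<lambda>b. degree (snd x b) = 0 \<and> sg (lead_coeff (snd x b)) = sg (lead_coeff (fst x))) \<F>"
      by simp
  qed
  then show ?thesis
  proof eventually_elim
    case (elim b)
    have const: "poly P x = lead_coeff P" "poly (q b) y = lead_coeff (q b)"
      "sg (lead_coeff P) = sg (lead_coeff (q b))" if Pq: "(P, q) \<in> S" for P q x y
    proof -
      have *: "poly p x = lead_coeff p" if "degree p = 0" for p :: "'c::comm_ring_1 poly" and x
        using that by (auto elim!: degree_eq_zeroE)
      show "poly P x = lead_coeff P" by (rule *[OF assms(3)[OF Pq]])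
      show "poly (q b) y = lead_coeff (q b)" using elim Pq by (intro *) force
      show "sg (lead_coeff P) = sg (lead_coeff (q b))" using elim Pq by force
    qed
    have noroot: "\<not> (P \<noteq> 0 \<and> poly P x = 0)" "\<not> (q b \<noteq> 0 \<and> poly (q b) y = 0)"
      "sg (poly P x) = sg (poly (q b) y)" if Pq: "(P, q) \<in> S" for P q x y
      unfolding const(1,2)[OF Pq] using const(3)[OF Pq] by auto
    have "sign_table {} ((\<lambda>(P, q). (P, q b)) ` S)"
      unfolding sign_table_def monotone_matching_def using noroot by fastforce
    then show ?case by blast
  qed
qed

text \<open>The elimination step of Cohen and Hormander: at a root of \<open>Q\<close>, the
  polynomials \<open>P\<close> and \<open>P mod Q\<close> have the same value. A table with the
  remainders thus knows the sign of \<open>P\<close> at the roots of \<open>S1\<close>. The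
  remainders are dropped before \<open>P\<close> is added, since this argument says nothing about
  their own roots.\<close>

lemma eventually_sign_table_step:
  assumes S: "finite S" "S \<subseteq> PP" and Pq: "(P, q) \<in> PP" "0 < degree P"
  defines "S1 \<equiv> insert (pderiv P, \<lambda>b. pderiv (q b)) S"
  assumes IH: "eventually (\<lambda>b. \<exists>\<rho>. sign_table \<rho> ((\<lambda>(P, q). (P, q b)) `
      (S1 \<union> (\<lambda>(Q, r). (P mod Q, \<lambda>b. q b mod r b)) ` {(Q, r) \<in> S1. Q \<noteq> 0}))) \<F>"
  shows "eventually (\<lambda>b. \<exists>\<rho>. sign_table \<rho> ((\<lambda>(P, q). (P, q b)) ` insert (P, q) S)) \<F>"
  using IH PP_degree[OF Pq(1)]
proof eventually_elim
  case (elim b)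
  define f where "f = (\<lambda>(P :: 'r poly, q). (P, q b :: real poly))"
  let ?S2 = "S1 \<union> (\<lambda>(Q, r). (P mod Q, \<lambda>b. q b mod r b)) ` {(Q, r) \<in> S1. Q \<noteq> 0}"
  obtain \<rho> where \<rho>: "sign_table \<rho> (f ` ?S2)" using elim unfolding f_def by blast
  define \<rho>' where "\<rho>' = {(z, w) \<in> \<rho>. \<exists>(P, p)\<in>f ` S1. P \<noteq> 0 \<and> poly P z = 0}"
  have T: "sign_table \<rho>' (f ` S1)"
    unfolding \<rho>'_def by (rule sign_table_subset[OF \<rho>]) auto
  have "sg (poly P z) = sg (poly (q b) w)" if zw: "(z, w) \<in> \<rho>'" for z w
  proof -
    obtain Q r where Q: "(Q, r) \<in> S1" "Q \<noteq> 0" "poly Q z = 0" and zw': "(z, w) \<in> \<rho>"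
      using zw unfolding \<rho>'_def f_def by auto
    have cell: "same_cell \<rho> z w"
      using same_cell_matched[OF _ zw'] \<rho> by (simp add: sign_table_def)
    have "(Q, r b) \<in> f ` ?S2" using Q(1) by (force simp: f_def)
    from sign_table_sg[OF \<rho> this cell] Q(3) have r: "poly (r b) w = 0" by (metis sg_eq_0_iff)
    have "(P mod Q, q b mod r b) \<in> f ` ?S2"
      using Q(1,2) by (force simp: f_def)
    from sign_table_sg[OF \<rho> this cell]
    have "sg (poly (P mod Q) z) = sg (poly (q b mod r b) w)" .
    moreover have "poly P z = poly (P mod Q) z"
      using Q(3) by (metis add_0 mult_div_mod_eq mult_zero_left poly_add poly_mult)
    moreover have "poly (q b) w = poly (q b mod r b) w"
      using r by (metis add_0 mult_div_mod_eq mult_zero_left poly_add poly_mult)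
    ultimately show ?thesis by simp
  qed
  moreover have "(pderiv P, pderiv (q b)) \<in> f ` S1" unfolding S1_def f_def by force
  ultimately have "extendable_table \<rho>' (f ` S1) P (q b)"
    unfolding extendable_table_def using T elim(2) Pq(2) by auto
  note T' = sign_table_extend[OF this]
  have "f ` insert (P, q) S \<subseteq> insert (P, q b) (f ` S1)" unfolding S1_def f_def by auto
  from sign_table_subset[OF T' this] show ?case unfolding f_def by blast
qed

text \<open>Induction on the maximal degree and, for fixed degree, on the number of polynomials that
  attain it. A step trades one of these for its derivative and remainders, all of smaller
  degree.\<close>

lemma eventually_sign_table:
  assumes "finite S" "S \<subseteq> PP"
  shows "eventually (\<lambda>b. \<exists>\<rho>. sign_table \<rho> ((\<lambda>(P, q). (P, q b)) ` S)) \<F>"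
proof -
  have *: "\<forall>S. finite S \<and> S \<subseteq> PP \<and> (\<forall>(P, q)\<in>S. degree P \<le> d) \<longrightarrow>
      eventually (\<lambda>b. \<exists>\<rho>. sign_table \<rho> ((\<lambda>(P, q). (P, q b)) ` S)) \<F>" for d
  proof (induction d)
    case 0
    show ?case using eventually_sign_table_const by fastforce
  next
    case (Suc d)
    let ?top = "\<lambda>S :: ('r poly \<times> ('b \<Rightarrow> real poly)) set. {x \<in> S. degree (fst x) = Suc d}"
    show ?case
    proof (intro allI impI)
      fix S :: "('r poly \<times> ('b \<Rightarrow> real poly)) set"
      assume "finite S \<and> S \<subseteq> PP \<and> (\<forall>(P, q)\<in>S. degree P \<le> Suc d)"
      then show "eventually (\<lambda>b. \<exists>\<rho>. sign_table \<rho> ((\<lambda>(P, q). (P, q b)) ` S)) \<F>"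
      proof (induction "card (?top S)" arbitrary: S)
        case 0
        then have "?top S = {}" by simp
        then have "\<forall>(P, q)\<in>S. degree P \<le> d" using 0(2) by (fastforce simp: le_Suc_eq)
        then show ?case using Suc.IH 0(2) by blast
      next
        case (Suc n)
        then have "?top S \<noteq> {}" by force
        then obtain P q where Pq: "(P, q) \<in> S" "degree P = Suc d" by auto
        define S0 where "S0 = S - {(P, q)}"
        have S0: "finite S0" "S0 \<subseteq> PP" "\<forall>(P, q)\<in>S0. degree P \<le> Suc d"
          and PqPP: "(P, q) \<in> PP" and S: "S = insert (P, q) S0"
          using Suc.prems Pq unfolding S0_def by auto
        define S1 where "S1 = insert (pderiv P, \<lambda>b. pderiv (q b)) S0"
        define S2 where "S2 = S1 \<union> (\<lambda>(Q, r). (P mod Q, \<lambda>b. q b mod r b)) ` {(Q, r) \<in> S1. Q \<noteq> 0}"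
        have dP: "degree (pderiv P) = d" using Pq(2) by (simp add: degree_pderiv)
        have dQ: "degree Q \<le> Suc d" if "(Q, r) \<in> S1" for Q r
          using that S0(3) dP unfolding S1_def by auto
        have dmod: "degree (P mod Q) \<le> d" if "(Q, r) \<in> S1" "Q \<noteq> 0" for Q r
          using degree_mod_less[OF that(2), of P] dQ[OF that(1)] by auto
        have S1PP: "S1 \<subseteq> PP" using S0(2) PP_pderiv[OF PqPP] by (auto simp: S1_def)
        have "finite S1" using S0(1) by (simp add: S1_def)
        moreover from this have "finite {(Q, r) \<in> S1. Q \<noteq> 0}" by (rule rev_finite_subset) auto
        ultimately have fin2: "finite S2" by (simp add: S2_def)
        have S2PP: "S2 \<subseteq> PP" unfolding S2_def using S1PP PP_mod[OF PqPP] by auto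
        have cases2: "(Q, r) \<in> S0 \<or> degree Q \<le> d" if Qr: "(Q, r) \<in> S2" for Q r
        proof -
          from Qr consider "(Q, r) \<in> S0" | "Q = pderiv P" | Q' r' where "Q = P mod Q'" "(Q', r') \<in> S1" "Q' \<noteq> 0"
            unfolding S2_def S1_def by auto
          then show ?thesis using dP dmod by cases auto
        qed
        have deg2: "\<forall>(Q, r)\<in>S2. degree Q \<le> Suc d"
        proof safe
          fix Q r assume "(Q, r) \<in> S2"
          from cases2[OF this] show "degree Q \<le> Suc d" using S0(3) by auto
        qed
        have "?top S2 = ?top S0"
        proof (intro equalityI subsetI)
          fix x assume x: "x \<in> ?top S2"
          then show "x \<in> ?top S0" using cases2[of "fst x" "snd x"] by simp
        next
          fix x assume "x \<in> ?top S0"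
          then show "x \<in> ?top S2" by (simp add: S2_def S1_def)
        qed
        moreover have "?top S = insert (P, q) (?top S0)" "(P, q) \<notin> ?top S0"
          using S Pq(2) S0_def by auto
        ultimately have "n = card (?top S2)"
          using Suc.hyps(2) S0(1) by simp
        from Suc.hyps(1)[OF this] fin2 S2PP deg2
        have "eventually (\<lambda>b. \<exists>\<rho>. sign_table \<rho> ((\<lambda>(P, q). (P, q b)) ` S2)) \<F>" by blast
        then show ?case
          unfolding S using eventually_sign_table_step[OF S0(1,2) PqPP] Pq(2)
          unfolding S2_def S1_def by simp
      qed
    qed
  qed
  obtain d where d: "\<forall>(P, q)\<in>S. degree P \<le> d"
  proof
    show "\<forall>(P, q)\<in>S. degree P \<le> Max (insert 0 ((\<lambda>x. degree (fst x)) ` S))"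
    proof safe
      fix P q assume "(P, q) \<in> S"
      then show "degree P \<le> Max (insert 0 ((\<lambda>x. degree (fst x)) ` S))"
        using assms(1) by (intro Max_ge) force+
    qed
  qed
  from *[of d, THEN spec, of S] show ?thesis using assms d by (elim mp) (intro conjI)
qed

lemma eventually_same_signs:
  assumes "finite S" "S \<subseteq> PP"
  shows "eventually (\<lambda>b. \<exists>y. \<forall>(P, q)\<in>S. sg (poly (q b) y) = sg (poly P x)) \<F>"
  using eventually_sign_table[OF assms]
proof eventually_elim
  case (elim b)
  then obtain \<rho> where \<rho>: "sign_table \<rho> ((\<lambda>(P, q). (P, q b)) ` S)" by blast
  then obtain y where "same_cell \<rho> x y"
    using same_cell_exists[of \<rho> x] by (auto simp: sign_table_def)
  then have "sg (poly P x) = sg (poly (q b) y)" if "(P, q) \<in> S" for P q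
    using sign_table_sg[OF \<rho>] that by force
  then show ?case by (intro exI[of _ y]) auto
qed

end

text \<open>Syntactic polynomials: one type for any number of variables, which can be evaluated in
  type-based rings as well as in carrier-based algebras and can carry an arbitrary preorder.\<close>

datatype pexp = PConst real | PVar nat | PAdd pexp pexp | PMul pexp pexp

primrec pev :: "(real \<Rightarrow> 'a::comm_ring_1) \<Rightarrow> (nat \<Rightarrow> 'a) \<Rightarrow> pexp \<Rightarrow> 'a" where
  "pev \<iota> \<xi> (PConst r) = \<iota> r"
| "pev \<iota> \<xi> (PVar i) = \<xi> i"
| "pev \<iota> \<xi> (PAdd a b) = pev \<iota> \<xi> a + pev \<iota> \<xi> b"
| "pev \<iota> \<xi> (PMul a b) = pev \<iota> \<xi> a * pev \<iota> \<xi> b"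

abbreviation reval :: "(nat \<Rightarrow> real) \<Rightarrow> pexp \<Rightarrow> real" where "reval \<equiv> pev (\<lambda>r. r)"

primrec pvars :: "pexp \<Rightarrow> nat set" where
  "pvars (PConst r) = {}"
| "pvars (PVar i) = {i}"
| "pvars (PAdd a b) = pvars a \<union> pvars b"
| "pvars (PMul a b) = pvars a \<union> pvars b"

lemma finite_pvars: "finite (pvars e)"
  by (induction e) auto

lemma pev_cong: "(\<And>i. i \<in> pvars e \<Longrightarrow> \<xi> i = \<xi>' i) \<Longrightarrow> pev \<iota> \<xi> e = pev \<iota> \<xi>' e"
  by (induction e) auto

fun list_padd :: "pexp list \<Rightarrow> pexp list \<Rightarrow> pexp list" where
  "list_padd [] ys = ys"
| "list_padd xs [] = xs"
| "list_padd (x # xs) (y # ys) = PAdd x y # list_padd xs ys"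

primrec list_pmult :: "pexp list \<Rightarrow> pexp list \<Rightarrow> pexp list" where
  "list_pmult [] ys = []"
| "list_pmult (x # xs) ys = list_padd (map (PMul x) ys) (PConst 0 # list_pmult xs ys)"

text \<open>Coefficients with respect to the variable \<open>n\<close>, lowest degree first, as
  expressions in the other variables. The last entry may vanish.\<close>

primrec pcoeffs :: "nat \<Rightarrow> pexp \<Rightarrow> pexp list" where
  "pcoeffs n (PConst r) = [PConst r]"
| "pcoeffs n (PVar i) = (if i = n then [PConst 0, PConst 1] else [PVar i])"
| "pcoeffs n (PAdd a b) = list_padd (pcoeffs n a) (pcoeffs n b)"
| "pcoeffs n (PMul a b) = list_pmult (pcoeffs n a) (pcoeffs n b)"

lemma Poly_list_padd:
  "Poly (map (pev \<iota> \<xi>) (list_padd xs ys)) = Poly (map (pev \<iota> \<xi>) xs) + Poly (map (pev \<iota> \<xi>) ys)"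
  by (induction xs ys rule: list_padd.induct) auto

lemma Poly_list_pmult:
  assumes "\<iota> 0 = 0"
  shows "Poly (map (pev \<iota> \<xi>) (list_pmult xs ys)) = Poly (map (pev \<iota> \<xi>) xs) * Poly (map (pev \<iota> \<xi>) ys)"
proof (induction xs)
  case (Cons x xs)
  have "Poly (map (pev \<iota> \<xi>) (map (PMul x) ys)) = smult (pev \<iota> \<xi> x) (Poly (map (pev \<iota> \<xi>) ys))"
    by (induction ys) auto
  then show ?case by (simp add: Poly_list_padd Cons.IH assms del: map_map)
qed simp

lemma pev_pcoeffs:
  assumes "\<iota> 0 = 0" "\<iota> 1 = 1"
  shows "pev \<iota> (\<xi>(n := x)) e = poly (Poly (map (pev \<iota> \<xi>) (pcoeffs n e))) x"
  by (induction e) (auto simp: assms Poly_list_padd Poly_list_pmult)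

lemma pvars_list_padd:
  "(\<Union>c\<in>set (list_padd xs ys). pvars c) \<subseteq> (\<Union>c\<in>set xs. pvars c) \<union> (\<Union>c\<in>set ys. pvars c)"
  by (induction xs ys rule: list_padd.induct) auto

lemma pvars_list_pmult:
  "(\<Union>c\<in>set (list_pmult xs ys). pvars c) \<subseteq> (\<Union>c\<in>set xs. pvars c) \<union> (\<Union>c\<in>set ys. pvars c)"
proof (induction xs)
  case (Cons x xs)
  have "(\<Union>c\<in>set (list_pmult (x # xs) ys). pvars c) \<subseteq>
      (\<Union>c\<in>set (map (PMul x) ys). pvars c) \<union> (\<Union>c\<in>set (PConst 0 # list_pmult xs ys). pvars c)"
    unfolding list_pmult.simps by (rule pvars_list_padd)
  also have "\<dots> \<subseteq> (\<Union>c\<in>set (x # xs). pvars c) \<union> (\<Union>c\<in>set ys. pvars c)"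
    using Cons.IH by auto
  finally show ?case .
qed simp

lemma pvars_pcoeffs: "(\<Union>c\<in>set (pcoeffs n e). pvars c) \<subseteq> pvars e - {n}"
proof (induction e)
  case (PAdd a b)
  then show ?case unfolding pcoeffs.simps pvars.simps
    by (intro order.trans[OF pvars_list_padd]) blast
next
  case (PMul a b)
  then show ?case unfolding pcoeffs.simps pvars.simps
    by (intro order.trans[OF pvars_list_pmult]) blast
qed auto

definition real_embedding :: "(real \<Rightarrow> 'a::comm_ring_1) \<Rightarrow> bool" where
  "real_embedding \<iota> \<longleftrightarrow> \<iota> 0 = 0 \<and> \<iota> 1 = 1 \<and> (\<forall>x y. \<iota> (x + y) = \<iota> x + \<iota> y \<and> \<iota> (x * y) = \<iota> x * \<iota> y)"

text \<open>A positive real number is an invertible square, and both properties survive in the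
  ordered field.\<close>

lemma sg_real_embedding:
  fixes \<iota> :: "real \<Rightarrow> 'a::linordered_field"
  assumes "real_embedding \<iota>"
  shows "sg (\<iota> r) = sg r"
proof -
  have h: "\<iota> 0 = 0" "\<iota> 1 = 1" "\<iota> (x + y) = \<iota> x + \<iota> y" "\<iota> (x * y) = \<iota> x * \<iota> y" for x y
    using assms by (auto simp: real_embedding_def)
  have pos: "\<iota> x > 0" if "x > 0" for x
  proof -
    have "\<iota> x = \<iota> (sqrt x) * \<iota> (sqrt x)" "\<iota> x * \<iota> (inverse x) = 1"
      using that by (simp_all add: h(2) flip: h(4))
    then have "\<iota> x \<noteq> 0" "\<iota> x \<ge> 0" by auto
    then show ?thesis by simp
  qed
  have "\<iota> (- x) = - \<iota> x" for x
    using h(3)[of x "- x"] h(1) by (simp add: eq_neg_iff_add_eq_0 add.commute)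
  then show ?thesis
    using pos[of r] pos[of "- r"] h(1) by (cases r "0::real" rule: linorder_cases) (auto simp: sg_def)
qed

lemma sg_divide: "sg (x / y) = sg x * sg (y :: 'a::linordered_field)"
  by (auto simp: sg_def zero_less_divide_iff divide_less_0_iff not_less)

text \<open>Induction over the variables. By the induction hypothesis, the conditions on signs of
  expressions in the first n variables generate a proper filter on real points. Along it, quotients
  of real values represent the quotients of values at \<xi>, which form the coefficient field
  \<open>K\<close>. A sign table for the given expressions as polynomials in the variable n then
  provides the last coordinate.\<close>

lemma real_point_with_signs:
  fixes \<iota> :: "real \<Rightarrow> 'a::real_closed_field"
  assumes \<iota>: "real_embedding \<iota>" and "finite E" "\<And>e. e \<in> E \<Longrightarrow> pvars e \<subseteq> {..<n}"
  shows "\<exists>b. \<forall>e\<in>E. sg (reval b e) = sg (pev \<iota> \<xi> e)"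
  using assms(2,3)
proof (induction n arbitrary: E)
  case 0
  have "pev \<iota> \<xi> e = \<iota> (reval (\<lambda>_. 0) e)" if "pvars e = {}" for e
    using that by (induction e) (use \<iota> in \<open>auto simp: real_embedding_def\<close>)
  then show ?case using 0 by (intro exI[of _ "\<lambda>_. 0"]) (auto simp: sg_real_embedding[OF \<iota>])
next
  case (Suc n)
  have \<iota>0: "\<iota> 0 = 0" "\<iota> 1 = 1" "\<And>x. \<iota> (- x) = - \<iota> x"
    using \<iota> unfolding real_embedding_def
    by (auto, metis add.right_inverse add_eq_0_iff)
  let ?A = "{e. pvars e \<subseteq> {..<n}}"
  define \<F> where "\<F> = (INF e\<in>?A. principal {b. sg (reval b e) = sg (pev \<iota> \<xi> e)})"
  have ev: "eventually (\<lambda>b. sg (reval b e) = sg (pev \<iota> \<xi> e)) \<F>" if "e \<in> ?A" for e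
    unfolding \<F>_def by (rule eventually_INF1[OF that]) (simp add: eventually_principal)
  have nontriv: "\<F> \<noteq> bot"
    unfolding \<F>_def
  proof (rule INF_filter_not_bot)
    fix E' assume E': "E' \<subseteq> ?A" "finite E'"
    then obtain b where "\<And>e. e \<in> E' \<Longrightarrow> sg (reval b e) = sg (pev \<iota> \<xi> e)" using Suc.IH[of E'] by blast
    then have "b \<in> (\<Inter>e\<in>E'. {b. sg (reval b e) = sg (pev \<iota> \<xi> e)})" by auto
    then show "(INF e\<in>E'. principal {b. sg (reval b e) = sg (pev \<iota> \<xi> e)}) \<noteq> bot"
      unfolding INF_principal_finite[OF E'(2)] principal_eq_bot_iff by blast
  qed
  define K where "K = {(a, g). \<exists>e1\<in>?A. \<exists>e2\<in>?A. pev \<iota> \<xi> e2 \<noteq> 0 \<and> a = pev \<iota> \<xi> e1 / pev \<iota> \<xi> e2 \<and>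
    eventually (\<lambda>b. reval b e2 \<noteq> 0 \<and> g b = reval b e1 / reval b e2) \<F>}"
  have nz: "eventually (\<lambda>b. reval b e \<noteq> 0) \<F>" if "e \<in> ?A" "pev \<iota> \<xi> e \<noteq> 0" for e
    using ev[OF that(1)] by eventually_elim (use that(2) in \<open>metis sg_eq_0_iff\<close>)
  have KI: "(a, g) \<in> K" if "e1 \<in> ?A" "e2 \<in> ?A" "pev \<iota> \<xi> e2 \<noteq> 0" "a = pev \<iota> \<xi> e1 / pev \<iota> \<xi> e2"
    "eventually (\<lambda>b. g b = reval b e1 / reval b e2) \<F>" for a g e1 e2
    unfolding K_def
    by (rule CollectI, rule case_prodI, rule bexI[OF _ that(1)], rule bexI[OF _ that(2)])
      (intro conjI that(3,4) eventually_conj nz[OF that(2,3)] that(5))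
  have KE: thesis if "(a, g) \<in> K"
    "\<And>e1 e2. \<lbrakk>e1 \<in> ?A; e2 \<in> ?A; pev \<iota> \<xi> e2 \<noteq> 0; a = pev \<iota> \<xi> e1 / pev \<iota> \<xi> e2;
      eventually (\<lambda>b. reval b e2 \<noteq> 0 \<and> g b = reval b e1 / reval b e2) \<F>\<rbrakk> \<Longrightarrow> thesis" for a g thesis
    using that unfolding K_def by blast
  interpret sign_filter \<F> K
  proof
    show "(0, \<lambda>_. 0) \<in> K"
      by (rule KI[of "PConst 0" "PConst 1"]) (auto simp: \<iota>0)
    show "(1, \<lambda>_. 1) \<in> K"
      by (rule KI[of "PConst 1" "PConst 1"]) (auto simp: \<iota>0)
  next
    fix a c :: 'a and g h :: "(nat \<Rightarrow> real) \<Rightarrow> real"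
    assume "(a, g) \<in> K" "(c, h) \<in> K"
    then obtain e1 e2 f1 f2 where e: "e1 \<in> ?A" "e2 \<in> ?A" "pev \<iota> \<xi> e2 \<noteq> 0" "a = pev \<iota> \<xi> e1 / pev \<iota> \<xi> e2"
      "eventually (\<lambda>b. reval b e2 \<noteq> 0 \<and> g b = reval b e1 / reval b e2) \<F>"
      and f: "f1 \<in> ?A" "f2 \<in> ?A" "pev \<iota> \<xi> f2 \<noteq> 0" "c = pev \<iota> \<xi> f1 / pev \<iota> \<xi> f2"
      "eventually (\<lambda>b. reval b f2 \<noteq> 0 \<and> h b = reval b f1 / reval b f2) \<F>"
      by (elim KE)
    show "(a - c, \<lambda>b. g b - h b) \<in> K"
    proof (rule KI[of "PAdd (PMul e1 f2) (PMul (PMul (PConst (- 1)) f1) e2)" "PMul e2 f2"])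
      show "eventually (\<lambda>b. g b - h b = reval b (PAdd (PMul e1 f2) (PMul (PMul (PConst (- 1)) f1) e2)) / reval b (PMul e2 f2)) \<F>"
        using e(5) f(5) by eventually_elim (auto simp: field_simps)
    qed (use e f in \<open>auto simp: \<iota>0 diff_frac_eq\<close>)
    show "(a * c, \<lambda>b. g b * h b) \<in> K"
    proof (rule KI[of "PMul e1 f1" "PMul e2 f2"])
      show "eventually (\<lambda>b. g b * h b = reval b (PMul e1 f1) / reval b (PMul e2 f2)) \<F>"
        using e(5) f(5) by eventually_elim auto
    qed (use e f in auto)
    show "(a / c, \<lambda>b. g b / h b) \<in> K" if "c \<noteq> 0"
    proof (rule KI[of "PMul e1 f2" "PMul e2 f1"])
      show "eventually (\<lambda>b. g b / h b = reval b (PMul e1 f2) / reval b (PMul e2 f1)) \<F>"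
        using e(5) f(5) by eventually_elim auto
    qed (use e f that in auto)
  next
    fix a :: 'a and g g' :: "(nat \<Rightarrow> real) \<Rightarrow> real"
    assume "(a, g) \<in> K"
    then obtain e1 e2 where e: "e1 \<in> ?A" "e2 \<in> ?A" "pev \<iota> \<xi> e2 \<noteq> 0" "a = pev \<iota> \<xi> e1 / pev \<iota> \<xi> e2"
      "eventually (\<lambda>b. reval b e2 \<noteq> 0 \<and> g b = reval b e1 / reval b e2) \<F>"
      by (elim KE)
    show "(a, g') \<in> K" if "eventually (\<lambda>b. g' b = g b) \<F>"
    proof (rule KI[OF e(1-4)])
      show "eventually (\<lambda>b. g' b = reval b e1 / reval b e2) \<F>"
        using e(5) that by eventually_elim auto
    qed
    show "eventually (\<lambda>b. sg (g b) = sg a) \<F>"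
      using e(5) ev[OF e(1)] ev[OF e(2)] by eventually_elim (simp add: e(4) sg_divide)
  qed
  have KA: "(pev \<iota> \<xi> e, \<lambda>b. reval b e) \<in> K" if "e \<in> ?A" for e
    by (rule KI[of e "PConst 1"]) (use that in \<open>auto simp: \<iota>0\<close>)
  define S where "S = (\<lambda>e. (Poly (map (pev \<iota> \<xi>) (pcoeffs n e)), \<lambda>b. Poly (map (reval b) (pcoeffs n e)))) ` E"
  have "(Poly (map (pev \<iota> \<xi>) cs), \<lambda>b. Poly (map (reval b) cs)) \<in> PP" if "set cs \<subseteq> ?A" for cs
  proof -
    have "(nth_default 0 (map (pev \<iota> \<xi>) cs) k, \<lambda>b. nth_default 0 (map (reval b) cs) k) \<in> K" for k
    proof (cases "k < length cs")
      case True
      then have "cs ! k \<in> ?A" using that nth_mem by blast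
      then show ?thesis using KA True by (simp add: nth_default_def)
    qed (simp add: nth_default_def K_zero)
    moreover have "degree (Poly (map (reval b) cs)) \<le> length cs" for b
      by (rule degree_le) (simp add: coeff_Poly_eq nth_default_beyond)
    then have "eventually (\<lambda>b. degree (Poly (map (reval b) cs)) \<le> length cs) \<F>" by simp
    ultimately show ?thesis unfolding PP_def coeff_Poly_eq[symmetric] by blast
  qed
  moreover have "set (pcoeffs n e) \<subseteq> ?A" if "e \<in> E" for e
    using pvars_pcoeffs[of n e] Suc.prems(2)[OF that] by (fastforce simp: less_Suc_eq)
  ultimately have "S \<subseteq> PP" unfolding S_def by blast
  moreover have "finite S" unfolding S_def using Suc.prems by simp
  ultimately have "eventually (\<lambda>b. \<exists>y. \<forall>(P, q)\<in>S. sg (poly (q b) y) = sg (poly P (\<xi> n))) \<F>"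
    by (intro eventually_same_signs)
  then obtain b y where signs: "\<forall>(P, q)\<in>S. sg (poly (q b) y) = sg (poly P (\<xi> n))"
    using eventually_happens'[OF nontriv] by blast
  have "sg (reval (b(n := y)) e) = sg (pev \<iota> \<xi> e)" if "e \<in> E" for e
  proof -
    have "sg (poly (Poly (map (reval b) (pcoeffs n e))) y) = sg (poly (Poly (map (pev \<iota> \<xi>) (pcoeffs n e))) (\<xi> n))"
      using signs that unfolding S_def by auto
    then show ?thesis
      using pev_pcoeffs[of "\<lambda>r. r" b n y e] pev_pcoeffs[OF \<iota>0(1,2), of \<xi> n "\<xi> n" e] by simp
  qed
  then show ?case by blast
qed

text \<open>The order of an ordered integral domain, seen on expressions before identifying equal
  ones. Every ring law appears as two inequalities, or as one if it is symmetric.\<close>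

locale pexp_order =
  fixes lq :: "pexp \<Rightarrow> pexp \<Rightarrow> bool"
  assumes total: "lq a b \<or> lq b a" and trans: "lq a b \<Longrightarrow> lq b c \<Longrightarrow> lq a c"
    and add_mono: "lq a b \<Longrightarrow> lq (PAdd a c) (PAdd b c)"
    and mult_mono: "lq a b \<Longrightarrow> lq (PConst 0) c \<Longrightarrow> lq (PMul a c) (PMul b c)"
    and mult_cong: "lq a b \<Longrightarrow> lq b a \<Longrightarrow> lq (PMul a c) (PMul b c)"
    and add_assoc: "lq (PAdd (PAdd a b) c) (PAdd a (PAdd b c))" "lq (PAdd a (PAdd b c)) (PAdd (PAdd a b) c)"
    and add_commute: "lq (PAdd a b) (PAdd b a)"
    and add_0: "lq (PAdd (PConst 0) a) a" "lq a (PAdd (PConst 0) a)"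
    and add_inverse: "lq (PAdd (PMul (PConst (- 1)) a) a) (PConst 0)" "lq (PConst 0) (PAdd (PMul (PConst (- 1)) a) a)"
    and mult_assoc: "lq (PMul (PMul a b) c) (PMul a (PMul b c))" "lq (PMul a (PMul b c)) (PMul (PMul a b) c)"
    and mult_commute: "lq (PMul a b) (PMul b a)"
    and mult_1: "lq (PMul (PConst 1) a) a" "lq a (PMul (PConst 1) a)"
    and distrib: "lq (PMul (PAdd a b) c) (PAdd (PMul a c) (PMul b c))" "lq (PAdd (PMul a c) (PMul b c)) (PMul (PAdd a b) c)"
    and const_add: "lq (PConst (r + s)) (PAdd (PConst r) (PConst s))" "lq (PAdd (PConst r) (PConst s)) (PConst (r + s))"
    and const_mult: "lq (PConst (r * s)) (PMul (PConst r) (PConst s))" "lq (PMul (PConst r) (PConst s)) (PConst (r * s))"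
    and not_one_le_zero: "\<not> lq (PConst 1) (PConst 0)"
    and no_zero_divisors: "lq (PMul a b) (PConst 0) \<Longrightarrow> lq (PConst 0) (PMul a b) \<Longrightarrow>
      lq a (PConst 0) \<and> lq (PConst 0) a \<or> lq b (PConst 0) \<and> lq (PConst 0) b"

definition realizable :: "(pexp \<Rightarrow> pexp \<Rightarrow> bool) \<Rightarrow> bool" where
  "realizable lq \<longleftrightarrow> (\<forall>E. finite E \<longrightarrow> (\<exists>b. \<forall>e\<in>E. (lq (PConst 0) e \<longleftrightarrow> 0 \<le> reval b e) \<and>
     (lq e (PConst 0) \<longleftrightarrow> reval b e \<le> 0)))"

text \<open>
  A type cannot depend on an order given in a proof. So the ordered domain below is built from one
  order that is not realizable, unless there is none; that its order is realizable then settles all orders.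
\<close>

definition critical_order :: "pexp \<Rightarrow> pexp \<Rightarrow> bool" where
  "critical_order = (SOME lq. pexp_order lq \<and> (realizable lq \<longrightarrow> (\<forall>lq'. pexp_order lq' \<longrightarrow> realizable lq')))"

lemma critical_order:
  "pexp_order critical_order"
  "realizable critical_order \<Longrightarrow> pexp_order lq \<Longrightarrow> realizable lq"
proof -
  have "pexp_order (\<lambda>a b. reval (\<lambda>_. 0) a \<le> reval (\<lambda>_. 0) b)"
    by unfold_locales (auto simp: algebra_simps mult_right_mono linorder_linear)
  then have "\<exists>lq. pexp_order lq \<and> (realizable lq \<longrightarrow> (\<forall>lq'. pexp_order lq' \<longrightarrow> realizable lq'))"
    by blast
  from someI_ex[OF this] show "pexp_order critical_order"
    "realizable critical_order \<Longrightarrow> pexp_order lq \<Longrightarrow> realizable lq"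
    unfolding critical_order_def[symmetric] by blast+
qed

section \<open>The ordered domain of the critical order\<close>

interpretation critical: pexp_order critical_order
  by (rule critical_order(1))

quotient_type critical_domain = pexp / "\<lambda>a b. critical_order a b \<and> critical_order b a"
  morphisms critical_rep critical_class
  by (rule equivpI; rule reflpI sympI transpI) (use critical.total critical.trans in blast)+

instantiation critical_domain :: comm_ring_1
begin

lift_definition zero_critical_domain :: critical_domain is "PConst 0" .
lift_definition one_critical_domain :: critical_domain is "PConst 1" .
lift_definition plus_critical_domain :: "critical_domain \<Rightarrow> critical_domain \<Rightarrow> critical_domain" is PAdd
  by (meson critical.trans critical.add_mono critical.add_commute)
lift_definition times_critical_domain :: "critical_domain \<Rightarrow> critical_domain \<Rightarrow> critical_domain" is PMul
  by (meson critical.trans critical.mult_cong critical.mult_commute)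
lift_definition uminus_critical_domain :: "critical_domain \<Rightarrow> critical_domain" is "PMul (PConst (- 1))"
  by (meson critical.trans critical.mult_cong critical.mult_commute)
definition minus_critical_domain :: "critical_domain \<Rightarrow> critical_domain \<Rightarrow> critical_domain" where
  "minus_critical_domain a b = a + - b"

instance
proof
  fix a b c :: critical_domain
  show "a + b + c = a + (b + c)" by transfer (simp add: critical.add_assoc)
  show "a + b = b + a" by transfer (simp add: critical.add_commute)
  show "0 + a = a" by transfer (simp add: critical.add_0)
  show "- a + a = 0" by transfer (simp add: critical.add_inverse)
  show "a - b = a + - b" by (rule minus_critical_domain_def)
  show "a * b * c = a * (b * c)" by transfer (simp add: critical.mult_assoc)
  show "a * b = b * a" by transfer (simp add: critical.mult_commute)
  show "1 * a = a" by transfer (simp add: critical.mult_1)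
  show "(a + b) * c = a * c + b * c" by transfer (simp add: critical.distrib)
  show "0 \<noteq> (1::critical_domain)" by transfer (simp add: critical.not_one_le_zero)
qed

end

instantiation critical_domain :: linordered_idom
begin

lift_definition less_eq_critical_domain :: "critical_domain \<Rightarrow> critical_domain \<Rightarrow> bool" is critical_order
  by (meson critical.trans)
definition less_critical_domain :: "critical_domain \<Rightarrow> critical_domain \<Rightarrow> bool" where
  "less_critical_domain a b \<longleftrightarrow> a \<le> b \<and> a \<noteq> b"
definition abs_critical_domain :: "critical_domain \<Rightarrow> critical_domain" where
  "abs_critical_domain a = (if a < 0 then - a else a)"
definition sgn_critical_domain :: "critical_domain \<Rightarrow> critical_domain" where
  "sgn_critical_domain a = (if a = 0 then 0 else if 0 < a then 1 else - 1)"

instance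
proof
  fix a b c :: critical_domain
  show anti: "a \<le> b \<Longrightarrow> b \<le> a \<Longrightarrow> a = b" for a b :: critical_domain by transfer simp
  show refl: "a \<le> a" for a :: critical_domain by transfer (use critical.total in blast)
  show "a < b \<longleftrightarrow> a \<le> b \<and> \<not> b \<le> a"
    unfolding less_critical_domain_def using anti refl by blast
  show "a \<le> b \<Longrightarrow> b \<le> c \<Longrightarrow> a \<le> c" by transfer (rule critical.trans)
  show "a \<le> b \<or> b \<le> a" by transfer (rule critical.total)
  show "a \<le> b \<Longrightarrow> c + a \<le> c + b"
    by (subst (1 2) add.commute) (transfer, rule critical.add_mono)
  have dom: "a * b = 0 \<Longrightarrow> a = 0 \<or> b = 0" for a b :: critical_domain
    by transfer (rule critical.no_zero_divisors, simp_all)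
  assume ab: "a < b" "0 < c"
  have "a * c \<le> b * c"
    using ab unfolding less_critical_domain_def by (transfer, simp add: critical.mult_mono)
  moreover have "a * c \<noteq> b * c"
  proof
    assume "a * c = b * c"
    then have "(a - b) * c = 0" by (simp add: left_diff_distrib)
    then show False using dom[of "a - b" c] ab by (auto simp: less_critical_domain_def)
  qed
  ultimately show "c * a < c * b"
    unfolding less_critical_domain_def by (simp add: mult.commute)
qed (auto simp: abs_critical_domain_def sgn_critical_domain_def)

end

instance real_closure :: (linordered_field) real_closed_field
  by (rule real_closed_fieldI) (use real_closure_IVT in blast)

lemma sg_to_real_closure: "sg (to_real_closure x) = sg x"
proof -
  have "to_real_closure x * to_real_closure (inverse x) = 1" if "x \<noteq> 0"
    using that by (metis right_inverse to_real_closure_simps(2,4))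
  then have "x \<noteq> 0 \<Longrightarrow> to_real_closure x \<noteq> 0" by auto
  then show ?thesis
    using to_real_closure_mono[of x 0] to_real_closure_mono[of 0 x]
    by (cases x "0::'a" rule: linorder_cases) (auto simp: sg_def)
qed

definition critical_point :: "pexp \<Rightarrow> critical_domain fract real_closure" where
  "critical_point e = to_real_closure (Fract (critical_class e) 1)"

text \<open>Only the critical order has to be treated. Its ordered domain embeds, with signs
  preserved, into the real closure of its fraction field. The images of the variables form a point
  with the prescribed signs there, and specialization replaces it by a real point.\<close>

theorem pexp_order_realizable:
  assumes "pexp_order lq"
  shows "realizable lq"
proof (rule critical_order(2)[OF _ assms])
  have hom: "critical_point (PAdd a b) = critical_point a + critical_point b"
    "critical_point (PMul a b) = critical_point a * critical_point b" for a b
    by (simp_all add: critical_point_def plus_critical_domain.abs_eq[symmetric] times_critical_domain.abs_eq[symmetric]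
        flip: to_real_closure_simps)
  have const: "critical_point (PConst (r + s)) = critical_point (PConst r) + critical_point (PConst s)"
    "critical_point (PConst (r * s)) = critical_point (PConst r) * critical_point (PConst s)" for r s
  proof -
    have "critical_class (PConst (r + s)) = critical_class (PAdd (PConst r) (PConst s))"
      "critical_class (PConst (r * s)) = critical_class (PMul (PConst r) (PConst s))"
      by (simp_all add: critical_domain.abs_eq_iff critical.const_add critical.const_mult)
    then show "critical_point (PConst (r + s)) = critical_point (PConst r) + critical_point (PConst s)"
      "critical_point (PConst (r * s)) = critical_point (PConst r) * critical_point (PConst s)"
      unfolding hom[symmetric] by (simp_all only: critical_point_def)
  qed
  have "critical_point (PConst 0) = 0" "critical_point (PConst 1) = 1"
    by (simp_all add: critical_point_def zero_critical_domain_def[symmetric] one_critical_domain_def[symmetric]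
        Zero_fract_def[symmetric] One_fract_def[symmetric])
  then have emb: "real_embedding (\<lambda>r. critical_point (PConst r))"
    by (simp add: real_embedding_def const)
  have pev: "pev (\<lambda>r. critical_point (PConst r)) (\<lambda>i. critical_point (PVar i)) e = critical_point e" for e
    by (induction e) (simp_all add: hom)
  have sgn: "sg (critical_point e) = sg (critical_class e)" for e
    unfolding critical_point_def sg_to_real_closure
    by (simp add: sg_def Zero_fract_def eq_fract less_fract)
  have lq: "critical_order (PConst 0) e \<longleftrightarrow> 0 \<le> critical_class e"
    "critical_order e (PConst 0) \<longleftrightarrow> critical_class e \<le> 0" for e
    by (simp_all add: zero_critical_domain_def less_eq_critical_domain.abs_eq)
  show "realizable critical_order"
    unfolding realizable_def
  proof (intro allI impI)
    fix E :: "pexp set" assume E: "finite E"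
    have "finite (\<Union>e\<in>E. pvars e)" using E finite_pvars by blast
    then obtain n where "(\<Union>e\<in>E. pvars e) \<subseteq> {..<n}" by (metis finite_nat_iff_bounded)
    then have "\<exists>b. \<forall>e\<in>E. sg (reval b e) = sg (critical_point e)"
      using real_point_with_signs[OF emb E, of n "\<lambda>i. critical_point (PVar i)"] unfolding pev by blast
    then obtain b where b: "\<And>e. e \<in> E \<Longrightarrow> sg (reval b e) = sg (critical_class e)"
      unfolding sgn by blast
    have "(critical_order (PConst 0) e \<longleftrightarrow> 0 \<le> reval b e) \<and> (critical_order e (PConst 0) \<longleftrightarrow> reval b e \<le> 0)"
      if "e \<in> E" for e
      using b[OF that] unfolding lq by (auto simp: sg_def split: if_splits)
    then show "\<exists>b. \<forall>e\<in>E. (critical_order (PConst 0) e \<longleftrightarrow> 0 \<le> reval b e) \<and>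
        (critical_order e (PConst 0) \<longleftrightarrow> reval b e \<le> 0)" by blast
  qed
qed

section \<open>Finite definition of real zero sets\<close>

definition pexps :: "nat \<Rightarrow> pexp set" where
  "pexps n = {e. pvars e \<subseteq> {..<n}}"

lemma pexps_simps [simp]:
  "PConst r \<in> pexps n" "PVar i \<in> pexps n \<longleftrightarrow> i < n"
  "PAdd a b \<in> pexps n \<longleftrightarrow> a \<in> pexps n \<and> b \<in> pexps n"
  "PMul a b \<in> pexps n \<longleftrightarrow> a \<in> pexps n \<and> b \<in> pexps n"
  by (auto simp: pexps_def)

lemma pexps_mono: "e \<in> pexps n \<Longrightarrow> e \<in> pexps (Suc n)"
  by (auto simp: pexps_def)

text \<open>Ideals of polynomial functions; their elements are represented by expressions.\<close>

definition pideal :: "nat \<Rightarrow> pexp set \<Rightarrow> bool" where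
  "pideal n J \<longleftrightarrow> J \<subseteq> pexps n \<and> PConst 0 \<in> J \<and> (\<forall>e\<in>J. \<forall>f\<in>J. PAdd e f \<in> J) \<and>
     (\<forall>e\<in>J. \<forall>f\<in>pexps n. PMul f e \<in> J) \<and>
     (\<forall>e\<in>J. \<forall>f\<in>pexps n. (\<forall>b. reval b e = reval b f) \<longrightarrow> f \<in> J)"

lemma pidealD:
  assumes "pideal n J"
  shows "e \<in> J \<Longrightarrow> e \<in> pexps n" "PConst 0 \<in> J" "e \<in> J \<Longrightarrow> f \<in> J \<Longrightarrow> PAdd e f \<in> J"
    "e \<in> J \<Longrightarrow> f \<in> pexps n \<Longrightarrow> PMul f e \<in> J"
    "e \<in> J \<Longrightarrow> f \<in> pexps n \<Longrightarrow> (\<And>b. reval b e = reval b f) \<Longrightarrow> f \<in> J"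
  using assms unfolding pideal_def by auto

lemma pideal_Int: "pideal n J \<Longrightarrow> pideal n J' \<Longrightarrow> pideal n (J \<inter> J')"
  unfolding pideal_def by auto

text \<open>A representation of degree at most \<open>k\<close> in the last variable, with
  \<open>c\<close> in position \<open>k\<close>. As \<open>c\<close> may be zero, the elements
  \<open>c\<close> that occur for a fixed \<open>k\<close> form an ideal.\<close>

definition has_lead :: "nat \<Rightarrow> pexp \<Rightarrow> nat \<Rightarrow> pexp \<Rightarrow> (nat \<Rightarrow> pexp) \<Rightarrow> bool" where
  "has_lead n e k c cs \<longleftrightarrow> c \<in> pexps n \<and> range cs \<subseteq> pexps n \<and>
     (\<forall>b. reval b e = (\<Sum>i<k. reval b (cs i) * b n ^ i) + reval b c * b n ^ k)"

definition lead :: "nat \<Rightarrow> pexp set \<Rightarrow> nat \<Rightarrow> pexp set" where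
  "lead n J k = {c. \<exists>e\<in>J. \<exists>cs. has_lead n e k c cs}"

lemma leadI: "e \<in> J \<Longrightarrow> has_lead n e k c cs \<Longrightarrow> c \<in> lead n J k"
  by (auto simp: lead_def)

lemma pideal_lead:
  assumes "pideal (Suc n) J"
  shows "pideal n (lead n J k)"
  unfolding pideal_def
proof (intro conjI ballI impI subsetI)
  note D = pidealD[OF assms]
  show "c \<in> pexps n" if "c \<in> lead n J k" for c
    using that by (auto simp: lead_def has_lead_def)
  show "PConst 0 \<in> lead n J k"
    by (rule leadI[OF D(2), of _ _ _ "\<lambda>_. PConst 0"]) (auto simp: has_lead_def)
  fix c assume "c \<in> lead n J k"
  then obtain e cs where e: "e \<in> J" "has_lead n e k c cs" by (auto simp: lead_def)
  {
    fix c' assume "c' \<in> lead n J k"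
    then obtain e' cs' where e': "e' \<in> J" "has_lead n e' k c' cs'" by (auto simp: lead_def)
    have "has_lead n (PAdd e e') k (PAdd c c') (\<lambda>i. PAdd (cs i) (cs' i))"
      using e(2) e'(2) unfolding has_lead_def
      by (auto simp: sum.distrib algebra_simps image_subset_iff)
    then show "PAdd c c' \<in> lead n J k" by (rule leadI[OF D(3)[OF e(1) e'(1)]])
  }
  {
    fix f assume f: "f \<in> pexps n"
    have "has_lead n (PMul f e) k (PMul f c) (\<lambda>i. PMul f (cs i))"
      using e(2) f unfolding has_lead_def
      by (auto simp: sum_distrib_left algebra_simps image_subset_iff)
    then show "PMul f c \<in> lead n J k" by (rule leadI[OF D(4)[OF e(1) pexps_mono[OF f]]])
    assume "\<forall>b. reval b c = reval b f"
    then have "has_lead n e k f cs" using e(2) f unfolding has_lead_def by simp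
    then show "f \<in> lead n J k" by (rule leadI[OF e(1)])
  }
qed

lemma lead_Suc:
  assumes "pideal (Suc n) J"
  shows "lead n J k \<subseteq> lead n J (Suc k)"
proof
  fix c assume "c \<in> lead n J k"
  then obtain e cs where e: "e \<in> J" "has_lead n e k c cs" by (auto simp: lead_def)
  have "has_lead n (PMul (PVar n) e) (Suc k) c (\<lambda>i. if i = 0 then PConst 0 else cs (i - 1))"
    using e(2) unfolding has_lead_def sum.lessThan_Suc_shift
    by (auto simp: sum_distrib_left algebra_simps image_subset_iff)
  moreover have "PMul (PVar n) e \<in> J" using pidealD(4)[OF assms e(1), of "PVar n"] by simp
  ultimately show "c \<in> lead n J (Suc k)" by (intro leadI)
qed

lemma lead_mono: "pideal (Suc n) J \<Longrightarrow> k \<le> l \<Longrightarrow> lead n J k \<subseteq> lead n J l"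
  using lift_Suc_mono_le[of "lead n J"] lead_Suc by blast

lemma poly_Poly_sum: "poly (Poly xs) (x::'a::comm_ring_1) = (\<Sum>i<length xs. xs ! i * x ^ i)"
  by (induction xs) (simp_all add: sum.lessThan_Suc_shift sum_distrib_left algebra_simps del: sum.lessThan_Suc)

lemma pexp_expansion:
  assumes "e \<in> pexps (Suc n)"
  shows "\<exists>k cs. range cs \<subseteq> pexps n \<and> (\<forall>b. reval b e = (\<Sum>i<k. reval b (cs i) * b n ^ i))"
proof -
  let ?cs = "\<lambda>i. if i < length (pcoeffs n e) then pcoeffs n e ! i else PConst 0"
  have "pcoeffs n e ! i \<in> pexps n" if "i < length (pcoeffs n e)" for i
    using pvars_pcoeffs[of n e] assms nth_mem[OF that] unfolding pexps_def by (fastforce simp: less_Suc_eq)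
  then have "range ?cs \<subseteq> pexps n" by auto
  moreover have "reval b e = (\<Sum>i<length (pcoeffs n e). reval b (?cs i) * b n ^ i)" for b
    using pev_pcoeffs[of "\<lambda>r. r" b n "b n" e] by (simp add: poly_Poly_sum)
  ultimately show ?thesis by blast
qed

text \<open>Generation by \<open>G\<close> is expressed through all ideals above \<open>G\<close>,
  which avoids explicit linear combinations.\<close>

definition finitely_generated_pideals :: "nat \<Rightarrow> bool" where
  "finitely_generated_pideals n \<longleftrightarrow> (\<forall>J. pideal n J \<longrightarrow>
     (\<exists>G\<subseteq>J. finite G \<and> (\<forall>J'. pideal n J' \<and> G \<subseteq> J' \<longrightarrow> J \<subseteq> J')))"

lemma finitely_generated_pidealsE:
  assumes "finitely_generated_pideals n" "pideal n J"
  obtains G where "G \<subseteq> J" "finite G" "\<And>J'. pideal n J' \<Longrightarrow> G \<subseteq> J' \<Longrightarrow> J \<subseteq> J'"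
proof -
  have "\<exists>G\<subseteq>J. finite G \<and> (\<forall>J'. pideal n J' \<and> G \<subseteq> J' \<longrightarrow> J \<subseteq> J')"
    using assms unfolding finitely_generated_pideals_def by (elim allE[of _ J] mp)
  then obtain G where G: "G \<subseteq> J" "finite G" "\<forall>J'. pideal n J' \<and> G \<subseteq> J' \<longrightarrow> J \<subseteq> J'" by blast
  show thesis by (rule that[OF G(1,2)]) (use G(3) in simp)
qed

text \<open>Hilbert's basis theorem. The ideals of leading coefficients increase with the degree,
  and generators of their union already occur at some level N. If \<open>J'\<close> contains
  elements of \<open>J\<close> whose leading coefficients generate the ideals of all levels up to N,
  then the intersection of \<open>J\<close> and \<open>J'\<close> has the same leading ideals as
  \<open>J\<close>; so the terms of an element of \<open>J\<close> can be cancelled from the top by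
  elements of \<open>J'\<close>.\<close>

lemma finitely_generated_pideals_Suc:
  assumes IH: "finitely_generated_pideals n"
  shows "finitely_generated_pideals (Suc n)"
  unfolding finitely_generated_pideals_def
proof (intro allI impI)
  fix J assume J: "pideal (Suc n) J"
  define L where "L = (\<Union>k. lead n J k)"
  have "pideal n L"
    unfolding pideal_def
  proof (intro conjI ballI impI)
    note D = pidealD[OF pideal_lead[OF J]]
    show "L \<subseteq> pexps n" using D(1) by (auto simp: L_def)
    show "PConst 0 \<in> L" using D(2) by (auto simp: L_def)
    fix e assume "e \<in> L"
    then obtain k where k: "e \<in> lead n J k" by (auto simp: L_def)
    {
      fix f assume "f \<in> L"
      then obtain l where l: "f \<in> lead n J l" by (auto simp: L_def)
      have "e \<in> lead n J (max k l)" "f \<in> lead n J (max k l)"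
        using k l lead_mono[OF J, of k "max k l"] lead_mono[OF J, of l "max k l"] by auto
      then show "PAdd e f \<in> L" using D(3) by (auto simp: L_def)
    }
    fix f assume "f \<in> pexps n"
    then show "PMul f e \<in> L" using D(4)[OF k] by (auto simp: L_def)
    assume "\<forall>b. reval b e = reval b f"
    then show "f \<in> L" using D(5)[OF k \<open>f \<in> pexps n\<close>] by (auto simp: L_def)
  qed
  then obtain G0 where G0: "G0 \<subseteq> L" "finite G0" "\<And>J'. pideal n J' \<Longrightarrow> G0 \<subseteq> J' \<Longrightarrow> L \<subseteq> J'"
    using finitely_generated_pidealsE[OF IH] by metis
  have "\<exists>N. G0 \<subseteq> lead n J N"
    using G0(2,1)
  proof (induction G0)
    case (insert c G)
    then obtain N k where "G \<subseteq> lead n J N" "c \<in> lead n J k" by (auto simp: L_def)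
    then have "insert c G \<subseteq> lead n J (max N k)"
      using lead_mono[OF J, of N "max N k"] lead_mono[OF J, of k "max N k"] by auto
    then show ?case by blast
  qed auto
  then obtain N where N: "G0 \<subseteq> lead n J N" by blast
  define gen where "gen k G \<longleftrightarrow> G \<subseteq> lead n J k \<and> finite G \<and> (\<forall>J'. pideal n J' \<longrightarrow> G \<subseteq> J' \<longrightarrow> lead n J k \<subseteq> J')"
    for k G
  have "\<exists>G. gen k G" for k
  proof (rule finitely_generated_pidealsE[OF IH pideal_lead[OF J, of k]])
    fix G assume "G \<subseteq> lead n J k" "finite G" "\<And>J'. pideal n J' \<Longrightarrow> G \<subseteq> J' \<Longrightarrow> lead n J k \<subseteq> J'"
    then show ?thesis unfolding gen_def by (intro exI[of _ G]) simp
  qed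
  then obtain G where "\<And>k. gen k (G k)" by metis
  then have G: "\<And>k. G k \<subseteq> lead n J k" "\<And>k. finite (G k)"
    "\<And>k J'. pideal n J' \<Longrightarrow> G k \<subseteq> J' \<Longrightarrow> lead n J k \<subseteq> J'" unfolding gen_def by simp_all
  \<comment> \<open>At level N the generators of the union are added; they take care of all higher
    levels.\<close>
  define W where "W k = (if k = N then G0 \<union> G N else G k)" for k
  have W: "W k \<subseteq> lead n J k" "finite (W k)" for k
    using G(1)[of k] G(2)[of k] N G0(2) by (auto simp: W_def)
  have "\<forall>k c. \<exists>e. c \<in> W k \<longrightarrow> e \<in> J \<and> (\<exists>cs. has_lead n e k c cs)"
    using W(1) unfolding lead_def by blast
  then obtain r where r: "\<And>k c. c \<in> W k \<Longrightarrow> r k c \<in> J \<and> (\<exists>cs. has_lead n (r k c) k c cs)"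
    by metis
  define H where "H = (\<Union>k\<le>N. r k ` W k)"
  have "J \<subseteq> J'" if J': "pideal (Suc n) J'" and HJ': "H \<subseteq> J'" for J'
  proof -
    let ?M = "J \<inter> J'"
    have M: "pideal (Suc n) ?M" by (rule pideal_Int[OF J J'])
    have WM: "W k \<subseteq> lead n ?M k" if "k \<le> N" for k
    proof
      fix c assume c: "c \<in> W k"
      then have "r k c \<in> H" using that by (auto simp: H_def)
      then have "r k c \<in> ?M" using HJ' r[OF c] by auto
      then show "c \<in> lead n ?M k" using r[OF c] leadI by blast
    qed
    have leadM: "lead n J k \<subseteq> lead n ?M k" for k
    proof (cases "k \<le> N")
      case True
      then have "G k \<subseteq> lead n ?M k" using WM[OF True] by (auto simp: W_def split: if_splits)
      then show ?thesis using G(3)[OF pideal_lead[OF M]] by blast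
    next
      case False
      have "G0 \<subseteq> lead n ?M N" using WM[of N] by (auto simp: W_def)
      also have "\<dots> \<subseteq> lead n ?M k" using False by (intro lead_mono[OF M]) simp
      finally have "L \<subseteq> lead n ?M k" using G0(3)[OF pideal_lead[OF M]] by blast
      then show ?thesis by (auto simp: L_def)
    qed
    have mem: "f \<in> J'" if "f \<in> J" "range cs \<subseteq> pexps n" "\<forall>b. reval b f = (\<Sum>i<k. reval b (cs i) * b n ^ i)"
      for f cs k
      using that
    proof (induction k arbitrary: f cs)
      case 0
      then have "reval b (PConst 0) = reval b f" for b by simp
      then show ?case
        using pidealD(5)[OF J' pidealD(2)[OF J']] pidealD(1)[OF J 0(1)] by blast
    next
      case (Suc k)
      have "has_lead n f k (cs k) cs" unfolding has_lead_def using Suc.prems by auto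
      then have "cs k \<in> lead n ?M k" using leadI[OF Suc.prems(1)] leadM by blast
      then obtain e cs' where e: "e \<in> J" "e \<in> J'" "has_lead n e k (cs k) cs'" by (auto simp: lead_def)
      let ?g = "PAdd f (PMul (PConst (- 1)) e)"
      have "?g \<in> J'"
      proof (rule Suc.IH[of _ "\<lambda>i. PAdd (cs i) (PMul (PConst (- 1)) (cs' i))"])
        show "?g \<in> J"
          using pidealD(3)[OF J Suc.prems(1) pidealD(4)[OF J e(1)]] by simp
        show "range (\<lambda>i. PAdd (cs i) (PMul (PConst (- 1)) (cs' i))) \<subseteq> pexps n"
          using Suc.prems(2) e(3) unfolding has_lead_def by (auto simp: image_subset_iff)
        show "\<forall>b. reval b ?g = (\<Sum>i<k. reval b (PAdd (cs i) (PMul (PConst (- 1)) (cs' i))) * b n ^ i)"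
          using Suc.prems(3) e(3) unfolding has_lead_def
          by (simp add: sum_subtractf algebra_simps)
      qed
      then have "PAdd ?g e \<in> J'" using pidealD(3)[OF J'] e(2) by blast
      then show ?case
        by (rule pidealD(5)[OF J']) (use pidealD(1)[OF J Suc.prems(1)] in auto)
    qed
    show ?thesis
    proof
      fix f assume f: "f \<in> J"
      from pexp_expansion[OF pidealD(1)[OF J f]] show "f \<in> J'" using mem[OF f] by blast
    qed
  qed
  moreover have "H \<subseteq> J" using r by (auto simp: H_def)
  moreover have "finite H" using W(2) by (auto simp: H_def)
  ultimately show "\<exists>G\<subseteq>J. finite G \<and> (\<forall>J'. pideal (Suc n) J' \<and> G \<subseteq> J' \<longrightarrow> J \<subseteq> J')" by blast
qed

lemma finitely_generated_pideals: "finitely_generated_pideals n"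
proof (induction n)
  case 0
  show ?case
    unfolding finitely_generated_pideals_def
  proof (intro allI impI)
    fix J assume J: "pideal 0 J"
    note D = pidealD[OF J]
    have const: "reval b e = reval b' e" if "e \<in> pexps 0" for e b b'
      by (rule pev_cong) (use that in \<open>auto simp: pexps_def\<close>)
    show "\<exists>G\<subseteq>J. finite G \<and> (\<forall>J'. pideal 0 J' \<and> G \<subseteq> J' \<longrightarrow> J \<subseteq> J')"
    proof (cases "\<exists>e\<in>J. reval (\<lambda>_. 0) e \<noteq> 0")
      case True
      then obtain e where e: "e \<in> J" "reval (\<lambda>_. 0) e \<noteq> 0" by blast
      have "J \<subseteq> J'" if J': "pideal 0 J'" "{e} \<subseteq> J'" for J'
      proof
        fix f assume f: "f \<in> J"
        have "PMul (PConst (reval (\<lambda>_. 0) f / reval (\<lambda>_. 0) e)) e \<in> J'"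
          using pidealD(4)[OF J'(1)] J'(2) by simp
        then show "f \<in> J'"
        proof (rule pidealD(5)[OF J'(1)])
          fix b
          show "reval b (PMul (PConst (reval (\<lambda>_. 0) f / reval (\<lambda>_. 0) e)) e) = reval b f"
            using e(2) const[OF D(1)[OF e(1)], of b "\<lambda>_. 0"] const[OF D(1)[OF f], of b "\<lambda>_. 0"] by simp
        qed (rule D(1)[OF f])
      qed
      then show ?thesis using e(1) by (intro exI[of _ "{e}"]) auto
    next
      case False
      have "J \<subseteq> J'" if J': "pideal 0 J'" for J'
      proof
        fix f assume f: "f \<in> J"
        then have "reval b (PConst 0) = reval b f" for b
          using False const[OF D(1)[OF f], of b "\<lambda>_. 0"] by simp
        then show "f \<in> J'" using pidealD(5)[OF J' pidealD(2)[OF J']] D(1)[OF f] by blast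
      qed
      then show ?thesis by (intro exI[of _ "{}"]) auto
    qed
  qed
qed (rule finitely_generated_pideals_Suc)

text \<open>A real point can be prescribed only finitely many signs at once, but it has to satisfy
  all relations between the generators of the algebra. The set \<open>J\<close> closes
  \<open>I\<close> under equality of real functions, which keeps the zeros and makes the basis
  theorem applicable.\<close>

lemma finite_defining_subset:
  assumes "I \<subseteq> pexps n" "PConst 0 \<in> I" "\<And>e f. e \<in> I \<Longrightarrow> f \<in> I \<Longrightarrow> PAdd e f \<in> I"
    "\<And>e f. e \<in> I \<Longrightarrow> f \<in> pexps n \<Longrightarrow> PMul f e \<in> I"
  shows "\<exists>G\<subseteq>I. finite G \<and> (\<forall>b. (\<forall>e\<in>G. reval b e = 0) \<longrightarrow> (\<forall>e\<in>I. reval b e = 0))"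
proof -
  define J where "J = {e \<in> pexps n. \<exists>f\<in>I. \<forall>b. reval b f = reval b e}"
  have "pideal n J"
    unfolding pideal_def
  proof (intro conjI ballI impI)
    show "J \<subseteq> pexps n" by (auto simp: J_def)
    show "PConst 0 \<in> J" using assms(2) by (auto simp: J_def intro!: bexI[of _ "PConst 0"])
    fix e assume "e \<in> J"
    then obtain e' where e: "e \<in> pexps n" "e' \<in> I" "\<And>b. reval b e' = reval b e" by (auto simp: J_def)
    {
      fix f assume "f \<in> J"
      then obtain f' where f: "f \<in> pexps n" "f' \<in> I" "\<And>b. reval b f' = reval b f" by (auto simp: J_def)
      show "PAdd e f \<in> J"
        unfolding J_def using e f assms(3)[OF e(2) f(2)] by (auto intro!: bexI[of _ "PAdd e' f'"])
    }
    fix f assume f: "f \<in> pexps n"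
    show "PMul f e \<in> J"
      unfolding J_def using e f assms(4)[OF e(2) f] by (auto intro!: bexI[of _ "PMul f e'"])
    assume "\<forall>b. reval b e = reval b f"
    then show "f \<in> J" using e f unfolding J_def by auto
  qed
  then obtain G where G: "G \<subseteq> J" "finite G" "\<And>J'. pideal n J' \<Longrightarrow> G \<subseteq> J' \<Longrightarrow> J \<subseteq> J'"
    using finitely_generated_pidealsE[OF finitely_generated_pideals] by metis
  have "\<forall>e\<in>G. \<exists>f\<in>I. \<forall>b. reval b f = reval b e" using G(1) by (auto simp: J_def)
  then obtain s where s: "\<And>e. e \<in> G \<Longrightarrow> s e \<in> I \<and> (\<forall>b. reval b (s e) = reval b e)" by metis
  have "reval b e = 0" if b: "\<forall>e\<in>s ` G. reval b e = 0" and e: "e \<in> I" for b e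
  proof -
    let ?J = "{e \<in> pexps n. reval b e = 0}"
    have "pideal n ?J" unfolding pideal_def by auto
    moreover have "G \<subseteq> ?J"
    proof
      fix e assume "e \<in> G"
      then have "reval b (s e) = 0" "reval b (s e) = reval b e" using b s by auto
      then show "e \<in> ?J" using G(1) \<open>e \<in> G\<close> by (auto simp: J_def)
    qed
    ultimately have "J \<subseteq> ?J" by (rule G(3))
    moreover have "e \<in> J" using e assms(1) by (auto simp: J_def)
    ultimately show ?thesis by blast
  qed
  moreover have "s ` G \<subseteq> I" using s by blast
  ultimately show ?thesis using G(2) by (intro exI[of _ "s ` G"]) auto
qed

section \<open>The Positivstellensatz\<close>

locale real_algebra =
  fixes A :: "(real, 'a, 'm) module_scheme" (structure)
  assumes comm_real_algebra: "comm_real_algebra A"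

sublocale real_algebra \<subseteq> cring A
  using comm_real_algebra by (simp add: comm_real_algebra_def Module.algebra_def)

context real_algebra
begin

lemma smult_closed: "x \<in> carrier A \<Longrightarrow> r \<odot> x \<in> carrier A"
    and smult_l_distr: "x \<in> carrier A \<Longrightarrow> (r + s) \<odot> x = r \<odot> x \<oplus> s \<odot> x"
    and smult_r_distr: "x \<in> carrier A \<Longrightarrow> y \<in> carrier A \<Longrightarrow> r \<odot> (x \<oplus> y) = r \<odot> x \<oplus> r \<odot> y"
    and smult_assoc: "x \<in> carrier A \<Longrightarrow> (r * s) \<odot> x = r \<odot> (s \<odot> x)"
    and smult_one: "x \<in> carrier A \<Longrightarrow> 1 \<odot> x = x"
    and smult_mult: "x \<in> carrier A \<Longrightarrow> y \<in> carrier A \<Longrightarrow> (r \<odot> x) \<otimes> y = r \<odot> (x \<otimes> y)"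
      "x \<in> carrier A \<Longrightarrow> y \<in> carrier A \<Longrightarrow> x \<otimes> (r \<odot> y) = r \<odot> (x \<otimes> y)"
proof -
  interpret alg: Module.algebra real_ring A
    using comm_real_algebra by (simp add: comm_real_algebra_def)
  have R: "carrier real_ring = UNIV" "r \<oplus>\<^bsub>real_ring\<^esub> s = r + s" "r \<otimes>\<^bsub>real_ring\<^esub> s = r * s" "\<one>\<^bsub>real_ring\<^esub> = 1"
    for r s by (simp_all add: ring_of_type_algebra_def)
  have cl: "r \<odot> x \<in> carrier A" if "x \<in> carrier A" for x using alg.smult_closed[of r x] that by (simp add: R)
  show "x \<in> carrier A \<Longrightarrow> r \<odot> x \<in> carrier A" using cl by blast
  show "x \<in> carrier A \<Longrightarrow> (r + s) \<odot> x = r \<odot> x \<oplus> s \<odot> x" using alg.smult_l_distr[of r s x] by (simp add: R)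
  show "x \<in> carrier A \<Longrightarrow> y \<in> carrier A \<Longrightarrow> r \<odot> (x \<oplus> y) = r \<odot> x \<oplus> r \<odot> y"
    using alg.smult_r_distr[of r x y] by (simp add: R)
  show "x \<in> carrier A \<Longrightarrow> (r * s) \<odot> x = r \<odot> (s \<odot> x)" using alg.smult_assoc1[of r s x] by (simp add: R)
  show "x \<in> carrier A \<Longrightarrow> 1 \<odot> x = x" using alg.smult_one[of x] by (simp add: R)
  have 1: "(r \<odot> x) \<otimes> y = r \<odot> (x \<otimes> y)" if "x \<in> carrier A" "y \<in> carrier A" for x y
    using alg.smult_assoc2[of r x y] that by (simp add: R)
  then show "x \<in> carrier A \<Longrightarrow> y \<in> carrier A \<Longrightarrow> (r \<odot> x) \<otimes> y = r \<odot> (x \<otimes> y)" by blast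
  show "x \<in> carrier A \<Longrightarrow> y \<in> carrier A \<Longrightarrow> x \<otimes> (r \<odot> y) = r \<odot> (x \<otimes> y)"
    using 1[of y x] m_comm[of x "r \<odot> y"] m_comm[of x y] cl by simp
qed

lemma smult_0: "x \<in> carrier A \<Longrightarrow> 0 \<odot> x = \<zero>"
  using smult_l_distr[of x 0 0] smult_closed[of x 0] by (simp add: add.r_cancel_one')

lemma smult_minus: "x \<in> carrier A \<Longrightarrow> (- r) \<odot> x = \<ominus> (r \<odot> x)"
  using smult_l_distr[of x "- r" r] smult_closed[of x] smult_0[of x]
  by (simp add: minus_equality)

lemma power2_eq: "a \<in> carrier A \<Longrightarrow> a [^] (2::nat) = a \<otimes> a"
  by (simp add: numeral_2_eq_2)

section \<open>Maximal preorders of the algebra\<close>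

lemma preorderingD:
  assumes "preordering A P"
  shows "s \<in> P \<Longrightarrow> s \<in> carrier A" "s \<in> P \<Longrightarrow> t \<in> P \<Longrightarrow> s \<otimes> t \<in> P"
    "s \<in> P \<Longrightarrow> t \<in> P \<Longrightarrow> s \<oplus> t \<in> P" "\<one> \<in> P"
    "a \<in> carrier A \<Longrightarrow> a \<otimes> a \<in> P" "\<zero> \<in> P" "0 \<le> r \<Longrightarrow> s \<in> P \<Longrightarrow> r \<odot> s \<in> P"
proof -
  show cl: "s \<in> carrier A" if "s \<in> P" for s using assms that by (auto simp: preordering_def)
  show mult: "s \<otimes> t \<in> P" if "s \<in> P" "t \<in> P" for s t using assms that by (auto simp: preordering_def)
  show "s \<in> P \<Longrightarrow> t \<in> P \<Longrightarrow> s \<oplus> t \<in> P" "\<one> \<in> P" using assms by (auto simp: preordering_def)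
  show sq: "a \<otimes> a \<in> P" if "a \<in> carrier A" for a
  proof -
    have "a [^] (2::nat) \<otimes> \<one> \<in> P" using assms that unfolding preordering_def by blast
    then show ?thesis using that by (simp add: power2_eq)
  qed
  show "\<zero> \<in> P" using sq[of \<zero>] by simp
  assume r: "0 \<le> r" and s: "s \<in> P"
  \<comment> \<open>A nonnegative scalar is the square of a scalar, so scaling is multiplication by
    a square.\<close>
  have "(sqrt r \<odot> \<one>) \<otimes> (sqrt r \<odot> \<one>) = r \<odot> \<one>"
    using r by (simp add: smult_mult smult_closed smult_assoc[symmetric])
  then have "r \<odot> \<one> \<in> P" using sq[of "sqrt r \<odot> \<one>"] by (simp add: smult_closed)
  then have "(r \<odot> \<one>) \<otimes> s \<in> P" using mult s by blast
  then show "r \<odot> s \<in> P" using cl[OF s] by (simp add: smult_mult)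
qed

lemma preorderingI:
  assumes "P \<subseteq> carrier A" "\<And>s t. s \<in> P \<Longrightarrow> t \<in> P \<Longrightarrow> s \<otimes> t \<in> P"
    "\<And>s t. s \<in> P \<Longrightarrow> t \<in> P \<Longrightarrow> s \<oplus> t \<in> P" "\<And>a. a \<in> carrier A \<Longrightarrow> a \<otimes> a \<in> P"
  shows "preordering A P"
  unfolding preordering_def
proof (intro conjI ballI)
  show "\<one> \<in> P" using assms(4)[of \<one>] by simp
  fix a t assume "a \<in> carrier A" "t \<in> P"
  then show "a [^] (2::nat) \<otimes> t \<in> P" using assms(2,4) by (simp add: power2_eq)
qed (use assms in auto)

definition adjoin :: "'a set \<Rightarrow> 'a \<Rightarrow> 'a set" where
  "adjoin P a = {s \<oplus> a \<otimes> t | s t. s \<in> P \<and> t \<in> P}"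

lemma preordering_adjoin:
  assumes P: "preordering A P" and a: "a \<in> carrier A"
  shows "preordering A (adjoin P a)" "P \<subseteq> adjoin P a" "a \<in> adjoin P a"
proof -
  note D = preorderingD[OF P]
  show sub: "P \<subseteq> adjoin P a"
  proof
    fix s assume "s \<in> P"
    then show "s \<in> adjoin P a"
      unfolding adjoin_def using D(1,6) a by (intro CollectI exI[of _ s] exI[of _ \<zero>]) auto
  qed
  show "a \<in> adjoin P a"
    unfolding adjoin_def using D(4,6) a by (intro CollectI exI[of _ \<zero>] exI[of _ \<one>]) auto
  show "preordering A (adjoin P a)"
  proof (rule preorderingI)
    show "adjoin P a \<subseteq> carrier A" unfolding adjoin_def using D(1) a by auto
    show "b \<otimes> b \<in> adjoin P a" if "b \<in> carrier A" for b using D(5)[OF that] sub by blast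
    fix x y assume "x \<in> adjoin P a" "y \<in> adjoin P a"
    then obtain s t s' t' where xy: "x = s \<oplus> a \<otimes> t" "y = s' \<oplus> a \<otimes> t'"
      and P': "s \<in> P" "t \<in> P" "s' \<in> P" "t' \<in> P"
      unfolding adjoin_def by blast
    note c = D(1)[OF P'(1)] D(1)[OF P'(2)] D(1)[OF P'(3)] D(1)[OF P'(4)] a
    have "x \<oplus> y = (s \<oplus> s') \<oplus> a \<otimes> (t \<oplus> t')" unfolding xy using c by algebra
    then show "x \<oplus> y \<in> adjoin P a" unfolding adjoin_def using D(3) P' by blast
    have "x \<otimes> y = (s \<otimes> s' \<oplus> (a \<otimes> a) \<otimes> (t \<otimes> t')) \<oplus> a \<otimes> (s \<otimes> t' \<oplus> t \<otimes> s')"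
      unfolding xy using c by algebra
    moreover have "s \<otimes> s' \<oplus> (a \<otimes> a) \<otimes> (t \<otimes> t') \<in> P" "s \<otimes> t' \<oplus> t \<otimes> s' \<in> P"
      by (intro D(2,3,5) P' a)+
    ultimately show "x \<otimes> y \<in> adjoin P a" unfolding adjoin_def by blast
  qed
qed

text \<open>Maximality in the form in which it is used: adjoining any further element produces
  -1.\<close>

definition maximal_preordering :: "'a set \<Rightarrow> bool" where
  "maximal_preordering P \<longleftrightarrow> preordering A P \<and> \<ominus> \<one> \<notin> P \<and>
     (\<forall>a\<in>carrier A - P. \<exists>s\<in>P. \<exists>t\<in>P. \<ominus> \<one> = s \<oplus> a \<otimes> t)"

lemma maximal_preorderingD:
  assumes "maximal_preordering P"
  shows "preordering A P" "\<ominus> \<one> \<notin> P" "a \<in> carrier A \<Longrightarrow> a \<notin> P \<Longrightarrow> \<exists>s\<in>P. \<exists>t\<in>P. \<ominus> \<one> = s \<oplus> a \<otimes> t"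
  using assms by (auto simp: maximal_preordering_def)

lemma maximal_preordering_exists:
  assumes "preordering A T" "\<ominus> \<one> \<notin> T"
  shows "\<exists>P. T \<subseteq> P \<and> maximal_preordering P"
proof -
  let ?S = "{Q. preordering A Q \<and> T \<subseteq> Q \<and> \<ominus> \<one> \<notin> Q}"
  have "\<exists>M\<in>?S. \<forall>Y\<in>?S. M \<subseteq> Y \<longrightarrow> Y = M"
  proof (rule subset_Zorn_nonempty)
    show "?S \<noteq> {}" using assms by blast
    fix C assume C: "C \<noteq> {}" "subset.chain ?S C"
    then have mem: "\<And>Q. Q \<in> C \<Longrightarrow> preordering A Q \<and> T \<subseteq> Q \<and> \<ominus> \<one> \<notin> Q"
      by (auto simp: subset.chain_def)
    have joint: "\<exists>Q\<in>C. x \<in> Q \<and> y \<in> Q" if "x \<in> \<Union>C" "y \<in> \<Union>C" for x y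
      using that C unfolding subset.chain_def by blast
    have "preordering A (\<Union>C)"
    proof (rule preorderingI)
      show "\<Union>C \<subseteq> carrier A" using mem preorderingD(1) by blast
      show "a \<otimes> a \<in> \<Union>C" if "a \<in> carrier A" for a using mem C(1) preorderingD(5)[OF _ that] by blast
      fix s t assume "s \<in> \<Union>C" "t \<in> \<Union>C"
      from joint[OF this] obtain Q where Q: "Q \<in> C" "s \<in> Q" "t \<in> Q" by blast
      then show "s \<otimes> t \<in> \<Union>C" "s \<oplus> t \<in> \<Union>C"
        using mem[OF Q(1)] preorderingD(2,3)[of Q s t] by blast+
    qed
    then show "\<Union>C \<in> ?S" using C mem by blast
  qed
  then obtain P where PS: "P \<in> ?S" and "\<forall>Y\<in>?S. P \<subseteq> Y \<longrightarrow> Y = P" by (elim bexE)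
  then have mx: "\<And>Y. preordering A Y \<Longrightarrow> T \<subseteq> Y \<Longrightarrow> \<ominus> \<one> \<notin> Y \<Longrightarrow> P \<subseteq> Y \<Longrightarrow> Y = P" by simp
  have P: "preordering A P" "T \<subseteq> P" "\<ominus> \<one> \<notin> P" using PS by simp_all
  have "\<exists>s\<in>P. \<exists>t\<in>P. \<ominus> \<one> = s \<oplus> a \<otimes> t" if a: "a \<in> carrier A" "a \<notin> P" for a
  proof (rule ccontr)
    assume "\<not> ?thesis"
    then have "\<ominus> \<one> \<notin> adjoin P a" unfolding adjoin_def by blast
    then have "adjoin P a = P"
      using preordering_adjoin[OF P(1) a(1)] P(2) by (intro mx) auto
    then show False using preordering_adjoin(3)[OF P(1) a(1)] a(2) by blast
  qed
  then show ?thesis unfolding maximal_preordering_def using P by blast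
qed

lemma maximal_preordering_total:
  assumes MP: "maximal_preordering P" and a: "a \<in> carrier A"
  shows "a \<in> P \<or> \<ominus> a \<in> P"
proof (rule ccontr)
  assume *: "\<not> ?thesis"
  note P = maximal_preorderingD(1,2)[OF MP] and mx = maximal_preorderingD(3)[OF MP]
  note D = preorderingD[OF P(1)]
  obtain s t where st: "s \<in> P" "t \<in> P" "\<ominus> \<one> = s \<oplus> a \<otimes> t" using mx[OF a] * by blast
  obtain s' t' where st': "s' \<in> P" "t' \<in> P" "\<ominus> \<one> = s' \<oplus> (\<ominus> a) \<otimes> t'" using mx[of "\<ominus> a"] a * by blast
  note c = D(1)[OF st(1)] D(1)[OF st(2)] D(1)[OF st'(1)] D(1)[OF st'(2)] a
  have "a \<otimes> t = \<ominus> \<one> \<ominus> s"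
  proof -
    have "a \<otimes> t = (s \<oplus> a \<otimes> t) \<ominus> s" using c by algebra
    then show ?thesis using st(3) by simp
  qed
  moreover have "a \<otimes> t' = \<one> \<oplus> s'"
  proof -
    have "a \<otimes> t' = \<ominus> (s' \<oplus> (\<ominus> a) \<otimes> t') \<oplus> s'" using c by algebra
    then show ?thesis unfolding st'(3)[symmetric] using c by simp
  qed
  moreover have "(a \<otimes> a) \<otimes> (t \<otimes> t') = (a \<otimes> t) \<otimes> (a \<otimes> t')" using c by algebra
  ultimately have "(a \<otimes> a) \<otimes> (t \<otimes> t') = (\<ominus> \<one> \<ominus> s) \<otimes> (\<one> \<oplus> s')" by simp
  then have "s \<oplus> s' \<oplus> s \<otimes> s' \<oplus> (a \<otimes> a) \<otimes> (t \<otimes> t') = s \<oplus> s' \<oplus> s \<otimes> s' \<oplus> (\<ominus> \<one> \<ominus> s) \<otimes> (\<one> \<oplus> s')" by simp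
  also have "\<dots> = \<ominus> \<one>" using c by algebra
  finally have "s \<oplus> s' \<oplus> s \<otimes> s' \<oplus> (a \<otimes> a) \<otimes> (t \<otimes> t') = \<ominus> \<one>" .
  moreover have "s \<oplus> s' \<oplus> s \<otimes> s' \<oplus> (a \<otimes> a) \<otimes> (t \<otimes> t') \<in> P" by (intro D(2,3,5) st st' a)
  ultimately show False using P(2) by simp
qed

text \<open>In the order given by \<open>P\<close> the hypotheses say that \<open>a\<close> and
  \<open>b\<close> are strictly positive. By maximality there are equations
  \<open>a \<otimes> t = \<one> \<oplus> s\<close> and
  \<open>b \<otimes> t' = \<one> \<oplus> s'\<close>; if the product were not strictly positive,
  multiplying them would put -1 into \<open>P\<close>.\<close>

lemma maximal_preordering_prime:
  assumes MP: "maximal_preordering P" and a: "\<ominus> a \<notin> P" "a \<in> carrier A" and b: "\<ominus> b \<notin> P" "b \<in> carrier A"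
  shows "\<ominus> (a \<otimes> b) \<notin> P"
proof
  assume ab: "\<ominus> (a \<otimes> b) \<in> P"
  note P = maximal_preorderingD(1,2)[OF MP] and mx = maximal_preorderingD(3)[OF MP]
  note D = preorderingD[OF P(1)]
  obtain s t where st: "s \<in> P" "t \<in> P" "\<ominus> \<one> = s \<oplus> (\<ominus> a) \<otimes> t" using mx[of "\<ominus> a"] a by blast
  obtain s' t' where st': "s' \<in> P" "t' \<in> P" "\<ominus> \<one> = s' \<oplus> (\<ominus> b) \<otimes> t'" using mx[of "\<ominus> b"] b by blast
  note c = D(1)[OF st(1)] D(1)[OF st(2)] D(1)[OF st'(1)] D(1)[OF st'(2)] a(2) b(2)
  have *: "x \<otimes> t = \<one> \<oplus> s" if "\<ominus> \<one> = s \<oplus> (\<ominus> x) \<otimes> t" "s \<in> carrier A" "t \<in> carrier A" "x \<in> carrier A" for x s t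
  proof -
    have "x \<otimes> t = \<ominus> (s \<oplus> (\<ominus> x) \<otimes> t) \<oplus> s" using that(2-4) by algebra
    then show ?thesis unfolding that(1)[symmetric] using that(2) by simp
  qed
  have "\<ominus> (a \<otimes> b) \<otimes> (t \<otimes> t') = \<ominus> ((a \<otimes> t) \<otimes> (b \<otimes> t'))" using c by algebra
  also have "\<dots> = \<ominus> ((\<one> \<oplus> s) \<otimes> (\<one> \<oplus> s'))" 
    unfolding *[OF st(3) c(1,2) a(2)] *[OF st'(3) c(3,4) b(2)] ..
  finally have "s \<oplus> s' \<oplus> s \<otimes> s' \<oplus> \<ominus> (a \<otimes> b) \<otimes> (t \<otimes> t') = s \<oplus> s' \<oplus> s \<otimes> s' \<oplus> \<ominus> ((\<one> \<oplus> s) \<otimes> (\<one> \<oplus> s'))" by simp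
  also have "\<dots> = \<ominus> \<one>" using c by algebra
  finally have "s \<oplus> s' \<oplus> s \<otimes> s' \<oplus> \<ominus> (a \<otimes> b) \<otimes> (t \<otimes> t') = \<ominus> \<one>" .
  moreover have "s \<oplus> s' \<oplus> s \<otimes> s' \<oplus> \<ominus> (a \<otimes> b) \<otimes> (t \<otimes> t') \<in> P" by (intro D(2,3) st st' ab)
  ultimately show False using P(2) by simp
qed

primrec aev :: "(nat \<Rightarrow> 'a) \<Rightarrow> pexp \<Rightarrow> 'a" where
  "aev g (PConst r) = r \<odot> \<one>"
| "aev g (PVar i) = g i"
| "aev g (PAdd a b) = aev g a \<oplus> aev g b"
| "aev g (PMul a b) = aev g a \<otimes> aev g b"

lemma aev_closed: "range g \<subseteq> carrier A \<Longrightarrow> aev g e \<in> carrier A"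
  by (induction e) (auto simp: smult_closed)

lemma aev_const: "aev g (PConst 0) = \<zero>" "aev g (PConst 1) = \<one>" "aev g (PConst (- 1)) = \<ominus> \<one>"
  by (simp_all add: smult_0 smult_one smult_minus)

text \<open>Expressions are compared through their values in \<open>A\<close>. Elements that lie in
  \<open>P\<close> with both signs become zero, so that an ordered domain arises without forming a
  quotient of \<open>A\<close>.\<close>

lemma pexp_order_maximal_preordering:
  assumes MP: "maximal_preordering P" and g: "range g \<subseteq> carrier A"
  shows "pexp_order (\<lambda>e f. aev g f \<ominus> aev g e \<in> P)"
proof
  note P = maximal_preorderingD(1,2)[OF MP]
  note D = preorderingD[OF P(1)]
  note tot = maximal_preordering_total[OF MP]
  fix e f h :: pexp and r s :: real
  define a b c where "a = aev g e" and "b = aev g f" and "c = aev g h"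
  note abc = a_def[symmetric] b_def[symmetric] c_def[symmetric]
  have cl: "a \<in> carrier A" "b \<in> carrier A" "c \<in> carrier A"
    using aev_closed[OF g] by (simp_all add: a_def b_def c_def)
  have zero: "x \<in> P" if "x = \<zero>" for x using that D(6) by simp
  have swap: "\<ominus> (x \<ominus> y) = y \<ominus> x" if "x \<in> carrier A" "y \<in> carrier A" for x y using that by algebra
  show "aev g f \<ominus> aev g e \<in> P \<or> aev g e \<ominus> aev g f \<in> P"
    using tot[of "b \<ominus> a"] swap[of b a] cl unfolding abc by auto
  show "aev g h \<ominus> aev g e \<in> P" if "aev g f \<ominus> aev g e \<in> P" "aev g h \<ominus> aev g f \<in> P"
  proof -
    have "c \<ominus> a = (b \<ominus> a) \<oplus> (c \<ominus> b)" using cl by algebra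
    then show ?thesis using D(3) that unfolding abc by simp
  qed
  show "aev g (PAdd f h) \<ominus> aev g (PAdd e h) \<in> P" if "aev g f \<ominus> aev g e \<in> P"
  proof -
    have "(b \<oplus> c) \<ominus> (a \<oplus> c) = b \<ominus> a" using cl by algebra
    then show ?thesis using that unfolding aev.simps abc by simp
  qed
  have dist: "(b \<otimes> c) \<ominus> (a \<otimes> c) = (b \<ominus> a) \<otimes> c" using cl by algebra
  show "aev g (PMul f h) \<ominus> aev g (PMul e h) \<in> P" if "aev g f \<ominus> aev g e \<in> P" "aev g h \<ominus> aev g (PConst 0) \<in> P"
  proof -
    have "c \<ominus> \<zero> = c" using cl by algebra
    then show ?thesis using that D(2) dist unfolding aev_const aev.simps(3,4) abc by simp
  qed
  show "aev g (PMul f h) \<ominus> aev g (PMul e h) \<in> P" if "aev g f \<ominus> aev g e \<in> P" "aev g e \<ominus> aev g f \<in> P"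
  proof -
    \<comment> \<open>Both signs of \<open>b \<ominus> a\<close> are in \<open>P\<close>, and
      \<open>c\<close> or its negative is, so one of the two factorizations has its factors in
      \<open>P\<close>.\<close>
    have "(b \<ominus> a) \<otimes> c = (a \<ominus> b) \<otimes> (\<ominus> c)" using cl by algebra
    then show ?thesis
      using that D(2)[of "b \<ominus> a" c] D(2)[of "a \<ominus> b" "\<ominus> c"] tot[OF cl(3)] dist unfolding aev.simps abc by auto
  qed
  show "aev g (PAdd e (PAdd f h)) \<ominus> aev g (PAdd (PAdd e f) h) \<in> P"
    "aev g (PAdd (PAdd e f) h) \<ominus> aev g (PAdd e (PAdd f h)) \<in> P"
    unfolding aev.simps abc by (rule zero; use cl in algebra)+
  show "aev g (PAdd f e) \<ominus> aev g (PAdd e f) \<in> P"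
    unfolding aev.simps abc by (rule zero; use cl in algebra)
  show "aev g e \<ominus> aev g (PAdd (PConst 0) e) \<in> P" "aev g (PAdd (PConst 0) e) \<ominus> aev g e \<in> P"
    unfolding aev_const aev.simps(3,4) abc by (rule zero; use cl in algebra)+
  show "aev g (PConst 0) \<ominus> aev g (PAdd (PMul (PConst (- 1)) e) e) \<in> P"
    "aev g (PAdd (PMul (PConst (- 1)) e) e) \<ominus> aev g (PConst 0) \<in> P"
    unfolding aev_const aev.simps(3,4) abc by (rule zero; use cl in algebra)+
  show "aev g (PMul e (PMul f h)) \<ominus> aev g (PMul (PMul e f) h) \<in> P"
    "aev g (PMul (PMul e f) h) \<ominus> aev g (PMul e (PMul f h)) \<in> P"
    unfolding aev.simps abc by (rule zero; use cl in algebra)+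
  show "aev g (PMul f e) \<ominus> aev g (PMul e f) \<in> P"
    unfolding aev.simps abc by (rule zero; use cl in algebra)
  show "aev g e \<ominus> aev g (PMul (PConst 1) e) \<in> P" "aev g (PMul (PConst 1) e) \<ominus> aev g e \<in> P"
    unfolding aev_const aev.simps(3,4) abc by (rule zero; use cl in algebra)+
  show "aev g (PAdd (PMul e h) (PMul f h)) \<ominus> aev g (PMul (PAdd e f) h) \<in> P"
    "aev g (PMul (PAdd e f) h) \<ominus> aev g (PAdd (PMul e h) (PMul f h)) \<in> P"
    unfolding aev.simps abc by (rule zero; use cl in algebra)+
  have eqs: "aev g (PConst (r + s)) = aev g (PAdd (PConst r) (PConst s))"
    "aev g (PConst (r * s)) = aev g (PMul (PConst r) (PConst s))"
    by (simp_all add: smult_l_distr smult_assoc smult_mult(1) smult_closed)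
  have self: "x \<ominus> x \<in> P" if "x \<in> carrier A" for x by (rule zero) (use that in algebra)
  show "aev g (PAdd (PConst r) (PConst s)) \<ominus> aev g (PConst (r + s)) \<in> P"
    "aev g (PConst (r + s)) \<ominus> aev g (PAdd (PConst r) (PConst s)) \<in> P"
    "aev g (PMul (PConst r) (PConst s)) \<ominus> aev g (PConst (r * s)) \<in> P"
    "aev g (PConst (r * s)) \<ominus> aev g (PMul (PConst r) (PConst s)) \<in> P"
    unfolding eqs by (intro self aev_closed[OF g])+
  have "\<zero> \<ominus> \<one> = \<ominus> \<one>" by algebra
  then show "\<not> aev g (PConst 0) \<ominus> aev g (PConst 1) \<in> P"
    unfolding aev_const using P(2) by simp
  show "aev g (PConst 0) \<ominus> aev g e \<in> P \<and> aev g e \<ominus> aev g (PConst 0) \<in> P \<or>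
      aev g (PConst 0) \<ominus> aev g f \<in> P \<and> aev g f \<ominus> aev g (PConst 0) \<in> P"
    if "aev g (PConst 0) \<ominus> aev g (PMul e f) \<in> P" "aev g (PMul e f) \<ominus> aev g (PConst 0) \<in> P"
  proof (rule ccontr)
    have z: "\<zero> \<ominus> x = \<ominus> x" "x \<ominus> \<zero> = x" if "x \<in> carrier A" for x using that by (simp_all add: minus_eq)
    assume "\<not> ?thesis"
    then have neg: "\<ominus> a \<notin> P \<or> a \<notin> P" "\<ominus> b \<notin> P \<or> b \<notin> P"
      unfolding aev_const abc using z cl by auto
    have ab: "\<ominus> (a \<otimes> b) \<in> P" "a \<otimes> b \<in> P"
      using that z cl unfolding aev_const aev.simps(4) abc by auto
    \<comment> \<open>If neither factor is null, one of \<open>a\<close>, \<open>\<ominus> a\<close>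
      and one of \<open>b\<close>, \<open>\<ominus> b\<close> is strictly positive. So is their
      product, which is \<open>a \<otimes> b\<close> up to sign and was assumed to be null.\<close>
    note prime = maximal_preordering_prime[OF MP]
    have m: "(\<ominus> a) \<otimes> b = \<ominus> (a \<otimes> b)" "a \<otimes> (\<ominus> b) = \<ominus> (a \<otimes> b)" "(\<ominus> a) \<otimes> (\<ominus> b) = a \<otimes> b"
      using cl by algebra+
    show False
      using neg prime[of a b] prime[of "\<ominus> a" b] prime[of a "\<ominus> b"] prime[of "\<ominus> a" "\<ominus> b"] ab cl m by auto
  qed
qed

lemma generated_by_pexps:
  assumes "finitely_generated_algebra A"
  obtains g d where "range g \<subseteq> carrier A" "\<And>a. a \<in> carrier A \<Longrightarrow> \<exists>e\<in>pexps d. aev g e = a"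
proof -
  obtain G where G: "finite G" "G \<subseteq> carrier A" "\<Inter>{B. real_subalgebra A B \<and> G \<subseteq> B} = carrier A"
    using assms unfolding finitely_generated_algebra_def by blast
  define d where "d = card G"
  obtain g0 where g0: "bij_betw g0 {0..<d} G"
    using ex_bij_betw_nat_finite[OF G(1)] unfolding d_def by blast
  define g where "g i = (if i < d then g0 i else \<zero>)" for i :: nat
  have im: "g0 i \<in> G" if "i < d" for i using g0 that by (auto simp: bij_betw_def)
  have g: "range g \<subseteq> carrier A" using im G(2) by (auto simp: g_def)
  let ?B = "aev g ` pexps d"
  have "subring ?B A"
  proof (rule subringI)
    show "?B \<subseteq> carrier A" using aev_closed[OF g] by blast
    show "\<one> \<in> ?B" by (rule image_eqI[of _ _ "PConst 1"]) (simp_all add: smult_one)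
    fix x assume "x \<in> ?B"
    then obtain e where e: "e \<in> pexps d" "x = aev g e" by blast
    have "\<ominus> x = aev g (PMul (PConst (- 1)) e)"
      using aev_closed[OF g, of e] by (simp add: e(2) smult_minus smult_one l_minus)
    then show "\<ominus> x \<in> ?B" by (rule image_eqI) (simp add: e(1))
    fix y assume "y \<in> ?B"
    then obtain f where f: "f \<in> pexps d" "y = aev g f" by blast
    show "x \<oplus> y \<in> ?B" by (rule image_eqI[of _ _ "PAdd e f"]) (simp_all add: e f)
    show "x \<otimes> y \<in> ?B" by (rule image_eqI[of _ _ "PMul e f"]) (simp_all add: e f)
  qed
  moreover have "c \<odot> x \<in> ?B" if "x \<in> ?B" for c x
  proof -
    from that obtain e where e: "e \<in> pexps d" "x = aev g e" by blast
    show ?thesis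
      by (rule image_eqI[of _ _ "PMul (PConst c) e"])
        (use aev_closed[OF g, of e] in \<open>simp_all add: e smult_mult(1)\<close>)
  qed
  ultimately have "real_subalgebra A ?B" unfolding real_subalgebra_def by blast
  moreover have "G \<subseteq> ?B"
  proof
    fix x assume "x \<in> G"
    then obtain i where "i < d" "x = g0 i" using g0 by (auto simp: bij_betw_def)
    then show "x \<in> ?B" by (intro image_eqI[of _ _ "PVar i"]) (simp_all add: g_def)
  qed
  ultimately have "carrier A \<subseteq> ?B" using G(3) by blast
  then show thesis using that[OF g, of d] by blast
qed

lemma preordering_Inter:
  assumes "\<And>P. P \<in> \<P> \<Longrightarrow> preordering A P" "\<P> \<noteq> {}"
  shows "preordering A (\<Inter>\<P>)"
proof (rule preorderingI)
  show "\<Inter>\<P> \<subseteq> carrier A" using assms preorderingD(1) by blast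
qed (use assms(1) preorderingD in auto)

lemma finitely_generated_preorderingE:
  assumes "finitely_generated_preordering A T"
  obtains G where "finite G" "G \<subseteq> carrier A" "G \<subseteq> T" "preordering A T"
    "\<And>P. preordering A P \<Longrightarrow> G \<subseteq> P \<Longrightarrow> T \<subseteq> P"
proof -
  obtain G where G: "finite G" "G \<subseteq> carrier A" "T = \<Inter>{P. preordering A P \<and> G \<subseteq> P}"
    using assms unfolding finitely_generated_preordering_def by blast
  have "preordering A (carrier A)" by (rule preorderingI) auto
  then have "preordering A T" unfolding G(3) using G(2) by (intro preordering_Inter) auto
  moreover have "G \<subseteq> T" unfolding G(3) by blast
  moreover have "T \<subseteq> P" if "preordering A P" "G \<subseteq> P" for P unfolding G(3) using that by blast
  ultimately show thesis using that[OF G(1,2)] by blast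
qed

lemma charactersD:
  assumes "x \<in> characters A"
  shows "f \<in> carrier A \<Longrightarrow> g \<in> carrier A \<Longrightarrow> x (f \<oplus> g) = x f + x g"
    "f \<in> carrier A \<Longrightarrow> x (c \<odot> f) = c * x f"
    "f \<in> carrier A \<Longrightarrow> g \<in> carrier A \<Longrightarrow> x (f \<otimes> g) = x f * x g" "x \<one> = 1" "x \<zero> = 0"
    "f \<in> carrier A \<Longrightarrow> x (\<ominus> f) = - x f" "x \<in> extensional (carrier A)"
proof -
  show add: "x (f \<oplus> g) = x f + x g" if "f \<in> carrier A" "g \<in> carrier A" for f g
    using assms that by (auto simp: characters_def linear_functional_def)
  show smult: "x (c \<odot> f) = c * x f" if "f \<in> carrier A" for c f
    using assms that by (auto simp: characters_def linear_functional_def)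
  show zero: "x \<zero> = 0" using add[of \<zero> \<zero>] by simp
  show "x (\<ominus> f) = - x f" if "f \<in> carrier A" using smult[OF that, of "-1"] that
    by (simp add: smult_minus smult_one)
qed (use assms in \<open>auto simp: characters_def\<close>)

lemma nonneg_set_generators:
  assumes "\<And>P. preordering A P \<Longrightarrow> G \<subseteq> P \<Longrightarrow> T \<subseteq> P" "G \<subseteq> carrier A"
    "x \<in> characters A" "\<And>t. t \<in> G \<Longrightarrow> 0 \<le> x t"
  shows "x \<in> nonneg_set A T"
proof -
  have "preordering A {f \<in> carrier A. 0 \<le> x f}"
    by (rule preorderingI) (auto simp: charactersD[OF assms(3)])
  then have "T \<subseteq> {f \<in> carrier A. 0 \<le> x f}" using assms by blast
  then show ?thesis using assms(3) by (auto simp: nonneg_set_def)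
qed

text \<open>If -1 is not in \<open>T\<close>, a maximal preorder above \<open>T\<close> orders the
  expressions. Two finite families of signs are realized at a real point: the generators of
  \<open>T\<close> are nonnegative, and a finite set that defines all relations of \<open>A\<close>
  vanishes. Evaluation at this point is then well defined on \<open>A\<close>, which makes it a
  character in K(T).\<close>

theorem positivstellensatz:
  assumes fg: "finitely_generated_algebra A" "finitely_generated_preordering A T"
    and empty: "nonneg_set A T = {}"
  shows "\<ominus> \<one> \<in> T"
proof (rule ccontr)
  assume "\<ominus> \<one> \<notin> T"
  obtain G where G: "finite G" "G \<subseteq> carrier A" "G \<subseteq> T" "preordering A T"
    "\<And>P. preordering A P \<Longrightarrow> G \<subseteq> P \<Longrightarrow> T \<subseteq> P"
    using finitely_generated_preorderingE[OF fg(2)] by metis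
  obtain g d where g: "range g \<subseteq> carrier A" and surj: "\<And>a. a \<in> carrier A \<Longrightarrow> \<exists>e\<in>pexps d. aev g e = a"
    using generated_by_pexps[OF fg(1)] by metis
  obtain P where P: "T \<subseteq> P" "maximal_preordering P"
    using maximal_preordering_exists[OF G(4) \<open>\<ominus> \<one> \<notin> T\<close>] by blast
  define lq where "lq e f \<longleftrightarrow> aev g f \<ominus> aev g e \<in> P" for e f
  have "realizable lq"
    unfolding lq_def by (rule pexp_order_realizable[OF pexp_order_maximal_preordering[OF P(2) g]])
  note cl = aev_closed[OF g]
  define I where "I = {e \<in> pexps d. aev g e = \<zero>}"
  have "\<exists>I0\<subseteq>I. finite I0 \<and> (\<forall>b. (\<forall>e\<in>I0. reval b e = 0) \<longrightarrow> (\<forall>e\<in>I. reval b e = 0))"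
    by (rule finite_defining_subset[of _ d]) (auto simp: I_def smult_0 cl)
  then obtain I0 where I0: "I0 \<subseteq> I" "finite I0" "\<And>b. (\<forall>e\<in>I0. reval b e = 0) \<Longrightarrow> (\<forall>e\<in>I. reval b e = 0)"
    by blast
  obtain s where s: "\<And>t. t \<in> G \<Longrightarrow> s t \<in> pexps d \<and> aev g (s t) = t"
    using surj G(2) by (metis subsetD)
  obtain b where b: "\<And>e. e \<in> I0 \<union> s ` G \<Longrightarrow> (lq (PConst 0) e \<longleftrightarrow> 0 \<le> reval b e) \<and> (lq e (PConst 0) \<longleftrightarrow> reval b e \<le> 0)"
    using \<open>realizable lq\<close> I0(2) G(1) unfolding realizable_def by (metis finite_UnI finite_imageI)
  have zP: "\<zero> \<in> P" by (rule preorderingD(6)[OF maximal_preorderingD(1)[OF P(2)]])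
  have "reval b e = 0" if "e \<in> I0" for e
  proof -
    have "aev g e = \<zero>" using that I0(1) by (auto simp: I_def)
    then have "lq (PConst 0) e" "lq e (PConst 0)" unfolding lq_def aev_const using zP by (simp_all add: minus_eq)
    then show ?thesis using b[of e] that by auto
  qed
  then have vanish: "reval b e = 0" if "e \<in> pexps d" "aev g e = \<zero>" for e
    using I0(3)[of b] that by (auto simp: I_def)
  have welldef: "reval b e = reval b f" if ef: "e \<in> pexps d" "f \<in> pexps d" "aev g e = aev g f" for e f
  proof -
    have "reval b (PAdd e (PMul (PConst (- 1)) f)) = 0"
      by (rule vanish) (use ef cl[of f] in \<open>simp_all add: smult_minus smult_one l_minus r_neg\<close>)
    then show ?thesis by simp
  qed
  define x where "x = restrict (\<lambda>a. reval b (SOME e. e \<in> pexps d \<and> aev g e = a)) (carrier A)"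
  have x: "x (aev g e) = reval b e" if "e \<in> pexps d" for e
  proof -
    let ?f = "SOME f. f \<in> pexps d \<and> aev g f = aev g e"
    have "?f \<in> pexps d \<and> aev g ?f = aev g e" by (rule someI[of _ e]) (simp add: that)
    then have "reval b ?f = reval b e" by (intro welldef that) simp_all
    then show ?thesis using cl by (simp add: x_def)
  qed
  have "x \<in> characters A"
    unfolding characters_def linear_functional_def
  proof (intro CollectI conjI ballI allI)
    show "x \<in> extensional (carrier A)" by (simp add: x_def)
    show "x \<one> = 1" using x[of "PConst 1"] by (simp add: smult_one)
    fix u assume u: "u \<in> carrier A"
    then obtain e where e: "e \<in> pexps d" "aev g e = u" using surj by blast
    show "x (c \<odot> u) = c * x u" for c
      using x[of "PMul (PConst c) e"] x[OF e(1)] e u by (simp add: smult_mult(1))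
    fix v assume v: "v \<in> carrier A"
    then obtain f where f: "f \<in> pexps d" "aev g f = v" using surj by blast
    show "x (u \<oplus> v) = x u + x v" "x (u \<otimes> v) = x u * x v"
      using x[of "PAdd e f"] x[of "PMul e f"] x[OF e(1)] x[OF f(1)] e f by simp_all
  qed
  moreover have "0 \<le> x t" if "t \<in> G" for t
  proof -
    have "lq (PConst 0) (s t)"
    proof -
      have "t \<in> P" "t \<in> carrier A" using that G(2,3) P(1) by auto
      then show ?thesis unfolding lq_def aev_const using s[OF that] by (simp add: minus_eq)
    qed
    then show ?thesis using b[of "s t"] that s[OF that] x[of "s t"] by simp
  qed
  ultimately have "x \<in> nonneg_set A T" by (intro nonneg_set_generators[OF G(5,2)]) auto
  then show False using empty by blast
qed

end

section \<open>Extension of positive functionals\<close>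

definition function_space :: "('i \<Rightarrow> real) set \<Rightarrow> bool" where
  "function_space D \<longleftrightarrow> (\<lambda>_. 0) \<in> D \<and> (\<forall>f\<in>D. \<forall>g\<in>D. (\<lambda>x. f x + g x) \<in> D) \<and> (\<forall>c. \<forall>f\<in>D. (\<lambda>x. c * f x) \<in> D)"

text \<open>Homogeneity is required as an inequality, which is easily checked for infima; scaling
  back by the inverse turns it into an equality.\<close>

definition sublinear_on :: "('i \<Rightarrow> real) set \<Rightarrow> (('i \<Rightarrow> real) \<Rightarrow> real) \<Rightarrow> bool" where
  "sublinear_on D p \<longleftrightarrow> (\<forall>f\<in>D. \<forall>g\<in>D. p (\<lambda>x. f x + g x) \<le> p f + p g) \<and>
     (\<forall>c\<ge>0. \<forall>f\<in>D. p (\<lambda>x. c * f x) \<le> c * p f)"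

context
  fixes D :: "('i \<Rightarrow> real) set"
  assumes D: "function_space D"
begin

lemma function_spaceD:
  "(\<lambda>_. 0) \<in> D" "f \<in> D \<Longrightarrow> g \<in> D \<Longrightarrow> (\<lambda>x. f x + g x) \<in> D" "f \<in> D \<Longrightarrow> (\<lambda>x. c * f x) \<in> D"
  "f \<in> D \<Longrightarrow> (\<lambda>x. - f x) \<in> D"
proof -
  show "f \<in> D \<Longrightarrow> (\<lambda>x. c * f x) \<in> D" for c using D by (auto simp: function_space_def)
  from this[of "-1"] show "f \<in> D \<Longrightarrow> (\<lambda>x. - f x) \<in> D" by simp
qed (use D in \<open>auto simp: function_space_def\<close>)

lemma sublinear_onD:
  assumes "sublinear_on D p"
  shows "f \<in> D \<Longrightarrow> g \<in> D \<Longrightarrow> p (\<lambda>x. f x + g x) \<le> p f + p g"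
    "0 \<le> c \<Longrightarrow> f \<in> D \<Longrightarrow> p (\<lambda>x. c * f x) = c * p f" "p (\<lambda>_. 0) = 0"
    "f \<in> D \<Longrightarrow> - p (\<lambda>x. - f x) \<le> p f"
proof -
  show add: "f \<in> D \<Longrightarrow> g \<in> D \<Longrightarrow> p (\<lambda>x. f x + g x) \<le> p f + p g" for f g
    using assms by (auto simp: sublinear_on_def)
  have le: "0 \<le> c \<Longrightarrow> f \<in> D \<Longrightarrow> p (\<lambda>x. c * f x) \<le> c * p f" for c f
    using assms by (auto simp: sublinear_on_def)
  show zero: "p (\<lambda>_. 0) = 0"
    using le[of 0 "\<lambda>_. 0"] add[of "\<lambda>_. 0" "\<lambda>_. 0"] function_spaceD(1) by simp
  show "p (\<lambda>x. c * f x) = c * p f" if "0 \<le> c" "f \<in> D"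
  proof (cases "c = 0")
    case False
    then have "p (\<lambda>x. inverse c * (c * f x)) \<le> inverse c * p (\<lambda>x. c * f x)"
      using that function_spaceD(3) by (intro le) auto
    then have "c * p f \<le> p (\<lambda>x. c * f x)"
      using False that(1) by (simp add: field_simps mult.assoc[symmetric])
    then show ?thesis using le[OF that] by simp
  qed (simp add: zero)
  show "- p (\<lambda>x. - f x) \<le> p f" if "f \<in> D"
    using add[OF that function_spaceD(4)[OF that]] zero by simp
qed

text \<open>By Zorn's lemma: the infimum of a chain exists because every member is bounded below at
  f by -p(-f), and it is subadditive because two members of a chain can be replaced by the smaller
  one. Values off \<open>D\<close> are normalized to 0, so that a comparison on \<open>D\<close> is
  one everywhere.\<close>

lemma minimal_sublinear_exists:
  assumes p: "sublinear_on D p"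
  shows "\<exists>q. sublinear_on D q \<and> (\<forall>f\<in>D. q f \<le> p f) \<and>
    (\<forall>q'. sublinear_on D q' \<and> (\<forall>f\<in>D. q' f \<le> q f) \<longrightarrow> (\<forall>f\<in>D. q' f = q f))"
proof -
  define S where "S = {q. sublinear_on D q \<and> (\<forall>f\<in>D. q f \<le> p f) \<and> (\<forall>f. f \<notin> D \<longrightarrow> q f = 0)}"
  \<comment> \<open>The order is reversed, since Zorn's lemma yields maximal elements.\<close>
  define below where "below = (\<lambda>q q' :: ('i \<Rightarrow> real) \<Rightarrow> real. \<forall>f. q' f \<le> q f)"
  have restr: "(\<lambda>f. if f \<in> D then q f else 0) \<in> S" if "sublinear_on D q" "\<And>f. f \<in> D \<Longrightarrow> q f \<le> p f" for q
    using that function_spaceD unfolding S_def sublinear_on_def by auto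
  have "\<exists>m\<in>S. \<forall>a\<in>S. below m a \<longrightarrow> a = m"
  proof (rule predicate_Zorn)
    show "partial_order_on S (relation_of below S)"
      by (rule partial_order_on_relation_ofI) (auto simp: below_def fun_eq_iff intro: order.trans order.antisym)
    fix C assume C: "C \<in> Chains (relation_of below S)"
    have CS: "C \<subseteq> S" using C Chains_relation_of by blast
    have chain: "below q q' \<or> below q' q" if "q \<in> C" "q' \<in> C" for q q'
      using C that unfolding Chains_def relation_of_def by auto
    show "\<exists>u\<in>S. \<forall>a\<in>C. below a u"
    proof (cases "C = {}")
      case True
      then show ?thesis using restr[OF p] by auto
    next
      case False
      define u where "u f = (INF q\<in>C. q f)" for f
      have sub: "sublinear_on D q" "\<And>f. f \<in> D \<Longrightarrow> q f \<le> p f" "\<And>f. f \<notin> D \<Longrightarrow> q f = 0" if "q \<in> C" for q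
        using that CS by (auto simp: S_def)
      have bdd: "bdd_below ((\<lambda>q. q f) ` C)" for f
      proof (cases "f \<in> D")
        case True
        have "- p (\<lambda>x. - f x) \<le> q f" if "q \<in> C" for q
          using sublinear_onD(4)[OF sub(1)[OF that] True] sub(2)[OF that function_spaceD(4)[OF True]] by linarith
        then show ?thesis by (intro bdd_belowI2)
      next
        case False
        then have "0 \<le> q f" if "q \<in> C" for q using sub(3)[OF that] by simp
        then show ?thesis by (intro bdd_belowI2)
      qed
      have le: "u f \<le> q f" if "q \<in> C" for q f
        unfolding u_def by (rule cINF_lower[OF bdd that])
      have ge: "c \<le> u f" if "\<And>q. q \<in> C \<Longrightarrow> c \<le> q f" for c f
        unfolding u_def by (rule cINF_greatest[OF False that])
      have "u (\<lambda>x. f x + g x) \<le> u f + u g" if fg: "f \<in> D" "g \<in> D" for f g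
      proof -
        have *: "u (\<lambda>x. f x + g x) \<le> q1 f + q2 g" if q: "q1 \<in> C" "q2 \<in> C" for q1 q2
        proof -
          obtain q where q': "q \<in> C" "q f \<le> q1 f" "q g \<le> q2 g"
            using chain[OF q] q unfolding below_def by (metis order.refl)
          then show ?thesis using le[OF q'(1)] sublinear_onD(1)[OF sub(1)[OF q'(1)] fg] by (smt (verit))
        qed
        have "u (\<lambda>x. f x + g x) - q1 f \<le> u g" if "q1 \<in> C" for q1
          using *[OF that] by (intro ge) (smt (verit))
        then have "u (\<lambda>x. f x + g x) - u g \<le> u f" by (intro ge) (smt (verit))
        then show ?thesis by simp
      qed
      moreover have "u (\<lambda>x. c * f x) \<le> c * u f" if c: "c \<ge> 0" "f \<in> D" for c f
      proof (cases "c = 0")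
        case True
        obtain q where q: "q \<in> C" using False by blast
        show ?thesis using True le[OF q, of "\<lambda>_. 0"] sublinear_onD(3)[OF sub(1)[OF q]] by simp
      next
        case False
        have "u (\<lambda>x. c * f x) / c \<le> u f"
        proof (rule ge)
          fix q assume q: "q \<in> C"
          have "u (\<lambda>x. c * f x) \<le> c * q f"
            using le[OF q, of "\<lambda>x. c * f x"] sublinear_onD(2)[OF sub(1)[OF q] c] by simp
          then show "u (\<lambda>x. c * f x) / c \<le> q f" using False c(1) by (simp add: pos_divide_le_eq mult.commute)
        qed
        then show ?thesis using False c(1) by (simp add: pos_divide_le_eq mult.commute)
      qed
      ultimately have "sublinear_on D u" by (auto simp: sublinear_on_def)
      moreover obtain q0 where q0: "q0 \<in> C" using False by blast
      have "u f \<le> p f" if "f \<in> D" for f using le[OF q0, of f] sub(2)[OF q0 that] by simp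
      moreover have "u f = 0" if "f \<notin> D" for f
        using le[OF q0, of f] ge[of 0 f] sub(3)[OF _ that] q0 by force
      ultimately have "u \<in> S" by (auto simp: S_def)
      then show ?thesis using le by (auto simp: below_def)
    qed
  qed
  then obtain m where m: "m \<in> S" "\<And>a. a \<in> S \<Longrightarrow> below m a \<Longrightarrow> a = m" by blast
  have "\<forall>f\<in>D. q' f = m f" if q': "sublinear_on D q'" "\<forall>f\<in>D. q' f \<le> m f" for q'
  proof -
    have eq: "(\<lambda>f. if f \<in> D then q' f else 0) = m"
    proof (rule m(2))
      show "(\<lambda>f. if f \<in> D then q' f else 0) \<in> S"
        using m(1) q' by (intro restr) (auto simp: S_def intro: order.trans)
      show "below m (\<lambda>f. if f \<in> D then q' f else 0)"
        using m(1) q' by (auto simp: S_def below_def)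
    qed
    have "q' f = m f" if "f \<in> D" for f using fun_cong[OF eq, of f] that by simp
    then show ?thesis by blast
  qed
  then show ?thesis using m(1) by (intro exI[of _ m]) (auto simp: S_def)
qed

text \<open>The infimum over t \<ge> 0 of q(f + t y) - t q(y) is again sublinear in f and at most
  q(f), hence equal to q(f) by minimality. The term with t = 1 gives the inequality.\<close>

lemma minimal_sublinear_superadditive:
  assumes q: "sublinear_on D q"
    and mn: "\<forall>q'. sublinear_on D q' \<and> (\<forall>f\<in>D. q' f \<le> q f) \<longrightarrow> (\<forall>f\<in>D. q' f = q f)"
    and fy: "f \<in> D" "y \<in> D"
  shows "q f + q y \<le> q (\<lambda>x. f x + y x)"
proof -
  note Q = sublinear_onD[OF q]
  define r where "r f = (INF t\<in>{0..}. q (\<lambda>x. f x + t * y x) - t * q y)" for f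
  have bdd: "bdd_below ((\<lambda>t. q (\<lambda>x. f x + t * y x) - t * q y) ` {0..})" if f: "f \<in> D" for f
  proof (rule bdd_belowI2)
    fix t :: real assume t: "t \<in> {0..}"
    have "q (\<lambda>x. (f x + t * y x) + - f x) \<le> q (\<lambda>x. f x + t * y x) + q (\<lambda>x. - f x)"
      using f fy(2) by (intro Q(1) function_spaceD)
    moreover have "(\<lambda>x. (f x + t * y x) + - f x) = (\<lambda>x. t * y x)" by auto
    ultimately show "- q (\<lambda>x. - f x) \<le> q (\<lambda>x. f x + t * y x) - t * q y"
      using Q(2)[of t y] t fy(2) by simp
  qed
  have le: "r f \<le> q (\<lambda>x. f x + t * y x) - t * q y" if "f \<in> D" "t \<ge> 0" for f t
    unfolding r_def using that by (intro cINF_lower bdd) auto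
  have ge: "c \<le> r f" if "\<And>t. t \<ge> 0 \<Longrightarrow> c \<le> q (\<lambda>x. f x + t * y x) - t * q y" for c f
    unfolding r_def using that by (intro cINF_greatest) auto
  have "r (\<lambda>x. f x + g x) \<le> r f + r g" if fg: "f \<in> D" "g \<in> D" for f g
  proof -
    have *: "r (\<lambda>x. f x + g x) \<le> (q (\<lambda>x. f x + s * y x) - s * q y) + (q (\<lambda>x. g x + t * y x) - t * q y)"
      if st: "s \<ge> 0" "t \<ge> 0" for s t
    proof -
      have "r (\<lambda>x. f x + g x) \<le> q (\<lambda>x. f x + g x + (s + t) * y x) - (s + t) * q y"
        using fg st by (intro le function_spaceD) auto
      moreover have "q (\<lambda>x. (f x + s * y x) + (g x + t * y x)) \<le> q (\<lambda>x. f x + s * y x) + q (\<lambda>x. g x + t * y x)"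
        using fg fy(2) by (intro Q(1) function_spaceD)
      moreover have "(\<lambda>x. (f x + s * y x) + (g x + t * y x)) = (\<lambda>x. f x + g x + (s + t) * y x)"
        by (auto simp: algebra_simps)
      ultimately show ?thesis by (simp add: algebra_simps)
    qed
    have "r (\<lambda>x. f x + g x) - (q (\<lambda>x. f x + s * y x) - s * q y) \<le> r g" if "s \<ge> 0" for s
      using *[OF that] by (intro ge) (smt (verit))
    then have "r (\<lambda>x. f x + g x) - r g \<le> r f" by (intro ge) (smt (verit))
    then show ?thesis by simp
  qed
  moreover have "r (\<lambda>x. c * f x) \<le> c * r f" if c: "c \<ge> 0" "f \<in> D" for c f
  proof (cases "c = 0")
    case True
    have "r (\<lambda>_. 0) \<le> 0" using le[OF function_spaceD(1), of 0] Q(3) by simp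
    then show ?thesis using True by simp
  next
    case False
    have "r (\<lambda>x. c * f x) / c \<le> r f"
    proof (rule ge)
      fix t :: real assume t: "t \<ge> 0"
      have "r (\<lambda>x. c * f x) \<le> q (\<lambda>x. c * f x + (c * t) * y x) - (c * t) * q y"
        using c t by (intro le function_spaceD) auto
      also have "(\<lambda>x. c * f x + (c * t) * y x) = (\<lambda>x. c * (f x + t * y x))"
        by (auto simp: algebra_simps)
      also have "q (\<lambda>x. c * (f x + t * y x)) = c * q (\<lambda>x. f x + t * y x)"
        using c fy(2) by (intro Q(2) function_spaceD)
      finally have "r (\<lambda>x. c * f x) \<le> c * (q (\<lambda>x. f x + t * y x) - t * q y)"
        by (simp only: right_diff_distrib mult.assoc)
      then show "r (\<lambda>x. c * f x) / c \<le> q (\<lambda>x. f x + t * y x) - t * q y"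
        using False c(1) by (simp add: pos_divide_le_eq mult.commute)
    qed
    then show ?thesis using False c(1) by (simp add: pos_divide_le_eq mult.commute)
  qed
  ultimately have "sublinear_on D r" by (auto simp: sublinear_on_def)
  moreover have "r f \<le> q f" if "f \<in> D" for f using le[OF that, of 0] by simp
  ultimately have "\<forall>f\<in>D. r f = q f" using mn by simp
  then have "r f = q f" using fy(1) by blast
  then show ?thesis using le[OF fy(1), of 1] by simp
qed

text \<open>The Hahn-Banach theorem for a vector space of functions given as a set: a minimal
  sublinear functional is additive and therefore linear.\<close>

theorem linear_functional_below_sublinear:
  assumes p: "sublinear_on D p"
  obtains q where "\<And>f. f \<in> D \<Longrightarrow> q f \<le> p f"
    "\<And>f g. f \<in> D \<Longrightarrow> g \<in> D \<Longrightarrow> q (\<lambda>x. f x + g x) = q f + q g"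
    "\<And>c f. f \<in> D \<Longrightarrow> q (\<lambda>x. c * f x) = c * q f"
proof -
  obtain q where q: "sublinear_on D q" "\<forall>f\<in>D. q f \<le> p f"
    "\<forall>q'. sublinear_on D q' \<and> (\<forall>f\<in>D. q' f \<le> q f) \<longrightarrow> (\<forall>f\<in>D. q' f = q f)"
    using minimal_sublinear_exists[OF p] by blast
  note Q = sublinear_onD[OF q(1)]
  have add: "q (\<lambda>x. f x + g x) = q f + q g" if "f \<in> D" "g \<in> D" for f g
  proof (rule antisym)
    show "q f + q g \<le> q (\<lambda>x. f x + g x)"
      by (rule minimal_sublinear_superadditive[OF q(1) q(3) that])
  qed (rule Q(1)[OF that])
  have "q (\<lambda>x. c * f x) = c * q f" if f: "f \<in> D" for c f
  proof (cases "c \<ge> 0")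
    case False
    have "q (\<lambda>x. (- c) * f x) = - c * q f" using False f by (intro Q(2)) auto
    moreover have "q (\<lambda>x. c * f x + (- c) * f x) = q (\<lambda>x. c * f x) + q (\<lambda>x. (- c) * f x)"
      using f by (intro add function_spaceD)
    ultimately show ?thesis using Q(3) by simp
  qed (use Q(2) f in auto)
  then show thesis by (intro that[of q]) (use q(2) add in auto)
qed

end

section \<open>Measures on the Cantor space\<close>

lemma compact_UNIV_bool_fun: "compact (UNIV :: ('j \<Rightarrow> bool) set)"
proof -
  have "compact_space (euclidean :: bool topology)"
    by (simp add: compact_space_def finite_imp_compact)
  then have "compact_space (product_topology (\<lambda>_. euclidean :: bool topology) (UNIV :: 'j set))"
    by (simp add: compact_space_product_topology)
  then show ?thesis unfolding euclidean_product_topology by (simp add: compact_space_def)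
qed

lemma clopen_finite_coordinates:
  fixes S :: "('j \<Rightarrow> bool) set"
  assumes J: "finite J" and dep: "\<And>u v. (\<forall>j\<in>J. u j = v j) \<Longrightarrow> u \<in> S \<Longrightarrow> v \<in> S"
  shows "open S" "closed S"
proof -
  have op: "open T" if depT: "\<And>u v. (\<forall>j\<in>J. u j = v j) \<Longrightarrow> u \<in> T \<Longrightarrow> v \<in> T" for T :: "('j \<Rightarrow> bool) set"
  proof (subst open_subopen, intro ballI)
    fix u assume u: "u \<in> T"
    let ?B = "\<Inter>j\<in>J. (\<lambda>v. v j) -` {u j}"
    have "open ?B" using J
      by (intro open_INT ballI open_vimage open_discrete) auto
    moreover have "?B \<subseteq> T" using depT[OF _ u] by auto
    ultimately show "\<exists>B. open B \<and> u \<in> B \<and> B \<subseteq> T" by (intro exI[of _ ?B]) auto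
  qed
  show "open S" by (rule op[OF dep])
  have "open (- S)"
  proof (rule op)
    fix u v assume uv: "\<forall>j\<in>J. u j = v j" "u \<in> - S"
    show "v \<in> - S"
    proof
      assume "v \<in> S"
      then have "u \<in> S" using dep[of v u] uv(1) by simp
      then show False using uv(2) by simp
    qed
  qed
  then show "closed S" by (simp add: closed_def)
qed

text \<open>Caratheodory's theorem asks for continuity at the empty set. By compactness a decreasing
  sequence of clopen sets with empty intersection is eventually empty, so finite additivity is
  enough.\<close>

theorem finitely_additive_clopen_extension:
  fixes m :: "('j \<Rightarrow> bool) set \<Rightarrow> real"
  assumes nonneg: "\<And>S. 0 \<le> m S"
    and add: "\<And>S T. S \<inter> T = {} \<Longrightarrow> m (S \<union> T) = m S + m T"
  obtains N where "space N = UNIV" "\<And>S. open S \<Longrightarrow> closed S \<Longrightarrow> S \<in> sets N"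
    "\<And>S. open S \<Longrightarrow> closed S \<Longrightarrow> emeasure N S = ennreal (m S)"
proof -
  let ?G = "{S :: ('j \<Rightarrow> bool) set. open S \<and> closed S}"
  have m0: "m {} = 0" using add[of "{}" "{}"] by simp
  interpret ring_of_sets UNIV ?G
    by (rule ring_of_setsI) (auto intro: open_Diff closed_Diff)
  have "\<exists>\<mu>. (\<forall>S\<in>?G. \<mu> S = ennreal (m S)) \<and> measure_space UNIV (sigma_sets UNIV ?G) \<mu>"
  proof (rule caratheodory_empty_continuous)
    show "positive ?G (\<lambda>S. ennreal (m S))" by (simp add: positive_def m0)
    show "additive ?G (\<lambda>S. ennreal (m S))"
      unfolding additive_def
    proof (intro ballI impI)
      fix S T :: "('j \<Rightarrow> bool) set" assume "S \<inter> T = {}"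
      then show "ennreal (m (S \<union> T)) = ennreal (m S) + ennreal (m T)"
        using add[of S T] nonneg by (simp add: ennreal_plus)
    qed
    fix B :: "nat \<Rightarrow> ('j \<Rightarrow> bool) set"
    assume B: "range B \<subseteq> ?G" "decseq B" "(\<Inter>i. B i) = {}"
    have "\<exists>n. B n = {}"
    proof (rule ccontr)
      assume ne: "\<nexists>n. B n = {}"
      have "UNIV \<inter> (\<Inter>n\<in>UNIV. B n) \<noteq> {}"
      proof (rule compact_imp_fip_image[OF compact_UNIV_bool_fun])
        show "closed (B n)" for n using B(1) by auto
        fix I :: "nat set" assume "finite I"
        then have "B (Max (insert 0 I)) \<subseteq> B i" if "i \<in> I" for i
          using that by (intro decseqD[OF B(2)] Max_ge) auto
        then have "B (Max (insert 0 I)) \<subseteq> (\<Inter>i\<in>I. B i)" by blast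
        then show "UNIV \<inter> (\<Inter>i\<in>I. B i) \<noteq> {}" using ne by blast
      qed
      then show False using B(3) by simp
    qed
    then obtain n where n: "B n = {}" by blast
    have "eventually (\<lambda>i. ennreal (m (B i)) = 0) sequentially"
    proof (rule eventually_sequentiallyI[of n])
      fix i assume "n \<le> i"
      then have "B i = {}" using B(2) n unfolding decseq_def by blast
      then show "ennreal (m (B i)) = 0" by (simp add: m0)
    qed
    then show "(\<lambda>i. ennreal (m (B i))) \<longlonglongrightarrow> 0" by (rule tendsto_eventually)
  qed simp
  then obtain \<mu> where \<mu>: "\<And>S. S \<in> ?G \<Longrightarrow> \<mu> S = ennreal (m S)" "measure_space UNIV (sigma_sets UNIV ?G) \<mu>"
    by blast
  let ?N = "measure_of UNIV ?G \<mu>"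
  have sets: "sets ?N = sigma_sets UNIV ?G" by (simp add: sets_measure_of)
  show thesis
  proof (rule that[of ?N])
    show "space ?N = UNIV" by (simp add: space_measure_of)
    fix S :: "('j \<Rightarrow> bool) set" assume S: "open S" "closed S"
    then show mem: "S \<in> sets ?N" unfolding sets by (intro sigma_sets.Basic) simp
    have "emeasure ?N S = \<mu> S"
      by (rule emeasure_measure_of[OF refl]) (use \<mu>(2) mem sets in \<open>auto simp: measure_space_def\<close>)
    then show "emeasure ?N S = ennreal (m S)" using \<mu>(1) S by simp
  qed
qed

text \<open>
  The staircase with steps at the fractions \<open>j/n\<close>, cut off at \<open>n\<close>, as a function of the truth values of
  \<open>y > j/n\<close>; at \<open>y = j/n\<close> either truth value is allowed.
\<close>

lemma staircase_error:
  fixes y :: real and n :: nat and above :: "int \<Rightarrow> bool"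
  assumes n: "n > 0" and above: "\<And>j. y > real_of_int j / n \<Longrightarrow> above j" "\<And>j. above j \<Longrightarrow> y \<ge> real_of_int j / n"
  defines "s \<equiv> (real (card {j \<in> {- (int n)\<^sup>2..<(int n)\<^sup>2}. above j}) - (real n)\<^sup>2) / n"
  shows "\<bar>s - y\<bar> \<le> (1 + y\<^sup>2) / n" "s\<^sup>2 \<le> 2 * y\<^sup>2 + 2"
proof -
  let ?M = "(int n)\<^sup>2" let ?J = "{j \<in> {- ?M..<?M}. above j}"
  have fin: "finite ?J" by (rule finite_subset[of _ "{- ?M..<?M}"]) auto
  have n0: "real n > 0" using n by simp
  have M: "real_of_int ?M = real n * real n" by (simp add: power2_eq_square)
  have s: "s = (real (card ?J) - real n * real n) / n" by (simp add: s_def power2_eq_square)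
  consider "\<bar>y\<bar> \<le> n" | "y > n" | "y < - real n" by linarith
  then have "\<bar>s - y\<bar> \<le> (1 + y\<^sup>2) / n \<and> \<bar>s\<bar> \<le> \<bar>y\<bar> + 1"
  proof cases
    case 1
    then have ny: "- (real n * real n) \<le> n * y" "n * y \<le> real n * real n"
      using n0 mult_left_mono[of "- real n" y n] mult_left_mono[of y "real n" n] by auto
    \<comment> \<open>All j below n y are counted and none above. With n^2 indices below 0, the
      count lies between n y + n^2 and n y + n^2 + 1.\<close>
    have "{- ?M..<\<lceil>n * y\<rceil>} \<subseteq> ?J"
    proof
      fix j assume j: "j \<in> {- ?M..<\<lceil>n * y\<rceil>}"
      then have jn: "real_of_int j < n * y" by (simp add: less_ceiling_iff)
      then have "real_of_int j / n < y" using n0 by (simp add: pos_divide_less_eq mult.commute)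
      moreover have "real_of_int j < real_of_int ?M" using jn ny(2) unfolding M by linarith
      then have "j < ?M" by (simp only: of_int_less_iff)
      ultimately show "j \<in> ?J" using j above(1) by auto
    qed
    then have "card {- ?M..<\<lceil>n * y\<rceil>} \<le> card ?J" by (intro card_mono fin)
    then have "\<lceil>n * y\<rceil> + ?M \<le> int (card ?J)" by simp
    then have "real_of_int (\<lceil>n * y\<rceil> + ?M) \<le> real_of_int (int (card ?J))" by (simp only: of_int_le_iff)
    then have lower: "n * y + real n * real n \<le> card ?J"
      using le_of_int_ceiling[of "n * y"] unfolding of_int_add M of_int_of_nat_eq by linarith
    have "?J \<subseteq> {- ?M..\<lfloor>n * y\<rfloor>}"
    proof
      fix j assume j: "j \<in> ?J"
      then have "real_of_int j / n \<le> y" using above(2) by auto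
      then have "real_of_int j \<le> n * y" using n0 by (simp add: pos_divide_le_eq mult.commute)
      then show "j \<in> {- ?M..\<lfloor>n * y\<rfloor>}" using j by (simp add: le_floor_iff)
    qed
    then have "card ?J \<le> card {- ?M..\<lfloor>n * y\<rfloor>}" by (intro card_mono) auto
    moreover have "- ?M \<le> \<lfloor>n * y\<rfloor>" using ny(1) M by (simp only: le_floor_iff of_int_minus)
    ultimately have "int (card ?J) \<le> \<lfloor>n * y\<rfloor> + ?M + 1" by simp
    then have "real_of_int (int (card ?J)) \<le> real_of_int (\<lfloor>n * y\<rfloor> + ?M + 1)" by (simp only: of_int_le_iff)
    then have upper: "card ?J \<le> n * y + real n * real n + 1"
      using of_int_floor_le[of "n * y"] unfolding of_int_add M of_int_of_nat_eq of_int_1 by linarith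
    have "y \<le> s" "s \<le> y + 1 / n"
      using lower upper n0 unfolding s by (auto simp: pos_le_divide_eq pos_divide_le_eq algebra_simps)
    moreover have "1 / n \<le> (1 + y\<^sup>2) / n" "1 / real n \<le> 1" using n by (auto simp: divide_right_mono)
    ultimately show ?thesis by linarith
  next
    case 2
    have "above j" if "j \<in> {- ?M..<?M}" for j
    proof -
      have "real_of_int j \<le> real_of_int ?M" using that by (simp only: of_int_le_iff) simp
      then have "real_of_int j / n \<le> n" unfolding M using n0 by (simp add: pos_divide_le_eq)
      then show ?thesis using 2 by (intro above(1)) linarith
    qed
    then have "?J = {- ?M..<?M}" by auto
    then have "real (card ?J) = 2 * (real n * real n)" by (simp add: power2_eq_square nat_mult_distrib)
    then have "s = n" using n0 unfolding s by simp
    \<comment> \<open>Beyond the last step the error is at most y, and n < y gives y \<le> y^2 /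
      n.\<close>
    moreover have "y * n \<le> y * y" using 2 n0 by (intro mult_left_mono) auto
    then have "y \<le> (1 + y\<^sup>2) / n" using n0 by (simp add: pos_le_divide_eq power2_eq_square)
    ultimately show ?thesis using 2 n0 by auto
  next
    case 3
    have "\<not> above j" if j: "j \<in> {- ?M..<?M}" for j
    proof
      assume "above j"
      then have "real_of_int j / n \<le> y" by (rule above(2))
      then have "real_of_int j / n < - real n" using 3 by linarith
      then have "real_of_int j < real_of_int (- ?M)" unfolding of_int_minus M using n0 by (simp add: pos_divide_less_eq)
      then show False using j by (simp only: of_int_less_iff) simp
    qed
    then have "?J = {}" by auto
    then have "real (card ?J) = 0" by (simp only: card.empty of_nat_0)
    then have "s = - real n" using n0 unfolding s by (simp only:) simp
    moreover have "(- y) * n \<le> (- y) * (- y)" using 3 n0 by (intro mult_left_mono) auto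
    then have "- y \<le> (1 + y\<^sup>2) / n" using n0 by (simp add: pos_le_divide_eq power2_eq_square)
    ultimately show ?thesis using 3 n0 by auto
  qed
  then show "\<bar>s - y\<bar> \<le> (1 + y\<^sup>2) / n" and "s\<^sup>2 \<le> 2 * y\<^sup>2 + 2"
  proof -
    assume *: "\<bar>s - y\<bar> \<le> (1 + y\<^sup>2) / n \<and> \<bar>s\<bar> \<le> \<bar>y\<bar> + 1"
    then show "\<bar>s - y\<bar> \<le> (1 + y\<^sup>2) / n" by blast
    have "s\<^sup>2 \<le> (\<bar>y\<bar> + 1)\<^sup>2" using * by (simp add: abs_le_square_iff[symmetric])
    also have "\<dots> \<le> 2 * y\<^sup>2 + 2"
      using zero_le_power2[of "\<bar>y\<bar> - 1"] by (simp add: power2_eq_square algebra_simps)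
    finally show "s\<^sup>2 \<le> 2 * y\<^sup>2 + 2" .
  qed
qed

section \<open>Characters and their topology\<close>

context real_algebra
begin

text \<open>The linear span described from outside, through all sets closed under the linear
  operations of \<open>A\<close>; this yields an induction rule over the carrier.\<close>

definition spanning :: "(nat \<Rightarrow> 'a) \<Rightarrow> bool" where
  "spanning e \<longleftrightarrow> range e \<subseteq> carrier A \<and> (\<forall>V. range e \<subseteq> V \<and>
     (\<forall>f\<in>carrier A \<inter> V. \<forall>g\<in>carrier A \<inter> V. f \<oplus> g \<in> V) \<and> (\<forall>c. \<forall>f\<in>carrier A \<inter> V. c \<odot> f \<in> V) \<longrightarrow> carrier A \<subseteq> V)"

lemma spanning_closed: "spanning e \<Longrightarrow> e k \<in> carrier A"
  by (auto simp: spanning_def)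

lemma spanning_induct [consumes 2, case_names base add smult]:
  assumes "spanning e" "f \<in> carrier A" "\<And>k. P (e k)"
    "\<And>f g. f \<in> carrier A \<Longrightarrow> g \<in> carrier A \<Longrightarrow> P f \<Longrightarrow> P g \<Longrightarrow> P (f \<oplus> g)"
    "\<And>c f. f \<in> carrier A \<Longrightarrow> P f \<Longrightarrow> P (c \<odot> f)"
  shows "P f"
proof -
  have "range e \<subseteq> Collect P \<and> (\<forall>f\<in>carrier A \<inter> Collect P. \<forall>g\<in>carrier A \<inter> Collect P. f \<oplus> g \<in> Collect P) \<and>
      (\<forall>c. \<forall>f\<in>carrier A \<inter> Collect P. c \<odot> f \<in> Collect P) \<longrightarrow> carrier A \<subseteq> Collect P"
    using assms(1) unfolding spanning_def by (elim conjE allE)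
  then have "carrier A \<subseteq> Collect P" using assms(3-5) by auto
  then show ?thesis using assms(2) by blast
qed

primrec monomial :: "(nat \<Rightarrow> 'a) \<Rightarrow> nat list \<Rightarrow> 'a" where
  "monomial g [] = \<one>"
| "monomial g (i # is) = g i \<otimes> monomial g is"

text \<open>The monomials in the generators, enumerated through lists of indices, span:
  concatenation of lists multiplies monomials, so their span is closed under multiplication.\<close>

lemma spanning_exists:
  assumes "finitely_generated_algebra A"
  shows "\<exists>e. spanning e"
proof -
  obtain g d where g: "range g \<subseteq> carrier A" and surj: "\<And>a. a \<in> carrier A \<Longrightarrow> \<exists>e\<in>pexps d. aev g e = a"
    using generated_by_pexps[OF assms] by metis
  have mono: "monomial g l \<in> carrier A" for l
    by (induction l) (use g in auto)
  have mult: "monomial g l \<otimes> monomial g l' = monomial g (l @ l')" for l l'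
    using g by (induction l) (auto simp: mono m_assoc image_subset_iff)
  define e where "e k = monomial g (from_nat k)" for k
  have e: "e (to_nat l) = monomial g l" for l by (simp add: e_def)
  define closed where "closed V \<longleftrightarrow> range e \<subseteq> V \<and> (\<forall>f\<in>carrier A \<inter> V. \<forall>g\<in>carrier A \<inter> V. f \<oplus> g \<in> V) \<and>
    (\<forall>c. \<forall>f\<in>carrier A \<inter> V. c \<odot> f \<in> V)" for V
  define W where "W = {a \<in> carrier A. \<forall>V. closed V \<longrightarrow> a \<in> V}"
  have W0: "monomial g l \<in> W" for l
    unfolding W_def closed_def using mono by (auto simp: image_subset_iff simp flip: e)
  have Wadd: "a \<oplus> b \<in> W" if "a \<in> W" "b \<in> W" for a b
    using that unfolding W_def closed_def by auto
  have Wsmult: "c \<odot> a \<in> W" if "a \<in> W" for c a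
    using that unfolding W_def closed_def by (auto simp: smult_closed)
  have Wc: "a \<in> carrier A" if "a \<in> W" for a using that by (simp add: W_def)
  have "closed W" unfolding closed_def using W0 Wadd Wsmult by (auto simp: e_def)
  have ind: "P a" if "a \<in> W" "\<And>l. P (monomial g l)" "\<And>a b. a \<in> W \<Longrightarrow> b \<in> W \<Longrightarrow> P a \<Longrightarrow> P b \<Longrightarrow> P (a \<oplus> b)"
    "\<And>c a. a \<in> W \<Longrightarrow> P a \<Longrightarrow> P (c \<odot> a)" for P a
  proof -
    have "closed {a \<in> W. P a}"
      unfolding closed_def using W0 Wadd Wsmult that(2-4) by (auto simp: e_def)
    then have "a \<in> {a \<in> W. P a}" using that(1) unfolding W_def by blast
    then show ?thesis by blast
  qed
  have Wmult: "a \<otimes> b \<in> W" if a: "a \<in> W" and b: "b \<in> W" for a b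
  proof -
    have *: "a \<otimes> monomial g l \<in> W" for l
      by (rule ind[of a "\<lambda>a. a \<otimes> monomial g l \<in> W"])
        (use a in \<open>auto simp: mult W0 mono l_distr Wc smult_mult(1) intro!: Wadd Wsmult\<close>)
    show ?thesis
      by (rule ind[of b "\<lambda>b. a \<otimes> b \<in> W"])
        (use b in \<open>auto simp: * r_distr Wc[OF a] Wc smult_mult(2) intro!: Wadd Wsmult\<close>)
  qed
  have "aev g p \<in> W" for p
  proof (induction p)
    case (PConst r)
    show ?case using Wsmult[OF W0[of "[]"]] by simp
  next
    case (PVar i)
    show ?case using W0[of "[i]"] g by (auto simp: image_subset_iff)
  qed (auto intro: Wadd Wmult)
  then have "carrier A \<subseteq> W" using surj by blast
  moreover have "range e \<subseteq> carrier A" using mono by (auto simp: e_def)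
  ultimately have "spanning e" unfolding spanning_def W_def closed_def by blast
  then show ?thesis by blast
qed

section \<open>The topology and the Borel sets of the character space\<close>

lemma topspace_character_topology: "topspace (character_topology A) = characters A"
  by (auto simp: character_topology_def characters_def PiE_def)

lemma openin_character_evaluation:
  assumes "f \<in> carrier A" "open B"
  shows "openin (character_topology A) {x \<in> characters A. x f \<in> B}"
proof -
  have "continuous_map (powertop_real (carrier A)) euclideanreal (\<lambda>x. x f)"
    using assms(1) by (rule continuous_map_product_projection)
  then have "continuous_map (character_topology A) euclideanreal (\<lambda>x. x f)"
    unfolding character_topology_def by (rule continuous_map_from_subtopology)
  from openin_continuous_map_preimage[OF this, of B] assms(2)
  show ?thesis unfolding topspace_character_topology by simp
qed

lemma openin_borel_sigma: "openin \<tau> U \<Longrightarrow> U \<in> sets (borel_sigma \<tau>)"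
  unfolding borel_sigma_def
  by (subst sets_measure_of) (auto dest: openin_subset)

lemma space_borel_sigma: "space (borel_sigma (character_topology A)) = characters A"
proof -
  have "{U. openin (character_topology A) U} \<subseteq> Pow (topspace (character_topology A))"
    by (auto dest: openin_subset)
  then show ?thesis by (simp add: borel_sigma_def space_measure_of topspace_character_topology)
qed

lemma character_evaluation_measurable:
  assumes "f \<in> carrier A"
  shows "(\<lambda>x. x f) \<in> borel_measurable (borel_sigma (character_topology A))"
proof (rule borel_measurableI)
  fix B :: "real set" assume "open B"
  have "(\<lambda>x. x f) -` B \<inter> space (borel_sigma (character_topology A)) = {x \<in> characters A. x f \<in> B}"
    by (auto simp: space_borel_sigma)
  then show "(\<lambda>x. x f) -` B \<inter> space (borel_sigma (character_topology A)) \<in> sets (borel_sigma (character_topology A))"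
    using openin_borel_sigma[OF openin_character_evaluation[OF assms \<open>open B\<close>]] by simp
qed

lemma character_evaluation_factor:
  assumes "spanning e" "f \<in> carrier A"
  shows "\<exists>\<phi>. continuous_on UNIV \<phi> \<and> (\<forall>x\<in>characters A. \<phi> (\<lambda>k. x (e k)) = x f)"
  using assms
proof (induction rule: spanning_induct)
  case (base k)
  show ?case by (rule exI[of _ "\<lambda>v. v k"]) auto
next
  case (add f g)
  then obtain \<phi> \<psi> where "continuous_on UNIV \<phi>" "\<forall>x\<in>characters A. \<phi> (\<lambda>k. x (e k)) = x f"
    "continuous_on UNIV \<psi>" "\<forall>x\<in>characters A. \<psi> (\<lambda>k. x (e k)) = x g" by blast
  then show ?case
    using add(1,2) by (intro exI[of _ "\<lambda>v. \<phi> v + \<psi> v"]) (auto intro!: continuous_intros simp: charactersD)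
next
  case (smult c f)
  then obtain \<phi> where "continuous_on UNIV \<phi>" "\<forall>x\<in>characters A. \<phi> (\<lambda>k. x (e k)) = x f" by blast
  then show ?case
    using smult(1) by (intro exI[of _ "\<lambda>v. c * \<phi> v"]) (auto intro!: continuous_intros simp: charactersD)
qed

text \<open>The topology is defined by the evaluations at all elements of \<open>A\<close>, but each
  of them is a continuous function of the coordinates \<open>x (e k)\<close>. So countably many
  coordinates induce it, and Borel sets can be handled in sequences of real numbers.\<close>

lemma openin_character_topologyE:
  assumes e: "spanning e" and U: "openin (character_topology A) U"
  obtains V :: "(nat \<Rightarrow> real) set" where "open V" "U = {x \<in> characters A. (\<lambda>k. x (e k)) \<in> V}"
proof -
  obtain W where W: "openin (powertop_real (carrier A)) W" "U = W \<inter> characters A"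
    using U unfolding character_topology_def by (auto simp: openin_subtopology)
  have loc: "\<exists>V. open V \<and> (\<lambda>k. x (e k)) \<in> V \<and> {x \<in> characters A. (\<lambda>k. x (e k)) \<in> V} \<subseteq> U" if x: "x \<in> U" for x
  proof -
    have "x \<in> W" "x \<in> characters A" using x W(2) by auto
    then obtain B where B: "finite {f \<in> carrier A. B f \<noteq> UNIV}" "\<And>f. f \<in> carrier A \<Longrightarrow> open (B f)"
      "x \<in> Pi\<^sub>E (carrier A) B" "Pi\<^sub>E (carrier A) B \<subseteq> W"
      using W(1) unfolding openin_product_topology_alt by (auto; metis)
    obtain \<phi> where \<phi>: "\<And>f. f \<in> carrier A \<Longrightarrow> continuous_on UNIV (\<phi> f) \<and> (\<forall>x\<in>characters A. \<phi> f (\<lambda>k. x (e k)) = x f)"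
      using character_evaluation_factor[OF e] by metis
    let ?F = "{f \<in> carrier A. B f \<noteq> UNIV}"
    let ?V = "\<Inter>f\<in>?F. \<phi> f -` B f"
    have "open ?V"
      using B(1,2) \<phi> by (intro open_INT ballI open_vimage) auto
    moreover have "(\<lambda>k. x (e k)) \<in> ?V"
      using B(3) \<phi> \<open>x \<in> characters A\<close> by (auto simp: PiE_def)
    moreover have "y \<in> U" if y: "y \<in> characters A" "(\<lambda>k. y (e k)) \<in> ?V" for y
    proof -
      have "y f \<in> B f" if f: "f \<in> carrier A" for f
      proof (cases "B f = UNIV")
        case False
        then have "\<phi> f (\<lambda>k. y (e k)) \<in> B f" using y(2) f by auto
        then show ?thesis using \<phi>[OF f] y(1) by simp
      qed simp
      then have "y \<in> Pi\<^sub>E (carrier A) B" using charactersD(7)[OF y(1)] by (auto simp: PiE_def)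
      then show ?thesis using B(4) W(2) y(1) by blast
    qed
    then have "{x \<in> characters A. (\<lambda>k. x (e k)) \<in> ?V} \<subseteq> U" by (intro subsetI) simp
    ultimately show ?thesis by (intro exI[of _ ?V]) simp
  qed
  define V where "V = \<Union>{V. open V \<and> {x \<in> characters A. (\<lambda>k. x (e k)) \<in> V} \<subseteq> U}"
  have "open V" unfolding V_def by (intro open_Union) auto
  moreover have "U \<subseteq> characters A" using W(2) by blast
  have "U = {x \<in> characters A. (\<lambda>k. x (e k)) \<in> V}"
  proof (intro equalityI subsetI)
    fix x assume x: "x \<in> U"
    from loc[OF this] obtain V' where "open V'" "(\<lambda>k. x (e k)) \<in> V'" "{x \<in> characters A. (\<lambda>k. x (e k)) \<in> V'} \<subseteq> U"
      by (elim exE conjE)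
    then show "x \<in> {x \<in> characters A. (\<lambda>k. x (e k)) \<in> V}"
      using x \<open>U \<subseteq> characters A\<close> unfolding V_def by auto
  next
    fix x assume "x \<in> {x \<in> characters A. (\<lambda>k. x (e k)) \<in> V}"
    then show "x \<in> U" unfolding V_def by auto
  qed
  ultimately show thesis using that by blast
qed

lemma openin_complement_nonneg_set:
  assumes "S \<subseteq> carrier A"
  shows "openin (character_topology A) (characters A - nonneg_set A S)"
proof -
  have "characters A - nonneg_set A S = (\<Union>f\<in>S. {x \<in> characters A. x f \<in> {..<0}})"
    by (auto simp: nonneg_set_def not_le)
  then show ?thesis
    using openin_character_evaluation[of _ "{..<0}"] assms by (auto intro!: openin_Union)
qed

text \<open>Convergence on a spanning sequence extends to all of \<open>A\<close>, and the defining
  equations and inequalities pass to the limit. This closedness later turns a cut approximated by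
  characters into a character.\<close>

lemma limit_of_characters:
  assumes e: "spanning e" and x: "\<And>n. x n \<in> nonneg_set A S" "S \<subseteq> carrier A"
    and conv: "\<And>k. (\<lambda>n. x n (e k)) \<longlonglongrightarrow> y k"
  shows "\<exists>z\<in>nonneg_set A S. \<forall>k. z (e k) = y k"
proof -
  have xc: "x n \<in> characters A" for n using x(1) by (auto simp: nonneg_set_def)
  have "convergent (\<lambda>n. x n f)" if "f \<in> carrier A" for f
    using e that
  proof (induction rule: spanning_induct)
    case (base k)
    show ?case using conv by (auto simp: convergent_def)
  next
    case (add f g)
    then show ?case by (simp add: charactersD[OF xc] convergent_add)
  next
    case (smult c f)
    then show ?case by (simp add: charactersD[OF xc] convergent_mult convergent_const)
  qed
  define z where "z = restrict (\<lambda>f. lim (\<lambda>n. x n f)) (carrier A)"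
  have lim: "(\<lambda>n. x n f) \<longlonglongrightarrow> z f" if "f \<in> carrier A" for f
    using \<open>f \<in> carrier A \<Longrightarrow> convergent (\<lambda>n. x n f)\<close>[OF that] that by (simp add: z_def convergent_LIMSEQ_iff)
  have "z \<in> characters A"
    unfolding characters_def linear_functional_def
  proof (intro CollectI conjI ballI allI)
    show "z \<in> extensional (carrier A)" by (simp add: z_def)
    show "z \<one> = 1"
      by (rule LIMSEQ_unique[OF lim]) (simp_all add: charactersD[OF xc])
    fix f assume f: "f \<in> carrier A"
    show "z (c \<odot> f) = c * z f" for c
      by (rule LIMSEQ_unique[OF lim[OF smult_closed[OF f]]])
        (use tendsto_mult[OF tendsto_const lim[OF f], of c] f in \<open>simp add: charactersD[OF xc]\<close>)
    fix g assume g: "g \<in> carrier A"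
    show "z (f \<oplus> g) = z f + z g"
      by (rule LIMSEQ_unique[OF lim])
        (use tendsto_add[OF lim[OF f] lim[OF g]] f g in \<open>simp_all add: charactersD[OF xc]\<close>)
    show "z (f \<otimes> g) = z f * z g"
      by (rule LIMSEQ_unique[OF lim])
        (use tendsto_mult[OF lim[OF f] lim[OF g]] f g in \<open>simp_all add: charactersD[OF xc]\<close>)
  qed
  moreover have "0 \<le> z f" if "f \<in> S" for f
    using x that by (intro tendsto_lowerbound[OF lim]) (auto simp: nonneg_set_def)
  moreover have "z (e k) = y k" for k
    by (rule LIMSEQ_unique[OF lim[OF spanning_closed[OF e]] conv])
  ultimately show ?thesis by (intro bexI[of _ z]) (auto simp: nonneg_set_def)
qed

end

section \<open>Haviland's theorem\<close>

context real_algebra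
begin

lemma linear_functionalD:
  assumes "linear_functional A L"
  shows "f \<in> carrier A \<Longrightarrow> g \<in> carrier A \<Longrightarrow> L (f \<oplus> g) = L f + L g"
    "f \<in> carrier A \<Longrightarrow> L (c \<odot> f) = c * L f" "L \<zero> = 0" "f \<in> carrier A \<Longrightarrow> L (\<ominus> f) = - L f"
    "f \<in> carrier A \<Longrightarrow> g \<in> carrier A \<Longrightarrow> L (f \<ominus> g) = L f - L g"
proof -
  show add: "f \<in> carrier A \<Longrightarrow> g \<in> carrier A \<Longrightarrow> L (f \<oplus> g) = L f + L g" for f g
    using assms by (auto simp: linear_functional_def)
  show smult: "f \<in> carrier A \<Longrightarrow> L (c \<odot> f) = c * L f" for c f
    using assms by (auto simp: linear_functional_def)
  show "L \<zero> = 0" using add[of \<zero> \<zero>] by simp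
  show neg: "f \<in> carrier A \<Longrightarrow> L (\<ominus> f) = - L f" for f
    using smult[of f "-1"] by (simp add: smult_minus smult_one)
  show "f \<in> carrier A \<Longrightarrow> g \<in> carrier A \<Longrightarrow> L (f \<ominus> g) = L f - L g"
    using add[of f "\<ominus> g"] neg[of g] by (simp add: minus_eq)
qed

text \<open>Large enough to contain all functions that are bounded on \<open>C\<close>, in
  particular indicators of arbitrary sets; small enough for the positive functional to extend,
  because every member lies between elements of \<open>A\<close>.\<close>

definition dominated :: "('a \<Rightarrow> real) set \<Rightarrow> (('a \<Rightarrow> real) \<Rightarrow> real) set" where
  "dominated C = {g. \<exists>f\<in>carrier A. \<forall>x\<in>C. \<bar>g x\<bar> \<le> x f}"

lemma function_space_dominated:
  assumes C: "C \<subseteq> characters A"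
  shows "function_space (dominated C)"
  unfolding function_space_def
proof (intro conjI ballI allI)
  have ch: "x \<in> characters A" if "x \<in> C" for x using C that by blast
  show "(\<lambda>_. 0) \<in> dominated C"
    unfolding dominated_def by (intro CollectI bexI[of _ \<zero>]) (auto simp: charactersD[OF ch])
  fix g assume "g \<in> dominated C"
  then obtain f where f: "f \<in> carrier A" "\<And>x. x \<in> C \<Longrightarrow> \<bar>g x\<bar> \<le> x f" by (auto simp: dominated_def)
  show "(\<lambda>x. c * g x) \<in> dominated C" for c
    unfolding dominated_def using f
    by (intro CollectI bexI[of _ "\<bar>c\<bar> \<odot> f"]) (auto simp: charactersD[OF ch] smult_closed abs_mult mult_left_mono)
  fix h assume "h \<in> dominated C"
  then obtain f' where f': "f' \<in> carrier A" "\<And>x. x \<in> C \<Longrightarrow> \<bar>h x\<bar> \<le> x f'" by (auto simp: dominated_def)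
  have "\<bar>g x + h x\<bar> \<le> x (f \<oplus> f')" if "x \<in> C" for x
    using f(2)[OF that] f'(2)[OF that] f(1) f'(1) charactersD(1)[OF ch[OF that]] by simp
  then show "(\<lambda>x. g x + h x) \<in> dominated C"
    unfolding dominated_def using f(1) f'(1) by (intro CollectI bexI[of _ "f \<oplus> f'"]) auto
qed

lemma evaluation_dominated:
  assumes "C \<subseteq> characters A" "f \<in> carrier A"
  shows "(\<lambda>x. x f) \<in> dominated C"
proof -
  have "\<bar>x f\<bar> \<le> x (\<one> \<oplus> f \<otimes> f)" if "x \<in> C" for x
  proof -
    have x: "x \<in> characters A" using assms(1) that by blast
    have "2 * \<bar>x f\<bar> \<le> 1 + (x f)\<^sup>2"
      using zero_le_power2[of "\<bar>x f\<bar> - 1"] by (simp add: power2_diff)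
    moreover have "0 \<le> \<bar>x f\<bar>" by simp
    ultimately have "\<bar>x f\<bar> \<le> 1 + (x f)\<^sup>2" by linarith
    then show ?thesis using assms(2) by (simp add: charactersD[OF x] power2_eq_square)
  qed
  then show ?thesis unfolding dominated_def using assms(2) by (intro CollectI bexI[of _ "\<one> \<oplus> f \<otimes> f"]) auto
qed

lemma bounded_dominated:
  assumes "C \<subseteq> characters A" "\<And>x. x \<in> C \<Longrightarrow> \<bar>g x\<bar> \<le> B"
  shows "g \<in> dominated C"
proof -
  have "x (B \<odot> \<one>) = B" if "x \<in> C" for x
    using assms(1) that charactersD(2,4)[of x] by (metis mult.right_neutral one_closed subsetD)
  note eq = this
  have "\<forall>x\<in>C. \<bar>g x\<bar> \<le> x (B \<odot> \<one>)"
  proof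
    fix x assume x: "x \<in> C"
    show "\<bar>g x\<bar> \<le> x (B \<odot> \<one>)" using assms(2)[OF x] eq[OF x] by simp
  qed
  then show ?thesis
    unfolding dominated_def by (intro CollectI bexI[of _ "B \<odot> \<one>"]) (simp_all add: smult_closed)
qed

text \<open>The sublinear functional is the infimum of \<open>L\<close> over the elements of
  \<open>A\<close> that lie above g on \<open>C\<close>. A linear functional q below it satisfies
  q(-g) \<le> L(0) = 0 for nonnegative g, and it agrees with \<open>L\<close> on \<open>A\<close>,
  being at most \<open>L\<close> at an element and at its negative.\<close>

lemma positive_extension:
  assumes C: "C \<subseteq> characters A" and L: "linear_functional A L"
    and pos: "\<And>f. f \<in> carrier A \<Longrightarrow> (\<And>x. x \<in> C \<Longrightarrow> 0 \<le> x f) \<Longrightarrow> 0 \<le> L f"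
  obtains \<Lambda> where
    "\<And>g h. g \<in> dominated C \<Longrightarrow> h \<in> dominated C \<Longrightarrow> \<Lambda> (\<lambda>x. g x + h x) = \<Lambda> g + \<Lambda> h"
    "\<And>c g. g \<in> dominated C \<Longrightarrow> \<Lambda> (\<lambda>x. c * g x) = c * \<Lambda> g"
    "\<And>g. g \<in> dominated C \<Longrightarrow> (\<And>x. x \<in> C \<Longrightarrow> 0 \<le> g x) \<Longrightarrow> 0 \<le> \<Lambda> g"
    "\<And>f. f \<in> carrier A \<Longrightarrow> \<Lambda> (\<lambda>x. x f) = L f"
proof -
  note Ld = linear_functionalD[OF L]
  have ch: "x \<in> characters A" if "x \<in> C" for x using C that by blast
  define U where "U g = {f \<in> carrier A. \<forall>x\<in>C. g x \<le> x f}" for g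
  define p where "p g = Inf (L ` U g)" for g
  have ne: "U g \<noteq> {}" if "g \<in> dominated C" for g
    using that unfolding dominated_def U_def by (force simp: abs_le_iff)
  have bdd: "bdd_below (L ` U g)" if g: "g \<in> dominated C" for g
  proof -
    obtain f where f: "f \<in> carrier A" "\<And>x. x \<in> C \<Longrightarrow> \<bar>g x\<bar> \<le> x f" using g by (auto simp: dominated_def)
    have "- L f \<le> L f'" if f': "f' \<in> U g" for f'
    proof -
      have c: "f' \<in> carrier A" using f' by (simp add: U_def)
      have "0 \<le> L (f' \<oplus> f)"
      proof (rule pos)
        fix x assume x: "x \<in> C"
        have "g x \<le> x f'" "\<bar>g x\<bar> \<le> x f" using f' f(2) x by (auto simp: U_def)
        then show "0 \<le> x (f' \<oplus> f)" using charactersD(1)[OF ch[OF x] c f(1)] by linarith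
      qed (use c f in simp)
      then show ?thesis using Ld(1)[OF c f(1)] by simp
    qed
    then show ?thesis by (intro bdd_belowI2)
  qed
  have le: "p g \<le> L f" if "g \<in> dominated C" "f \<in> U g" for g f
    unfolding p_def using that bdd by (intro cInf_lower) auto
  have ge: "c \<le> p g" if "g \<in> dominated C" "\<And>f. f \<in> U g \<Longrightarrow> c \<le> L f" for c g
    unfolding p_def using that ne by (intro cInf_greatest) auto
  note fs = function_space_dominated[OF C]
  note fsD = function_spaceD[OF fs]
  have "sublinear_on (dominated C) p"
    unfolding sublinear_on_def
  proof (intro conjI ballI allI impI)
    fix g h assume g: "g \<in> dominated C" and h: "h \<in> dominated C"
    have *: "p (\<lambda>x. g x + h x) \<le> L f + L f'" if "f \<in> U g" "f' \<in> U h" for f f'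
    proof -
      have "f \<oplus> f' \<in> U (\<lambda>x. g x + h x)"
        using that by (auto simp: U_def charactersD[OF ch] add_mono)
      from le[OF fsD(2)[OF g h] this] show ?thesis using Ld(1)[of f f'] that by (simp add: U_def)
    qed
    have "p (\<lambda>x. g x + h x) - L f \<le> p h" if "f \<in> U g" for f
      using *[OF that] by (intro ge[OF h]) (simp add: algebra_simps)
    then have "p (\<lambda>x. g x + h x) - p h \<le> L f" if "f \<in> U g" for f
      using that by (simp add: algebra_simps)
    then have "p (\<lambda>x. g x + h x) - p h \<le> p g" by (intro ge[OF g])
    then show "p (\<lambda>x. g x + h x) \<le> p g + p h" by simp
  next
    fix c :: real and g assume c: "0 \<le> c" and g: "g \<in> dominated C"
    show "p (\<lambda>x. c * g x) \<le> c * p g"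
    proof (cases "c = 0")
      case True
      have "\<zero> \<in> U (\<lambda>_. 0)" by (auto simp: U_def charactersD[OF ch])
      from le[OF fsD(1) this] show ?thesis using True Ld(3) by simp
    next
      case False
      have "p (\<lambda>x. c * g x) / c \<le> p g"
      proof (rule ge[OF g])
        fix f assume f: "f \<in> U g"
        have "c \<odot> f \<in> U (\<lambda>x. c * g x)"
          using f c by (auto simp: U_def charactersD[OF ch] smult_closed mult_left_mono)
        from le[OF fsD(3)[OF g] this] have "p (\<lambda>x. c * g x) \<le> c * L f" using Ld(2)[of f c] f by (simp add: U_def)
        then show "p (\<lambda>x. c * g x) / c \<le> L f" using False c by (simp add: pos_divide_le_eq mult.commute)
      qed
      then show ?thesis using False c by (simp add: pos_divide_le_eq mult.commute)
    qed
  qed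
  then show thesis
  proof (rule linear_functional_below_sublinear[OF fs])
    fix q assume q: "\<And>g. g \<in> dominated C \<Longrightarrow> q g \<le> p g"
      "\<And>g h. g \<in> dominated C \<Longrightarrow> h \<in> dominated C \<Longrightarrow> q (\<lambda>x. g x + h x) = q g + q h"
      "\<And>c g. g \<in> dominated C \<Longrightarrow> q (\<lambda>x. c * g x) = c * q g"
    show thesis
  proof (rule that[of q])
    show "q (\<lambda>x. g x + h x) = q g + q h" if "g \<in> dominated C" "h \<in> dominated C" for g h by (rule q(2)[OF that])
    show "q (\<lambda>x. c * g x) = c * q g" if "g \<in> dominated C" for c g by (rule q(3)[OF that])
    show "0 \<le> q g" if g: "g \<in> dominated C" "\<And>x. x \<in> C \<Longrightarrow> 0 \<le> g x" for g
    proof -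
      have "\<zero> \<in> U (\<lambda>x. (- 1) * g x)" using g(2) by (auto simp: U_def charactersD[OF ch])
      then have "q (\<lambda>x. (- 1) * g x) \<le> 0"
        using q(1)[OF fsD(3)[OF g(1)], of "- 1"] le[OF fsD(3)[OF g(1)], of \<zero> "- 1"] Ld(3) by simp
      then show ?thesis unfolding q(3)[OF g(1)] by simp
    qed
    fix f assume f: "f \<in> carrier A"
    note fd = evaluation_dominated[OF C f]
    have "q (\<lambda>x. x f) \<le> L f"
      using q(1)[OF fd] le[OF fd, of f] f by (simp add: U_def)
    moreover have "q (\<lambda>x. (- 1) * x f) \<le> L (\<ominus> f)"
    proof -
      have "\<ominus> f \<in> U (\<lambda>x. (- 1) * x f)" using f by (simp add: U_def charactersD[OF ch])
      from le[OF fsD(3)[OF fd] this] q(1)[OF fsD(3)[OF fd], of "- 1"] show ?thesis by linarith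
    qed
    ultimately show "q (\<lambda>x. x f) = L f" unfolding q(3)[OF fd] using Ld(4)[OF f] by simp
  qed
  qed
qed

end

text \<open>The point x of \<open>C\<close> is recorded by the pattern \<open>bits x\<close> of its
  comparisons with rational numbers, one cut for each coordinate. \<open>N\<close> lives on all
  patterns, most of which come from no point, and gives a clopen set the mass that
  \<open>\<Lambda>\<close> assigns to its preimage under \<open>bits\<close>.\<close>

locale moment_model = real_algebra +
  fixes e :: "nat \<Rightarrow> 'a" and S :: "'a set" and C :: "('a \<Rightarrow> real) set" and L :: "'a \<Rightarrow> real"
    and \<Lambda> :: "(('a \<Rightarrow> real) \<Rightarrow> real) \<Rightarrow> real" and N :: "(nat \<times> rat \<Rightarrow> bool) measure"
  fixes bits :: "('a \<Rightarrow> real) \<Rightarrow> nat \<times> rat \<Rightarrow> bool"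
  defines "bits \<equiv> \<lambda>x (k, q). x (e k) \<le> real_of_rat q"
  assumes span: "spanning e" and S: "S \<subseteq> carrier A" and C: "C = nonneg_set A S" "C \<noteq> {}"
    and L: "linear_functional A L"
    and \<Lambda>_add: "\<And>g h. g \<in> dominated C \<Longrightarrow> h \<in> dominated C \<Longrightarrow> \<Lambda> (\<lambda>x. g x + h x) = \<Lambda> g + \<Lambda> h"
    and \<Lambda>_scale: "\<And>c g. g \<in> dominated C \<Longrightarrow> \<Lambda> (\<lambda>x. c * g x) = c * \<Lambda> g"
    and \<Lambda>_pos: "\<And>g. g \<in> dominated C \<Longrightarrow> (\<And>x. x \<in> C \<Longrightarrow> 0 \<le> g x) \<Longrightarrow> 0 \<le> \<Lambda> g"
    and \<Lambda>_L: "\<And>f. f \<in> carrier A \<Longrightarrow> \<Lambda> (\<lambda>x. x f) = L f"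
    and N_space: "space N = UNIV" and N_sets: "\<And>B. open B \<Longrightarrow> closed B \<Longrightarrow> B \<in> sets N"
    and N_emeasure: "\<And>B. open B \<Longrightarrow> closed B \<Longrightarrow> emeasure N B = ennreal (\<Lambda> (\<lambda>x. indicator B (bits x)))"
begin

lemma C_characters: "C \<subseteq> characters A"
  by (auto simp: C nonneg_set_def)

lemmas fsD = function_spaceD[OF function_space_dominated[OF C_characters]]
lemmas bounded_dom = bounded_dominated[OF C_characters]
lemmas eval_dom = evaluation_dominated[OF C_characters]

lemma \<Lambda>_mono:
  assumes "g \<in> dominated C" "h \<in> dominated C" "\<And>x. x \<in> C \<Longrightarrow> g x \<le> h x"
  shows "\<Lambda> g \<le> \<Lambda> h"
proof -
  have "0 \<le> \<Lambda> (\<lambda>x. h x + (- 1) * g x)"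
    by (rule \<Lambda>_pos[OF fsD(2)[OF assms(2) fsD(3)[OF assms(1)]]]) (use assms(3) in simp)
  then show ?thesis
    using \<Lambda>_add[OF assms(2) fsD(3)[OF assms(1)], of "- 1"] \<Lambda>_scale[OF assms(1), of "- 1"] by simp
qed

lemma \<Lambda>_cong:
  assumes "g \<in> dominated C" "\<And>x. x \<in> C \<Longrightarrow> g x = h x"
  shows "\<Lambda> g = \<Lambda> h"
proof -
  have "h \<in> dominated C" using assms by (auto simp: dominated_def)
  then show ?thesis using assms \<Lambda>_mono[of g h] \<Lambda>_mono[of h g] by simp
qed

lemma \<Lambda>_sum:
  assumes "finite I" "\<And>i. i \<in> I \<Longrightarrow> g i \<in> dominated C"
  shows "\<Lambda> (\<lambda>x. \<Sum>i\<in>I. g i x) = (\<Sum>i\<in>I. \<Lambda> (g i))" "(\<lambda>x. \<Sum>i\<in>I. g i x) \<in> dominated C"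
proof -
  have "\<Lambda> (\<lambda>x. \<Sum>i\<in>I. g i x) = (\<Sum>i\<in>I. \<Lambda> (g i)) \<and> (\<lambda>x. \<Sum>i\<in>I. g i x) \<in> dominated C"
    using assms
  proof (induction I)
    case empty
    show ?case using \<Lambda>_scale[OF fsD(1), of 0] fsD(1) by simp
  next
    case (insert i I)
    then show ?case using \<Lambda>_add[of "g i" "\<lambda>x. \<Sum>i\<in>I. g i x"] fsD(2)[of "g i" "\<lambda>x. \<Sum>i\<in>I. g i x"] by simp
  qed
  then show "\<Lambda> (\<lambda>x. \<Sum>i\<in>I. g i x) = (\<Sum>i\<in>I. \<Lambda> (g i))" "(\<lambda>x. \<Sum>i\<in>I. g i x) \<in> dominated C" by auto
qed

lemma indicator_dom: "(\<lambda>x. indicator B (bits x)) \<in> dominated C"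
  by (rule bounded_dom[of _ 1]) (auto simp: indicator_def)

sublocale N: finite_measure N
  by (rule finite_measureI) (simp add: N_space N_emeasure)

lemma N_measure:
  assumes "open B" "closed B"
  shows "measure N B = \<Lambda> (\<lambda>x. indicator B (bits x))"
  unfolding measure_def N_emeasure[OF assms]
  by (rule enn2real_ennreal) (rule \<Lambda>_pos[OF indicator_dom], simp)

text \<open>A function of finitely many bits takes finitely many values, each on a clopen set, so
  linearity of both sides reduces the claim to clopen sets.\<close>

lemma cylinder_integral:
  fixes \<phi> :: "(nat \<times> rat \<Rightarrow> bool) \<Rightarrow> real"
  assumes J: "finite J" and dep: "\<And>u v. \<forall>j\<in>J. u j = v j \<Longrightarrow> \<phi> u = \<phi> v"
  shows "integrable N \<phi>" "(\<integral>u. \<phi> u \<partial>N) = \<Lambda> (\<lambda>x. \<phi> (bits x))" "(\<lambda>x. \<phi> (bits x)) \<in> dominated C"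
proof -
  have "range \<phi> \<subseteq> (\<lambda>T. \<phi> (\<lambda>j. j \<in> T)) ` Pow J"
  proof safe
    fix u
    have "\<phi> u = \<phi> (\<lambda>j. j \<in> {j \<in> J. u j})" by (rule dep) auto
    then show "\<phi> u \<in> (\<lambda>T. \<phi> (\<lambda>j. j \<in> T)) ` Pow J" by (rule image_eqI) auto
  qed
  then have R: "finite (range \<phi>)" by (rule finite_subset) (use J in simp)
  define B where "B r = {u. \<phi> u = r}" for r
  have B: "open (B r)" "closed (B r)" for r
    using clopen_finite_coordinates[OF J, of "B r"] dep unfolding B_def by (metis (mono_tags, lifting) mem_Collect_eq)+
  have eq: "\<phi> u = (\<Sum>r\<in>range \<phi>. r * indicator (B r) u)" for u
  proof -
    have "(\<Sum>r\<in>range \<phi>. r * indicator (B r) u) = (\<Sum>r\<in>range \<phi>. if r = \<phi> u then \<phi> u else 0)"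
      by (rule sum.cong) (auto simp: B_def indicator_def)
    then show ?thesis using R by simp
  qed
  have int: "integrable N (\<lambda>u. r * indicator (B r) u)" for r
    using N_sets[OF B] by (intro integrable_mult_right integrable_real_indicator) (auto simp: N.emeasure_eq_measure)
  show "integrable N \<phi>" by (subst eq[abs_def]) (intro Bochner_Integration.integrable_sum int)
  have "(\<integral>u. \<phi> u \<partial>N) = (\<Sum>r\<in>range \<phi>. \<integral>u. r * indicator (B r) u \<partial>N)"
    by (subst eq) (rule Bochner_Integration.integral_sum, rule int)
  also have "\<dots> = (\<Sum>r\<in>range \<phi>. r * \<Lambda> (\<lambda>x. indicator (B r) (bits x)))"
    using N_sets[OF B] N_space by (simp add: N_measure[OF B])
  also have "\<dots> = (\<Sum>r\<in>range \<phi>. \<Lambda> (\<lambda>x. r * indicator (B r) (bits x)))"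
    by (simp add: \<Lambda>_scale[OF indicator_dom])
  also have "\<dots> = \<Lambda> (\<lambda>x. \<Sum>r\<in>range \<phi>. r * indicator (B r) (bits x))"
    using R by (subst \<Lambda>_sum(1)) (auto intro: fsD(3) indicator_dom)
  finally show "(\<integral>u. \<phi> u \<partial>N) = \<Lambda> (\<lambda>x. \<phi> (bits x))" by (simp only: eq[symmetric])
  have "(\<lambda>x. \<Sum>r\<in>range \<phi>. r * indicator (B r) (bits x)) \<in> dominated C"
    using R by (intro \<Lambda>_sum(2) fsD(3) indicator_dom)
  then show "(\<lambda>x. \<phi> (bits x)) \<in> dominated C" by (simp only: eq[symmetric])
qed

end

context moment_model
begin

lemma coordinate_sets: "{u. u j} \<in> sets N" "{u. \<not> u j} \<in> sets N"
  by (rule N_sets; rule clopen_finite_coordinates[of "{j}"]; auto)+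

lemma C_D: "x \<in> C \<Longrightarrow> x \<in> characters A"
  using C_characters by blast

text \<open>By Chebyshev's inequality, patterns that place the coordinate k beyond n + 1 in absolute
  value have mass at most L((\<open>e k\<close>)^2) / (n + 1). So patterns that place it at infinity
  are null.\<close>

lemma AE_cut: "AE u in N. \<forall>k. (\<exists>q. u (k, q)) \<and> (\<exists>q. \<not> u (k, q))"
proof -
  have null: "emeasure N B0 = 0"
    if B0: "B0 \<in> sets N" and B: "\<And>n. open (B n) \<and> closed (B n) \<and> B0 \<subseteq> B n"
      and big: "\<And>n x. x \<in> C \<Longrightarrow> bits x \<in> B n \<Longrightarrow> real (Suc n) \<le> \<bar>x (e k)\<bar>" for B0 and B :: "nat \<Rightarrow> _" and k
  proof -
    let ?f = "e k \<otimes> e k"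
    have f: "?f \<in> carrier A" using spanning_closed[OF span] by simp
    have "measure N B0 \<le> L ?f * inverse (real (Suc n))" for n
    proof -
      have "measure N B0 \<le> measure N (B n)"
        using B[of n] N_sets by (intro N.finite_measure_mono) auto
      also have "\<dots> = \<Lambda> (\<lambda>x. indicator (B n) (bits x))" using B[of n] by (intro N_measure) auto
      also have "\<dots> \<le> \<Lambda> (\<lambda>x. inverse (real (Suc n)) * x ?f)"
      proof (rule \<Lambda>_mono[OF indicator_dom fsD(3)[OF eval_dom[OF f]]])
        fix x assume x: "x \<in> C"
        have xf: "x ?f = (x (e k))\<^sup>2" using spanning_closed[OF span] by (simp add: charactersD[OF C_D[OF x]] power2_eq_square)
        show "indicator (B n) (bits x) \<le> inverse (real (Suc n)) * x ?f"
        proof (cases "bits x \<in> B n")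
          case True
          have a: "real (Suc n) \<le> \<bar>x (e k)\<bar>" by (rule big[OF x True])
          have "real (Suc n) * 1 \<le> \<bar>x (e k)\<bar> * \<bar>x (e k)\<bar>" using a by (intro mult_mono) auto
          then have "real (Suc n) \<le> (x (e k))\<^sup>2" by (simp add: power2_eq_square)
          then show ?thesis using True unfolding xf by (simp add: field_simps)
        next
          case False
          then show ?thesis unfolding xf by simp
        qed
      qed
      also have "\<dots> = L ?f * inverse (real (Suc n))" by (simp add: \<Lambda>_scale[OF eval_dom[OF f]] \<Lambda>_L[OF f])
      finally show ?thesis .
    qed
    moreover have "(\<lambda>n. L ?f * inverse (real (Suc n))) \<longlonglongrightarrow> L ?f * 0"
      by (intro tendsto_mult tendsto_const LIMSEQ_inverse_real_of_nat)
    ultimately have "measure N B0 \<le> L ?f * 0" by (intro LIMSEQ_le_const) auto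
    then have "measure N B0 = 0" using measure_nonneg[of N B0] by linarith
    then show ?thesis by (simp add: N.emeasure_eq_measure)
  qed
  have "AE u in N. (\<exists>q. u (k, q)) \<and> (\<exists>q. \<not> u (k, q))" for k
  proof (rule AE_conjI)
    have "emeasure N (\<Inter>q. {u. \<not> u (k, q)}) = 0"
    proof (rule null[of _ "\<lambda>n. {u. \<not> u (k, of_nat (Suc n))}"])
      show "(\<Inter>q. {u. \<not> u (k, q)}) \<in> sets N" using coordinate_sets by (intro sets.countable_INT) auto
      show "open {u. \<not> u (k, rat_of_nat (Suc n))} \<and> closed {u. \<not> u (k, rat_of_nat (Suc n))} \<and>
          (\<Inter>q. {u. \<not> u (k, q)}) \<subseteq> {u. \<not> u (k, rat_of_nat (Suc n))}" for n
        using clopen_finite_coordinates[of "{(k, rat_of_nat (Suc n))}" "{u. \<not> u (k, rat_of_nat (Suc n))}"] by auto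
      show "real (Suc n) \<le> \<bar>x (e k)\<bar>" if "bits x \<in> {u. \<not> u (k, rat_of_nat (Suc n))}" for n x
        using that by (simp add: bits_def of_rat_add)
    qed
    then show "AE u in N. \<exists>q. u (k, q)"
      by (intro AE_I[of _ _ "\<Inter>q. {u. \<not> u (k, q)}"]) (auto intro!: sets.countable_INT coordinate_sets)
    have "emeasure N (\<Inter>q. {u. u (k, q)}) = 0"
    proof (rule null[of _ "\<lambda>n. {u. u (k, - of_nat (Suc n))}"])
      show "(\<Inter>q. {u. u (k, q)}) \<in> sets N" using coordinate_sets by (intro sets.countable_INT) auto
      show "open {u. u (k, - rat_of_nat (Suc n))} \<and> closed {u. u (k, - rat_of_nat (Suc n))} \<and>
          (\<Inter>q. {u. u (k, q)}) \<subseteq> {u. u (k, - rat_of_nat (Suc n))}" for n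
        using clopen_finite_coordinates[of "{(k, - rat_of_nat (Suc n))}" "{u. u (k, - rat_of_nat (Suc n))}"] by auto
      show "real (Suc n) \<le> \<bar>x (e k)\<bar>" if "bits x \<in> {u. u (k, - rat_of_nat (Suc n))}" for n x
        using that by (simp add: bits_def of_rat_add of_rat_minus of_rat_diff)
    qed
    then show "AE u in N. \<exists>q. \<not> u (k, q)"
      by (intro AE_I[of _ _ "\<Inter>q. {u. u (k, q)}"]) (auto intro!: sets.countable_INT coordinate_sets)
  qed
  then show ?thesis by (simp add: AE_all_countable)
qed

text \<open>Agreement with a point of \<open>C\<close> on an initial part of the bits is a clopen
  condition of full mass. Imposing it for all n keeps the patterns measurable, while the image of
  \<open>C\<close> under \<open>bits\<close> is not obviously so.\<close>

definition approximable :: "nat \<Rightarrow> (nat \<times> rat \<Rightarrow> bool) set" where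
  "approximable n = {u. \<exists>x\<in>C. \<forall>j. to_nat j < n \<longrightarrow> u j = bits x j}"

lemma approximable_clopen: "open (approximable n)" "closed (approximable n)"
proof -
  have "finite (to_nat -` {..<n} :: (nat \<times> rat) set)"
    by (rule finite_vimageI) auto
  then have "finite {j :: nat \<times> rat. to_nat j < n}" by (simp add: vimage_def)
  from clopen_finite_coordinates[OF this, of "approximable n"]
  show "open (approximable n)" "closed (approximable n)"
    unfolding approximable_def by fastforce+
qed

lemma AE_approximable: "AE u in N. \<forall>n. u \<in> approximable n"
proof -
  have "AE u in N. u \<in> approximable n" for n
  proof -
    have cl: "open (- approximable n)" "closed (- approximable n)"
      using approximable_clopen[of n] by (simp_all add: open_Compl closed_Compl)
    have "\<Lambda> (\<lambda>x. indicator (- approximable n) (bits x)) = \<Lambda> (\<lambda>_. 0)"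
      by (rule \<Lambda>_cong[OF indicator_dom]) (auto simp: approximable_def indicator_def)
    then have "emeasure N (- approximable n) = 0"
      using N_emeasure[OF cl] \<Lambda>_scale[OF fsD(1), of 0] by simp
    then show ?thesis
      by (intro AE_I[of _ _ "- approximable n"]) (auto intro: N_sets[OF cl])
  qed
  then show ?thesis by (simp add: AE_all_countable)
qed

definition good :: "(nat \<times> rat \<Rightarrow> bool) set" where
  "good = {u. (\<forall>k. (\<exists>q. u (k, q)) \<and> (\<exists>q. \<not> u (k, q))) \<and> (\<forall>n. u \<in> approximable n)}"

lemma good_sets: "good \<in> sets N"
proof -
  have "good = (\<Inter>k. (\<Union>q. {u. u (k, q)}) \<inter> (\<Union>q. {u. \<not> u (k, q)})) \<inter> (\<Inter>n. approximable n)"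
    by (auto simp: good_def)
  moreover have "(\<Inter>k. (\<Union>q. {u. u (k, q)}) \<inter> (\<Union>q. {u. \<not> u (k, q)})) \<in> sets N"
    by (intro sets.countable_INT sets.Int sets.countable_UN image_subsetI coordinate_sets) auto
  moreover have "(\<Inter>n. approximable n) \<in> sets N"
    by (intro sets.countable_INT image_subsetI N_sets approximable_clopen) auto
  ultimately show ?thesis by simp
qed

lemma AE_good: "AE u in N. u \<in> good"
  using AE_cut AE_approximable by eventually_elim (simp add: good_def)

text \<open>Strict on one side only: if a coordinate equals the rational q, the bit at q is left
  free, as characters may approach the value from either side.\<close>

definition decodes :: "(nat \<times> rat \<Rightarrow> bool) \<Rightarrow> ('a \<Rightarrow> real) \<Rightarrow> bool" where
  "decodes u x \<longleftrightarrow> x \<in> C \<and> (\<forall>k q. (x (e k) < real_of_rat q \<longrightarrow> u (k, q)) \<and> (u (k, q) \<longrightarrow> x (e k) \<le> real_of_rat q))"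

text \<open>Characters that agree with \<open>u\<close> on longer and longer parts converge, in each
  coordinate, to the real number defined by the cut. The limit is a character in
  \<open>C\<close>.\<close>

lemma decodes_exists:
  assumes u: "u \<in> good"
  shows "\<exists>x. decodes u x"
proof -
  have "\<forall>n. \<exists>x\<in>C. \<forall>j. to_nat j < n \<longrightarrow> u j = bits x j" using u by (simp add: good_def approximable_def)
  then obtain x where x: "\<And>n. x n \<in> C" "\<And>n j. to_nat j < n \<Longrightarrow> u j = bits (x n) j" by metis
  have ev: "eventually (\<lambda>n. u j = bits (x n) j) sequentially" for j
    by (rule eventually_sequentiallyI[of "Suc (to_nat j)"]) (simp add: x(2))
  have mono: "u (k, q')" if "u (k, q)" "q \<le> q'" for k q q'
  proof -
    have "eventually (\<lambda>n. u (k, q')) sequentially"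
      using ev[of "(k, q)"] ev[of "(k, q')"]
    proof eventually_elim
      case (elim n)
      have "real_of_rat q \<le> real_of_rat q'" using that(2) by (simp add: of_rat_less_eq)
      then show ?case using elim that(1) by (simp add: bits_def)
    qed
    then show ?thesis by simp
  qed
  define y where "y k = Inf {real_of_rat q |q. u (k, q)}" for k
  have ne: "{real_of_rat q |q. u (k, q)} \<noteq> {}" for k using u by (auto simp: good_def)
  have bdd: "bdd_below {real_of_rat q |q. u (k, q)}" for k
  proof -
    obtain q0 where q0: "\<not> u (k, q0)" using u by (auto simp: good_def)
    have "real_of_rat q0 \<le> real_of_rat q" if "u (k, q)" for q
      using mono[OF that, of q0] q0 by (cases "q \<le> q0") (auto simp: of_rat_less_eq)
    then show ?thesis by (intro bdd_belowI[of _ "real_of_rat q0"]) auto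
  qed
  have y_le: "y k \<le> real_of_rat q" if "u (k, q)" for k q
    unfolding y_def using that by (intro cInf_lower bdd) auto
  have y_less: "\<exists>q. u (k, q) \<and> real_of_rat q < a" if "y k < a" for k a
    using that cInf_less_iff[OF ne bdd, of k a] unfolding y_def by auto
  have conv: "(\<lambda>n. x n (e k)) \<longlonglongrightarrow> y k" for k
  proof (rule order_tendstoI)
    fix a assume "a < y k"
    then obtain r where "r \<in> \<rat>" "a < r" "r < y k" using Rats_dense_in_real by blast
    then obtain q where q: "a < real_of_rat q" "real_of_rat q < y k" by (auto elim!: Rats_cases)
    then have "\<not> u (k, q)" using y_le[of k q] by auto
    from ev[of "(k, q)"] show "eventually (\<lambda>n. a < x n (e k)) sequentially"
      by eventually_elim (use \<open>\<not> u (k, q)\<close> q(1) in \<open>simp add: bits_def\<close>)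
  next
    fix a assume "y k < a"
    then obtain q where q: "u (k, q)" "real_of_rat q < a" using y_less by blast
    from ev[of "(k, q)"] show "eventually (\<lambda>n. x n (e k) < a) sequentially"
      by eventually_elim (use q in \<open>simp add: bits_def\<close>)
  qed
  have "\<exists>z\<in>nonneg_set A S. \<forall>k. z (e k) = y k"
    by (rule limit_of_characters[OF span, of x S y]) (use x(1) S conv C in auto)
  then obtain z where z: "z \<in> C" "\<And>k. z (e k) = y k" unfolding C by blast
  have "u (k, q)" if "y k < real_of_rat q" for k q
    using y_less[OF that] mono by (metis less_imp_le of_rat_less)
  then have "decodes u z" unfolding decodes_def using z y_le by auto
  then show ?thesis by blast
qed

text \<open>Off the good patterns the value is a fixed point of \<open>C\<close>. So
  \<open>decode\<close> maps into \<open>C\<close> everywhere and is constant on the null set of bad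
  patterns.\<close>

definition decode :: "(nat \<times> rat \<Rightarrow> bool) \<Rightarrow> 'a \<Rightarrow> real" where
  "decode u = (if u \<in> good then SOME x. decodes u x else SOME x. x \<in> C)"

lemma decode: "decode u \<in> C" "u \<in> good \<Longrightarrow> decodes u (decode u)"
proof -
  show *: "u \<in> good \<Longrightarrow> decodes u (decode u)"
    using someI_ex[OF decodes_exists] by (simp add: decode_def)
  show "decode u \<in> C"
  proof (cases "u \<in> good")
    case True
    then show ?thesis using * by (simp add: decodes_def)
  next
    case False
    then show ?thesis using C(2) by (simp add: decode_def some_in_eq)
  qed
qed

lemma decode_coordinate_measurable: "(\<lambda>u. decode u (e k)) \<in> borel_measurable N"
proof (rule borel_measurableI_less)
  fix a :: real
  let ?x0 = "SOME x. x \<in> C"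
  have "decode u (e k) < a \<longleftrightarrow> (\<exists>q\<in>{q. real_of_rat q < a}. u (k, q))" if "u \<in> good" for u
  proof
    assume "decode u (e k) < a"
    then obtain r where "r \<in> \<rat>" "decode u (e k) < r" "r < a" using Rats_dense_in_real by blast
    then obtain q where "decode u (e k) < real_of_rat q" "real_of_rat q < a" by (auto elim!: Rats_cases)
    then show "\<exists>q\<in>{q. real_of_rat q < a}. u (k, q)" using decode(2)[OF that] by (auto simp: decodes_def)
  next
    assume "\<exists>q\<in>{q. real_of_rat q < a}. u (k, q)"
    then show "decode u (e k) < a" using decode(2)[OF that] by (force simp: decodes_def)
  qed
  then have "{u \<in> space N. decode u (e k) < a} =
      (good \<inter> (\<Union>q\<in>{q. real_of_rat q < a}. {u. u (k, q)})) \<union> (if ?x0 (e k) < a then space N - good else {})"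
    unfolding N_space by (auto simp: decode_def)
  moreover have "\<dots> \<in> sets N"
    using good_sets coordinate_sets by (auto intro!: sets.Un sets.Int sets.countable_UN'' countableI_type)
  ultimately show "{u \<in> space N. decode u (e k) < a} \<in> sets N" by simp
qed

lemma decode_measurable: "decode \<in> measurable N (borel_sigma (character_topology A))"
  unfolding borel_sigma_def
proof (rule measurable_measure_of)
  show "{U. openin (character_topology A) U} \<subseteq> Pow (topspace (character_topology A))"
    by (auto dest: openin_subset)
  show "decode \<in> space N \<rightarrow> topspace (character_topology A)"
    using decode(1) C_D by (auto simp: topspace_character_topology)
  fix U assume "U \<in> {U. openin (character_topology A) U}"
  then obtain V :: "(nat \<Rightarrow> real) set" where V: "open V" "U = {x \<in> characters A. (\<lambda>k. x (e k)) \<in> V}"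
    using openin_character_topologyE[OF span] by blast
  have "(\<lambda>u k. decode u (e k)) \<in> borel_measurable N"
    by (rule measurable_coordinatewise_then_product) (rule decode_coordinate_measurable)
  then have "(\<lambda>u k. decode u (e k)) -` V \<inter> space N \<in> sets N"
    using V(1) by (intro measurable_sets[of _ _ borel]) auto
  moreover have "decode -` U \<inter> space N = (\<lambda>u k. decode u (e k)) -` V \<inter> space N"
    using V(2) decode(1) C_D by auto
  ultimately show "decode -` U \<inter> space N \<in> sets N" by simp
qed

end

context moment_model
begin

text \<open>It reads finitely many bits, so its integral is a value of \<open>\<Lambda>\<close>; the
  coordinate that it approximates depends on infinitely many bits. A false bit at j/n means that the
  coordinate is at least j/n.\<close>

definition staircase :: "nat \<Rightarrow> nat \<Rightarrow> (nat \<times> rat \<Rightarrow> bool) \<Rightarrow> real" where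
  "staircase k n u = (real (card {j \<in> {- (int n)\<^sup>2..<(int n)\<^sup>2}. \<not> u (k, of_int j / of_nat n)}) - (real n)\<^sup>2) / n"

lemma staircase_cylinder:
  "\<exists>J. finite J \<and> (\<forall>u v. (\<forall>j\<in>J. u j = v j) \<longrightarrow> staircase k n u = staircase k n v)"
proof (intro exI conjI allI impI)
  let ?J = "(\<lambda>j. (k, of_int j / of_nat n :: rat)) ` {- (int n)\<^sup>2..<(int n)\<^sup>2}"
  show "finite ?J" by simp
  fix u v :: "nat \<times> rat \<Rightarrow> bool" assume "\<forall>j\<in>?J. u j = v j"
  then have "{j \<in> {- (int n)\<^sup>2..<(int n)\<^sup>2}. \<not> u (k, of_int j / of_nat n)} =
    {j \<in> {- (int n)\<^sup>2..<(int n)\<^sup>2}. \<not> v (k, of_int j / of_nat n)}" by auto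
  then show "staircase k n u = staircase k n v" by (simp only: staircase_def)
qed

lemma staircase_integral:
  "integrable N (staircase k n)" "(\<integral>u. staircase k n u \<partial>N) = \<Lambda> (\<lambda>x. staircase k n (bits x))"
  "(\<lambda>x. staircase k n (bits x)) \<in> dominated C"
  "integrable N (\<lambda>u. (staircase k n u)\<^sup>2)"
  "(\<integral>u. (staircase k n u)\<^sup>2 \<partial>N) = \<Lambda> (\<lambda>x. (staircase k n (bits x))\<^sup>2)"
  "(\<lambda>x. (staircase k n (bits x))\<^sup>2) \<in> dominated C"
proof -
  obtain J where J: "finite J" "\<And>u v. \<forall>j\<in>J. u j = v j \<Longrightarrow> staircase k n u = staircase k n v"
    using staircase_cylinder[of k n] by blast
  show "integrable N (staircase k n)" "(\<integral>u. staircase k n u \<partial>N) = \<Lambda> (\<lambda>x. staircase k n (bits x))"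
    "(\<lambda>x. staircase k n (bits x)) \<in> dominated C"
    by (rule cylinder_integral[OF J(1)]; rule J(2); assumption)+
  have J2: "(staircase k n u)\<^sup>2 = (staircase k n v)\<^sup>2" if "\<forall>j\<in>J. u j = v j" for u v
    using J(2)[OF that] by simp
  show "integrable N (\<lambda>u. (staircase k n u)\<^sup>2)"
    "(\<integral>u. (staircase k n u)\<^sup>2 \<partial>N) = \<Lambda> (\<lambda>x. (staircase k n (bits x))\<^sup>2)"
    "(\<lambda>x. (staircase k n (bits x))\<^sup>2) \<in> dominated C"
    by (rule cylinder_integral[OF J(1), of "\<lambda>u. (staircase k n u)\<^sup>2"]; rule J2; assumption)+
qed

lemma real_of_rat_fraction: "real_of_rat (of_int j / of_nat n) = real_of_int j / real n"
  by (simp add: of_rat_divide)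

lemma staircase_decode:
  assumes "n > 0" "u \<in> good"
  shows "\<bar>staircase k n u - decode u (e k)\<bar> \<le> (1 + (decode u (e k))\<^sup>2) / n"
  unfolding staircase_def
proof (rule staircase_error(1)[OF assms(1)])
  fix j :: int
  have d: "decodes u (decode u)" by (rule decode(2)[OF assms(2)])
  show "\<not> u (k, rat_of_int j / rat_of_nat n)" if "real_of_int j / real n < decode u (e k)"
    using d that unfolding decodes_def real_of_rat_fraction[symmetric] by (meson not_le)
  show "real_of_int j / real n \<le> decode u (e k)" if "\<not> u (k, rat_of_int j / rat_of_nat n)"
    using d that unfolding decodes_def real_of_rat_fraction[symmetric] by (meson not_le)
qed

lemma staircase_bits:
  assumes "n > 0"
  shows "\<bar>staircase k n (bits x) - x (e k)\<bar> \<le> (1 + (x (e k))\<^sup>2) / n"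
    "(staircase k n (bits x))\<^sup>2 \<le> 2 * (x (e k))\<^sup>2 + 2"
  unfolding staircase_def
  by (rule staircase_error[OF assms]; simp add: bits_def real_of_rat_fraction)+

text \<open>The integral of a staircase is a value of \<open>\<Lambda>\<close>. It differs from the
  integral of the coordinate y and from \<open>L (e k)\<close> by at most a constant over n, because
  the pointwise error (1 + y^2)/n is integrable and is dominated by an element of \<open>A\<close>
  on \<open>C\<close>.\<close>

lemma moment_of_coordinate:
  shows "integrable N (\<lambda>u. decode u (e k))" "(\<integral>u. decode u (e k) \<partial>N) = L (e k)"
proof -
  let ?y = "\<lambda>u. decode u (e k)"
  let ?f = "\<one> \<oplus> e k \<otimes> e k"
  note Ld = linear_functionalD[OF L]
  have ek: "e k \<in> carrier A" by (rule spanning_closed[OF span])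
  then have f: "?f \<in> carrier A" by simp
  have xf: "x ?f = 1 + (x (e k))\<^sup>2" if "x \<in> C" for x
    using ek by (simp add: charactersD[OF C_D[OF that]] power2_eq_square)
  have my: "?y \<in> borel_measurable N" by (rule decode_coordinate_measurable)
  have lim: "AE u in N. (\<lambda>n. staircase k (Suc n) u) \<longlonglongrightarrow> ?y u"
    using AE_good
  proof eventually_elim
    case (elim u)
    have "(\<lambda>n. staircase k (Suc n) u - ?y u) \<longlonglongrightarrow> 0"
    proof (rule Lim_null_comparison)
      show "eventually (\<lambda>n. norm (staircase k (Suc n) u - ?y u) \<le> (1 + (?y u)\<^sup>2) * inverse (real (Suc n))) sequentially"
        using staircase_decode[OF _ elim, of "Suc _" k] by (intro always_eventually allI) (simp add: divide_inverse)
      show "(\<lambda>n. (1 + (?y u)\<^sup>2) * inverse (real (Suc n))) \<longlonglongrightarrow> 0"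
        using tendsto_mult[OF tendsto_const LIMSEQ_inverse_real_of_nat, of "1 + (?y u)\<^sup>2"] by simp
    qed
    then show ?case by (simp add: LIM_zero_cancel)
  qed
  define B where "B = L (2 \<odot> ?f)"
  have sq: "(\<integral>\<^sup>+u. ennreal ((staircase k (Suc n) u)\<^sup>2) \<partial>N) \<le> ennreal B" for n
  proof -
    have "(\<integral>\<^sup>+u. ennreal ((staircase k (Suc n) u)\<^sup>2) \<partial>N) = ennreal (\<Lambda> (\<lambda>x. (staircase k (Suc n) (bits x))\<^sup>2))"
      using staircase_integral(4,5)[of k "Suc n"] by (subst nn_integral_eq_integral) auto
    moreover have "\<Lambda> (\<lambda>x. (staircase k (Suc n) (bits x))\<^sup>2) \<le> \<Lambda> (\<lambda>x. x (2 \<odot> ?f))"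
    proof (rule \<Lambda>_mono[OF staircase_integral(6) eval_dom[OF smult_closed[OF f]]])
      fix x assume x: "x \<in> C"
      have "x (2 \<odot> ?f) = 2 * (1 + (x (e k))\<^sup>2)" using charactersD(2)[OF C_D[OF x] f] xf[OF x] by simp
      then show "(staircase k (Suc n) (bits x))\<^sup>2 \<le> x (2 \<odot> ?f)" using staircase_bits(2)[of "Suc n" k x] by simp
    qed
    ultimately show ?thesis using \<Lambda>_L[OF smult_closed[OF f], of 2] by (simp add: B_def ennreal_leI)
  qed
  \<comment> \<open>Fatou's lemma: the staircases converge almost everywhere, and the integrals of
    their squares are bounded by \<open>B\<close>.\<close>
  have "(\<integral>\<^sup>+u. ennreal ((?y u)\<^sup>2) \<partial>N) = (\<integral>\<^sup>+u. liminf (\<lambda>n. ennreal ((staircase k (Suc n) u)\<^sup>2)) \<partial>N)"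
  proof (rule nn_integral_cong_AE)
    show "AE u in N. ennreal ((?y u)\<^sup>2) = liminf (\<lambda>n. ennreal ((staircase k (Suc n) u)\<^sup>2))"
      using lim
    proof eventually_elim
      case (elim u)
      then have "(\<lambda>n. ennreal ((staircase k (Suc n) u)\<^sup>2)) \<longlonglongrightarrow> ennreal ((?y u)\<^sup>2)"
        by (intro tendsto_ennrealI tendsto_power)
      from lim_imp_Liminf[OF _ this] show ?case by simp
    qed
  qed
  also have "\<dots> \<le> liminf (\<lambda>n. \<integral>\<^sup>+u. ennreal ((staircase k (Suc n) u)\<^sup>2) \<partial>N)"
    by (rule nn_integral_liminf) (use borel_measurable_integrable[OF staircase_integral(4)] in measurable)
  also have "\<dots> \<le> ennreal B"
    using sq by (intro Liminf_le) auto
  finally have fin: "(\<integral>\<^sup>+u. ennreal ((?y u)\<^sup>2) \<partial>N) < \<infinity>" by (simp add: order.strict_trans1[of _ "ennreal B"])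
  have int2: "integrable N (\<lambda>u. (?y u)\<^sup>2)"
    using my fin by (intro integrableI_nonneg) auto
  have int1: "integrable N (\<lambda>u. 1 + (?y u)\<^sup>2)" using int2 by simp
  show int: "integrable N ?y"
  proof (rule Bochner_Integration.integrable_bound[OF int1 my], rule AE_I2)
    fix u
    have "2 * \<bar>?y u\<bar> \<le> 1 + (?y u)\<^sup>2" using zero_le_power2[of "\<bar>?y u\<bar> - 1"] by (simp add: power2_diff)
    then show "norm (?y u) \<le> norm (1 + (?y u)\<^sup>2)" by (simp add: abs_if split: if_splits)
  qed
  define c where "c = (\<integral>u. 1 + (?y u)\<^sup>2 \<partial>N)"
  have "\<bar>(\<integral>u. ?y u \<partial>N) - L (e k)\<bar> \<le> (c + L ?f) * inverse (real (Suc n))" for n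
  proof -
    let ?s = "staircase k (Suc n)"
    have "\<bar>(\<integral>u. ?s u \<partial>N) - (\<integral>u. ?y u \<partial>N)\<bar> = \<bar>\<integral>u. ?s u - ?y u \<partial>N\<bar>"
      using int staircase_integral(1)[of k "Suc n"] by simp
    also have "\<dots> \<le> (\<integral>u. \<bar>?s u - ?y u\<bar> \<partial>N)"
      by (rule integral_abs_bound)
    also have "\<dots> \<le> (\<integral>u. (1 + (?y u)\<^sup>2) * inverse (real (Suc n)) \<partial>N)"
    proof (rule integral_mono_AE)
      show "integrable N (\<lambda>u. \<bar>?s u - ?y u\<bar>)" using int staircase_integral(1)[of k "Suc n"] by auto
      show "integrable N (\<lambda>u. (1 + (?y u)\<^sup>2) * inverse (real (Suc n)))" using int1 by simp
      show "AE u in N. \<bar>?s u - ?y u\<bar> \<le> (1 + (?y u)\<^sup>2) * inverse (real (Suc n))"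
        using AE_good by eventually_elim (use staircase_decode[of "Suc n" _ k] in \<open>simp add: divide_inverse\<close>)
    qed
    also have "\<dots> = c * inverse (real (Suc n))" by (simp add: c_def)
    finally have 1: "\<bar>(\<integral>u. ?s u \<partial>N) - (\<integral>u. ?y u \<partial>N)\<bar> \<le> c * inverse (real (Suc n))" .
    have b: "\<bar>?s (bits x) - x (e k)\<bar> \<le> x (inverse (real (Suc n)) \<odot> ?f)" if x: "x \<in> C" for x
    proof -
      have "x (inverse (real (Suc n)) \<odot> ?f) = inverse (real (Suc n)) * (1 + (x (e k))\<^sup>2)"
        using charactersD(2)[OF C_D[OF x] f] xf[OF x] by simp
      then show ?thesis using staircase_bits(1)[of "Suc n" k x] by (simp add: divide_inverse mult.commute)
    qed
    let ?g = "inverse (real (Suc n)) \<odot> ?f"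
    have g: "?g \<in> carrier A" by (rule smult_closed[OF f])
    have "\<Lambda> (\<lambda>x. ?s (bits x)) \<le> \<Lambda> (\<lambda>x. x (e k \<oplus> ?g))"
    proof (rule \<Lambda>_mono[OF staircase_integral(3) eval_dom])
      fix x assume x: "x \<in> C"
      show "?s (bits x) \<le> x (e k \<oplus> ?g)" using b[OF x] charactersD(1)[OF C_D[OF x] ek g] by linarith
    qed (use ek g in simp)
    moreover have "\<Lambda> (\<lambda>x. x (e k \<ominus> ?g)) \<le> \<Lambda> (\<lambda>x. ?s (bits x))"
    proof (rule \<Lambda>_mono[OF eval_dom staircase_integral(3)])
      fix x assume x: "x \<in> C"
      have "x (e k \<ominus> ?g) = x (e k) - x ?g"
        using charactersD(1,6)[OF C_D[OF x]] ek g by (simp add: minus_eq)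
      then show "x (e k \<ominus> ?g) \<le> ?s (bits x)" using b[OF x] by linarith
    qed (use ek g in simp)
    ultimately have "\<bar>\<Lambda> (\<lambda>x. ?s (bits x)) - L (e k)\<bar> \<le> L ?g"
      using \<Lambda>_L[of "e k \<oplus> ?g"] \<Lambda>_L[of "e k \<ominus> ?g"] Ld(1)[OF ek g] Ld(5)[OF ek g] ek g by simp
    then have 2: "\<bar>(\<integral>u. ?s u \<partial>N) - L (e k)\<bar> \<le> L ?f * inverse (real (Suc n))"
      unfolding staircase_integral(2) using Ld(2)[OF f] by (simp add: mult.commute)
    show ?thesis using 1 2 by (simp add: distrib_right)
  qed
  moreover have "(\<lambda>n. (c + L ?f) * inverse (real (Suc n))) \<longlonglongrightarrow> (c + L ?f) * 0"
    by (intro tendsto_mult tendsto_const LIMSEQ_inverse_real_of_nat)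
  ultimately have "\<bar>(\<integral>u. ?y u \<partial>N) - L (e k)\<bar> \<le> (c + L ?f) * 0"
    by (intro LIMSEQ_le_const) auto
  then show "(\<integral>u. ?y u \<partial>N) = L (e k)" by simp
qed

theorem representing_measure:
  "\<exists>\<mu>\<in>moment_measures A. (\<forall>f\<in>carrier A. L f = (\<integral>x. x f \<partial>\<mu>)) \<and> (AE x in \<mu>. x \<in> C)"
proof -
  let ?M = "borel_sigma (character_topology A)"
  let ?\<mu> = "distr N ?M decode"
  have *: "integrable N (\<lambda>u. decode u f) \<and> (\<integral>u. decode u f \<partial>N) = L f" if "f \<in> carrier A" for f
    using span that
  proof (induction rule: spanning_induct)
    case (base k)
    show ?case using moment_of_coordinate by blast
  next
    case (add f g)
    then show ?case
      using linear_functionalD(1)[OF L] by (simp add: charactersD[OF C_D[OF decode(1)]])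
  next
    case (smult c f)
    then show ?case
      using linear_functionalD(2)[OF L] by (simp add: charactersD[OF C_D[OF decode(1)]])
  qed
  have "?\<mu> \<in> moment_measures A"
    unfolding moment_measures_def
    using * by (auto simp: integrable_distr_eq[OF decode_measurable character_evaluation_measurable])
  moreover have "L f = (\<integral>x. x f \<partial>?\<mu>)" if "f \<in> carrier A" for f
    using *[OF that] by (simp add: integral_distr[OF decode_measurable character_evaluation_measurable[OF that]])
  moreover have "AE x in ?\<mu>. x \<in> C"
  proof (subst AE_distr_iff[OF decode_measurable])
    have "characters A - C \<in> sets ?M"
      using openin_borel_sigma[OF openin_complement_nonneg_set[OF S]] by (simp add: C)
    then have "space ?M - (characters A - C) \<in> sets ?M" by blast
    moreover have "space ?M - (characters A - C) = {x \<in> space ?M. x \<in> C}"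
      unfolding space_borel_sigma by blast
    ultimately show "{x \<in> space ?M. x \<in> C} \<in> sets ?M" by simp
  qed (use decode(1) in simp)
  ultimately show ?thesis by blast
qed

end

context real_algebra
begin

text \<open>
  A positive extension of \<open>L\<close> to the functions dominated by \<open>A\<close> assigns a mass to every Boolean
  combination of conditions \<open>x (e k) \<le> q\<close>. This finitely additive mass on the clopen subsets of a Cantor space
  is countably additive by compactness, and almost all of its points are cuts that define characters.
\<close>

theorem haviland:
  assumes e: "spanning e" and S: "S \<subseteq> carrier A" and L: "linear_functional A L"
    and pos: "\<And>f. f \<in> carrier A \<Longrightarrow> (\<And>x. x \<in> nonneg_set A S \<Longrightarrow> 0 \<le> x f) \<Longrightarrow> 0 \<le> L f"
  shows "\<exists>\<mu>\<in>moment_measures A. (\<forall>f\<in>carrier A. L f = (\<integral>x. x f \<partial>\<mu>)) \<and> (AE x in \<mu>. x \<in> nonneg_set A S)"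
proof (cases "nonneg_set A S = {}")
  \<comment> \<open>Without points in the set, \<open>pos\<close> applies to f and to its negative,
    so \<open>L\<close> vanishes on \<open>A\<close> and the zero measure represents it.\<close>
  case True
  let ?\<mu> = "null_measure (borel_sigma (character_topology A))"
  have "L f = 0" if "f \<in> carrier A" for f
    using pos[of f] pos[of "\<ominus> f"] that True linear_functionalD(4)[OF L that] by simp
  moreover have i: "integrable ?\<mu> (\<lambda>x. x f) \<and> (\<integral>x. x f \<partial>?\<mu>) = 0" if "f \<in> carrier A" for f
  proof -
    have m: "(\<lambda>x. x f) \<in> borel_measurable ?\<mu>"
      using character_evaluation_measurable[OF that] by (simp add: measurable_def)
    have ae: "AE x in ?\<mu>. x f = 0" by (rule AE_I[of _ _ "space ?\<mu>"]) auto
    then have "integrable ?\<mu> (\<lambda>x. x f)" using m by (subst integrable_cong_AE[of _ _ "\<lambda>_. 0"]) auto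
    moreover have "(\<integral>x. x f \<partial>?\<mu>) = (\<integral>x. 0 \<partial>?\<mu>)" using m ae by (intro integral_cong_AE) auto
    ultimately show ?thesis by simp
  qed
  moreover have "AE x in ?\<mu>. x \<in> nonneg_set A S" by (rule AE_I[of _ _ "space ?\<mu>"]) auto
  moreover have "?\<mu> \<in> moment_measures A" unfolding moment_measures_def using i by simp
  ultimately show ?thesis by (intro bexI[of _ ?\<mu>]) auto
next
  case False
  define C where "C = nonneg_set A S"
  have C: "C \<subseteq> characters A" by (auto simp: C_def nonneg_set_def)
  define bits where "bits = (\<lambda>x (k, q). x (e k) \<le> real_of_rat q)"
  show ?thesis
  proof (rule positive_extension[OF C L])
    show "0 \<le> L f" if "f \<in> carrier A" "\<And>x. x \<in> C \<Longrightarrow> 0 \<le> x f" for f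
      using pos[OF that(1)] that(2) by (simp add: C_def)
    fix \<Lambda> assume \<Lambda>: "\<And>g h. g \<in> dominated C \<Longrightarrow> h \<in> dominated C \<Longrightarrow> \<Lambda> (\<lambda>x. g x + h x) = \<Lambda> g + \<Lambda> h"
      "\<And>c g. g \<in> dominated C \<Longrightarrow> \<Lambda> (\<lambda>x. c * g x) = c * \<Lambda> g"
      "\<And>g. g \<in> dominated C \<Longrightarrow> (\<And>x. x \<in> C \<Longrightarrow> 0 \<le> g x) \<Longrightarrow> 0 \<le> \<Lambda> g"
      "\<And>f. f \<in> carrier A \<Longrightarrow> \<Lambda> (\<lambda>x. x f) = L f"
    have dom: "(\<lambda>x. indicator B (bits x)) \<in> dominated C" for B
      by (rule bounded_dominated[OF C, of _ 1]) (auto simp: indicator_def)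
    let ?m = "\<lambda>B. \<Lambda> (\<lambda>x. indicator B (bits x))"
    show ?thesis
    proof (rule finitely_additive_clopen_extension[of ?m])
      show "0 \<le> ?m B" for B by (rule \<Lambda>(3)[OF dom]) simp
      show "?m (B \<union> B') = ?m B + ?m B'" if "B \<inter> B' = {}" for B B'
      proof -
        have "(\<lambda>x. indicator (B \<union> B') (bits x)) = (\<lambda>x. indicator B (bits x) + indicator B' (bits x) :: real)"
          using that by (intro ext) (auto simp: indicator_def)
        then show ?thesis using \<Lambda>(1)[OF dom dom] by simp
      qed
      fix N assume N: "space N = UNIV" "\<And>B. open B \<Longrightarrow> closed B \<Longrightarrow> B \<in> sets N"
        "\<And>B. open B \<Longrightarrow> closed B \<Longrightarrow> emeasure N B = ennreal (?m B)"
      have "moment_model A e S C L \<Lambda> N"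
      proof (rule moment_model.intro[OF real_algebra_axioms moment_model_axioms.intro])
        show "spanning e" "S \<subseteq> carrier A" "linear_functional A L" "space N = UNIV" by fact+
        show "C = nonneg_set A S" "C \<noteq> {}" using False by (simp_all add: C_def)
        show "emeasure N B = ennreal (\<Lambda> (\<lambda>x. indicat_real B (\<lambda>(k, q). x (e k) \<le> real_of_rat q)))"
          if "open B" "closed B" for B
          using N(3)[OF that] unfolding bits_def .
      qed (fact \<Lambda> N(2))+
      from moment_model.representing_measure[OF this] show ?thesis unfolding C_def .
    qed
  qed
qed

section \<open>Supports and almost sure statements\<close>

lemma measure_support_subset:
  assumes S: "S \<subseteq> carrier A" and \<mu>: "\<mu> \<in> moment_measures A" and ae: "AE x in \<mu>. x \<in> nonneg_set A S"
  shows "measure_support (character_topology A) \<mu> \<subseteq> nonneg_set A S"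
proof
  let ?U = "characters A - nonneg_set A S"
  fix x assume x: "x \<in> measure_support (character_topology A) \<mu>"
  show "x \<in> nonneg_set A S"
  proof (rule ccontr)
    assume "x \<notin> nonneg_set A S"
    moreover have "x \<in> characters A" using x by (simp add: measure_support_def topspace_character_topology)
    ultimately have "emeasure \<mu> ?U > 0"
      using x openin_complement_nonneg_set[OF S] by (auto simp: measure_support_def)
    moreover have "?U \<in> null_sets \<mu>"
    proof (rule AE_iff_null_sets[THEN iffD2])
      show "?U \<in> sets \<mu>"
        using openin_borel_sigma[OF openin_complement_nonneg_set[OF S]] \<mu> by (simp add: moment_measures_def)
      show "AE x in \<mu>. x \<notin> ?U" using ae by eventually_elim simp
    qed
    ultimately show False by (simp add: null_sets_def)
  qed
qed

lemma moment_measure_space: "\<mu> \<in> moment_measures A \<Longrightarrow> space \<mu> = characters A"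
  using sets_eq_imp_space_eq[of \<mu> "borel_sigma (character_topology A)"] space_borel_sigma
  by (simp add: moment_measures_def)

text \<open>The complement of the support is null although it may be an uncountable union of null
  sets: a countable basis for sequences of real numbers covers it by countably many of them.\<close>

lemma AE_measure_support:
  assumes e: "spanning e" and S: "S \<subseteq> carrier A" and \<mu>: "\<mu> \<in> moment_measures A"
    and supp: "measure_support (character_topology A) \<mu> \<subseteq> nonneg_set A S"
  shows "AE x in \<mu>. x \<in> nonneg_set A S"
proof -
  obtain \<B> :: "(nat \<Rightarrow> real) set set" where \<B>: "countable \<B>" "topological_basis \<B>"
    using ex_countable_basis by blast
  let ?pre = "\<lambda>V. {x \<in> characters A. (\<lambda>k. x (e k)) \<in> V}"
  define \<N> where "\<N> = {V \<in> \<B>. emeasure \<mu> (?pre V) = 0 \<and> ?pre V \<in> sets \<mu>}"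
  have "(\<Union>V\<in>\<N>. ?pre V) \<in> null_sets \<mu>"
    using \<B>(1) by (intro null_sets_UN') (auto simp: \<N>_def null_sets_def intro: countable_subset)
  moreover have "{x \<in> space \<mu>. x \<notin> nonneg_set A S} \<subseteq> (\<Union>V\<in>\<N>. ?pre V)"
  proof
    fix x assume "x \<in> {x \<in> space \<mu>. x \<notin> nonneg_set A S}"
    then have x: "x \<in> characters A" "x \<notin> measure_support (character_topology A) \<mu>"
      using supp moment_measure_space[OF \<mu>] by auto
    then obtain U where U: "openin (character_topology A) U" "x \<in> U" "\<not> emeasure \<mu> U > 0"
      by (auto simp: measure_support_def topspace_character_topology)
    obtain V where V: "open V" "U = ?pre V" using openin_character_topologyE[OF e U(1)] by blast
    have "(\<lambda>k. x (e k)) \<in> V" using U(2) V(2) by simp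
    then obtain V' where V': "V' \<in> \<B>" "(\<lambda>k. x (e k)) \<in> V'" "V' \<subseteq> V"
      using topological_basisE[OF \<B>(2) V(1)] by metis
    have "open V'" using \<B>(2) V'(1) by (simp add: topological_basis_open)
    have Us: "U \<in> sets \<mu>" using openin_borel_sigma[OF U(1)] \<mu> by (simp add: moment_measures_def)
    have "?pre V' \<in> sets \<mu>"
    proof -
      have "(\<lambda>x k. x (e k)) \<in> borel_measurable \<mu>"
        by (rule measurable_coordinatewise_then_product)
          (use \<mu> spanning_closed[OF e] in \<open>auto simp: moment_measures_def intro: borel_measurable_integrable\<close>)
      then have "(\<lambda>x k. x (e k)) -` V' \<inter> space \<mu> \<in> sets \<mu>"
        using \<open>open V'\<close> by (intro measurable_sets[of _ _ borel]) auto
      moreover have "(\<lambda>x k. x (e k)) -` V' \<inter> space \<mu> = ?pre V'"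
        using moment_measure_space[OF \<mu>] by auto
      ultimately show ?thesis by simp
    qed
    moreover have "emeasure \<mu> (?pre V') \<le> emeasure \<mu> U"
      using V' V(2) Us by (intro emeasure_mono) auto
    then have "emeasure \<mu> (?pre V') = 0" using U(3) by (simp add: not_less)
    ultimately have "V' \<in> \<N>" using V'(1) by (simp add: \<N>_def)
    then show "x \<in> (\<Union>V\<in>\<N>. ?pre V)" using V'(2) x(1) by blast
  qed
  ultimately show ?thesis by (rule AE_I')
qed

definition nonneg_on :: "('a \<Rightarrow> real) set \<Rightarrow> 'a \<Rightarrow> bool" where
  "nonneg_on C f \<longleftrightarrow> f \<in> carrier A \<and> (\<forall>x\<in>C. 0 \<le> x f)"

text \<open>The common form of both moment properties without measures. The preorder determines the
  functionals and \<open>C\<close> the test elements, and the two vary independently.\<close>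

definition positive_on :: "('a \<Rightarrow> real) set \<Rightarrow> 'a set \<Rightarrow> bool" where
  "positive_on C T \<longleftrightarrow> (\<forall>L f. positive_functional A T L \<and> nonneg_on C f \<longrightarrow> 0 \<le> L f)"

lemma positive_on_measure:
  assumes "spanning e" "S \<subseteq> carrier A" "positive_on (nonneg_set A S) T" "positive_functional A T L"
  shows "\<exists>\<mu>\<in>moment_measures A. (\<forall>f\<in>carrier A. L f = (\<integral>x. x f \<partial>\<mu>)) \<and> (AE x in \<mu>. x \<in> nonneg_set A S)"
proof (rule haviland[OF assms(1,2)])
  show "linear_functional A L" using assms(4) by (simp add: positive_functional_def)
  fix f assume "f \<in> carrier A" "\<And>x. x \<in> nonneg_set A S \<Longrightarrow> 0 \<le> x f"
  then have "nonneg_on (nonneg_set A S) f" by (simp add: nonneg_on_def)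
  then show "0 \<le> L f" using assms(3,4) unfolding positive_on_def by blast
qed

lemma nonneg_set_empty: "nonneg_set A {} = characters A"
  by (simp add: nonneg_set_def)

lemma MP_iff_positive_on:
  assumes e: "spanning e"
  shows "MP A T \<longleftrightarrow> positive_on (characters A) T"
proof
  assume MP: "MP A T"
  show "positive_on (characters A) T"
    unfolding positive_on_def
  proof (intro allI impI, elim conjE)
    fix L f assume L: "positive_functional A T L" and f: "nonneg_on (characters A) f"
    obtain \<mu> where \<mu>: "\<mu> \<in> moment_measures A" "\<forall>f\<in>carrier A. L f = (\<integral>x. x f \<partial>\<mu>)"
      using MP L unfolding MP_def by blast
    have "0 \<le> (\<integral>x. x f \<partial>\<mu>)"
      using f moment_measure_space[OF \<mu>(1)] by (intro Bochner_Integration.integral_nonneg) (auto simp: nonneg_on_def)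
    then show "0 \<le> L f" using \<mu>(2) f by (simp add: nonneg_on_def)
  qed
next
  assume p: "positive_on (characters A) T"
  show "MP A T"
    unfolding MP_def
  proof (intro allI impI)
    fix L assume "positive_functional A T L"
    from positive_on_measure[OF e empty_subsetI, unfolded nonneg_set_empty, OF p this]
    show "\<exists>\<mu>\<in>moment_measures A. \<forall>f\<in>carrier A. L f = (\<integral>x. x f \<partial>\<mu>)" by blast
  qed
qed

lemma SMP_iff_positive_on:
  assumes e: "spanning e" and T: "T \<subseteq> carrier A"
  shows "SMP A T \<longleftrightarrow> positive_on (nonneg_set A T) T"
proof
  assume SMP: "SMP A T"
  show "positive_on (nonneg_set A T) T"
    unfolding positive_on_def
  proof (intro allI impI, elim conjE)
    fix L f assume L: "positive_functional A T L" and f: "nonneg_on (nonneg_set A T) f"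
    obtain \<mu> where \<mu>: "\<mu> \<in> moment_measures A" "\<forall>f\<in>carrier A. L f = (\<integral>x. x f \<partial>\<mu>)"
      "measure_support (character_topology A) \<mu> \<subseteq> nonneg_set A T"
      using SMP L unfolding SMP_def by blast
    have "AE x in \<mu>. 0 \<le> x f"
      using AE_measure_support[OF e T \<mu>(1,3)] by eventually_elim (use f in \<open>simp add: nonneg_on_def\<close>)
    then have "0 \<le> (\<integral>x. x f \<partial>\<mu>)" by (rule integral_nonneg_AE)
    then show "0 \<le> L f" using \<mu>(2) f by (simp add: nonneg_on_def)
  qed
next
  assume p: "positive_on (nonneg_set A T) T"
  show "SMP A T"
    unfolding SMP_def
  proof (intro allI impI)
    fix L assume "positive_functional A T L"
    from positive_on_measure[OF e T p this] obtain \<mu> where \<mu>: "\<mu> \<in> moment_measures A"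
      "\<forall>f\<in>carrier A. L f = (\<integral>x. x f \<partial>\<mu>)" "AE x in \<mu>. x \<in> nonneg_set A T" by blast
    then show "\<exists>\<mu>\<in>moment_measures A. (\<forall>f\<in>carrier A. L f = (\<integral>x. x f \<partial>\<mu>)) \<and>
        measure_support (character_topology A) \<mu> \<subseteq> nonneg_set A T"
      using measure_support_subset[OF T \<mu>(1,3)] by blast
  qed
qed

text \<open>The squares of the \<open>d i\<close> have integral 0 under the representing measure,
  which is thus carried by their common zeros; nonnegativity of \<open>f\<close> there gives a
  nonnegative integral.\<close>

lemma positive_on_restrict:
  assumes e: "spanning e" and S: "S \<subseteq> carrier A" and T: "positive_on (nonneg_set A S) T"
    and L: "positive_functional A T L" and d: "\<And>i::'n::finite. d i \<in> carrier A" "\<And>i. L (d i \<otimes> d i) = 0"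
    and f: "nonneg_on {x \<in> nonneg_set A S. \<forall>i. x (d i) = 0} f"
  shows "0 \<le> L f"
proof -
  obtain \<mu> where \<mu>: "\<mu> \<in> moment_measures A" "\<forall>f\<in>carrier A. L f = (\<integral>x. x f \<partial>\<mu>)"
    "AE x in \<mu>. x \<in> nonneg_set A S"
    using positive_on_measure[OF e S T L] by blast
  have "AE x in \<mu>. x (d i) = 0" for i
  proof -
    have dd: "d i \<otimes> d i \<in> carrier A" using d(1) by simp
    have sp: "AE x in \<mu>. x \<in> characters A" using moment_measure_space[OF \<mu>(1)] by (intro AE_I2) simp
    have sq: "AE x in \<mu>. 0 \<le> x (d i \<otimes> d i)"
      using sp by eventually_elim (simp add: charactersD(3)[OF _ d(1) d(1)])
    have "(\<integral>x. x (d i \<otimes> d i) \<partial>\<mu>) = 0" using \<mu>(2) dd d(2)[of i] by metis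
    moreover have "integrable \<mu> (\<lambda>x. x (d i \<otimes> d i))" using \<mu>(1) dd by (simp add: moment_measures_def)
    ultimately have "AE x in \<mu>. x (d i \<otimes> d i) = 0"
      using integral_nonneg_eq_0_iff_AE[of \<mu> "\<lambda>x. x (d i \<otimes> d i)"] sq by simp
    then show ?thesis using sp by eventually_elim (simp add: charactersD(3)[OF _ d(1) d(1)])
  qed
  then have "AE x in \<mu>. \<forall>i. x (d i) = 0" by (simp add: AE_all_countable)
  then have "AE x in \<mu>. 0 \<le> x f"
    using \<mu>(3) by eventually_elim (use f in \<open>simp add: nonneg_on_def\<close>)
  then have "0 \<le> (\<integral>x. x f \<partial>\<mu>)" by (rule integral_nonneg_AE)
  then show ?thesis using \<mu>(2) f by (simp add: nonneg_on_def)
qed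

end

section \<open>Bounds for positive functionals\<close>

lemma psd_form_discriminant:
  fixes x y z :: real
  assumes "\<And>a b. 0 \<le> a * a * x + 2 * a * b * y + b * b * z"
  shows "y\<^sup>2 \<le> x * z"
proof (cases "z = 0")
  case True
  have "y = 0"
  proof (rule ccontr)
    assume "y \<noteq> 0"
    \<comment> \<open>With these arguments the form takes the value -1.\<close>
    then show False using assms[of 1 "- (x + 1) / (2 * y)"] True by (simp add: field_simps)
  qed
  then show ?thesis using True by simp
next
  case False
  then have z: "0 < z" using assms[of 0 1] by simp
  have "0 \<le> z * (x * z - y\<^sup>2)" using assms[of z "- y"] by (simp add: algebra_simps power2_eq_square)
  then show ?thesis using z by (simp add: zero_le_mult_iff)
qed

text \<open>Consecutive quotients of a logarithmically convex sequence increase. A first quotient q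
  > r would give growth at least like q^n, eventually above K r^n.\<close>

lemma log_convex_geometric_bound:
  fixes a :: "nat \<Rightarrow> real"
  assumes nn: "\<And>n. 0 \<le> a n" and conv: "\<And>n. (a (Suc n))\<^sup>2 \<le> a n * a (Suc (Suc n))"
    and bound: "\<And>n. a n \<le> K * r ^ n" and r: "0 < r"
  shows "a 1 \<le> r * a 0"
proof (rule ccontr)
  assume neg: "\<not> ?thesis"
  have a0: "0 < a 0"
  proof (rule ccontr)
    assume "\<not> 0 < a 0"
    then have "a 0 = 0" using nn[of 0] by simp
    then show False using conv[of 0] neg by simp
  qed
  define q where "q = a 1 / a 0"
  have q: "r < q" using neg a0 by (simp add: q_def field_simps)
  have "0 < a n \<and> q * a n \<le> a (Suc n)" for n
  proof (induction n)
    case 0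
    show ?case using a0 by (simp add: q_def)
  next
    case (Suc n)
    have "0 < q * a n" using Suc q r by simp
    then have p: "0 < a (Suc n)" using Suc by linarith
    have "a n * (q * a (Suc n)) \<le> (a (Suc n))\<^sup>2"
      using mult_right_mono[of "q * a n" "a (Suc n)" "a (Suc n)"] Suc p by (simp add: power2_eq_square mult_ac)
    also have "\<dots> \<le> a n * a (Suc (Suc n))" by (rule conv)
    finally show ?case using p Suc by simp
  qed
  note step = this
  have low: "q ^ n * a 0 \<le> a n" for n
  proof (induction n)
    case (Suc n)
    have "q ^ Suc n * a 0 = q * (q ^ n * a 0)" by simp
    also have "\<dots> \<le> q * a n" using Suc q r by (intro mult_left_mono) auto
    also have "\<dots> \<le> a (Suc n)" using step[of n] by simp
    finally show ?case .
  qed simp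
  obtain n where n: "K / a 0 < (q / r) ^ n" using real_arch_pow[of "q / r" "K / a 0"] q r by auto
  have "K * r ^ n < q ^ n * a 0" using n a0 r by (simp add: field_simps power_divide)
  then show False using low[of n] bound[of n] by linarith
qed

context real_algebra
begin

lemma positive_functionalD:
  assumes "positive_functional A T L"
  shows "linear_functional A L" "t \<in> T \<Longrightarrow> 0 \<le> L t"
  using assms by (auto simp: positive_functional_def)

lemma functional_Cauchy_Schwarz:
  assumes T: "preordering A T" and L: "positive_functional A T L" and t: "t \<in> T"
    and f: "f \<in> carrier A" and g: "g \<in> carrier A"
  shows "(L (f \<otimes> g \<otimes> t))\<^sup>2 \<le> L (f \<otimes> f \<otimes> t) * L (g \<otimes> g \<otimes> t)"
proof (rule psd_form_discriminant)
  note LD = linear_functionalD[OF positive_functionalD(1)[OF L]]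
  have tc: "t \<in> carrier A" using preorderingD(1)[OF T t] .
  fix a b :: real
  define F G where "F = a \<odot> f" and "G = b \<odot> g"
  have FG: "F \<in> carrier A" "G \<in> carrier A" using f g by (simp_all add: F_def G_def smult_closed)
  have "(F \<oplus> G) \<otimes> (F \<oplus> G) \<otimes> t \<in> T" using FG t by (intro preorderingD(2,5)[OF T]) auto
  then have "0 \<le> L ((F \<oplus> G) \<otimes> (F \<oplus> G) \<otimes> t)" by (rule positive_functionalD(2)[OF L])
  also have "(F \<oplus> G) \<otimes> (F \<oplus> G) \<otimes> t = F \<otimes> F \<otimes> t \<oplus> (F \<otimes> G \<otimes> t \<oplus> F \<otimes> G \<otimes> t) \<oplus> G \<otimes> G \<otimes> t"
    using FG tc by algebra
  also have "L \<dots> = L (F \<otimes> F \<otimes> t) + 2 * L (F \<otimes> G \<otimes> t) + L (G \<otimes> G \<otimes> t)"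
    using FG tc by (simp add: LD(1))
  also have "\<dots> = a * a * L (f \<otimes> f \<otimes> t) + 2 * a * b * L (f \<otimes> g \<otimes> t) + b * b * L (g \<otimes> g \<otimes> t)"
    using f g tc by (simp add: F_def G_def smult_mult smult_closed LD(2))
  finally show "0 \<le> \<dots>" .
qed

lemma positive_functional_null:
  assumes T: "preordering A T" and L: "positive_functional A T L" and f: "f \<in> carrier A" and 0: "L (f \<otimes> f) = 0"
    and g: "g \<in> carrier A"
  shows "L (f \<otimes> g) = 0"
  using functional_Cauchy_Schwarz[OF T L preorderingD(4)[OF T] f g] f g 0 by simp

section \<open>Bounds from the Positivstellensatz\<close>

lemma finitely_generated_preorderingI:
  assumes "finite G" "preordering A T" "G \<subseteq> T" "\<And>P. preordering A P \<Longrightarrow> G \<subseteq> P \<Longrightarrow> T \<subseteq> P"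
  shows "finitely_generated_preordering A T"
  unfolding finitely_generated_preordering_def
proof (intro exI conjI)
  show "G \<subseteq> carrier A" using assms(2,3) preorderingD(1) by blast
  show "T = \<Inter>{P. preordering A P \<and> G \<subseteq> P}" using assms(2-4) by blast
qed (rule assms(1))

lemma finitely_generated_adjoin:
  assumes "finitely_generated_preordering A T" and a: "a \<in> carrier A"
  shows "finitely_generated_preordering A (adjoin T a)"
proof (rule finitely_generated_preorderingE[OF assms(1)])
  fix G assume G: "finite G" "G \<subseteq> T" "preordering A T" "\<And>P. preordering A P \<Longrightarrow> G \<subseteq> P \<Longrightarrow> T \<subseteq> P"
  note adj = preordering_adjoin[OF G(3) a]
  show ?thesis
  proof (rule finitely_generated_preorderingI[of "insert a G"])
    show "insert a G \<subseteq> adjoin T a" using adj(2,3) G(2) by blast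
    fix P assume P: "preordering A P" "insert a G \<subseteq> P"
    then have TP: "T \<subseteq> P" using G(4) by simp
    show "adjoin T a \<subseteq> P"
    proof
      fix y assume "y \<in> adjoin T a"
      then obtain s t where y: "y = s \<oplus> a \<otimes> t" "s \<in> T" "t \<in> T" unfolding adjoin_def by blast
      show "y \<in> P" unfolding y(1) by (intro preorderingD(2,3)[OF P(1)]) (use P(2) TP y in auto)
    qed
  qed (use G(1) adj(1) in auto)
qed

text \<open>
  The Positivstellensatz provides \<open>-1 = s + (h\<^sup>2 - c\<^sup>2) t\<close>, hence \<open>L (h\<^bsup>2n\<^esup> u)\<close> grows at most
  like \<open>c\<^bsup>2n\<^esup>\<close>. By the Cauchy-Schwarz inequality this sequence is logarithmically convex, so the bound on
  its growth also bounds its first quotient.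
\<close>

theorem functional_bound:
  assumes fg: "finitely_generated_algebra A" "finitely_generated_preordering A T"
    and h: "h \<in> carrier A" and c: "0 < c" "\<forall>x\<in>nonneg_set A T. \<bar>x h\<bar> < c"
    and L: "positive_functional A T L" and u: "u \<in> T"
  shows "L (h \<otimes> h \<otimes> u) \<le> c\<^sup>2 * L u"
proof -
  have T: "preordering A T" by (rule finitely_generated_preorderingE[OF fg(2)])
  note D = preorderingD[OF T] and LD = linear_functionalD[OF positive_functionalD(1)[OF L]]
    and Lp = positive_functionalD(2)[OF L]
  define k where "k = c\<^sup>2 \<odot> \<one>"
  define b where "b = h \<otimes> h \<ominus> k"
  have kc: "k \<in> carrier A" and bc: "b \<in> carrier A" using h by (simp_all add: k_def b_def smult_closed)
  note adj = preordering_adjoin[OF T bc]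
  \<comment> \<open>\<open>b\<close> is strictly negative on K(T), because the bound
    \<open>c\<close> is strict.\<close>
  have "nonneg_set A (adjoin T b) = {}"
  proof (rule equals0I)
    fix x assume x: "x \<in> nonneg_set A (adjoin T b)"
    then have xc: "x \<in> characters A" and xT: "x \<in> nonneg_set A T" and xb: "0 \<le> x b"
      using adj(2,3) by (auto simp: nonneg_set_def)
    have "x b = (x h)\<^sup>2 - c\<^sup>2"
      using h kc by (simp add: b_def minus_eq charactersD[OF xc] power2_eq_square) (simp add: k_def charactersD[OF xc] power2_eq_square)
    moreover have "(x h)\<^sup>2 < c\<^sup>2" using bspec[OF c(2) xT] c(1) by (simp add: abs_square_less_1 power2_strict_mono)
    ultimately show False using xb by simp
  qed
  from positivstellensatz[OF fg(1) finitely_generated_adjoin[OF fg(2) bc] this]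
  obtain s t where st: "s \<in> T" "t \<in> T" "\<ominus> \<one> = s \<oplus> b \<otimes> t" unfolding adjoin_def by blast
  have stc: "s \<in> carrier A" "t \<in> carrier A" using D(1) st by simp_all
  define w where "w n = ((\<lambda>v. h \<otimes> h \<otimes> v) ^^ n) u" for n
  have wS: "w (Suc n) = h \<otimes> h \<otimes> w n" for n by (simp add: w_def)
  have w0: "w 0 = u" by (simp add: w_def)
  have wT: "w n \<in> T" for n by (induction n) (use u D(2,5) h in \<open>auto simp: w0 wS\<close>)
  have wc: "w n \<in> carrier A" for n using D(1)[OF wT] .
  define b' where "b' n = L (t \<otimes> w n)" for n
  have b'0: "0 \<le> b' n" for n unfolding b'_def using D(2) st wT by (intro Lp) auto
  \<comment> \<open>The certificate multiplied by \<open>w n\<close>. Since the left side is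
    nonnegative, \<open>b'\<close> grows at most geometrically, and then \<open>b'\<close> bounds
    the left side.\<close>
  have main: "L (w n) \<le> c\<^sup>2 * b' n - b' (Suc n)" for n
  proof -
    have "w n = \<ominus> (s \<oplus> b \<otimes> t) \<otimes> w n" unfolding st(3)[symmetric] using wc[of n] by simp
    also have "\<dots> = k \<otimes> (t \<otimes> w n) \<ominus> t \<otimes> (h \<otimes> h \<otimes> w n) \<ominus> s \<otimes> w n"
      unfolding b_def using stc h kc wc[of n] by algebra
    also have "k \<otimes> (t \<otimes> w n) = c\<^sup>2 \<odot> (t \<otimes> w n)" using stc wc[of n] by (simp add: k_def smult_mult)
    finally have "L (w n) = L (c\<^sup>2 \<odot> (t \<otimes> w n) \<ominus> t \<otimes> (h \<otimes> h \<otimes> w n) \<ominus> s \<otimes> w n)" by simp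
    also have "\<dots> = c\<^sup>2 * b' n - b' (Suc n) - L (s \<otimes> w n)"
      using stc h wc[of n] by (simp add: LD(2,5) smult_closed b'_def wS)
    finally show ?thesis using Lp[OF D(2)[OF st(1) wT[of n]]] by simp
  qed
  have a0: "0 \<le> L (w n)" for n using Lp[OF wT] .
  have b'b: "b' n \<le> b' 0 * (c\<^sup>2) ^ n" for n
  proof (induction n)
    case (Suc n)
    have "b' (Suc n) \<le> c\<^sup>2 * b' n" using main[of n] a0[of n] by linarith
    also have "\<dots> \<le> c\<^sup>2 * (b' 0 * (c\<^sup>2) ^ n)" using Suc by (intro mult_left_mono) auto
    finally show ?case by (simp add: mult_ac)
  qed simp
  have "L (w 1) \<le> c\<^sup>2 * L (w 0)"
  proof (rule log_convex_geometric_bound)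
    show "0 \<le> L (w n)" for n by (rule a0)
    show "(L (w (Suc n)))\<^sup>2 \<le> L (w n) * L (w (Suc (Suc n)))" for n
      using functional_Cauchy_Schwarz[OF T L wT[of n] one_closed, of "h \<otimes> h"] h wc[of n] by (simp add: wS m_assoc)
    show "L (w n) \<le> c\<^sup>2 * b' 0 * (c\<^sup>2) ^ n" for n
    proof -
      have "L (w n) \<le> c\<^sup>2 * b' n" using main[of n] b'0[of "Suc n"] by linarith
      also have "\<dots> \<le> c\<^sup>2 * (b' 0 * (c\<^sup>2) ^ n)" using b'b by (intro mult_left_mono) auto
      finally show ?thesis by (simp add: mult_ac)
    qed
  qed (use c in simp)
  then show ?thesis using wS[of 0] w0 by simp
qed

text \<open>Every c > 0 bounds \<open>f\<close> strictly on K(T), so L(f^2) \<le> c^2 L(1) for all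
  of them and L(f^2) = 0. The Cauchy-Schwarz inequality gives L(f) = 0.\<close>

lemma functional_vanishes:
  assumes fg: "finitely_generated_algebra A" "finitely_generated_preordering A T"
    and f: "f \<in> carrier A" "\<And>x. x \<in> nonneg_set A T \<Longrightarrow> x f = 0" and L: "positive_functional A T L"
  shows "L f = 0"
proof -
  have T: "preordering A T" by (rule finitely_generated_preorderingE[OF fg(2)])
  note D = preorderingD[OF T]
  have L1: "0 \<le> L \<one>" by (rule positive_functionalD(2)[OF L D(4)])
  have "L (f \<otimes> f) = 0"
  proof (rule ccontr)
    define v where "v = L (f \<otimes> f)"
    assume "L (f \<otimes> f) \<noteq> 0"
    then have v: "0 < v" using positive_functionalD(2)[OF L D(5)[OF f(1)]] by (simp add: v_def)
    \<comment> \<open>Chosen such that c^2 L(1) < v; the summand 1 covers the case L(1) = 0.\<close>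
    define c where "c = sqrt (v / (1 + L \<one>))"
    have c: "0 < c" "c\<^sup>2 = v / (1 + L \<one>)" using v L1 by (simp_all add: c_def)
    have small: "\<forall>x\<in>nonneg_set A T. \<bar>x f\<bar> < c" 
    proof
      fix x assume "x \<in> nonneg_set A T"
      then show "\<bar>x f\<bar> < c" using f(2)[of x] c(1) by simp
    qed
    have "v \<le> c\<^sup>2 * L \<one>"
      using functional_bound[OF fg f(1) c(1) small L D(4)] f(1) by (simp add: v_def)
    then show False using v L1 by (simp add: c(2) field_simps)
  qed
  from positive_functional_null[OF T L f(1) this one_closed] show ?thesis using f by simp
qed

section \<open>Ideals and preorders\<close>

lemma idealI':
  assumes "I \<subseteq> carrier A" "\<zero> \<in> I" "\<And>a b. a \<in> I \<Longrightarrow> b \<in> I \<Longrightarrow> a \<oplus> b \<in> I"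
    and mult: "\<And>a b. a \<in> I \<Longrightarrow> b \<in> carrier A \<Longrightarrow> b \<otimes> a \<in> I"
  shows "ideal I A"
proof (rule idealI)
  show "ring A" by (rule ring_axioms)
  have "inv\<^bsub>add_monoid A\<^esub> a \<in> I" if "a \<in> I" for a
  proof -
    have "a \<in> carrier A" using that assms(1) by blast
    then have "\<ominus> a = (\<ominus> \<one>) \<otimes> a" by (simp add: l_minus)
    then show ?thesis using mult[OF that, of "\<ominus> \<one>"] by (simp add: a_inv_def)
  qed
  then show "subgroup I (add_monoid A)"
    by (intro subgroup.intro) (use assms in auto)
  show "a \<otimes> x \<in> I" if "a \<in> I" "x \<in> carrier A" for a x
  proof -
    have "a \<otimes> x = x \<otimes> a" using that assms(1) by (intro m_comm) auto
    then show ?thesis using mult[OF that] by simp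
  qed
qed (rule mult)

lemma idealD:
  assumes "ideal I A"
  shows "a \<in> I \<Longrightarrow> a \<in> carrier A" "\<zero> \<in> I" "a \<in> I \<Longrightarrow> b \<in> I \<Longrightarrow> a \<oplus> b \<in> I" "a \<in> I \<Longrightarrow> \<ominus> a \<in> I"
    "a \<in> I \<Longrightarrow> b \<in> carrier A \<Longrightarrow> b \<otimes> a \<in> I" "a \<in> I \<Longrightarrow> c \<odot> a \<in> I"
proof -
  interpret ideal I A by fact
  show cl: "a \<in> I \<Longrightarrow> a \<in> carrier A" for a by (rule a_Hcarr)
  show "\<zero> \<in> I" by (rule zero_closed)
  show "a \<in> I \<Longrightarrow> b \<in> I \<Longrightarrow> a \<oplus> b \<in> I" by (rule a_closed)
  show "a \<in> I \<Longrightarrow> \<ominus> a \<in> I" by (rule a_inv_closed)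
  show l: "a \<in> I \<Longrightarrow> b \<in> carrier A \<Longrightarrow> b \<otimes> a \<in> I" for a b by (rule I_l_closed)
  show "c \<odot> a \<in> I" if "a \<in> I"
    using l[OF that, of "c \<odot> \<one>"] cl[OF that] by (simp add: smult_closed smult_mult)
qed

text \<open>The identity 4 b c = (b + 1)^2 c + (b - 1)^2 (-c) shows that multiplication by an
  arbitrary \<open>b\<close> stays in \<open>P\<close>; the factor 4 is removed by scaling.\<close>

lemma ideal_support:
  assumes P: "preordering A P"
  shows "ideal {a \<in> carrier A. a \<in> P \<and> \<ominus> a \<in> P} A"
proof (rule idealI')
  note D = preorderingD[OF P]
  fix a b assume a: "a \<in> {a \<in> carrier A. a \<in> P \<and> \<ominus> a \<in> P}"
  show "a \<oplus> b \<in> {a \<in> carrier A. a \<in> P \<and> \<ominus> a \<in> P}" if b: "b \<in> {a \<in> carrier A. a \<in> P \<and> \<ominus> a \<in> P}"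
  proof -
    have "\<ominus> (a \<oplus> b) = \<ominus> a \<oplus> \<ominus> b" using a b by (simp add: minus_add)
    then show ?thesis using a b D(3) by simp
  qed
  assume b: "b \<in> carrier A"
  have mult: "b \<otimes> c \<in> P" if c: "c \<in> carrier A" "c \<in> P" "\<ominus> c \<in> P" for c
  proof -
    let ?y = "b \<otimes> c"
    have "(b \<oplus> \<one>) \<otimes> (b \<oplus> \<one>) \<otimes> c \<oplus> (b \<ominus> \<one>) \<otimes> (b \<ominus> \<one>) \<otimes> (\<ominus> c) \<in> P"
      using b c by (intro D(2,3,5)) auto
    also have "(b \<oplus> \<one>) \<otimes> (b \<oplus> \<one>) \<otimes> c \<oplus> (b \<ominus> \<one>) \<otimes> (b \<ominus> \<one>) \<otimes> (\<ominus> c) = (?y \<oplus> ?y) \<oplus> (?y \<oplus> ?y)"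
      using b c(1) by algebra
    also have "\<dots> = 4 \<odot> ?y"
      using smult_l_distr[of ?y 1 1] smult_l_distr[of ?y 2 2] b c(1) by (simp add: smult_one)
    finally have "4 \<odot> ?y \<in> P" .
    then have "(1/4) \<odot> (4 \<odot> ?y) \<in> P" by (rule D(7)[rotated]) simp
    then show ?thesis using b c(1) by (simp add: smult_assoc[symmetric] smult_one)
  qed
  have "\<ominus> (b \<otimes> a) = b \<otimes> (\<ominus> a)" using a b by (simp add: r_minus)
  then show "b \<otimes> a \<in> {a \<in> carrier A. a \<in> P \<and> \<ominus> a \<in> P}"
    using mult[of a] mult[of "\<ominus> a"] a b by simp
qed (use preorderingD(6)[OF P] in auto)

lemma mem_set_add: "y \<in> S <+>\<^bsub>A\<^esub> I \<longleftrightarrow> (\<exists>s\<in>S. \<exists>d\<in>I. y = s \<oplus> d)"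
  by (auto simp: set_add_def')

lemma preordering_add_ideal:
  assumes T: "preordering A T" and I: "ideal I A"
  shows "preordering A (T <+>\<^bsub>A\<^esub> I)" "T \<subseteq> T <+>\<^bsub>A\<^esub> I" "I \<subseteq> T <+>\<^bsub>A\<^esub> I"
proof -
  note D = preorderingD[OF T] and ID = idealD[OF I]
  show sub: "T \<subseteq> T <+>\<^bsub>A\<^esub> I"
  proof
    fix t assume t: "t \<in> T"
    then have "t = t \<oplus> \<zero>" using D(1) by simp
    then show "t \<in> T <+>\<^bsub>A\<^esub> I" using t ID(2) unfolding mem_set_add by blast
  qed
  show "I \<subseteq> T <+>\<^bsub>A\<^esub> I"
  proof
    fix t assume t: "t \<in> I"
    then have "t = \<zero> \<oplus> t" using ID(1) by simp
    then show "t \<in> T <+>\<^bsub>A\<^esub> I" using t D(6) unfolding mem_set_add by blast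
  qed
  show "preordering A (T <+>\<^bsub>A\<^esub> I)"
  proof (rule preorderingI)
    show "T <+>\<^bsub>A\<^esub> I \<subseteq> carrier A" using D(1) ID(1) by (auto simp: mem_set_add)
    show "a \<otimes> a \<in> T <+>\<^bsub>A\<^esub> I" if "a \<in> carrier A" for a using D(5)[OF that] sub by blast
    fix x y assume "x \<in> T <+>\<^bsub>A\<^esub> I" "y \<in> T <+>\<^bsub>A\<^esub> I"
    then obtain s d s' d' where xy: "x = s \<oplus> d" "y = s' \<oplus> d'" and sd: "s \<in> T" "d \<in> I" "s' \<in> T" "d' \<in> I"
      unfolding mem_set_add by blast
    note c = D(1)[OF sd(1)] ID(1)[OF sd(2)] D(1)[OF sd(3)] ID(1)[OF sd(4)]
    have "x \<oplus> y = (s \<oplus> s') \<oplus> (d \<oplus> d')" unfolding xy using c by algebra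
    then show "x \<oplus> y \<in> T <+>\<^bsub>A\<^esub> I" unfolding mem_set_add using D(3) ID(3) sd by blast
    have "x \<otimes> y = (s \<otimes> s') \<oplus> (s \<otimes> d' \<oplus> (s' \<oplus> d') \<otimes> d)" unfolding xy using c by algebra
    moreover have "s \<otimes> d' \<oplus> (s' \<oplus> d') \<otimes> d \<in> I" using c sd by (intro ID(3,5)) auto
    ultimately show "x \<otimes> y \<in> T <+>\<^bsub>A\<^esub> I" unfolding mem_set_add using D(2) sd by blast
  qed
qed

text \<open>The generators of the ideal are adjoined with both signs. A preorder that contains them
  in this way contains the whole ideal, since its support is an ideal.\<close>

lemma finitely_generated_add_genideal:
  assumes "finitely_generated_preordering A T" and J: "finite J" "J \<subseteq> carrier A"
  shows "finitely_generated_preordering A (T <+>\<^bsub>A\<^esub> Idl J)"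
proof (rule finitely_generated_preorderingE[OF assms(1)])
  fix G assume G: "finite G" "G \<subseteq> T" "preordering A T" "\<And>P. preordering A P \<Longrightarrow> G \<subseteq> P \<Longrightarrow> T \<subseteq> P"
  note I = genideal_ideal[OF J(2)]
  note add = preordering_add_ideal[OF G(3) I]
  show ?thesis
  proof (rule finitely_generated_preorderingI[of "G \<union> J \<union> a_inv A ` J"])
    have "J \<subseteq> T <+>\<^bsub>A\<^esub> Idl J" using genideal_self[OF J(2)] add(3) by blast
    moreover have "a_inv A ` J \<subseteq> T <+>\<^bsub>A\<^esub> Idl J" using genideal_self[OF J(2)] add(3) idealD(4)[OF I] by blast
    ultimately show "G \<union> J \<union> a_inv A ` J \<subseteq> T <+>\<^bsub>A\<^esub> Idl J" using add(2) G(2) by blast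
    fix P assume P: "preordering A P" "G \<union> J \<union> a_inv A ` J \<subseteq> P"
    have TP: "T \<subseteq> P" using G(4)[OF P(1)] P(2) by blast
    have "Idl J \<subseteq> {a \<in> carrier A. a \<in> P \<and> \<ominus> a \<in> P}"
      using P(2) J(2) by (intro genideal_minimal ideal_support P(1)) blast
    then have IP: "Idl J \<subseteq> P" by blast
    show "T <+>\<^bsub>A\<^esub> Idl J \<subseteq> P"
    proof
      fix y assume "y \<in> T <+>\<^bsub>A\<^esub> Idl J"
      then obtain s d where y: "y = s \<oplus> d" "s \<in> T" "d \<in> Idl J" unfolding mem_set_add by blast
      show "y \<in> P" unfolding y(1) by (rule preorderingD(3)[OF P(1)]) (use TP IP y in auto)
    qed
  qed (use G(1) J add(1) in auto)
qed

text \<open>An ideal contains the negatives of its elements, so nonnegativity on it means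
  vanishing.\<close>

lemma positive_functional_add_ideal:
  assumes T: "preordering A T" and I: "ideal I A"
  shows "positive_functional A (T <+>\<^bsub>A\<^esub> I) L \<longleftrightarrow> positive_functional A T L \<and> (\<forall>d\<in>I. L d = 0)"
proof
  assume p: "positive_functional A (T <+>\<^bsub>A\<^esub> I) L"
  note add = preordering_add_ideal[OF T I] and LD = linear_functionalD[OF positive_functionalD(1)[OF p]]
  have "L d = 0" if "d \<in> I" for d
  proof -
    have "0 \<le> L d" "0 \<le> L (\<ominus> d)"
      using that idealD(4)[OF I that] add(3) by (auto intro!: positive_functionalD(2)[OF p])
    then show ?thesis using LD(4) idealD(1)[OF I that] by simp
  qed
  then show "positive_functional A T L \<and> (\<forall>d\<in>I. L d = 0)"
    using p add(2) by (auto simp: positive_functional_def)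
next
  assume p: "positive_functional A T L \<and> (\<forall>d\<in>I. L d = 0)"
  then have LD: "linear_functional A L" by (simp add: positive_functional_def)
  show "positive_functional A (T <+>\<^bsub>A\<^esub> I) L"
    unfolding positive_functional_def
  proof (intro conjI ballI LD)
    fix y assume "y \<in> T <+>\<^bsub>A\<^esub> I"
    then obtain s d where y: "y = s \<oplus> d" "s \<in> T" "d \<in> I" unfolding mem_set_add by blast
    have "L y = L s + L d"
      unfolding y(1) using linear_functionalD(1)[OF LD] preorderingD(1)[OF T y(2)] idealD(1)[OF I y(3)] by simp
    then show "0 \<le> L y" using p y by (auto simp: positive_functional_def)
  qed
qed

lemma character_positive_functional:
  "x \<in> characters A \<Longrightarrow> positive_functional A S x \<longleftrightarrow> x \<in> nonneg_set A S"
  by (simp add: positive_functional_def nonneg_set_def characters_def)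

lemma nonneg_set_add_ideal:
  assumes T: "preordering A T" and I: "ideal I A"
  shows "nonneg_set A (T <+>\<^bsub>A\<^esub> I) = nonneg_set A T \<inter> zero_set A I"
proof -
  have "x \<in> nonneg_set A (T <+>\<^bsub>A\<^esub> I) \<longleftrightarrow> x \<in> nonneg_set A T \<inter> zero_set A I" if "x \<in> characters A" for x
    using positive_functional_add_ideal[OF T I, of x] that
    unfolding character_positive_functional[OF that] by (auto simp: zero_set_def)
  then show ?thesis by (auto simp: nonneg_set_def)
qed

lemma ideal_vanishing_ideal:
  assumes "Z \<subseteq> characters A"
  shows "ideal (vanishing_ideal A Z) A"
proof (rule idealI')
  show "\<zero> \<in> vanishing_ideal A Z" using charactersD(5) assms by (auto simp: vanishing_ideal_def)
  fix a b assume a: "a \<in> vanishing_ideal A Z"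
  show "a \<oplus> b \<in> vanishing_ideal A Z" if b: "b \<in> vanishing_ideal A Z"
    unfolding vanishing_ideal_def
  proof (intro CollectI conjI ballI)
    show "a \<oplus> b \<in> carrier A" using a b by (simp add: vanishing_ideal_def)
    fix x assume x: "x \<in> Z"
    then have "x \<in> characters A" using assms by blast
    moreover have "x a = 0" "x b = 0" using x a b unfolding vanishing_ideal_def by blast+
    ultimately show "x (a \<oplus> b) = 0" using a b by (simp add: vanishing_ideal_def charactersD(1))
  qed
  show "b \<otimes> a \<in> vanishing_ideal A Z" if b: "b \<in> carrier A"
    unfolding vanishing_ideal_def
  proof (intro CollectI conjI ballI)
    show "b \<otimes> a \<in> carrier A" using a b by (simp add: vanishing_ideal_def)
    fix x assume x: "x \<in> Z"
    then have "x \<in> characters A" using assms by blast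
    moreover have "x a = 0" using x a b unfolding vanishing_ideal_def by blast+
    ultimately show "x (b \<otimes> a) = 0" using a b by (simp add: vanishing_ideal_def charactersD(3))
  qed
qed (auto simp: vanishing_ideal_def)

lemma zero_set_genideal:
  assumes "J \<subseteq> carrier A"
  shows "zero_set A (Idl J) = {x \<in> characters A. \<forall>j\<in>J. x j = 0}"
proof -
  have "x f = 0" if x: "x \<in> characters A" "\<forall>j\<in>J. x j = 0" and f: "f \<in> Idl J" for x f
  proof -
    have "Idl J \<subseteq> vanishing_ideal A {x}"
      using x assms by (intro genideal_minimal ideal_vanishing_ideal) (auto simp: vanishing_ideal_def)
    then show ?thesis using f by (auto simp: vanishing_ideal_def)
  qed
  then show ?thesis using genideal_self[OF assms] by (auto simp: zero_set_def)
qed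

lemma zero_set_vanishing_ideal:
  assumes "I \<subseteq> carrier A"
  shows "zero_set A (vanishing_ideal A (zero_set A I)) = zero_set A I" "I \<subseteq> vanishing_ideal A (zero_set A I)"
  using assms by (auto simp: zero_set_def vanishing_ideal_def)

end

section \<open>Extremal functionals\<close>

lemma compact_function_box:
  fixes M :: "'a \<Rightarrow> real"
  shows "compact {L. \<forall>g. \<bar>L g\<bar> \<le> M g}"
proof -
  have "compactin (product_topology (\<lambda>_. euclidean) UNIV) (PiE UNIV (\<lambda>g. {- M g..M g}))"
    by (simp add: compactin_PiE compactin_euclidean_iff)
  moreover have "PiE UNIV (\<lambda>g. {- M g..M g}) = {L. \<forall>g. \<bar>L g\<bar> \<le> M g}"
    by (auto simp: PiE_iff abs_le_iff minus_le_iff)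
  ultimately show ?thesis unfolding euclidean_product_topology by (simp add: compactin_euclidean_iff)
qed

text \<open>The sets of points that minimize the first n coordinates one after the other are
  compact, nonempty and decreasing. Every point in their intersection is a lexicographic
  minimum.\<close>

lemma lexicographic_minimum:
  fixes B :: "('a \<Rightarrow> real) set" and v :: "nat \<Rightarrow> 'a"
  assumes "compact B" "closed B" "B \<noteq> {}"
  shows "\<exists>L\<in>B. \<forall>n. \<forall>L'\<in>B. (\<forall>k<n. L' (v k) = L (v k)) \<longrightarrow> L (v n) \<le> L' (v n)"
proof -
  define F where "F = rec_nat B (\<lambda>n S. {L \<in> S. \<forall>L'\<in>S. L (v n) \<le> L' (v n)})"
  have F0: "F 0 = B" and FS: "F (Suc n) = {L \<in> F n. \<forall>L'\<in>F n. L (v n) \<le> L' (v n)}" for n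
    by (simp_all add: F_def)
  have cF: "compact (F n) \<and> closed (F n) \<and> F n \<noteq> {}" for n
  proof (induction n)
    case (Suc n)
    have "continuous_on (F n) (\<lambda>L. L (v n))"
      by (rule continuous_on_subset[OF continuous_on_product_coordinates]) simp
    then obtain L where L: "L \<in> F n" "\<forall>L'\<in>F n. L (v n) \<le> L' (v n)"
      using continuous_attains_inf Suc by blast
    have "F (Suc n) = F n \<inter> {L'. L' (v n) \<le> L (v n)}"
      unfolding FS using L by (auto intro: order_trans)
    moreover have "closed {L'. L' (v n) \<le> L (v n)}"
      by (intro closed_Collect_le continuous_on_product_coordinates continuous_on_const)
    ultimately show ?case using compact_Int_closed[of "F n"] closed_Int[of "F n"] Suc L by auto
  qed (use assms in \<open>simp add: F0\<close>)
  have mono: "F n \<subseteq> F m" if "m \<le> n" for m n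
    using that by (rule lift_Suc_antimono_le[rotated]) (simp add: FS)
  have "B \<inter> \<Inter>(range F) \<noteq> {}"
  proof (rule compact_imp_fip[OF assms(1)])
    show "closed S" if "S \<in> range F" for S
    proof -
      obtain n where "S = F n" using \<open>S \<in> range F\<close> by (elim rangeE)
      then show ?thesis using cF[of n] by simp
    qed
    fix \<F> assume \<F>: "finite \<F>" "\<F> \<subseteq> range F"
    then obtain I where I: "finite I" "\<F> = F ` I" using finite_subset_image[OF \<F>] by blast
    let ?m = "Max (insert 0 I)"
    have "F ?m \<subseteq> F i" if "i \<in> insert 0 I" for i using I(1) that by (intro mono Max_ge) auto
    then have "F ?m \<subseteq> B \<inter> \<Inter>\<F>" unfolding I(2) using F0 by blast
    then show "B \<inter> \<Inter>\<F> \<noteq> {}" using cF by blast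
  qed
  then obtain L where L: "L \<in> B" "\<And>n. L \<in> F n" by blast
  show ?thesis
  proof (intro bexI[of _ L] allI ballI impI)
    fix n L' assume L': "L' \<in> B" "\<forall>k<n. L' (v k) = L (v k)"
    have "k \<le> n \<longrightarrow> L' \<in> F k" for k
    proof (induction k)
      case (Suc k)
      show ?case
      proof
        assume k: "Suc k \<le> n"
        then have "L' (v k) = L (v k)" "L' \<in> F k" using L'(2) Suc by auto
        then show "L' \<in> F (Suc k)" using L(2)[of "Suc k"] unfolding FS by simp
      qed
    qed (use L' in \<open>simp add: F0\<close>)
    then show "L (v n) \<le> L' (v n)" using L(2)[of "Suc n"] unfolding FS by simp
  qed (rule L(1))
qed

context real_algebra
begin

text \<open>From positivity at (1 + a)^2 and (1 - a)^2. It controls a functional on arbitrary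
  elements by its values on \<open>T\<close>, and thereby puts the cap below into a box.\<close>

lemma positive_functional_abs_le:
  assumes T: "preordering A T" and L: "positive_functional A T L" and a: "a \<in> carrier A"
  shows "\<bar>L a\<bar> \<le> L (\<one> \<oplus> a \<otimes> a)"
proof -
  note D = preorderingD[OF T] and LD = linear_functionalD[OF positive_functionalD(1)[OF L]]
    and Lp = positive_functionalD(2)[OF L]
  have "(\<one> \<oplus> a) \<otimes> (\<one> \<oplus> a) = (\<one> \<oplus> a \<otimes> a) \<oplus> (a \<oplus> a)" using a by algebra
  then have "0 \<le> L (\<one> \<oplus> a \<otimes> a) + 2 * L a"
    using Lp[OF D(5)[of "\<one> \<oplus> a"]] a LD(1)[of "\<one> \<oplus> a \<otimes> a" "a \<oplus> a"] LD(1)[of a a] by simp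
  moreover have "(\<one> \<ominus> a) \<otimes> (\<one> \<ominus> a) = (\<one> \<oplus> a \<otimes> a) \<ominus> (a \<oplus> a)" using a by algebra
  then have "0 \<le> L (\<one> \<oplus> a \<otimes> a) - 2 * L a"
    using Lp[OF D(5)[of "\<one> \<ominus> a"]] a LD(5)[of "\<one> \<oplus> a \<otimes> a" "a \<oplus> a"] LD(1)[of a a] by simp
  moreover have "0 \<le> L (\<one> \<oplus> a \<otimes> a)" using a by (intro Lp D(3,4,5))
  ultimately show ?thesis by linarith
qed

lemma functional_eqI:
  assumes e: "spanning e" and L: "linear_functional A L" and L': "linear_functional A L'"
    and eq: "\<And>k. L (e k) = L' (e k)" and g: "g \<in> carrier A"
  shows "L g = L' g"
  using e g by (induction g rule: spanning_induct) (use eq in \<open>simp_all add: linear_functionalD[OF L] linear_functionalD[OF L']\<close>)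

lemma closed_positive_functionals: "closed {L. positive_functional A T L}"
  unfolding positive_functional_def linear_functional_def Ball_def
  by (intro closed_Collect_conj closed_Collect_all closed_Collect_imp open_Collect_const
      closed_Collect_eq closed_Collect_le continuous_on_add continuous_on_mult continuous_on_const
      continuous_on_product_coordinates)

section \<open>A compact cap of the cone of positive functionals\<close>

lemma positive_functional_scale:
  assumes "positive_functional A T L" "0 \<le> c"
  shows "positive_functional A T (\<lambda>g. c * L g)"
  using assms by (auto simp: positive_functional_def linear_functional_def algebra_simps)

text \<open>The values off the carrier are normalized, because compactness is taken in the space of
  all functions on the type \<open>'a\<close>.\<close>

definition positive_cone :: "'a set \<Rightarrow> ('a \<Rightarrow> real) set" where
  "positive_cone T = {L. positive_functional A T L \<and> (\<forall>g. g \<notin> carrier A \<longrightarrow> L g = 0)}"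

text \<open>Bounds on all partial sums, rather than on the sum of the series, are closed conditions;
  for nonnegative terms they also contain the convergence.\<close>

definition cone_base :: "'a set \<Rightarrow> (nat \<Rightarrow> 'a) \<Rightarrow> (nat \<Rightarrow> real) \<Rightarrow> ('a \<Rightarrow> real) set" where
  "cone_base T q \<epsilon> = {L \<in> positive_cone T. \<forall>n. (\<Sum>k<n. \<epsilon> k * L (q k)) \<le> 1}"

lemma compact_cone_base:
  assumes T: "preordering A T" and e: "spanning e" and \<epsilon>: "\<And>k. 0 < \<epsilon> k"
  shows "compact (cone_base T (\<lambda>k. \<one> \<oplus> e k \<otimes> e k) \<epsilon>)" (is "compact ?B")
    and "closed (cone_base T (\<lambda>k. \<one> \<oplus> e k \<otimes> e k) \<epsilon>)"
proof -
  note D = preorderingD[OF T] and ec = spanning_closed[OF e]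
  have q: "\<one> \<oplus> e k \<otimes> e k \<in> T" for k using ec by (intro D(3,4,5))
  have "\<exists>M. \<forall>L\<in>?B. \<bar>L g\<bar> \<le> M" if "g \<in> carrier A" for g
    using e that
  proof (induction g rule: spanning_induct)
    case (base k)
    have "\<bar>L (e k)\<bar> \<le> 1 / \<epsilon> k" if "L \<in> ?B" for L
    proof -
      have L: "positive_functional A T L" and s: "(\<Sum>j<Suc k. \<epsilon> j * L (\<one> \<oplus> e j \<otimes> e j)) \<le> 1"
        using that unfolding cone_base_def positive_cone_def by blast+
      have "0 \<le> (\<Sum>j<k. \<epsilon> j * L (\<one> \<oplus> e j \<otimes> e j))"
        using positive_functionalD(2)[OF L q] less_imp_le[OF \<epsilon>] by (intro sum_nonneg mult_nonneg_nonneg)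
      then have "\<epsilon> k * L (\<one> \<oplus> e k \<otimes> e k) \<le> 1" using s by simp
      then have "L (\<one> \<oplus> e k \<otimes> e k) \<le> 1 / \<epsilon> k" using \<epsilon>[of k] by (simp add: field_simps)
      then show ?thesis using positive_functional_abs_le[OF T L ec[of k]] by linarith
    qed
    then show ?case by blast
  next
    case (add f g)
    then obtain M N where MN: "\<forall>L\<in>?B. \<bar>L f\<bar> \<le> M" "\<forall>L\<in>?B. \<bar>L g\<bar> \<le> N" by blast
    have "\<bar>L (f \<oplus> g)\<bar> \<le> M + N" if L: "L \<in> ?B" for L
    proof -
      have "linear_functional A L" using L by (simp add: cone_base_def positive_cone_def positive_functional_def)
      then have "L (f \<oplus> g) = L f + L g" using add by (intro linear_functionalD(1))
      then show ?thesis using bspec[OF MN(1) L] bspec[OF MN(2) L] by linarith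
    qed
    then show ?case by blast
  next
    case (smult c f)
    then obtain M where M: "\<forall>L\<in>?B. \<bar>L f\<bar> \<le> M" by blast
    have "\<bar>L (c \<odot> f)\<bar> \<le> \<bar>c\<bar> * M" if L: "L \<in> ?B" for L
    proof -
      have "linear_functional A L" using L by (simp add: cone_base_def positive_cone_def positive_functional_def)
      then have "L (c \<odot> f) = c * L f" using smult by (intro linear_functionalD(2))
      then show ?thesis using bspec[OF M L] by (simp add: abs_mult mult_left_mono)
    qed
    then show ?case by blast
  qed
  moreover have "\<forall>L\<in>?B. \<bar>L g\<bar> \<le> 0" if "g \<notin> carrier A" for g
    using that by (simp add: cone_base_def positive_cone_def)
  ultimately have "\<forall>g. \<exists>M. \<forall>L\<in>?B. \<bar>L g\<bar> \<le> M" by blast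
  then obtain M where M: "\<forall>g. \<forall>L\<in>?B. \<bar>L g\<bar> \<le> M g" by metis
  show "closed ?B"
    unfolding cone_base_def positive_cone_def mem_Collect_eq
    by (intro closed_Collect_conj closed_positive_functionals closed_Collect_all closed_Collect_imp open_Collect_const
      closed_Collect_eq closed_Collect_le continuous_on_sum continuous_on_mult continuous_on_const
      continuous_on_product_coordinates)
  then have "compact ({L. \<forall>g. \<bar>L g\<bar> \<le> M g} \<inter> ?B)" by (rule compact_Int_closed[OF compact_function_box])
  moreover have "{L. \<forall>g. \<bar>L g\<bar> \<le> M g} \<inter> ?B = ?B" using M by blast
  ultimately show "compact ?B" by simp
qed

text \<open>
  A lexicographic minimum over \<open>f, e 0, e 1, \<dots>\<close> on the compact base is an extreme point: the
  normalized summands of a decomposition have the same minima, one coordinate after the other. The weights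
  \<open>\<epsilon>\<close> are chosen such that \<open>L0\<close> belongs to the base.
\<close>

lemma extremal_functional:
  assumes T: "preordering A T" and e: "spanning e" and L0: "positive_functional A T L0"
    and f: "f \<in> carrier A" "L0 f < 0"
  shows "\<exists>L\<in>positive_cone T. L f < 0 \<and> (\<forall>L1\<in>positive_cone T. \<forall>L2\<in>positive_cone T.
    (\<forall>g. L g = L1 g + L2 g) \<longrightarrow> (\<exists>\<kappa>. \<forall>g\<in>carrier A. L1 g = \<kappa> * L g))"
proof -
  note D = preorderingD[OF T] and ec = spanning_closed[OF e]
  define q where "q k = \<one> \<oplus> e k \<otimes> e k" for k
  have q: "q k \<in> T" for k unfolding q_def using ec by (intro D(3,4,5))
  have qc: "q k \<in> carrier A" for k using D(1)[OF q] .
  \<comment> \<open>The k-th term of the series at \<open>L0\<close> is at most (1/2)^(k+1), so its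
    partial sums stay below 1.\<close>
  define \<epsilon> where "\<epsilon> k = (1/2)^Suc k / (1 + L0 (q k))" for k
  have L0q: "0 \<le> L0 (q k)" for k using positive_functionalD(2)[OF L0 q] .
  have \<epsilon>: "0 < \<epsilon> k" for k unfolding \<epsilon>_def using L0q[of k] by (intro divide_pos_pos) auto
  define B where "B = cone_base T q \<epsilon>"
  define N where "N L = (\<Sum>k. \<epsilon> k * L (q k))" for L
  have Kpos: "0 \<le> \<epsilon> k * L (q k)" if "L \<in> positive_cone T" for L k
    using that positive_functionalD(2)[of T L, OF _ q] less_imp_le[OF \<epsilon>] by (simp add: positive_cone_def)
  have lin: "linear_functional A L" if "L \<in> positive_cone T" for L
    using that by (simp add: positive_cone_def positive_functional_def)
  have BI: "L \<in> B" if "L \<in> positive_cone T" "summable (\<lambda>k. \<epsilon> k * L (q k))" "N L \<le> 1" for L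
    unfolding B_def cone_base_def using that(1) sum_le_suminf[OF that(2) _ Kpos[OF that(1)]] that(3)
    by (auto simp: N_def intro: order_trans)
  have BN: "summable (\<lambda>k. \<epsilon> k * L (q k))" "N L \<le> 1" "L \<in> positive_cone T" if "L \<in> B" for L
  proof -
    show K: "L \<in> positive_cone T" using that by (simp add: B_def cone_base_def)
    have s: "(\<Sum>k<n. \<epsilon> k * L (q k)) \<le> 1" for n using that by (simp add: B_def cone_base_def)
    show sm: "summable (\<lambda>k. \<epsilon> k * L (q k))" by (rule summableI_nonneg_bounded[OF Kpos[OF K] s])
    show "N L \<le> 1" unfolding N_def by (rule suminf_le_const[OF sm s])
  qed
  \<comment> \<open>\<open>N\<close> vanishes only at the zero functional: the values at
    \<open>q k\<close> dominate those at \<open>e k\<close>, which span.\<close>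
  have N0: "L g = 0" if L: "L \<in> positive_cone T" "summable (\<lambda>k. \<epsilon> k * L (q k))" "N L = 0" and g: "g \<in> carrier A" for L g
  proof -
    have "\<forall>k. \<epsilon> k * L (q k) = 0" using suminf_eq_zero_iff[OF L(2) Kpos[OF L(1)]] L(3) by (simp add: N_def)
    then have z: "L (q k) = 0" for k using \<epsilon>[of k] by (metis less_irrefl mult_eq_0_iff)
    have "L (e k) = 0" for k
      using positive_functional_abs_le[OF T _ ec[of k], of L] z[of k] L(1) by (simp add: q_def positive_cone_def)
    moreover have "linear_functional A (\<lambda>_. 0)" by (simp add: linear_functional_def)
    ultimately show ?thesis using functional_eqI[OF e lin[OF L(1)], of "\<lambda>_. 0" g] g by simp
  qed
  have scale: "(\<lambda>g. c * L g) \<in> positive_cone T" if "L \<in> positive_cone T" "0 \<le> c" for c L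
    using that positive_functional_scale[of T L c] by (simp add: positive_cone_def)
  have scaleN: "(\<lambda>g. L g / N L) \<in> B" if L: "L \<in> positive_cone T" "summable (\<lambda>k. \<epsilon> k * L (q k))" "0 < N L" for L
  proof (rule BI)
    show "(\<lambda>g. L g / N L) \<in> positive_cone T" using scale[OF L(1), of "1 / N L"] L(3) by simp
    show "summable (\<lambda>k. \<epsilon> k * (L (q k) / N L))" using summable_divide[OF L(2), of "N L"] by simp
    show "N (\<lambda>g. L g / N L) \<le> 1"
      using suminf_divide[OF L(2), of "N L"] L(3) unfolding N_def by simp
  qed
  define L0' where "L0' g = (if g \<in> carrier A then L0 g else 0)" for g
  have "L0' \<in> B"
    unfolding B_def cone_base_def
  proof (intro CollectI conjI allI)
    show "L0' \<in> positive_cone T"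
      using L0 D(1) by (auto simp: positive_cone_def positive_functional_def linear_functional_def L0'_def smult_closed)
    fix n
    have "(\<Sum>k<n. \<epsilon> k * L0' (q k)) \<le> (\<Sum>k<n. (1/2)^Suc k)"
    proof (rule sum_mono)
      fix k
      have "\<epsilon> k * L0' (q k) = (1/2)^Suc k * (L0 (q k) / (1 + L0 (q k)))" by (simp add: \<epsilon>_def L0'_def qc)
      also have "\<dots> \<le> (1/2)^Suc k * 1" using L0q[of k] by (intro mult_left_mono) (auto simp: field_simps)
      finally show "\<epsilon> k * L0' (q k) \<le> (1/2)^Suc k" by simp
    qed
    also have "\<dots> = 1 - (1/2)^n" by (induction n) (simp_all add: field_simps)
    also have "\<dots> \<le> 1" by simp
    finally show "(\<Sum>k<n. \<epsilon> k * L0' (q k)) \<le> 1" .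
  qed
  \<comment> \<open>With \<open>f\<close> in front, the minimum satisfies L f \<le> L0 f <
    0.\<close>
  define v where "v n = (case n of 0 \<Rightarrow> f | Suc k \<Rightarrow> e k)" for n
  have "compact B" "closed B" unfolding B_def q_def by (rule compact_cone_base[OF T e \<epsilon>])+
  with \<open>L0' \<in> B\<close> obtain L where LB: "L \<in> B"
    and min: "\<And>n L'. L' \<in> B \<Longrightarrow> (\<forall>k<n. L' (v k) = L (v k)) \<Longrightarrow> L (v n) \<le> L' (v n)"
    using lexicographic_minimum[of B v] by blast
  note LK = BN(3)[OF LB] and Ls = BN(1)[OF LB]
  have Lf: "L f < 0" using min[OF \<open>L0' \<in> B\<close>, of 0] f by (simp add: v_def L0'_def)
  have "0 \<le> N L" unfolding N_def by (rule suminf_nonneg[OF Ls Kpos[OF LK]])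
  moreover have "N L \<noteq> 0" using N0[OF LK Ls _ f(1)] Lf by auto
  ultimately have Npos: "0 < N L" by simp
  \<comment> \<open>If \<open>N L\<close> were below 1, normalizing would lower the negative value
    \<open>L f\<close>.\<close>
  have "L f \<le> L f / N L" using min[OF scaleN[OF LK Ls Npos], of 0] by (simp add: v_def)
  then have "1 \<le> N L" using Lf Npos by (simp add: field_simps)
  then have N1: "N L = 1" using BN(2)[OF LB] by simp
  have "\<exists>\<kappa>. \<forall>g\<in>carrier A. L1 g = \<kappa> * L g"
    if L1: "L1 \<in> positive_cone T" and L2: "L2 \<in> positive_cone T" and sum: "\<And>g. L g = L1 g + L2 g" for L1 L2
  proof -
    have sm: "summable (\<lambda>k. \<epsilon> k * L1 (q k))" "summable (\<lambda>k. \<epsilon> k * L2 (q k))"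
      by (rule summable_comparison_test'[OF Ls, of 0],
          use Kpos[OF L1] Kpos[OF L2] in \<open>simp add: sum distrib_left\<close>)+
    have N12: "N L1 + N L2 = 1"
      using suminf_add[OF sm] N1 by (simp add: N_def sum distrib_left)
    have nn: "0 \<le> N L1" "0 \<le> N L2"
      unfolding N_def by (rule suminf_nonneg[OF sm(1) Kpos[OF L1]] suminf_nonneg[OF sm(2) Kpos[OF L2]])+
    consider "N L1 = 0" | "N L2 = 0" | "0 < N L1" "0 < N L2" using nn by linarith
    then show ?thesis
    proof cases
      case 1
      then show ?thesis using N0[OF L1 sm(1)] by (intro exI[of _ 0]) simp
    next
      case 2
      then show ?thesis using N0[OF L2 sm(2)] sum by (intro exI[of _ 1]) simp
    next
      case 3
      note B1 = scaleN[OF L1 sm(1) 3(1)] and B2 = scaleN[OF L2 sm(2) 3(2)]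
      have eq: "L1 (v n) / N L1 = L (v n) \<and> L2 (v n) / N L2 = L (v n)" for n
      proof (induction n rule: less_induct)
        case (less n)
        have "L (v n) \<le> L1 (v n) / N L1" "L (v n) \<le> L2 (v n) / N L2"
          using min[OF B1, of n] min[OF B2, of n] less by auto
        then have m: "N L1 * L (v n) \<le> L1 (v n)" "N L2 * L (v n) \<le> L2 (v n)"
          using 3 by (simp_all add: field_simps)
        moreover have "L1 (v n) + L2 (v n) = N L1 * L (v n) + N L2 * L (v n)"
          using sum[of "v n"] N12 by (simp flip: distrib_right)
        ultimately have "L1 (v n) = N L1 * L (v n)" "L2 (v n) = N L2 * L (v n)" by linarith+
        then show ?case using 3 by simp
      qed
      have "L1 g = N L1 * L g" if "g \<in> carrier A" for g
      proof (rule functional_eqI[OF e lin[OF L1] lin[OF scale[OF LK nn(1)]] _ that])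
        show "L1 (e k) = N L1 * L (e k)" for k using eq[of "Suc k"] 3 by (simp add: v_def field_simps)
      qed
      then show ?thesis by blast
    qed
  qed
  then show ?thesis using LK Lf by blast
qed

lemma extremal_functional_multiplicative:
  assumes T: "preordering A T" and e: "spanning e" and L0: "positive_functional A T L0"
    and f: "f \<in> carrier A" "L0 f < 0" and h: "\<And>i. h i \<in> carrier A" and c: "0 < c"
    and bound: "\<And>L i t. positive_functional A T L \<Longrightarrow> t \<in> T \<Longrightarrow> L (h i \<otimes> h i \<otimes> t) \<le> c\<^sup>2 * L t"
  shows "\<exists>L lam. positive_functional A T L \<and> L f < 0 \<and> (\<forall>i. \<forall>g\<in>carrier A. L (h i \<otimes> g) = lam i * L g)"
proof -
  obtain L where LK: "L \<in> positive_cone T" and Lf: "L f < 0"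
    and ext: "\<And>L1 L2. L1 \<in> positive_cone T \<Longrightarrow> L2 \<in> positive_cone T \<Longrightarrow> (\<forall>g. L g = L1 g + L2 g) \<Longrightarrow>
      (\<exists>\<kappa>. \<forall>g\<in>carrier A. L1 g = \<kappa> * L g)"
    using extremal_functional[OF T e L0 f] by blast
  have L: "positive_functional A T L" using LK by (simp add: positive_cone_def)
  note D = preorderingD[OF T] and LD = linear_functionalD[OF positive_functionalD(1)[OF L]]
  have "\<exists>l. \<forall>g\<in>carrier A. L (h i \<otimes> g) = l * L g" for i
  proof -
    \<comment> \<open>This is \<open>L\<close> composed with multiplication by (1 + s h/c)/2; the
      choices s = 1 and s = -1 add up to \<open>L\<close>.\<close>
    define L' where "L' s g = (if g \<in> carrier A then L g / 2 + s / (2 * c) * L (h i \<otimes> g) else 0)" for s g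
    have K: "L' s \<in> positive_cone T" if s: "\<bar>s\<bar> = 1" for s
      unfolding positive_cone_def positive_functional_def linear_functional_def
    proof (intro CollectI conjI ballI allI impI)
      show "L' s (x \<oplus> y) = L' s x + L' s y" if "x \<in> carrier A" "y \<in> carrier A" for x y
        using that h by (simp add: L'_def LD(1) r_distr add_divide_distrib distrib_left)
      show "L' s (r \<odot> x) = r * L' s x" if "x \<in> carrier A" for x r
        using that h by (simp add: L'_def LD(2) smult_closed smult_mult distrib_left)
      show "L' s x = 0" if "x \<notin> carrier A" for x using that by (simp add: L'_def)
      fix t assume t: "t \<in> T"
      have tc: "t \<in> carrier A" using D(1)[OF t] .
      have Lt: "0 \<le> L t" using positive_functionalD(2)[OF L t] .
      \<comment> \<open>The Cauchy-Schwarz inequality transfers the bound on h^2 to one on h itself: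
        the absolute value of L(h t) is at most c L(t).\<close>
      have "(L (h i \<otimes> t))\<^sup>2 \<le> L (h i \<otimes> h i \<otimes> t) * L t"
        using functional_Cauchy_Schwarz[OF T L t h[of i] one_closed] h tc by simp
      also have "\<dots> \<le> c\<^sup>2 * L t * L t" using bound[OF L t, of i] Lt by (intro mult_right_mono)
      also have "\<dots> = (c * L t)\<^sup>2" by (simp add: power2_eq_square)
      finally have "\<bar>L (h i \<otimes> t)\<bar> \<le> c * L t" using c Lt by (simp add: abs_le_square_iff[symmetric] abs_mult)
      then have "\<bar>s / (2 * c) * L (h i \<otimes> t)\<bar> \<le> L t / 2" using c s by (simp add: abs_mult field_simps)
      then have "0 \<le> L t / 2 + s / (2 * c) * L (h i \<otimes> t)" by linarith
      then show "0 \<le> L' s t" using tc by (simp add: L'_def)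
    qed
    have "\<forall>g. L g = L' 1 g + L' (-1) g" using LK by (simp add: L'_def positive_cone_def field_simps)
    from ext[OF K K this] obtain \<kappa> where \<kappa>: "\<forall>g\<in>carrier A. L' 1 g = \<kappa> * L g" by auto
    have "L (h i \<otimes> g) = ((2 * \<kappa> - 1) * c) * L g" if "g \<in> carrier A" for g
    proof -
      have "L g + L (h i \<otimes> g) / c = 2 * \<kappa> * L g" using bspec[OF \<kappa> that] that by (simp add: L'_def field_simps)
      then have "L (h i \<otimes> g) / c = (2 * \<kappa> - 1) * L g" by (simp add: algebra_simps)
      then show ?thesis using c by (simp add: divide_eq_eq mult_ac)
    qed
    then show ?thesis by blast
  qed
  then obtain lam where "\<forall>i. \<forall>g\<in>carrier A. L (h i \<otimes> g) = lam i * L g"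
    using choice[of "\<lambda>i l. \<forall>g\<in>carrier A. L (h i \<otimes> g) = l * L g"] by blast
  then show ?thesis using L Lf by blast
qed

end

section \<open>Quotient algebras\<close>

text \<open>An abstract surjection with kernel \<open>I\<close>, which keeps cosets out of the
  arguments; the coset algebra is one instance.\<close>

locale algebra_quotient = real_algebra A for A :: "(real, 'a, 'm) module_scheme" (structure) +
  fixes Q :: "(real, 'b, 'k) module_scheme" and \<pi> :: "'a \<Rightarrow> 'b" and I :: "'a set"
  assumes I: "ideal I A"
    and carrier_Q: "carrier Q = \<pi> ` carrier A"
    and \<pi>_add: "\<And>a b. a \<in> carrier A \<Longrightarrow> b \<in> carrier A \<Longrightarrow> \<pi> (a \<oplus> b) = \<pi> a \<oplus>\<^bsub>Q\<^esub> \<pi> b"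
    and \<pi>_mult: "\<And>a b. a \<in> carrier A \<Longrightarrow> b \<in> carrier A \<Longrightarrow> \<pi> (a \<otimes> b) = \<pi> a \<otimes>\<^bsub>Q\<^esub> \<pi> b"
    and \<pi>_smult: "\<And>c a. a \<in> carrier A \<Longrightarrow> \<pi> (c \<odot> a) = c \<odot>\<^bsub>Q\<^esub> \<pi> a"
    and \<pi>_one: "\<pi> \<one> = \<one>\<^bsub>Q\<^esub>" and \<pi>_zero: "\<pi> \<zero> = \<zero>\<^bsub>Q\<^esub>"
    and \<pi>_eq: "\<And>a b. a \<in> carrier A \<Longrightarrow> b \<in> carrier A \<Longrightarrow> \<pi> a = \<pi> b \<Longrightarrow> a \<ominus> b \<in> I"
    and \<pi>_kernel: "\<And>a. a \<in> I \<Longrightarrow> \<pi> a = \<pi> \<zero>"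
begin

lemma comm_real_algebra_Q: "comm_real_algebra Q"
proof -
  note flip = \<pi>_add[symmetric] \<pi>_mult[symmetric] \<pi>_smult[symmetric] \<pi>_one[symmetric] \<pi>_zero[symmetric]
  have cQ: "cring Q"
  proof (rule cringI)
    show "abelian_group Q"
    proof (rule abelian_groupI)
      fix x assume "x \<in> carrier Q"
      then obtain a where a: "a \<in> carrier A" "x = \<pi> a" by (auto simp: carrier_Q)
      then have "\<pi> (\<ominus> a) \<oplus>\<^bsub>Q\<^esub> x = \<zero>\<^bsub>Q\<^esub>" by (simp add: flip l_neg)
      then show "\<exists>y\<in>carrier Q. y \<oplus>\<^bsub>Q\<^esub> x = \<zero>\<^bsub>Q\<^esub>" using a by (auto simp: carrier_Q)
    qed (auto simp: carrier_Q flip a_ac)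
    show "Group.comm_monoid Q"
      by (rule comm_monoidI) (auto simp: carrier_Q flip m_ac)
  qed (auto simp: carrier_Q flip l_distr)
  have cR: "cring real_ring"
    using comm_real_algebra by (simp add: comm_real_algebra_def Module.algebra_def Module.module_def)
  have "Module.algebra real_ring Q"
    by (rule algebraI[OF cR cQ])
      (auto simp: carrier_Q flip ring_of_type_algebra_def smult_closed smult_l_distr smult_r_distr smult_assoc
        smult_one smult_mult)
  then show ?thesis by (simp add: comm_real_algebra_def)
qed

sublocale Q: real_algebra Q
  by unfold_locales (rule comm_real_algebra_Q)

lemma spanning_Q:
  assumes e: "spanning e"
  shows "Q.spanning (\<lambda>k. \<pi> (e k))"
  unfolding Q.spanning_def
proof (intro conjI allI impI)
  show "range (\<lambda>k. \<pi> (e k)) \<subseteq> carrier Q" using spanning_closed[OF e] by (auto simp: carrier_Q)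
  fix V assume V: "range (\<lambda>k. \<pi> (e k)) \<subseteq> V \<and> (\<forall>f\<in>carrier Q \<inter> V. \<forall>g\<in>carrier Q \<inter> V. f \<oplus>\<^bsub>Q\<^esub> g \<in> V) \<and>
    (\<forall>c. \<forall>f\<in>carrier Q \<inter> V. c \<odot>\<^bsub>Q\<^esub> f \<in> V)"
  have "\<pi> a \<in> V" if "a \<in> carrier A" for a
    using e that
  proof (induction a rule: spanning_induct)
    case (base k)
    show ?case using V by blast
  next
    case (add f g)
    have "\<pi> f \<in> carrier Q \<inter> V" "\<pi> g \<in> carrier Q \<inter> V" using add by (auto simp: carrier_Q)
    then show ?case using V add by (simp add: \<pi>_add)
  next
    case (smult c f)
    have "\<pi> f \<in> carrier Q \<inter> V" using smult by (auto simp: carrier_Q)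
    then show ?case using V smult by (simp add: \<pi>_smult)
  qed
  then show "carrier Q \<subseteq> V" by (auto simp: carrier_Q)
qed

lemma linear_pullback:
  assumes "linear_functional Q M"
  shows "linear_functional A (\<lambda>a. M (\<pi> a))"
  using assms by (auto simp: linear_functional_def carrier_Q \<pi>_add \<pi>_smult)

lemma linear_pushforward:
  assumes L: "linear_functional A L" and 0: "\<forall>d\<in>I. L d = 0"
  obtains M where "linear_functional Q M" "\<forall>a\<in>carrier A. M (\<pi> a) = L a"
proof
  define M where "M y = L (SOME a. a \<in> carrier A \<and> \<pi> a = y)" for y
  have M: "M (\<pi> a) = L a" if a: "a \<in> carrier A" for a
  proof -
    define b where "b = (SOME b. b \<in> carrier A \<and> \<pi> b = \<pi> a)"
    have b: "b \<in> carrier A \<and> \<pi> b = \<pi> a" unfolding b_def by (rule someI[of _ a]) (use a in simp)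
    then have "b \<ominus> a \<in> I" using \<pi>_eq a by simp
    then have "L b - L a = 0" using 0 linear_functionalD(5)[OF L] a b by metis
    then show ?thesis by (simp add: M_def b_def)
  qed
  then show "\<forall>a\<in>carrier A. M (\<pi> a) = L a" by blast
  show "linear_functional Q M"
    using L by (auto simp: linear_functional_def carrier_Q \<pi>_add[symmetric] \<pi>_smult[symmetric] M smult_closed)
qed

lemma character_pullback:
  assumes y: "y \<in> characters Q"
  shows "restrict (\<lambda>a. y (\<pi> a)) (carrier A) \<in> zero_set A I"
proof -
  have "linear_functional Q y" using y by (simp add: characters_def)
  note l = linear_pullback[OF this]
  have z: "y (\<pi> a) = 0" if "a \<in> I" for a using \<pi>_kernel[OF that] Q.charactersD(5)[OF y] by (simp add: \<pi>_zero)
  have "restrict (\<lambda>a. y (\<pi> a)) (carrier A) \<in> characters A"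
    unfolding characters_def
    using l Q.charactersD(3,4)[OF y]
    by (auto simp: linear_functional_def smult_closed \<pi>_mult \<pi>_one carrier_Q)
  then show ?thesis using z idealD(1)[OF I] by (simp add: zero_set_def)
qed

lemma character_pushforward:
  assumes x: "x \<in> zero_set A I"
  obtains y where "y \<in> characters Q" "\<forall>a\<in>carrier A. y (\<pi> a) = x a"
proof -
  have xc: "x \<in> characters A" using x by (simp add: zero_set_def)
  have "linear_functional A x" "\<forall>d\<in>I. x d = 0" using x by (simp_all add: zero_set_def characters_def)
  from linear_pushforward[OF this] obtain M where M: "linear_functional Q M" "\<forall>a\<in>carrier A. M (\<pi> a) = x a" .
  let ?y = "restrict M (carrier Q)"
  have y: "?y (\<pi> a) = x a" if "a \<in> carrier A" for a using M(2) that by (simp add: carrier_Q)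
  show ?thesis
  proof
    show "\<forall>a\<in>carrier A. ?y (\<pi> a) = x a" using y by blast
    have "linear_functional Q ?y"
      using M(1) Q.add.m_closed Q.smult_closed by (simp add: linear_functional_def)
    moreover have "?y (f \<otimes>\<^bsub>Q\<^esub> g) = ?y f * ?y g" if fg: "f \<in> carrier Q" "g \<in> carrier Q" for f g
    proof -
      obtain a b where ab: "a \<in> carrier A" "f = \<pi> a" "b \<in> carrier A" "g = \<pi> b" using fg by (auto simp: carrier_Q)
      have "?y (\<pi> (a \<otimes> b)) = ?y (\<pi> a) * ?y (\<pi> b)"
        unfolding y[OF ab(1)] y[OF ab(3)] y[OF m_closed[OF ab(1,3)]] by (rule charactersD(3)[OF xc ab(1,3)])
      then show ?thesis unfolding ab(2,4) using \<pi>_mult[OF ab(1,3)] by simp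
    qed
    moreover have "?y \<one>\<^bsub>Q\<^esub> = 1" using y[OF one_closed] charactersD(4)[OF xc] by (simp add: \<pi>_one)
    ultimately show "?y \<in> characters Q" by (simp add: characters_def)
  qed
qed

text \<open>Characters of the quotient correspond to the zeros of \<open>I\<close>. Functionals on
  the quotient that are positive on the image of \<open>S\<close> correspond to
  \<open>S\<close>-positive ones, which vanish on \<open>I\<close> because \<open>S\<close> contains
  \<open>I\<close>. The set \<open>U\<close> is separate since (SMP) takes \<open>U = S\<close> and
  (MP) takes \<open>U = {}\<close>.\<close>

lemma positive_on_Q:
  assumes S: "preordering A S" "I \<subseteq> S" and U: "U \<subseteq> carrier A"
  shows "Q.positive_on (nonneg_set Q (\<pi> ` U)) (\<pi> ` S) \<longleftrightarrow> positive_on (nonneg_set A U \<inter> zero_set A I) S"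
proof
  have SQ: "\<pi> ` S \<subseteq> carrier Q" using preorderingD(1)[OF S(1)] by (auto simp: carrier_Q)
  assume p: "Q.positive_on (nonneg_set Q (\<pi> ` U)) (\<pi> ` S)"
  show "positive_on (nonneg_set A U \<inter> zero_set A I) S"
    unfolding positive_on_def
  proof (intro allI impI, elim conjE)
    fix L f assume L: "positive_functional A S L" and f: "nonneg_on (nonneg_set A U \<inter> zero_set A I) f"
    note lin = positive_functionalD(1)[OF L]
    have "L d = 0" if "d \<in> I" for d
    proof -
      have "0 \<le> L d" "0 \<le> L (\<ominus> d)"
        using positive_functionalD(2)[OF L] that idealD(4)[OF I that] S(2) by blast+
      then show ?thesis using linear_functionalD(4)[OF lin idealD(1)[OF I that]] by simp
    qed
    then have 0: "\<forall>d\<in>I. L d = 0" by blast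
    from linear_pushforward[OF lin 0] obtain M where M: "linear_functional Q M" "\<forall>a\<in>carrier A. M (\<pi> a) = L a" .
    have fc: "f \<in> carrier A" using f by (simp add: nonneg_on_def)
    have "positive_functional Q (\<pi> ` S) M"
      using M positive_functionalD(2)[OF L] preorderingD(1)[OF S(1)] by (auto simp: positive_functional_def)
    moreover have "Q.nonneg_on (nonneg_set Q (\<pi> ` U)) (\<pi> f)"
      unfolding Q.nonneg_on_def
    proof (intro conjI ballI)
      show "\<pi> f \<in> carrier Q" using fc by (simp add: carrier_Q)
      fix y assume y: "y \<in> nonneg_set Q (\<pi> ` U)"
      let ?x = "restrict (\<lambda>a. y (\<pi> a)) (carrier A)"
      have z: "?x \<in> zero_set A I" using character_pullback y by (simp add: nonneg_set_def)
      moreover have "?x \<in> nonneg_set A U" using z y U by (auto simp: nonneg_set_def zero_set_def subset_iff)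
      ultimately have "0 \<le> ?x f" using f unfolding nonneg_on_def by blast
      then show "0 \<le> y (\<pi> f)" using fc by simp
    qed
    ultimately have "0 \<le> M (\<pi> f)" using p unfolding Q.positive_on_def by blast
    then show "0 \<le> L f" using M(2) fc by simp
  qed
next
  assume p: "positive_on (nonneg_set A U \<inter> zero_set A I) S"
  show "Q.positive_on (nonneg_set Q (\<pi> ` U)) (\<pi> ` S)"
    unfolding Q.positive_on_def
  proof (intro allI impI, elim conjE)
    fix M F assume M: "positive_functional Q (\<pi> ` S) M" and F: "Q.nonneg_on (nonneg_set Q (\<pi> ` U)) F"
    then obtain f where f: "f \<in> carrier A" "F = \<pi> f" by (auto simp: Q.nonneg_on_def carrier_Q)
    have "positive_functional A S (\<lambda>a. M (\<pi> a))"
      using M linear_pullback[of M] by (simp add: positive_functional_def)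
    moreover have "nonneg_on (nonneg_set A U \<inter> zero_set A I) f"
      unfolding nonneg_on_def
    proof (intro conjI ballI f(1))
      fix x assume x: "x \<in> nonneg_set A U \<inter> zero_set A I"
      then have xz: "x \<in> zero_set A I" by blast
      from character_pushforward[OF xz] obtain y where y: "y \<in> characters Q" "\<forall>a\<in>carrier A. y (\<pi> a) = x a" .
      have "0 \<le> y (\<pi> u)" if "u \<in> U" for u
      proof -
        have "y (\<pi> u) = x u" using y(2) U that by blast
        then show ?thesis using x that by (simp add: nonneg_set_def)
      qed
      then have "y \<in> nonneg_set Q (\<pi> ` U)" using y(1) by (simp add: nonneg_set_def)
      then have "0 \<le> y (\<pi> f)" using F unfolding Q.nonneg_on_def f(2) by blast
      then show "0 \<le> x f" using y(2) f(1) by simp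
    qed
    ultimately have "0 \<le> M (\<pi> f)" using p unfolding positive_on_def by blast
    then show "0 \<le> M F" by (simp add: f(2))
  qed
qed

text \<open>K(S) lies in the zero set of \<open>I\<close>, as \<open>S\<close> contains the elements
  of \<open>I\<close> with both signs. So the restriction to zeros changes nothing.\<close>

lemma SMP_Q:
  assumes e: "spanning e" and S: "preordering A S" "I \<subseteq> S"
  shows "SMP Q (\<pi> ` S) \<longleftrightarrow> SMP A S"
proof -
  have Sc: "S \<subseteq> carrier A" using preorderingD(1)[OF S(1)] by blast
  have "\<pi> ` S \<subseteq> carrier Q" using Sc by (auto simp: carrier_Q)
  note iff = Q.SMP_iff_positive_on[OF spanning_Q[OF e] this] SMP_iff_positive_on[OF e Sc]
  have "nonneg_set A S \<subseteq> zero_set A I"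
  proof
    fix x assume x: "x \<in> nonneg_set A S"
    then have xc: "x \<in> characters A" by (simp add: nonneg_set_def)
    have "x d = 0" if "d \<in> I" for d
    proof -
      have "d \<in> S" "\<ominus> d \<in> S" using that idealD(4)[OF I that] S(2) by blast+
      then have "0 \<le> x d" "0 \<le> x (\<ominus> d)" using x unfolding nonneg_set_def by blast+
      then show ?thesis using charactersD(6)[OF xc idealD(1)[OF I that]] by simp
    qed
    then show "x \<in> zero_set A I" using xc by (simp add: zero_set_def)
  qed
  then have "nonneg_set A S \<inter> zero_set A I = nonneg_set A S" by blast
  then show ?thesis using positive_on_Q[OF S Sc] unfolding iff by simp
qed

text \<open>The characters of the quotient are only the zeros of \<open>I\<close>, so this is
  formally stronger than (MP) for \<open>S\<close> in \<open>A\<close>. The fibres close the gap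
  through a representing measure.\<close>

lemma MP_Q:
  assumes e: "spanning e" and S: "preordering A S" "I \<subseteq> S"
  shows "MP Q (\<pi> ` S) \<longleftrightarrow> positive_on (zero_set A I) S"
proof -
  have "characters A \<inter> zero_set A I = zero_set A I" by (auto simp: zero_set_def)
  then show ?thesis
    using positive_on_Q[OF S empty_subsetI]
    unfolding Q.MP_iff_positive_on[OF spanning_Q[OF e]] by (simp add: nonneg_set_empty Q.nonneg_set_empty)
qed

end

lemma (in real_algebra) quotient_algebra_quotient:
  assumes I: "ideal I A"
  shows "algebra_quotient A (quotient_algebra A I) (\<lambda>a. I +>\<^bsub>A\<^esub> a) I"
proof -
  interpret I: ideal I A by fact
  have sel: "carrier (quotient_algebra A I) = a_rcosets\<^bsub>A\<^esub> I"
    "C \<oplus>\<^bsub>quotient_algebra A I\<^esub> D = C <+>\<^bsub>A\<^esub> D" "C \<otimes>\<^bsub>quotient_algebra A I\<^esub> D = rcoset_mult A I C D"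
    "\<one>\<^bsub>quotient_algebra A I\<^esub> = I +>\<^bsub>A\<^esub> \<one>" "\<zero>\<^bsub>quotient_algebra A I\<^esub> = I"
    "c \<odot>\<^bsub>quotient_algebra A I\<^esub> C = (\<Union>x\<in>C. I +>\<^bsub>A\<^esub> (c \<odot> x))" for C D c
    by (simp_all add: quotient_algebra_def ring.extend_def module.fields_def FactRing_def)
  note same = quotient_eq_iff_same_a_r_cos[OF I]
  have zero: "I +>\<^bsub>A\<^esub> \<zero> = I" using I.a_subset by (rule a_coset_add_zero)
  show ?thesis
  proof
    show "carrier (quotient_algebra A I) = (\<lambda>a. I +>\<^bsub>A\<^esub> a) ` carrier A"
      by (auto simp: sel A_RCOSETS_def')
    fix a assume a: "a \<in> carrier A"
    show "I +>\<^bsub>A\<^esub> (a \<oplus> b) = (I +>\<^bsub>A\<^esub> a) \<oplus>\<^bsub>quotient_algebra A I\<^esub> (I +>\<^bsub>A\<^esub> b)" if "b \<in> carrier A" for b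
      using I.a_rcos_sum[OF a that] by (simp add: sel)
    show "I +>\<^bsub>A\<^esub> (a \<otimes> b) = (I +>\<^bsub>A\<^esub> a) \<otimes>\<^bsub>quotient_algebra A I\<^esub> (I +>\<^bsub>A\<^esub> b)" if "b \<in> carrier A" for b
      using I.rcoset_mult_add[OF a that] by (simp add: sel)
    show "a \<ominus> b \<in> I" if "b \<in> carrier A" "I +>\<^bsub>A\<^esub> a = I +>\<^bsub>A\<^esub> b" for b
      using same[OF a that(1)] that(2) by simp
    fix c :: real
    \<comment> \<open>All cosets in the union that defines the scalar multiple of a coset
      coincide.\<close>
    have "I +>\<^bsub>A\<^esub> (c \<odot> x) = I +>\<^bsub>A\<^esub> (c \<odot> a)" if x: "x \<in> I +>\<^bsub>A\<^esub> a" for x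
    proof -
      obtain d where d: "d \<in> I" "x = d \<oplus> a" using x by (auto simp: a_r_coset_def')
      have dc: "d \<in> carrier A" using idealD(1)[OF I d(1)] .
      have "c \<odot> x \<ominus> c \<odot> a = c \<odot> d"
        unfolding d(2) smult_r_distr[OF dc a] using smult_closed[OF dc, of c] smult_closed[OF a, of c] by algebra
      then have "c \<odot> x \<ominus> c \<odot> a \<in> I" using idealD(6)[OF I d(1)] by simp
      then show ?thesis using same[of "c \<odot> x" "c \<odot> a"] a dc d(2) by (simp add: smult_closed)
    qed
    moreover have "a \<in> I +>\<^bsub>A\<^esub> a" using a by (rule I.a_rcos_self)
    ultimately show "I +>\<^bsub>A\<^esub> (c \<odot> a) = c \<odot>\<^bsub>quotient_algebra A I\<^esub> (I +>\<^bsub>A\<^esub> a)"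
      unfolding sel by blast
  next
    show "I +>\<^bsub>A\<^esub> \<one> = \<one>\<^bsub>quotient_algebra A I\<^esub>" "I +>\<^bsub>A\<^esub> \<zero> = \<zero>\<^bsub>quotient_algebra A I\<^esub>"
      by (simp_all add: sel zero)
    show "I +>\<^bsub>A\<^esub> a = I +>\<^bsub>A\<^esub> \<zero>" if "a \<in> I" for a
      using same[of a \<zero>] idealD(1)[OF I that] that by (simp add: minus_eq)
  qed
qed

section \<open>Fibres\<close>

context real_algebra
begin

lemma positive_on_mono:
  "positive_on C T \<Longrightarrow> C \<subseteq> C' \<Longrightarrow> positive_on C' T"
  unfolding positive_on_def nonneg_on_def by blast

end

locale bounded_fibration = real_algebra A for A :: "(real, 'a, 'm) module_scheme" (structure) +
  fixes T :: "'a set" and h :: "'n::finite \<Rightarrow> 'a"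
  assumes fgA: "finitely_generated_algebra A" and fgT: "finitely_generated_preordering A T"
    and h: "\<And>i. h i \<in> carrier A" and bdd: "\<And>i. bounded ((\<lambda>x. x (h i)) ` nonneg_set A T)"
begin

abbreviation generator :: "real ^ 'n \<Rightarrow> 'n \<Rightarrow> 'a" where
  "generator lam i \<equiv> h i \<ominus> (lam $ i) \<odot> \<one>"

abbreviation (input) "I \<equiv> fibre_ideal A h"
abbreviation (input) "I' \<equiv> fibre_ideal_hat A h"
abbreviation (input) "Tf \<equiv> fibre_preordering A T h"
abbreviation (input) "Tf' \<equiv> fibre_preordering_hat A T h"
abbreviation (input) "Z lam \<equiv> zero_set A (fibre_ideal A h lam)"

lemma preordering_T: "preordering A T"
  by (rule finitely_generated_preorderingE[OF fgT])

lemma generator_closed: "generator lam i \<in> carrier A"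
  using h by (simp add: smult_closed)

lemma range_generator: "range (generator lam) \<subseteq> carrier A"
  using generator_closed by blast

lemma ideal_fibre: "ideal (I lam) A"
  unfolding fibre_ideal_def by (rule genideal_ideal[OF range_generator])

lemma ideal_fibre_hat: "ideal (I' lam) A"
  unfolding fibre_ideal_hat_def by (rule ideal_vanishing_ideal) (auto simp: zero_set_def)

lemma fibre_ideal_subset_hat: "I lam \<subseteq> I' lam" and zero_set_hat: "zero_set A (I' lam) = Z lam"
proof -
  have "I lam \<subseteq> carrier A" using idealD(1)[OF ideal_fibre] by blast
  from zero_set_vanishing_ideal[OF this] show "I lam \<subseteq> I' lam" "zero_set A (I' lam) = Z lam"
    unfolding fibre_ideal_hat_def by simp_all
qed

lemma character_generator:
  "x \<in> characters A \<Longrightarrow> x (generator lam i) = x (h i) - lam $ i"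
  using h by (simp add: minus_eq charactersD smult_closed)

lemma zero_set_fibre: "Z lam = {x \<in> characters A. \<forall>i. x (generator lam i) = 0}"
  unfolding fibre_ideal_def zero_set_genideal[OF range_generator] by simp

lemma preordering_fibre: "preordering A (Tf lam)" "T \<subseteq> Tf lam" "I lam \<subseteq> Tf lam"
  unfolding fibre_preordering_def by (rule preordering_add_ideal[OF preordering_T ideal_fibre])+

lemma preordering_fibre_hat: "preordering A (Tf' lam)" "T \<subseteq> Tf' lam" "I' lam \<subseteq> Tf' lam"
  unfolding fibre_preordering_hat_def by (rule preordering_add_ideal[OF preordering_T ideal_fibre_hat])+

lemma finitely_generated_fibre: "finitely_generated_preordering A (Tf lam)"
  unfolding fibre_preordering_def fibre_ideal_def
  by (rule finitely_generated_add_genideal[OF fgT _ range_generator]) simp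

lemma nonneg_set_fibre: "nonneg_set A (Tf lam) = nonneg_set A T \<inter> Z lam"
  "nonneg_set A (Tf' lam) = nonneg_set A T \<inter> Z lam"
  unfolding fibre_preordering_def fibre_preordering_hat_def
  by (simp_all only: nonneg_set_add_ideal[OF preordering_T ideal_fibre]
      nonneg_set_add_ideal[OF preordering_T ideal_fibre_hat] zero_set_hat)

lemma positive_functional_fibre:
  "positive_functional A (Tf lam) L \<longleftrightarrow> positive_functional A T L \<and> (\<forall>d\<in>I lam. L d = 0)"
  unfolding fibre_preordering_def by (rule positive_functional_add_ideal[OF preordering_T ideal_fibre])

text \<open>Elements of the larger ideal vanish on the zero set, in particular on K of the fibre
  preorder, so every functional that is positive on that preorder annihilates them.\<close>

lemma positive_functional_fibre_hat:
  "positive_functional A (Tf' lam) L \<longleftrightarrow> positive_functional A (Tf lam) L"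
proof -
  have hat: "positive_functional A (Tf' lam) L \<longleftrightarrow> positive_functional A T L \<and> (\<forall>d\<in>I' lam. L d = 0)"
    unfolding fibre_preordering_hat_def by (rule positive_functional_add_ideal[OF preordering_T ideal_fibre_hat])
  have "L d = 0" if L: "positive_functional A (Tf lam) L" and d: "d \<in> I' lam" for d
  proof (rule functional_vanishes[OF fgA finitely_generated_fibre _ _ L])
    show "d \<in> carrier A" by (rule idealD(1)[OF ideal_fibre_hat d])
    show "x d = 0" if "x \<in> nonneg_set A (Tf lam)" for x
      using that d unfolding nonneg_set_fibre fibre_ideal_hat_def vanishing_ideal_def by blast
  qed
  then show ?thesis unfolding hat using fibre_ideal_subset_hat[of lam] positive_functional_fibre[of lam L] by blast
qed

lemma positive_on_fibre_hat: "positive_on C (Tf' lam) \<longleftrightarrow> positive_on C (Tf lam)"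
  by (simp add: positive_on_def positive_functional_fibre_hat)

text \<open>The generators of the ideal and their squares are annihilated by \<open>L\<close>, so a
  representing measure is carried by the fibre.\<close>

lemma positive_on_fibre:
  assumes e: "spanning e" and U: "U \<subseteq> carrier A" and p: "positive_on (nonneg_set A U) (Tf lam)"
  shows "positive_on (nonneg_set A U \<inter> Z lam) (Tf lam)"
  unfolding positive_on_def
proof (intro allI impI, elim conjE)
  fix L f assume L: "positive_functional A (Tf lam) L" and f: "nonneg_on (nonneg_set A U \<inter> Z lam) f"
  have "L (generator lam i \<otimes> generator lam i) = 0" for i
  proof -
    have "generator lam i \<in> I lam" unfolding fibre_ideal_def using genideal_self[OF range_generator] by blast
    from idealD(5)[OF ideal_fibre this generator_closed] show ?thesis using L unfolding positive_functional_fibre by blast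
  qed
  moreover have "nonneg_set A U \<inter> Z lam = {x \<in> nonneg_set A U. \<forall>i. x (generator lam i) = 0}"
    unfolding zero_set_fibre by (auto simp: nonneg_set_def)
  ultimately show "0 \<le> L f"
    using f by (intro positive_on_restrict[OF e U p L generator_closed]) auto
qed

lemma uniform_bound:
  "\<exists>c>0. \<forall>i. \<forall>x\<in>nonneg_set A T. \<bar>x (h i)\<bar> < c"
proof -
  have "\<forall>i. \<exists>b. \<forall>x\<in>nonneg_set A T. \<bar>x (h i)\<bar> \<le> b"
    using bdd unfolding bounded_iff by auto
  then obtain b where b: "\<forall>i. \<forall>x\<in>nonneg_set A T. \<bar>x (h i)\<bar> \<le> b i" by metis
  show ?thesis
  proof (intro exI conjI allI)
    show "0 < 1 + (\<Sum>i\<in>UNIV. \<bar>b i\<bar>)" by (intro add_pos_nonneg sum_nonneg) auto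
    show "\<forall>x\<in>nonneg_set A T. \<bar>x (h i)\<bar> < 1 + (\<Sum>i\<in>UNIV. \<bar>b i\<bar>)" for i
    proof
      fix x assume "x \<in> nonneg_set A T"
      then have "\<bar>x (h i)\<bar> \<le> b i" using b by blast
      moreover have "\<bar>b i\<bar> \<le> (\<Sum>i\<in>UNIV. \<bar>b i\<bar>)" by (rule member_le_sum) auto
      ultimately show "\<bar>x (h i)\<bar> < 1 + (\<Sum>i\<in>UNIV. \<bar>b i\<bar>)" by linarith
    qed
  qed
qed

text \<open>The elements a with L(a g) = 0 for all g form an ideal, and the eigenvalue equations put
  the generators \<open>h i\<close> - \<open>lam $ i\<close> into it.\<close>

lemma positive_functional_fibre_of_eigen:
  assumes L: "positive_functional A T L" and eig: "\<And>i g. g \<in> carrier A \<Longrightarrow> L (h i \<otimes> g) = lam $ i * L g"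
  shows "positive_functional A (Tf lam) L"
  unfolding positive_functional_fibre
proof (intro conjI L ballI)
  note LD = linear_functionalD[OF positive_functionalD(1)[OF L]]
  let ?N = "{a \<in> carrier A. \<forall>g\<in>carrier A. L (a \<otimes> g) = 0}"
  have "ideal ?N A"
  proof (rule idealI')
    fix a b assume a: "a \<in> ?N"
    show "a \<oplus> b \<in> ?N" if "b \<in> ?N" using a that by (simp add: l_distr LD(1))
    show "b \<otimes> a \<in> ?N" if b: "b \<in> carrier A"
    proof (intro CollectI conjI ballI)
      fix g assume g: "g \<in> carrier A"
      have "b \<otimes> a \<otimes> g = a \<otimes> (b \<otimes> g)" using a b g by (simp add: m_ac)
      then show "L (b \<otimes> a \<otimes> g) = 0" using a b g by simp
    qed (use a b in simp)
  qed (use LD(3) in auto)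
  moreover have "generator lam i \<in> ?N" for i
  proof (intro CollectI conjI ballI generator_closed)
    fix g assume g: "g \<in> carrier A"
    have "generator lam i \<otimes> g = h i \<otimes> g \<ominus> ((lam $ i) \<odot> \<one>) \<otimes> g"
      using h[of i] g smult_closed[OF one_closed, of "lam $ i"] by algebra
    also have "((lam $ i) \<odot> \<one>) \<otimes> g = (lam $ i) \<odot> g" using g by (simp add: smult_mult)
    finally show "L (generator lam i \<otimes> g) = 0" using h g eig[OF g, of i] by (simp add: LD(2,5) smult_closed)
  qed
  ultimately have sub: "I lam \<subseteq> ?N" unfolding fibre_ideal_def by (intro genideal_minimal) auto
  fix d assume "d \<in> I lam"
  then have d: "d \<in> carrier A" "L (d \<otimes> \<one>) = 0" using sub one_closed by blast+
  then show "L d = 0" by simp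
qed

lemma positive_on_of_fibres:
  assumes e: "spanning e" and p: "\<And>lam. lam \<in> joint_image h (nonneg_set A T) \<Longrightarrow> positive_on C (Tf lam)"
  shows "positive_on C T"
  unfolding positive_on_def
proof (intro allI impI, elim conjE)
  fix L0 f assume L0: "positive_functional A T L0" and f: "nonneg_on C f"
  have fc: "f \<in> carrier A" using f by (simp add: nonneg_on_def)
  show "0 \<le> L0 f"
  proof (rule ccontr)
    assume "\<not> ?thesis"
    then have L0f: "L0 f < 0" by simp
    obtain c where c: "0 < c" "\<forall>i. \<forall>x\<in>nonneg_set A T. \<bar>x (h i)\<bar> < c"
      using uniform_bound by blast
    have "\<exists>L lam. positive_functional A T L \<and> L f < 0 \<and> (\<forall>i. \<forall>g\<in>carrier A. L (h i \<otimes> g) = lam i * L g)"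
      by (rule extremal_functional_multiplicative[OF preordering_T e L0 fc L0f h c(1)])
        (rule functional_bound[OF fgA fgT h c(1) spec[OF c(2)]])
    then obtain L lam where L: "positive_functional A T L" "L f < 0" "\<forall>i. \<forall>g\<in>carrier A. L (h i \<otimes> g) = lam i * L g"
      by blast
    define v where "v = (\<chi> i. lam i)"
    have Lv: "positive_functional A (Tf v) L"
      by (rule positive_functional_fibre_of_eigen[OF L(1)]) (use L(3) in \<open>simp add: v_def\<close>)
    show False
    proof (cases "v \<in> joint_image h (nonneg_set A T)")
      case True
      then show False using p[OF True] Lv f L(2) unfolding positive_on_def by fastforce
    next
      case False
      have "nonneg_set A (Tf v) = {}"
      proof (rule equals0I)
        fix x assume "x \<in> nonneg_set A (Tf v)"
        then have x: "x \<in> nonneg_set A T" "x \<in> Z v" unfolding nonneg_set_fibre by blast+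
        then have xc: "x \<in> characters A" by (simp add: nonneg_set_def)
        have "v = (\<chi> i. x (h i))"
          using x(2) character_generator[OF xc] unfolding zero_set_fibre by (simp add: vec_eq_iff)
        then show False using False x(1) unfolding joint_image_def by blast
      qed
      from positivstellensatz[OF fgA finitely_generated_fibre this]
      \<comment> \<open>Together with positivity at 1 this gives L(1) = 0, and \<open>L\<close>
        vanishes by the Cauchy-Schwarz inequality.\<close>
      have "0 \<le> L (\<ominus> \<one>)" by (rule positive_functionalD(2)[OF Lv])
      then have "L \<one> = 0"
        using linear_functionalD(4)[OF positive_functionalD(1)[OF L(1)] one_closed]
          positive_functionalD(2)[OF L(1) preorderingD(4)[OF preordering_T]] by simp
      then have "L (\<one> \<otimes> f) = 0" using positive_functional_null[OF preordering_T L(1) one_closed _ fc] by simp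
      then show False using L(2) fc by simp
    qed
  qed
qed

lemma positive_on_fibre_of_total:
  assumes "positive_on C T"
  shows "positive_on C (Tf lam)"
  using assms unfolding positive_on_def positive_functional_fibre by blast

section \<open>The equivalent conditions\<close>

text \<open>The third equivalence serves the quotients, where (MP) tests elements that are
  nonnegative on the fibre only. For (SMP) this restriction is already part of K of the fibre
  preorder.\<close>

lemma moment_properties_fibres:
  assumes e: "spanning e"
  shows "SMP A T \<longleftrightarrow> (\<forall>lam\<in>joint_image h (nonneg_set A T). SMP A (Tf lam))" (is ?S1)
    and "MP A T \<longleftrightarrow> (\<forall>lam\<in>joint_image h (nonneg_set A T). MP A (Tf lam))" (is ?M1)
    and "MP A T \<longleftrightarrow> (\<forall>lam\<in>joint_image h (nonneg_set A T). positive_on (Z lam) (Tf lam))" (is ?M2)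
proof -
  have Tc: "T \<subseteq> carrier A" "Tf lam \<subseteq> carrier A" for lam
    using preorderingD(1)[OF preordering_T] preorderingD(1)[OF preordering_fibre(1)] by blast+
  note smp = SMP_iff_positive_on[OF e Tc(1)] SMP_iff_positive_on[OF e Tc(2)] and mp = MP_iff_positive_on[OF e]
  show ?S1
    unfolding smp nonneg_set_fibre
  proof
    assume p: "positive_on (nonneg_set A T) T"
    show "\<forall>lam\<in>joint_image h (nonneg_set A T). positive_on (nonneg_set A T \<inter> Z lam) (Tf lam)"
      by (intro ballI positive_on_fibre[OF e Tc(1)] positive_on_fibre_of_total p)
  next
    assume p: "\<forall>lam\<in>joint_image h (nonneg_set A T). positive_on (nonneg_set A T \<inter> Z lam) (Tf lam)"
    show "positive_on (nonneg_set A T) T"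
      by (rule positive_on_of_fibres[OF e], rule positive_on_mono, erule bspec[OF p]) simp
  qed
  have 1: "positive_on (Z lam) (Tf lam)" if "positive_on (characters A) T" for lam
  proof -
    have "characters A \<inter> Z lam = Z lam" by (auto simp: zero_set_def)
    then show ?thesis
      using positive_on_fibre[OF e empty_subsetI, of lam] positive_on_fibre_of_total[OF that, of lam]
      by (simp add: nonneg_set_empty)
  qed
  have 2: "positive_on (characters A) (Tf lam)" if "positive_on (Z lam) (Tf lam)" for lam
    using that by (rule positive_on_mono) (auto simp: zero_set_def)
  show ?M1 unfolding mp using positive_on_of_fibres[OF e, of "characters A"] 1 2 by blast
  show ?M2 unfolding mp using positive_on_of_fibres[OF e, of "characters A"] 1 2 by blast
qed

lemma moment_properties_hat:
  assumes e: "spanning e"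
  shows "SMP A (Tf' lam) \<longleftrightarrow> SMP A (Tf lam)" "MP A (Tf' lam) \<longleftrightarrow> MP A (Tf lam)"
proof -
  have Tc: "Tf lam \<subseteq> carrier A" "Tf' lam \<subseteq> carrier A"
    using preorderingD(1)[OF preordering_fibre(1)] preorderingD(1)[OF preordering_fibre_hat(1)] by blast+
  show "SMP A (Tf' lam) \<longleftrightarrow> SMP A (Tf lam)"
    unfolding SMP_iff_positive_on[OF e Tc(1)] SMP_iff_positive_on[OF e Tc(2)] nonneg_set_fibre positive_on_fibre_hat ..
  show "MP A (Tf' lam) \<longleftrightarrow> MP A (Tf lam)"
    unfolding MP_iff_positive_on[OF e] positive_on_fibre_hat ..
qed

lemma moment_properties_quotient:
  assumes e: "spanning e"
  shows "SMP (quotient_algebra A (I lam)) (quotient_image A (Tf lam) (I lam)) \<longleftrightarrow> SMP A (Tf lam)"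
    and "SMP (quotient_algebra A (I' lam)) (quotient_image A (Tf' lam) (I' lam)) \<longleftrightarrow> SMP A (Tf lam)"
    and "MP (quotient_algebra A (I lam)) (quotient_image A (Tf lam) (I lam)) \<longleftrightarrow> positive_on (Z lam) (Tf lam)"
    and "MP (quotient_algebra A (I' lam)) (quotient_image A (Tf' lam) (I' lam)) \<longleftrightarrow> positive_on (Z lam) (Tf lam)"
proof -
  interpret Q: algebra_quotient A "quotient_algebra A (I lam)" "\<lambda>a. I lam +>\<^bsub>A\<^esub> a" "I lam"
    by (rule quotient_algebra_quotient[OF ideal_fibre])
  interpret Q': algebra_quotient A "quotient_algebra A (I' lam)" "\<lambda>a. I' lam +>\<^bsub>A\<^esub> a" "I' lam"
    by (rule quotient_algebra_quotient[OF ideal_fibre_hat])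
  show "SMP (quotient_algebra A (I lam)) (quotient_image A (Tf lam) (I lam)) \<longleftrightarrow> SMP A (Tf lam)"
    unfolding quotient_image_def by (rule Q.SMP_Q[OF e preordering_fibre(1,3)])
  show "SMP (quotient_algebra A (I' lam)) (quotient_image A (Tf' lam) (I' lam)) \<longleftrightarrow> SMP A (Tf lam)"
    unfolding quotient_image_def Q'.SMP_Q[OF e preordering_fibre_hat(1,3)] by (rule moment_properties_hat[OF e])
  show "MP (quotient_algebra A (I lam)) (quotient_image A (Tf lam) (I lam)) \<longleftrightarrow> positive_on (Z lam) (Tf lam)"
    unfolding quotient_image_def by (rule Q.MP_Q[OF e preordering_fibre(1,3)])
  show "MP (quotient_algebra A (I' lam)) (quotient_image A (Tf' lam) (I' lam)) \<longleftrightarrow> positive_on (Z lam) (Tf lam)"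
    unfolding quotient_image_def Q'.MP_Q[OF e preordering_fibre_hat(1,3)] zero_set_hat positive_on_fibre_hat ..
qed

end

theorem theorem3:
  fixes A :: "(real, 'a, 'm) module_scheme"
    and T :: "'a set"
    and h :: "'n::finite \<Rightarrow> 'a"
  assumes "comm_real_algebra A"
    and "finitely_generated_algebra A"
    and "finitely_generated_preordering A T"
    and "\<And>i. h i \<in> carrier A"
    and "\<And>i. bounded ((\<lambda>x. x (h i)) ` nonneg_set A T)"
  shows
    "(SMP A T \<longleftrightarrow>
        (\<forall>lam\<in>joint_image h (nonneg_set A T). SMP A (fibre_preordering A T h lam))) \<and>
     (SMP A T \<longleftrightarrow>
        (\<forall>lam\<in>joint_image h (nonneg_set A T). SMP A (fibre_preordering_hat A T h lam))) \<and>
     (SMP A T \<longleftrightarrow>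
        (\<forall>lam\<in>joint_image h (nonneg_set A T).
           SMP (quotient_algebra A (fibre_ideal A h lam))
             (quotient_image A (fibre_preordering A T h lam) (fibre_ideal A h lam)))) \<and>
     (SMP A T \<longleftrightarrow>
        (\<forall>lam\<in>joint_image h (nonneg_set A T).
           SMP (quotient_algebra A (fibre_ideal_hat A h lam))
             (quotient_image A (fibre_preordering_hat A T h lam) (fibre_ideal_hat A h lam)))) \<and>
     (MP A T \<longleftrightarrow>
        (\<forall>lam\<in>joint_image h (nonneg_set A T). MP A (fibre_preordering A T h lam))) \<and>
     (MP A T \<longleftrightarrow>
        (\<forall>lam\<in>joint_image h (nonneg_set A T). MP A (fibre_preordering_hat A T h lam))) \<and>
     (MP A T \<longleftrightarrow>
        (\<forall>lam\<in>joint_image h (nonneg_set A T).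
           MP (quotient_algebra A (fibre_ideal A h lam))
             (quotient_image A (fibre_preordering A T h lam) (fibre_ideal A h lam)))) \<and>
     (MP A T \<longleftrightarrow>
        (\<forall>lam\<in>joint_image h (nonneg_set A T).
           MP (quotient_algebra A (fibre_ideal_hat A h lam))
             (quotient_image A (fibre_preordering_hat A T h lam) (fibre_ideal_hat A h lam))))"
proof -
  interpret bounded_fibration A T h
    by unfold_locales (fact assms)+
  obtain e where e: "spanning e" using spanning_exists[OF assms(2)] by blast
  show ?thesis
    unfolding moment_properties_hat[OF e] moment_properties_quotient[OF e]
    using moment_properties_fibres[OF e] by (intro conjI)
qed

end
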